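(* Let $(M,\omega)$ be a compact connected Hermitian manifold, let $E$ be a Hermitian complex (not necessarily holomorphic) vector bundle or a Riemannian real vector bundle over $M$, and let $\nabla^E$ be any metric connection on $E$, with $(1,1)$-curvature $R^E$ and second Hermitian-Ricci curvature $\mathrm{Tr}_\omega R^E$. (1) If $\mathrm{Tr}_\omega R^E$ is nonpositive everywhere, then every $\bar\partial_E$-closed section $s$ of $E$ is parallel, i.e. $\nabla^E s=0$. (2) If $\mathrm{Tr}_\omega R^E$ is nonpositive everywhere and negative at some point, then $\mathcal H^0_{\bar\partial_E}(M,E)=0$. (3) If $\mathrm{Tr}_\omega R^E$ is $p$-nonpositive everywhere and $p$-negative at some point, then $\mathcal H^0_{\bar\partial_E}(M,\Lambda^qE)=0$ for every $q$ with $p\le q\le \operatorname{rank}(E)$.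
   Context: The metric is $h=(h_{i\bar j})$ in local holomorphic coordinates, with inverse $(h^{i\bar j})$ and fundamental form $\omega=\frac{\sqrt{-1}}{2}h_{i\bar j}dz^i\wedge d\bar z^j$. If $E$ is a real bundle, complex $E$-valued forms take values in $E\otimes\mathbb C$ with the Hermitian extension of the metric. Decompose $\nabla^E=\nabla'^E+\nabla''^E$ into $(1,0)$ and $(0,1)$ parts. Define $\partial_E(\phi\otimes s)=\partial\phi\otimes s+(-1)^{p+q}\phi\wedge\nabla'^Es$ and $\bar\partial_E(\phi\otimes s)=\bar\partial\phi\otimes s+(-1)^{p+q}\phi\wedge\nabla''^Es$ for $\phi\in\Omega^{p,q}(M)$, $s\in\Gamma(M,E)$. The $(1,1)$-curvature $R^E=R_{i\bar j\alpha}^{\beta}dz^i\wedge d\bar z^j\otimes e^\alpha\otimes e_\beta\in\Gamma(M,\Lambda^{1,1}T^*M\otimes E^*\otimes E)$ represents the operator $\partial_E\bar\partial_E+\bar\partial_E\partial_E$ (here $\{e_\alpha\}$ is a local frame of $E$ with dual frame $\{e^\alpha\}$). The second Hermitian-Ricci curvature $\mathrm{Tr}_\omega R^E$ has components $R_{\alpha\bar\beta}=h^{i\bar j}R_{i\bar j\alpha\bar\beta}$, where $R_{i\bar j\alpha\bar\beta}=R_{i\bar j\alpha}^{\gamma}\langle e_\gamma,e_\beta\rangle$; this is a Hermitian form on $E$. A Hermitian form of rank $r$ with eigenvalues $\lambda_1\le\dots\le\lambda_r$ (with respect to the metric of $E$) is called $p$-nonpositive (resp. $p$-negative, $p$-nonnegative,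 $p$-positive) if $\lambda_{i_1}+\dots+\lambda_{i_p}\le 0$ (resp. $<0$, $\ge0$, $>0$) for all $1\le i_1<\dots<i_p\le r$; the case $p=1$ is ordinary nonpositivity, negativity, etc. Finally $\mathcal H^{0}_{\bar\partial_E}(M,E)=\{s\in\Gamma(M,E): \bar\partial_Es=0\}$, and $\Lambda^qE$ carries the induced metric and connection. *)

theory Defs
  imports "HOL-Analysis.Analysis" "HOL-Library.Function_Algebras"
begin

section \<open>Smooth and holomorphic maps between open subsets of normed spaces\<close>

fun Ck_on :: "nat \<Rightarrow> 'a::real_normed_vector set \<Rightarrow> ('a \<Rightarrow> 'b::real_normed_vector) \<Rightarrow> bool" where
  "Ck_on 0 S f \<longleftrightarrow> continuous_on S f"
| "Ck_on (Suc k) S f \<longleftrightarrow>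
     (\<forall>x\<in>S. f differentiable (at x)) \<and> (\<forall>v. Ck_on k S (\<lambda>x. frechet_derivative f (at x) v))"

text \<open>Used for open subsets \<open>S\<close> of finite-dimensional spaces only.\<close>

definition smooth_on :: "'a::real_normed_vector set \<Rightarrow> ('a \<Rightarrow> 'b::real_normed_vector) \<Rightarrow> bool" where
  "smooth_on S f \<longleftrightarrow> (\<forall>k. Ck_on k S f)"

text \<open>Holomorphic in several variables: the real derivative exists and is complex linear.\<close>

definition holomorphic_map_on :: "(complex ^ 'n) set \<Rightarrow> (complex ^ 'n \<Rightarrow> complex ^ 'n) \<Rightarrow> bool" where
  "holomorphic_map_on S f \<longleftrightarrow>
     (\<forall>z\<in>S. \<exists>f'. (f has_derivative f') (at z) \<and> (\<forall>c v. f' (c *s v) = c *s f' v))"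

section \<open>Complex manifolds\<close>

text \<open>The manifold is the whole type \<open>'m\<close>. A chart is a domain together with a coordinate map
  \<open>z = (z\<^sup>1, \<dots>, z\<^sup>n)\<close>; the coordinate map is only relevant on the domain.\<close>

type_synonym ('m, 'n) chart = "'m set \<times> ('m \<Rightarrow> complex ^ 'n)"

definition chart_inv :: "('m, 'n) chart \<Rightarrow> complex ^ 'n \<Rightarrow> 'm" where
  "chart_inv c = inv_into (fst c) (snd c)"

definition transition :: "('m, 'n) chart \<Rightarrow> ('m, 'n) chart \<Rightarrow> complex ^ 'n \<Rightarrow> complex ^ 'n" where
  "transition c c' = snd c' \<circ> chart_inv c"

definition complex_atlas :: "('m::topological_space, 'n::finite) chart set \<Rightarrow> bool" where
  "complex_atlas A \<longleftrightarrow>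
     (\<Union>c\<in>A. fst c) = UNIV \<and>
     (\<forall>c\<in>A. open (fst c) \<and> open (snd c ` fst c) \<and>
        homeomorphism (fst c) (snd c ` fst c) (snd c) (chart_inv c)) \<and>
     (\<forall>c\<in>A. \<forall>c'\<in>A. holomorphic_map_on (snd c ` (fst c \<inter> fst c')) (transition c c'))"

definition smooth_map :: "('m, 'n::finite) chart set \<Rightarrow> 'm set \<Rightarrow> ('m \<Rightarrow> 'b::real_normed_vector) \<Rightarrow> bool" where
  "smooth_map A W f \<longleftrightarrow> (\<forall>c\<in>A. smooth_on (snd c ` (W \<inter> fst c)) (f \<circ> chart_inv c))"

text \<open>A real tangent vector at \<open>x\<close> is given by its components \<open>v :: complex ^ 'n\<close> with respect to a
  chart \<open>c\<close> around \<open>x\<close>, via the identification of \<open>\<complex>\<^sup>n\<close> with \<open>\<real>\<^sup>2\<^sup>n\<close>; thus \<open>axis i 1\<close> and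
  \<open>axis i \<i>\<close> are the vectors \<open>\<partial>/\<partial>x\<^sup>i\<close> and \<open>\<partial>/\<partial>y\<^sup>i\<close>, where \<open>z\<^sup>i = x\<^sup>i + \<i> y\<^sup>i\<close>.
  The components with respect to another chart \<open>c'\<close> are \<open>change_coords c c' x v\<close>.\<close>

definition change_coords ::
  "('m, 'n::finite) chart \<Rightarrow> ('m, 'n) chart \<Rightarrow> 'm \<Rightarrow> complex ^ 'n \<Rightarrow> complex ^ 'n" where
  "change_coords c c' x v = frechet_derivative (transition c c') (at (snd c x)) v"

definition dfun ::
  "('m \<Rightarrow> 'b::real_normed_vector) \<Rightarrow> ('m, 'n::finite) chart \<Rightarrow> 'm \<Rightarrow> complex ^ 'n \<Rightarrow> 'b" where
  "dfun f c x v = frechet_derivative (f \<circ> chart_inv c) (at (snd c x)) v"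

section \<open>Hermitian metrics on the manifold\<close>

definition sesq_form :: "complex ^ 'n ^ 'n \<Rightarrow> complex ^ 'n \<Rightarrow> complex ^ 'n::finite \<Rightarrow> complex" where
  "sesq_form H v w = (\<Sum>i\<in>UNIV. \<Sum>j\<in>UNIV. H $ i $ j * v $ i * cnj (w $ j))"

text \<open>\<open>h c x $ i $ j\<close> is the component at \<open>x\<close> in the chart \<open>c\<close> with holomorphic index \<open>i\<close> and
  antiholomorphic index \<open>j\<close>.\<close>

definition hermitian_metric ::
  "('m, 'n::finite) chart set \<Rightarrow> (('m, 'n) chart \<Rightarrow> 'm \<Rightarrow> complex ^ 'n ^ 'n) \<Rightarrow> bool" where
  "hermitian_metric A h \<longleftrightarrow>
     (\<forall>c\<in>A. smooth_map A (fst c) (h c) \<and>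
        (\<forall>x\<in>fst c. (\<forall>i j. h c x $ j $ i = cnj (h c x $ i $ j)) \<and>
           (\<forall>v. v \<noteq> 0 \<longrightarrow> 0 < Re (sesq_form (h c x) v v)))) \<and>
     (\<forall>c\<in>A. \<forall>c'\<in>A. \<forall>x\<in>fst c \<inter> fst c'. \<forall>v w.
        sesq_form (h c x) v w =
        sesq_form (h c' x) (change_coords c c' x v) (change_coords c c' x w))"

section \<open>Vector bundles\<close>

text \<open>The fibres are subspaces of an ambient vector space over \<open>'k\<close> (\<open>real\<close> or \<open>complex\<close>) without
  topology; this is no restriction, since the direct sum of all fibres may be taken as ambient space.
  The smooth structure is given by a family of local frames, indexed by the finite set \<open>idx\<close>, that
  cover the base and are related by smooth transition matrices.\<close>

record ('k, 'm, 'v, 'i) vbundle =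
  fibre :: "'m \<Rightarrow> 'v set"
  scl :: "'k \<Rightarrow> 'v \<Rightarrow> 'v"
  idx :: "'i set"
  frames :: "('m set \<times> ('i \<Rightarrow> 'm \<Rightarrow> 'v)) set"

definition bundle_rank :: "('k, 'm, 'v, 'i) vbundle \<Rightarrow> nat" where
  "bundle_rank E = card (idx E)"

definition vector_bundle ::
  "('m::topological_space, 'n::finite) chart set \<Rightarrow>
   ('k::real_normed_field, 'm, 'v::ab_group_add, 'i) vbundle \<Rightarrow> bool" where
  "vector_bundle A E \<longleftrightarrow>
     vector_space (scl E) \<and> finite (idx E) \<and>
     (\<forall>x. module.subspace (scl E) (fibre E x)) \<and>
     (\<Union>(V, e)\<in>frames E. V) = UNIV \<and>
     (\<forall>(V, e)\<in>frames E. open V \<and>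
        (\<forall>x\<in>V. inj_on (\<lambda>\<alpha>. e \<alpha> x) (idx E) \<and>
           \<not> module.dependent (scl E) ((\<lambda>\<alpha>. e \<alpha> x) ` idx E) \<and>
           module.span (scl E) ((\<lambda>\<alpha>. e \<alpha> x) ` idx E) = fibre E x)) \<and>
     (\<forall>(V, e)\<in>frames E. \<forall>(V', e')\<in>frames E. \<exists>t.
        (\<forall>\<alpha>\<in>idx E. \<forall>\<beta>\<in>idx E. smooth_map A (V \<inter> V') (t \<alpha> \<beta> :: 'm \<Rightarrow> 'k)) \<and>
        (\<forall>x\<in>V \<inter> V'. \<forall>\<alpha>\<in>idx E. e' \<alpha> x = (\<Sum>\<beta>\<in>idx E. scl E (t \<alpha> \<beta> x) (e \<beta> x))))"

text \<open>Local sections over an open set \<open>W\<close> are total functions whose values outside \<open>W\<close> are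
  irrelevant.\<close>

definition smooth_section ::
  "('m, 'n::finite) chart set \<Rightarrow> ('k::real_normed_field, 'm, 'v::ab_group_add, 'i) vbundle \<Rightarrow>
   'm set \<Rightarrow> ('m \<Rightarrow> 'v) \<Rightarrow> bool" where
  "smooth_section A E W s \<longleftrightarrow>
     (\<forall>x\<in>W. s x \<in> fibre E x) \<and>
     (\<forall>(V, e)\<in>frames E. \<exists>f.
        (\<forall>\<alpha>\<in>idx E. smooth_map A (W \<inter> V) (f \<alpha> :: 'm \<Rightarrow> 'k)) \<and>
        (\<forall>x\<in>W \<inter> V. s x = (\<Sum>\<alpha>\<in>idx E. scl E (f \<alpha> x) (e \<alpha> x))))"

definition frame_coeff ::
  "('k::real_normed_field, 'm, 'v::ab_group_add, 'i) vbundle \<Rightarrow> ('i \<Rightarrow> 'm \<Rightarrow> 'v) \<Rightarrow> 'm \<Rightarrow> 'v \<Rightarrow> 'i \<Rightarrow> 'k" where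
  "frame_coeff E e x u \<alpha> = module.representation (scl E) ((\<lambda>\<beta>. e \<beta> x) ` idx E) u (e \<alpha> x)"

text \<open>The conjugation \<open>cj\<close> is \<open>cnj\<close> for Hermitian and the identity for Riemannian metrics.\<close>

definition fibre_metric ::
  "('k \<Rightarrow> 'k) \<Rightarrow> ('m, 'n::finite) chart set \<Rightarrow>
   ('k::real_normed_field, 'm, 'v::ab_group_add, 'i) vbundle \<Rightarrow> ('m \<Rightarrow> 'v \<Rightarrow> 'v \<Rightarrow> 'k) \<Rightarrow> bool" where
  "fibre_metric cj A E g \<longleftrightarrow>
     (\<forall>x. \<forall>u\<in>fibre E x. \<forall>v\<in>fibre E x. \<forall>w\<in>fibre E x. \<forall>a.
        g x (u + v) w = g x u w + g x v w \<and>
        g x (scl E a u) w = a * g x u w \<and>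
        g x w u = cj (g x u w)) \<and>
     (\<forall>x. \<forall>u\<in>fibre E x. u \<noteq> 0 \<longrightarrow> (\<exists>r>0. g x u u = of_real r)) \<and>
     (\<forall>(V, e)\<in>frames E. \<forall>\<alpha>\<in>idx E. \<forall>\<beta>\<in>idx E. smooth_map A V (\<lambda>x. g x (e \<alpha> x) (e \<beta> x)))"

definition hermitian_bundle ::
  "('m::topological_space, 'n::finite) chart set \<Rightarrow>
   (complex, 'm, 'v::ab_group_add, 'i) vbundle \<Rightarrow> ('m \<Rightarrow> 'v \<Rightarrow> 'v \<Rightarrow> complex) \<Rightarrow> bool" where
  "hermitian_bundle A E g \<longleftrightarrow> vector_bundle A E \<and> fibre_metric cnj A E g"

definition riemannian_bundle ::
  "('m::topological_space, 'n::finite) chart set \<Rightarrow>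
   (real, 'm, 'v::ab_group_add, 'i) vbundle \<Rightarrow> ('m \<Rightarrow> 'v \<Rightarrow> 'v \<Rightarrow> real) \<Rightarrow> bool" where
  "riemannian_bundle A E g \<longleftrightarrow> vector_bundle A E \<and> fibre_metric (\<lambda>a. a) A E g"

section \<open>Connections\<close>

text \<open>\<open>D s c x v\<close> is the covariant derivative at \<open>x\<close> of the local section \<open>s\<close> in the direction of the
  real tangent vector with components \<open>v\<close> in the chart \<open>c\<close>. A connection acts on sections over
  arbitrary open sets and is compatible with restriction.\<close>

type_synonym ('m, 'n, 'v) conn = "('m \<Rightarrow> 'v) \<Rightarrow> ('m, 'n) chart \<Rightarrow> 'm \<Rightarrow> complex ^ 'n \<Rightarrow> 'v"

definition connection ::
  "('m::topological_space, 'n::finite) chart set \<Rightarrow>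
   ('k::real_normed_field, 'm, 'v::ab_group_add, 'i) vbundle \<Rightarrow> ('m, 'n, 'v) conn \<Rightarrow> bool" where
  "connection A E D \<longleftrightarrow>
     (\<forall>W s. open W \<and> smooth_section A E W s \<longrightarrow>
        \<comment> \<open>\<open>D s\<close> is a smooth \<open>E\<close>-valued 1-form on \<open>W\<close>\<close>
        (\<forall>c\<in>A. \<forall>v. smooth_section A E (W \<inter> fst c) (\<lambda>x. D s c x v)) \<and>
        (\<forall>c\<in>A. \<forall>x\<in>W \<inter> fst c. \<forall>v w r.
           D s c x (v + w) = D s c x v + D s c x w \<and>
           D s c x (r *\<^sub>R v) = scl E (of_real r) (D s c x v)) \<and>
        (\<forall>c\<in>A. \<forall>c'\<in>A. \<forall>x\<in>W \<inter> fst c \<inter> fst c'. \<forall>v.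
           D s c x v = D s c' x (change_coords c c' x v)) \<and>
        (\<forall>t. smooth_section A E W t \<longrightarrow> (\<forall>c\<in>A. \<forall>x\<in>W \<inter> fst c. \<forall>v.
           ((\<forall>y\<in>W. s y = t y) \<longrightarrow> D s c x v = D t c x v) \<and>
           D (\<lambda>y. s y + t y) c x v = D s c x v + D t c x v)) \<and>
        (\<forall>f :: 'm \<Rightarrow> 'k. smooth_map A W f \<longrightarrow> (\<forall>c\<in>A. \<forall>x\<in>W \<inter> fst c. \<forall>v.
           D (\<lambda>y. scl E (f y) (s y)) c x v =
           scl E (dfun f c x v) (s x) + scl E (f x) (D s c x v))))"

definition metric_connection ::
  "('m::topological_space, 'n::finite) chart set \<Rightarrow>
   ('k::real_normed_field, 'm, 'v::ab_group_add, 'i) vbundle \<Rightarrow>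
   ('m \<Rightarrow> 'v \<Rightarrow> 'v \<Rightarrow> 'k) \<Rightarrow> ('m, 'n, 'v) conn \<Rightarrow> bool" where
  "metric_connection A E g D \<longleftrightarrow> connection A E D \<and>
     (\<forall>W s t. open W \<and> smooth_section A E W s \<and> smooth_section A E W t \<longrightarrow>
        (\<forall>c\<in>A. \<forall>x\<in>W \<inter> fst c. \<forall>v.
           dfun (\<lambda>y. g y (s y) (t y)) c x v = g x (D s c x v) (t x) + g x (s x) (D t c x v)))"

definition parallel_section ::
  "('m, 'n::finite) chart set \<Rightarrow> ('m, 'n, 'v::ab_group_add) conn \<Rightarrow> ('m \<Rightarrow> 'v) \<Rightarrow> bool" where
  "parallel_section A D s \<longleftrightarrow> (\<forall>c\<in>A. \<forall>x\<in>fst c. \<forall>v. D s c x v = 0)"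

section \<open>The (1,0) and (0,1) operators and the (1,1)-curvature\<close>

text \<open>\<open>E\<close>-valued forms are written through their components in a chart with coordinates \<open>z\<^sup>i\<close>. In the
  comments \<open>w\<^sup>i\<close> is the conjugate of \<open>z\<^sup>i\<close>, and \<open>\<partial>\<close>, \<open>\<partial>'\<close> are the operators of type (1,0), (0,1) on
  \<open>E\<close>-valued forms.
  Since \<open>\<partial>/\<partial>z\<^sup>i = (\<partial>/\<partial>x\<^sup>i - \<i> \<partial>/\<partial>y\<^sup>i) / 2\<close>, the (1,0)-part of \<open>D s\<close> is
  \<open>\<Sum>i. dz\<^sup>i \<otimes> del E D c s i\<close> and its (0,1)-part is \<open>\<Sum>j. dw\<^sup>j \<otimes> delbar E D c s j\<close>.\<close>

definition del ::
  "(complex, 'm, 'v::ab_group_add, 'i) vbundle \<Rightarrow> ('m, 'n::finite, 'v) conn \<Rightarrow> ('m, 'n) chart \<Rightarrow>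
   ('m \<Rightarrow> 'v) \<Rightarrow> 'n \<Rightarrow> 'm \<Rightarrow> 'v" where
  "del E D c s i x =
     scl E (1/2) (D s c x (axis i 1)) - scl E (\<i>/2) (D s c x (axis i \<i>))"

definition delbar ::
  "(complex, 'm, 'v::ab_group_add, 'i) vbundle \<Rightarrow> ('m, 'n::finite, 'v) conn \<Rightarrow> ('m, 'n) chart \<Rightarrow>
   ('m \<Rightarrow> 'v) \<Rightarrow> 'n \<Rightarrow> 'm \<Rightarrow> 'v" where
  "delbar E D c s j x =
     scl E (1/2) (D s c x (axis j 1)) + scl E (\<i>/2) (D s c x (axis j \<i>))"

text \<open>\<open>\<partial>\<close> of the (0,1)-form \<open>\<Sum>j. dw\<^sup>j \<otimes> \<eta> j\<close>, as the coefficients of \<open>dz\<^sup>i \<and> dw\<^sup>j\<close>: the sign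
  \<open>(-1)\<^sup>1\<close> in the Leibniz rule for \<open>\<partial>\<close> cancels against the one from \<open>dw\<^sup>j \<and> dz\<^sup>i = - dz\<^sup>i \<and> dw\<^sup>j\<close>.\<close>

definition del_01 ::
  "(complex, 'm, 'v::ab_group_add, 'i) vbundle \<Rightarrow> ('m, 'n::finite, 'v) conn \<Rightarrow> ('m, 'n) chart \<Rightarrow>
   ('n \<Rightarrow> 'm \<Rightarrow> 'v) \<Rightarrow> 'n \<Rightarrow> 'n \<Rightarrow> 'm \<Rightarrow> 'v" where
  "del_01 E D c \<eta> i j x = del E D c (\<eta> j) i x"

text \<open>\<open>\<partial>'\<close> of the (1,0)-form \<open>\<Sum>i. dz\<^sup>i \<otimes> \<xi> i\<close>; here the sign \<open>(-1)\<^sup>1\<close> remains.\<close>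

definition delbar_10 ::
  "(complex, 'm, 'v::ab_group_add, 'i) vbundle \<Rightarrow> ('m, 'n::finite, 'v) conn \<Rightarrow> ('m, 'n) chart \<Rightarrow>
   ('n \<Rightarrow> 'm \<Rightarrow> 'v) \<Rightarrow> 'n \<Rightarrow> 'n \<Rightarrow> 'm \<Rightarrow> 'v" where
  "delbar_10 E D c \<xi> i j x = - delbar E D c (\<xi> i) j x"

definition curvature_11 ::
  "(complex, 'm, 'v::ab_group_add, 'i) vbundle \<Rightarrow> ('m, 'n::finite, 'v) conn \<Rightarrow> ('m, 'n) chart \<Rightarrow>
   ('m \<Rightarrow> 'v) \<Rightarrow> 'n \<Rightarrow> 'n \<Rightarrow> 'm \<Rightarrow> 'v" where
  "curvature_11 E D c s i j x =
     del_01 E D c (delbar E D c s) i j x + delbar_10 E D c (del E D c s) i j x"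

definition H0 ::
  "('m, 'n::finite) chart set \<Rightarrow> (complex, 'm, 'v::ab_group_add, 'i) vbundle \<Rightarrow>
   ('m, 'n, 'v) conn \<Rightarrow> ('m \<Rightarrow> 'v) set" where
  "H0 A E D = {s. smooth_section A E UNIV s \<and> (\<forall>c\<in>A. \<forall>x\<in>fst c. \<forall>j. delbar E D c s j x = 0)}"

section \<open>The second Hermitian-Ricci curvature\<close>

text \<open>The value of the curvature operator on the local section \<open>e\<^sub>\<alpha>\<close> is \<open>\<Sum>\<gamma>. R(i, j, \<alpha>; \<gamma>) e\<^sub>\<gamma>\<close>, and
  \<open>\<gamma>\<close> is lowered with the metric: \<open>R(i, j, \<alpha>, \<beta>) = \<Sum>\<gamma>. R(i, j, \<alpha>; \<gamma>) \<langle>e\<^sub>\<gamma>, e\<^sub>\<beta>\<rangle>\<close>.\<close>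

definition curvature_comp ::
  "(complex, 'm, 'v::ab_group_add, 'i) vbundle \<Rightarrow> ('m \<Rightarrow> 'v \<Rightarrow> 'v \<Rightarrow> complex) \<Rightarrow>
   ('m, 'n::finite, 'v) conn \<Rightarrow> ('m, 'n) chart \<Rightarrow> ('i \<Rightarrow> 'm \<Rightarrow> 'v) \<Rightarrow>
   'n \<Rightarrow> 'n \<Rightarrow> 'i \<Rightarrow> 'i \<Rightarrow> 'm \<Rightarrow> complex" where
  "curvature_comp E g D c e i j \<alpha> \<beta> x = g x (curvature_11 E D c (e \<alpha>) i j x) (e \<beta> x)"

text \<open>Contraction with the inverse metric \<open>h\<^sup>i\<^sup>j\<close> (holomorphic index \<open>i\<close>, antiholomorphic index \<open>j\<close>). It
  satisfies \<open>\<Sum>j. h\<^sup>i\<^sup>j h\<^sub>k\<^sub>j = \<delta>\<^sub>i\<^sub>k\<close>, hence it is the entry at \<open>(j, i)\<close> of the inverse matrix.\<close>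

definition ricci_comp ::
  "(('m, 'n::finite) chart \<Rightarrow> 'm \<Rightarrow> complex ^ 'n ^ 'n) \<Rightarrow>
   (complex, 'm, 'v::ab_group_add, 'i) vbundle \<Rightarrow> ('m \<Rightarrow> 'v \<Rightarrow> 'v \<Rightarrow> complex) \<Rightarrow>
   ('m, 'n, 'v) conn \<Rightarrow> ('m, 'n) chart \<Rightarrow> ('i \<Rightarrow> 'm \<Rightarrow> 'v) \<Rightarrow> 'i \<Rightarrow> 'i \<Rightarrow> 'm \<Rightarrow> complex" where
  "ricci_comp h E g D c e \<alpha> \<beta> x =
     (\<Sum>i\<in>UNIV. \<Sum>j\<in>UNIV. matrix_inv (h c x) $ j $ i * curvature_comp E g D c e i j \<alpha> \<beta> x)"

definition ricci_form ::
  "(('m, 'n::finite) chart \<Rightarrow> 'm \<Rightarrow> complex ^ 'n ^ 'n) \<Rightarrow>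
   (complex, 'm, 'v::ab_group_add, 'i) vbundle \<Rightarrow> ('m \<Rightarrow> 'v \<Rightarrow> 'v \<Rightarrow> complex) \<Rightarrow>
   ('m, 'n, 'v) conn \<Rightarrow> ('m, 'n) chart \<Rightarrow> ('i \<Rightarrow> 'm \<Rightarrow> 'v) \<Rightarrow> 'm \<Rightarrow> 'v \<Rightarrow> 'v \<Rightarrow> complex" where
  "ricci_form h E g D c e x u w =
     (\<Sum>\<alpha>\<in>idx E. \<Sum>\<beta>\<in>idx E.
        ricci_comp h E g D c e \<alpha> \<beta> x * frame_coeff E e x u \<alpha> * cnj (frame_coeff E e x w \<beta>))"

text \<open>\<open>ls\<close> lists, with multiplicity and in nondecreasing order, the eigenvalues of the Hermitian form
  \<open>B\<close> with respect to the inner product \<open>G\<close> on the \<open>r\<close>-dimensional space \<open>V\<close>; \<open>u 0, \<dots>, u (r - 1)\<close> is a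
  corresponding orthonormal basis of eigenvectors.\<close>

definition form_eigenvalues ::
  "'v set \<Rightarrow> nat \<Rightarrow> ('v \<Rightarrow> 'v \<Rightarrow> complex) \<Rightarrow> ('v \<Rightarrow> 'v \<Rightarrow> complex) \<Rightarrow> real list \<Rightarrow> bool" where
  "form_eigenvalues V r G B ls \<longleftrightarrow>
     length ls = r \<and> sorted ls \<and>
     (\<exists>u. (\<forall>a<r. u a \<in> V) \<and>
          (\<forall>a<r. \<forall>b<r. G (u a) (u b) = (if a = b then 1 else 0)) \<and>
          (\<forall>a<r. \<forall>w\<in>V. B (u a) w = of_real (ls ! a) * G (u a) w))"

definition form_p_nonpositive ::
  "nat \<Rightarrow> 'v set \<Rightarrow> nat \<Rightarrow> ('v \<Rightarrow> 'v \<Rightarrow> complex) \<Rightarrow> ('v \<Rightarrow> 'v \<Rightarrow> complex) \<Rightarrow> bool" where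
  "form_p_nonpositive p V r G B \<longleftrightarrow>
     (\<exists>ls. form_eigenvalues V r G B ls \<and> (\<forall>I\<subseteq>{..<r}. card I = p \<longrightarrow> (\<Sum>a\<in>I. ls ! a) \<le> 0))"

definition form_p_negative ::
  "nat \<Rightarrow> 'v set \<Rightarrow> nat \<Rightarrow> ('v \<Rightarrow> 'v \<Rightarrow> complex) \<Rightarrow> ('v \<Rightarrow> 'v \<Rightarrow> complex) \<Rightarrow> bool" where
  "form_p_negative p V r G B \<longleftrightarrow>
     (\<exists>ls. form_eigenvalues V r G B ls \<and> (\<forall>I\<subseteq>{..<r}. card I = p \<longrightarrow> (\<Sum>a\<in>I. ls ! a) < 0))"

text \<open>The Ricci form at \<open>x\<close> does not depend on the chart and the frame around \<open>x\<close> used to compute it.\<close>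

definition ricci_p_nonpositive ::
  "nat \<Rightarrow> ('m, 'n::finite) chart set \<Rightarrow> (('m, 'n) chart \<Rightarrow> 'm \<Rightarrow> complex ^ 'n ^ 'n) \<Rightarrow>
   (complex, 'm, 'v::ab_group_add, 'i) vbundle \<Rightarrow> ('m \<Rightarrow> 'v \<Rightarrow> 'v \<Rightarrow> complex) \<Rightarrow>
   ('m, 'n, 'v) conn \<Rightarrow> 'm \<Rightarrow> bool" where
  "ricci_p_nonpositive p A h E g D x \<longleftrightarrow>
     (\<forall>c\<in>A. \<forall>(V, e)\<in>frames E. x \<in> fst c \<and> x \<in> V \<longrightarrow>
        form_p_nonpositive p (fibre E x) (bundle_rank E) (g x) (ricci_form h E g D c e x))"

definition ricci_p_negative ::
  "nat \<Rightarrow> ('m, 'n::finite) chart set \<Rightarrow> (('m, 'n) chart \<Rightarrow> 'm \<Rightarrow> complex ^ 'n ^ 'n) \<Rightarrow>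
   (complex, 'm, 'v::ab_group_add, 'i) vbundle \<Rightarrow> ('m \<Rightarrow> 'v \<Rightarrow> 'v \<Rightarrow> complex) \<Rightarrow>
   ('m, 'n, 'v) conn \<Rightarrow> 'm \<Rightarrow> bool" where
  "ricci_p_negative p A h E g D x \<longleftrightarrow>
     (\<forall>c\<in>A. \<forall>(V, e)\<in>frames E. x \<in> fst c \<and> x \<in> V \<longrightarrow>
        form_p_negative p (fibre E x) (bundle_rank E) (g x) (ricci_form h E g D c e x))"

section \<open>Complexification of real bundles\<close>

text \<open>The pair \<open>(a, b)\<close> stands for \<open>a \<otimes> 1 + b \<otimes> \<i>\<close>.\<close>

definition cplx_bundle ::
  "(real, 'm, 'v::ab_group_add, 'i) vbundle \<Rightarrow> (complex, 'm, 'v \<times> 'v, 'i) vbundle" where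
  "cplx_bundle E =
     \<lparr> fibre = (\<lambda>x. fibre E x \<times> fibre E x),
       scl = (\<lambda>z (a, b). (scl E (Re z) a - scl E (Im z) b, scl E (Re z) b + scl E (Im z) a)),
       idx = idx E,
       frames = (\<lambda>(V, e). (V, \<lambda>\<alpha> x. (e \<alpha> x, 0))) ` frames E \<rparr>"

definition cplx_metric :: "('m \<Rightarrow> 'v \<Rightarrow> 'v \<Rightarrow> real) \<Rightarrow> 'm \<Rightarrow> 'v \<times> 'v \<Rightarrow> 'v \<times> 'v \<Rightarrow> complex" where
  "cplx_metric g x =
     (\<lambda>(a, b) (a', b'). Complex (g x a a' + g x b b') (g x b a' - g x a b'))"

definition cplx_conn :: "('m, 'n, 'v) conn \<Rightarrow> ('m, 'n, 'v \<times> 'v) conn" where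
  "cplx_conn D s c x v = (D (fst \<circ> s) c x v, D (snd \<circ> s) c x v)"

section \<open>Exterior powers\<close>

text \<open>The decomposable vector \<open>v\<^sub>1 \<and> \<dots> \<and> v\<^sub>q\<close> is realised as the alternating form
  \<open>(\<xi>\<^sub>1, \<dots>, \<xi>\<^sub>q) \<mapsto> det (\<xi>\<^sub>i (v\<^sub>j))\<close> on linear functionals. It is a function on lists; its value on lists
  of the wrong length or containing a nonlinear function is set to 0.\<close>

definition wedge ::
  "('k::real_normed_field \<Rightarrow> 'v::ab_group_add \<Rightarrow> 'v) \<Rightarrow> 'v list \<Rightarrow> ('v \<Rightarrow> 'k) list \<Rightarrow> 'k" where
  "wedge sc vs = (\<lambda>\<xi>s.
     if length \<xi>s = length vs \<and> (\<forall>\<xi>\<in>set \<xi>s. Vector_Spaces.linear sc (*) \<xi>)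
     then \<Sum>\<sigma> | \<sigma> permutes {..<length vs}. of_int (sign \<sigma>) * (\<Prod>k<length vs. (\<xi>s ! \<sigma> k) (vs ! k))
     else 0)"

definition fun_scl :: "'k::real_normed_field \<Rightarrow> ('a \<Rightarrow> 'k) \<Rightarrow> 'a \<Rightarrow> 'k" where
  "fun_scl a f = (\<lambda>y. a * f y)"

definition ext_power ::
  "nat \<Rightarrow> ('k::real_normed_field, 'm, 'v::ab_group_add, 'i::linorder) vbundle \<Rightarrow>
   ('k, 'm, ('v \<Rightarrow> 'k) list \<Rightarrow> 'k, 'i list) vbundle" where
  "ext_power q E =
     \<lparr> fibre = (\<lambda>x. module.span fun_scl {wedge (scl E) vs | vs. length vs = q \<and> set vs \<subseteq> fibre E x}),
       scl = fun_scl,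
       idx = {\<alpha>s. length \<alpha>s = q \<and> set \<alpha>s \<subseteq> idx E \<and> sorted_wrt (<) \<alpha>s},
       frames = (\<lambda>(V, e). (V, \<lambda>\<alpha>s x. wedge (scl E) (map (\<lambda>\<alpha>. e \<alpha> x) \<alpha>s))) ` frames E \<rparr>"

text \<open>The connection induced on \<open>\<Lambda>\<^sup>q E\<close> is the one given on decomposable sections by the Leibniz rule
  \<open>D (s\<^sub>1 \<and> \<dots> \<and> s\<^sub>q) = \<Sum>k. s\<^sub>1 \<and> \<dots> \<and> D s\<^sub>k \<and> \<dots> \<and> s\<^sub>q\<close>; this determines it on all local sections.\<close>

definition induced_connection ::
  "('m::topological_space, 'n::finite) chart set \<Rightarrow>
   ('k::real_normed_field, 'm, 'v::ab_group_add, 'i::linorder) vbundle \<Rightarrow> ('m, 'n, 'v) conn \<Rightarrow>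
   nat \<Rightarrow> ('m, 'n, ('v \<Rightarrow> 'k) list \<Rightarrow> 'k) conn \<Rightarrow> bool" where
  "induced_connection A E D q L \<longleftrightarrow>
     connection A (ext_power q E) L \<and>
     (\<forall>W ss. open W \<and> length ss = q \<and> (\<forall>s\<in>set ss. smooth_section A E W s) \<longrightarrow>
        (\<forall>c\<in>A. \<forall>x\<in>W \<inter> fst c. \<forall>v.
           L (\<lambda>y. wedge (scl E) (map (\<lambda>s. s y) ss)) c x v =
           (\<Sum>k<q. wedge (scl E) ((map (\<lambda>s. s x) ss)[k := D (ss ! k) c x v]))))"

end

theory Submission
  imports Defs
begin

text \<open>In a local frame of \<open>E\<close>, a \<open>\<partial>'\<close>-closed section of \<open>\<Lambda>\<^sup>q E\<close> is an alternating tensor \<open>T\<close>, and the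
  operator \<open>h\<^sup>i\<^sup>j \<partial>\<^sub>i \<partial>'\<^sub>j\<close> applied to \<open>|T|\<^sup>2\<close> gives \<open>h\<^sup>i\<^sup>j \<langle>D\<^sub>i T, D\<^sub>j T\<rangle>\<close> minus the trace of the curvature
  of \<open>\<Lambda>\<^sup>q E\<close> evaluated on \<open>T\<close>. In a unitary basis diagonalising the Ricci form of \<open>E\<close> the latter is
  \<open>\<Sum>\<^sub>a (\<lambda>\<^sub>a\<^sub>1 + \<dots> + \<lambda>\<^sub>a\<^sub>q) |T\<^sub>a|\<^sup>2\<close>; only sums over \<open>q\<close> distinct eigenvalues enter because \<open>T\<close> is alternating,
  and these are nonpositive for \<open>q \<ge> p\<close>. The operator involves no connection on the base and no zeroth
  order term, so Hopf's maximum principle applies although \<open>h\<close> need not be Kaehler: \<open>|T|\<^sup>2\<close> is constant on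
  the compact connected manifold, \<open>D T = 0\<close>, and \<open>T\<close> vanishes at a point of negativity, hence everywhere.
  Sections of a complexified real bundle are complex tensors over real frames, so that the same
  argument covers \<open>\<Lambda>\<^sup>q E \<otimes> \<complex>\<close>.\<close>

section \<open>Smooth maps and Wirtinger derivatives\<close>

text \<open>Alternating tensors are kept with all their components inside the full tensor power,
  where metric, connection and curvature act slot by slot; no separate metric on the exterior power
  is introduced. The Bochner formula is therefore proved once, for an abstract Gram matrix with
  compatible connection coefficients, and the tensor power is a second instance of the same locale.
  Derivatives are always taken in the given frames, while the unitary eigenbasis serves only for
  algebra at one point. That basis is part of the curvature hypothesis itself
  (\<open>form_eigenvalues\<close>), so neither a spectral theorem nor a smooth choice of
  eigenvectors is involved. Sums of q eigenvalues follow from sums of p by averaging over subsets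
  with one element removed. The curvature hypothesis bounds the operator applied to the norm from
  below; once the norm is known to be constant, the second-order condition at a maximum bounds it
  from above, and this forces both nonnegative terms of the formula to zero. The trace is split into
  complex directions by a Cholesky factorisation of the inverse metric.\<close>

lemma Ck_on_eqI:
  assumes "open S"
  shows "Ck_on k S f \<Longrightarrow> (\<And>x. x \<in> S \<Longrightarrow> f x = g x) \<Longrightarrow> Ck_on k S g"
proof (induction k arbitrary: f g)
  case 0
  then show ?case by (simp cong: continuous_on_cong)
next
  case (Suc k)
  have d: "(g has_derivative frechet_derivative f (at x)) (at x)" if x: "x \<in> S" for x
  proof (rule has_derivative_transform_within_open[OF _ assms x Suc.prems(2)])
    show "(f has_derivative frechet_derivative f (at x)) (at x)"
      using Suc.prems(1) x frechet_derivative_works by (metis Ck_on.simps(2))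
  qed
  have "Ck_on k S (\<lambda>x. frechet_derivative g (at x) v)" for v
  proof (rule Suc.IH)
    show "Ck_on k S (\<lambda>x. frechet_derivative f (at x) v)"
      using Suc.prems(1) by simp
    show "frechet_derivative f (at x) v = frechet_derivative g (at x) v" if "x \<in> S" for x
      by (rule fun_cong[OF frechet_derivative_at[OF d[OF that]]])
  qed
  then show ?case
    unfolding Ck_on.simps using d differentiable_def by blast
qed

text \<open>The successor clause of \<open>Ck_on\<close> mentions \<open>frechet_derivative\<close>;
  here any explicit derivative is accepted, so the induction steps below can use the expressions
  that the sum and product rules deliver.\<close>

lemma Ck_on_SucI:
  assumes "open S" and d: "\<And>x. x \<in> S \<Longrightarrow> (f has_derivative f' x) (at x)"
    and f': "\<And>v. Ck_on k S (\<lambda>x. f' x v)"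
  shows "Ck_on (Suc k) S f"
proof -
  have "Ck_on k S (\<lambda>x. frechet_derivative f (at x) v)" for v
    by (rule Ck_on_eqI[OF assms(1) f']) (rule fun_cong[OF frechet_derivative_at[OF d]])
  then show ?thesis
    unfolding Ck_on.simps using d differentiable_def by blast
qed

lemma Ck_on_SucD1: "Ck_on (Suc k) S f \<Longrightarrow> x \<in> S \<Longrightarrow> (f has_derivative frechet_derivative f (at x)) (at x)"
  using frechet_derivative_works by auto

lemma Ck_on_SucD2: "Ck_on (Suc k) S f \<Longrightarrow> Ck_on k S (\<lambda>x. frechet_derivative f (at x) v)"
  by simp

text \<open>Not immediate, because the successor clause contains no lower clause: the base case is
  continuity of differentiable functions. Products need this, since a differentiated product retains
  an undifferentiated factor.\<close>

lemma Ck_on_SucD: "Ck_on (Suc k) S f \<Longrightarrow> Ck_on k S f"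
proof (induction k arbitrary: f)
  case 0
  then show ?case
    by (auto intro!: continuous_at_imp_continuous_on differentiable_imp_continuous_within)
next
  case (Suc k)
  have "Ck_on k S (\<lambda>x. frechet_derivative f (at x) v)" for v
    by (rule Suc.IH[OF Ck_on_SucD2[OF Suc.prems]])
  with Suc.prems show ?case by simp
qed

lemma Ck_on_const [simp]: "Ck_on k S (\<lambda>x. c)"
  by (induction k arbitrary: c) auto

lemma Ck_on_add:
  assumes "open S"
  shows "Ck_on k S f \<Longrightarrow> Ck_on k S g \<Longrightarrow> Ck_on k S (\<lambda>x. f x + g x)"
proof (induction k arbitrary: f g)
  case (Suc k)
  show ?case
    by (rule Ck_on_SucI[OF assms has_derivative_add[OF Ck_on_SucD1[OF Suc.prems(1)] Ck_on_SucD1[OF Suc.prems(2)]]])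
      (assumption | rule Suc.IH Ck_on_SucD2 Suc.prems)+
qed (auto intro: continuous_on_add)

lemma Ck_on_bounded_bilinear:
  assumes "bounded_bilinear B" "open S"
  shows "Ck_on k S f \<Longrightarrow> Ck_on k S g \<Longrightarrow> Ck_on k S (\<lambda>x. B (f x) (g x))"
proof (induction k arbitrary: f g)
  case 0
  then show ?case by (simp add: bounded_bilinear.continuous_on[OF assms(1)])
next
  case (Suc k)
  show ?case
    by (rule Ck_on_SucI[OF assms(2) bounded_bilinear.FDERIV[OF assms(1)
            Ck_on_SucD1[OF Suc.prems(1)] Ck_on_SucD1[OF Suc.prems(2)]]])
      (assumption | rule Ck_on_add assms Suc.IH Ck_on_SucD2 Suc.prems Ck_on_SucD[OF Suc.prems(1)]
          Ck_on_SucD[OF Suc.prems(2)])+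
qed

lemma Ck_on_bounded_linear:
  assumes "bounded_linear L" "open S"
  shows "Ck_on k S f \<Longrightarrow> Ck_on k S (\<lambda>x. L (f x))"
proof (induction k arbitrary: f)
  case 0
  then show ?case by (simp add: bounded_linear.continuous_on[OF assms(1)])
next
  case (Suc k)
  show ?case
    by (rule Ck_on_SucI[OF assms(2) bounded_linear.has_derivative[OF assms(1) Ck_on_SucD1[OF Suc.prems]]])
      (assumption | rule Suc.IH Ck_on_SucD2 Suc.prems)+
qed

lemma smooth_on_cong:
  "open S \<Longrightarrow> (\<And>x. x \<in> S \<Longrightarrow> f x = g x) \<Longrightarrow> smooth_on S f \<longleftrightarrow> smooth_on S g"
  unfolding smooth_on_def using Ck_on_eqI[of S _ f g] Ck_on_eqI[of S _ g f] by (simp add: eq_commute) blast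

lemma smooth_on_derivative: "smooth_on S f \<Longrightarrow> smooth_on S (\<lambda>x. frechet_derivative f (at x) v)"
  unfolding smooth_on_def using Ck_on.simps(2) by blast

lemma smooth_on_differentiable: "smooth_on S f \<Longrightarrow> x \<in> S \<Longrightarrow> f differentiable (at x)"
  unfolding smooth_on_def using Ck_on.simps(2) by blast

lemma smooth_on_continuous_on: "smooth_on S f \<Longrightarrow> continuous_on S f"
  unfolding smooth_on_def using Ck_on.simps(1) by blast

section \<open>Charts and smooth functions on the manifold\<close>

lemma open_chart_image:
  assumes "complex_atlas A" "c \<in> A" "open W"
  shows "open (snd c ` (W \<inter> fst c))"
proof -
  have "homeomorphism (fst c) (snd c ` fst c) (snd c) (chart_inv c)" "open (snd c ` fst c)"
    using assms unfolding complex_atlas_def by auto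
  then have "openin (top_of_set (snd c ` fst c)) (snd c ` (W \<inter> fst c))"
    using assms(3) by (metis homeomorphism_imp_open_map inf_commute openin_open_Int)
  then show ?thesis using \<open>open (snd c ` fst c)\<close> openin_open_trans by blast
qed

lemma chart_inv_inverse:
  assumes "complex_atlas A" "c \<in> A" "x \<in> fst c"
  shows "chart_inv c (snd c x) = x"
  using assms unfolding complex_atlas_def homeomorphism_def by blast

lemma ex_chart:
  assumes "complex_atlas A"
  obtains c where "c \<in> A" "x \<in> fst c"
  using assms unfolding complex_atlas_def by blast

lemma open_chart_dom: "complex_atlas A \<Longrightarrow> c \<in> A \<Longrightarrow> open (fst c)"
  unfolding complex_atlas_def by blast

lemma smooth_map_const [simp]: "smooth_map A W (\<lambda>x. c)"
  by (simp add: smooth_map_def smooth_on_def o_def)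

lemma smooth_map_subset:
  assumes "complex_atlas A" "open W" "smooth_map A W f" "W' \<subseteq> W" 
  shows "smooth_map A W' f"
proof -
  have "Ck_on k S' f" if "Ck_on k S f" "S' \<subseteq> S" for k S S' and f :: "complex ^ 'b \<Rightarrow> 'c"
    using that by (induction k arbitrary: f) (auto intro: continuous_on_subset)
  moreover have "snd c ` (W' \<inter> fst c) \<subseteq> snd c ` (W \<inter> fst c)" for c :: "('a, 'b) chart"
    using assms(4) by blast
  ultimately show ?thesis using assms(3) unfolding smooth_map_def smooth_on_def by blast
qed

lemma smooth_map_cong:
  assumes "complex_atlas A" "open W" "\<And>x. x \<in> W \<Longrightarrow> f x = g x"
  shows "smooth_map A W f \<longleftrightarrow> smooth_map A W g"
proof -
  have "smooth_on (snd c ` (W \<inter> fst c)) (f \<circ> chart_inv c) \<longleftrightarrow> smooth_on (snd c ` (W \<inter> fst c)) (g \<circ> chart_inv c)"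
    if "c \<in> A" for c
    using assms that
    by (intro smooth_on_cong open_chart_image[OF assms(1)]) (auto simp: chart_inv_inverse)
  then show ?thesis by (auto simp: smooth_map_def)
qed

lemma smooth_map_bounded_bilinear:
  assumes "bounded_bilinear B" "complex_atlas A" "open W" "smooth_map A W f" "smooth_map A W g"
  shows "smooth_map A W (\<lambda>x. B (f x) (g x))"
  using assms open_chart_image[OF assms(2) _ assms(3)] Ck_on_bounded_bilinear[OF assms(1)]
  unfolding smooth_map_def smooth_on_def o_def by blast

lemma smooth_map_bounded_linear:
  assumes "bounded_linear L" "complex_atlas A" "open W" "smooth_map A W f"
  shows "smooth_map A W (\<lambda>x. L (f x))"
  using assms open_chart_image[OF assms(2) _ assms(3)] Ck_on_bounded_linear[OF assms(1)]
  unfolding smooth_map_def smooth_on_def o_def by blast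

lemma smooth_map_add:
  assumes "complex_atlas A" "open W" "smooth_map A W f" "smooth_map A W g"
  shows "smooth_map A W (\<lambda>x. f x + g x)"
  using assms open_chart_image[OF assms(1) _ assms(2)] Ck_on_add
  unfolding smooth_map_def smooth_on_def o_def by blast

lemmas smooth_map_mult = smooth_map_bounded_bilinear[OF bounded_bilinear_mult]

lemma smooth_map_sum:
  assumes "complex_atlas A" "open W" "\<And>i. i \<in> I \<Longrightarrow> smooth_map A W (f i)"
  shows "smooth_map A W (\<lambda>x. \<Sum>i\<in>I. f i x)"
  using assms(3) by (induction I rule: infinite_finite_induct) (auto intro: smooth_map_add assms(1,2))

lemma smooth_map_prod:
  fixes f :: "'i \<Rightarrow> 'm::topological_space \<Rightarrow> 'k::real_normed_field"
  assumes "complex_atlas A" "open W" "\<And>i. i \<in> I \<Longrightarrow> smooth_map A W (f i)"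
  shows "smooth_map A W (\<lambda>x. \<Prod>i\<in>I. f i x)"
  using assms(3) by (induction I rule: infinite_finite_induct) (auto intro: smooth_map_mult assms(1,2))

lemma smooth_map_differentiable:
  assumes "smooth_map A W f" "c \<in> A" "x \<in> W" "x \<in> fst c"
  shows "(f \<circ> chart_inv c) differentiable (at (snd c x))"
  using assms smooth_on_differentiable unfolding smooth_map_def by blast

section \<open>Wirtinger calculus\<close>

text \<open>The Wirtinger operators along the i-th coordinate and its conjugate, for functions that
  are only real differentiable. They are total: where f has no derivative the value is arbitrary,
  hence the differentiability hypotheses of the rules below.\<close>

definition dz :: "'n::finite \<Rightarrow> (complex ^ 'n \<Rightarrow> complex) \<Rightarrow> complex ^ 'n \<Rightarrow> complex" where
  "dz i f z = (frechet_derivative f (at z) (axis i 1) - \<i> * frechet_derivative f (at z) (axis i \<i>)) / 2"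

definition dzb :: "'n::finite \<Rightarrow> (complex ^ 'n \<Rightarrow> complex) \<Rightarrow> complex ^ 'n \<Rightarrow> complex" where
  "dzb i f z = (frechet_derivative f (at z) (axis i 1) + \<i> * frechet_derivative f (at z) (axis i \<i>)) / 2"

text \<open>Existence of second derivatives is all that the maximum principle asks of a function.
  The class is closed under exponentials by a short argument, so the barrier can be handled without
  composition rules for \<open>smooth_on\<close>.\<close>

definition twice_differentiable_on ::
  "'a::real_normed_vector set \<Rightarrow> ('a \<Rightarrow> 'b::real_normed_vector) \<Rightarrow> bool" where
  "twice_differentiable_on U f \<longleftrightarrow>
     (\<forall>z\<in>U. f differentiable at z \<and> (\<forall>v. (\<lambda>z. frechet_derivative f (at z) v) differentiable at z))"

lemma frechet_derivative_eqI: "(f has_derivative D) (at z) \<Longrightarrow> frechet_derivative f (at z) = D"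
  using frechet_derivative_at by metis

lemma has_derivative_dz:
  assumes "(f has_derivative D) (at z)"
  shows "dz i f z = (D (axis i 1) - \<i> * D (axis i \<i>)) / 2"
    and "dzb i f z = (D (axis i 1) + \<i> * D (axis i \<i>)) / 2"
  unfolding dz_def dzb_def frechet_derivative_eqI[OF assms] by simp_all

lemma frechet_has_derivative: "f differentiable at z \<Longrightarrow> (f has_derivative frechet_derivative f (at z)) (at z)"
  by (simp add: frechet_derivative_works)

lemma dz_transform:
  assumes "open U" "z \<in> U" "\<And>y. y \<in> U \<Longrightarrow> f y = g y"
  shows "dz i f z = dz i g z" "dzb i f z = dzb i g z"
proof -
  have "frechet_derivative f (at z) = frechet_derivative g (at z)"
  proof -
    have *: "(g has_derivative D) (at z)" if "(f has_derivative D) (at z)" and "\<And>y. y \<in> U \<Longrightarrow> f y = g y" for D f g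
      using has_derivative_transform_within_open[OF that(1) assms(1,2) that(2)] .
    \<comment> \<open>Both functions have the same set of derivatives at z, possibly empty. Since
      \<open>frechet_derivative\<close> is a choice from this set, the equality holds without any
      differentiability.\<close>
    have "(f has_derivative D) (at z) \<longleftrightarrow> (g has_derivative D) (at z)" for D
      using *[of f D g] *[of g D f] assms(3) by auto
    then show ?thesis unfolding frechet_derivative_def by presburger
  qed
  then show "dz i f z = dz i g z" "dzb i f z = dzb i g z" unfolding dz_def dzb_def by simp_all
qed

lemma differentiable_transform_open:
  assumes "f differentiable at z" "open U" "z \<in> U" "\<And>y. y \<in> U \<Longrightarrow> f y = g y"
  shows "g differentiable at z"
  using assms has_derivative_transform_within_open unfolding differentiable_def by metis

lemma dz_const [simp]: "dz i (\<lambda>z. c) z = 0" "dzb i (\<lambda>z. c) z = 0"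
  by (simp_all add: dz_def dzb_def)

lemma dz_add:
  assumes "f differentiable at z" "g differentiable at z"
  shows "dz i (\<lambda>z. f z + g z) z = dz i f z + dz i g z"
    and "dzb i (\<lambda>z. f z + g z) z = dzb i f z + dzb i g z"
  using has_derivative_dz[OF has_derivative_add[OF assms[THEN frechet_has_derivative]], of i]
  by (simp_all add: dz_def dzb_def add_divide_distrib diff_divide_distrib distrib_left)

lemma dz_mult:
  assumes "f differentiable at z" "g differentiable at z"
  shows "dz i (\<lambda>z. f z * g z) z = dz i f z * g z + f z * dz i g z"
    and "dzb i (\<lambda>z. f z * g z) z = dzb i f z * g z + f z * dzb i g z"
  using has_derivative_dz[OF has_derivative_mult[OF assms[THEN frechet_has_derivative]], of i]
  by (simp_all add: dz_def dzb_def add_divide_distrib diff_divide_distrib algebra_simps)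

lemma dz_cmult:
  assumes "f differentiable at z"
  shows "dz i (\<lambda>z. c * f z) z = c * dz i f z" "dzb i (\<lambda>z. c * f z) z = c * dzb i f z"
  using dz_mult[of "\<lambda>z. c" z f i] assms by simp_all

lemma differentiable_cnj: "f differentiable at z \<Longrightarrow> (\<lambda>z. cnj (f z)) differentiable at z"
  unfolding differentiable_def using has_derivative_cnj by blast

lemma dz_cnj:
  assumes "f differentiable at z"
  shows "dz i (\<lambda>z. cnj (f z)) z = cnj (dzb i f z)" "dzb i (\<lambda>z. cnj (f z)) z = cnj (dz i f z)"
  using has_derivative_dz[OF has_derivative_cnj[OF assms[THEN frechet_has_derivative]], of i]
  by (simp_all add: dz_def dzb_def)

lemma dz_sum:
  assumes "\<And>k. k \<in> K \<Longrightarrow> f k differentiable at z"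
  shows "dz i (\<lambda>z. \<Sum>k\<in>K. f k z) z = (\<Sum>k\<in>K. dz i (f k) z)"
    and "dzb i (\<lambda>z. \<Sum>k\<in>K. f k z) z = (\<Sum>k\<in>K. dzb i (f k) z)"
proof -
  have "((\<lambda>z. \<Sum>k\<in>K. f k z) has_derivative (\<lambda>v. \<Sum>k\<in>K. frechet_derivative (f k) (at z) v)) (at z)"
    by (intro has_derivative_sum frechet_has_derivative assms)
  from has_derivative_dz[OF this, of i]
  show "dz i (\<lambda>z. \<Sum>k\<in>K. f k z) z = (\<Sum>k\<in>K. dz i (f k) z)"
    and "dzb i (\<lambda>z. \<Sum>k\<in>K. f k z) z = (\<Sum>k\<in>K. dzb i (f k) z)"
    by (simp_all add: dz_def dzb_def sum.distrib sum_subtractf sum_distrib_left flip: sum_divide_distrib)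
qed

lemma dz_exp:
  assumes "f differentiable at z"
  shows "dz i (\<lambda>z. exp (f z)) z = exp (f z) * dz i f z" "dzb i (\<lambda>z. exp (f z)) z = exp (f z) * dzb i f z"
proof -
  have "((\<lambda>z. exp (f z)) has_derivative (\<lambda>v. exp (f z) * frechet_derivative f (at z) v)) (at z)"
    using has_derivative_compose[OF frechet_has_derivative[OF assms], of exp "(*) (exp (f z))"]
      DERIV_exp[of "f z"] by (simp add: has_field_derivative_def)
  from has_derivative_dz[OF this, of i]
  show "dz i (\<lambda>z. exp (f z)) z = exp (f z) * dz i f z" "dzb i (\<lambda>z. exp (f z)) z = exp (f z) * dzb i f z"
    by (simp_all add: dz_def dzb_def add_divide_distrib diff_divide_distrib algebra_simps)
qed

text \<open>The differentiated factor is selected by \<open>if\<close> inside a single product: this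
  is the shape of \<open>at_slot\<close>, through which connection coefficients act on tensors. The
  three claims share one induction because each step differentiates the partial product.\<close>

lemma dz_prod:
  assumes "finite K" "\<And>k. k \<in> K \<Longrightarrow> f k differentiable at z"
  shows "(\<lambda>z. \<Prod>k\<in>K. f k z) differentiable at z"
    and "dz i (\<lambda>z. \<Prod>k\<in>K. f k z) z = (\<Sum>k\<in>K. \<Prod>l\<in>K. if l = k then dz i (f k) z else f l z)"
    and "dzb i (\<lambda>z. \<Prod>k\<in>K. f k z) z = (\<Sum>k\<in>K. \<Prod>l\<in>K. if l = k then dzb i (f k) z else f l z)"
proof -
  have "(\<lambda>z. \<Prod>k\<in>K. f k z) differentiable at z
     \<and> dz i (\<lambda>z. \<Prod>k\<in>K. f k z) z = (\<Sum>k\<in>K. \<Prod>l\<in>K. if l = k then dz i (f k) z else f l z)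
     \<and> dzb i (\<lambda>z. \<Prod>k\<in>K. f k z) z = (\<Sum>k\<in>K. \<Prod>l\<in>K. if l = k then dzb i (f k) z else f l z)"
    using assms
  proof (induction K rule: finite_induct)
    case (insert a K)
    have [simp]: "(\<Prod>l\<in>K. if l = a then X else f l z) = (\<Prod>l\<in>K. f l z)" for X
      using insert by (intro prod.cong) auto
    have *: "(\<Sum>k\<in>K. \<Prod>l\<in>insert a K. if l = k then h k else f l z)
        = f a z * (\<Sum>k\<in>K. \<Prod>l\<in>K. if l = k then h k else f l z)" for h
      unfolding sum_distrib_left using insert.hyps by (intro sum.cong) auto
    from insert * show ?case
      by (simp add: dz_mult sum.insert algebra_simps)
  qed simp
  then show "(\<lambda>z. \<Prod>k\<in>K. f k z) differentiable at z"
    and "dz i (\<lambda>z. \<Prod>k\<in>K. f k z) z = (\<Sum>k\<in>K. \<Prod>l\<in>K. if l = k then dz i (f k) z else f l z)"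
    and "dzb i (\<lambda>z. \<Prod>k\<in>K. f k z) z = (\<Sum>k\<in>K. \<Prod>l\<in>K. if l = k then dzb i (f k) z else f l z)" by auto
qed

lemma twice_differentiable_onD:
  assumes "twice_differentiable_on U f" "z \<in> U"
  shows "f differentiable at z" "(\<lambda>z. frechet_derivative f (at z) v) differentiable at z"
  using assms unfolding twice_differentiable_on_def by auto

lemma dz_differentiable:
  assumes "twice_differentiable_on U f" "z \<in> U"
  shows "dz i f differentiable at z" "dzb i f differentiable at z"
proof -
  have d: "(\<lambda>z. frechet_derivative f (at z) v) differentiable at z" for v
    by (rule twice_differentiable_onD(2)[OF assms])
  have "(\<lambda>z. (frechet_derivative f (at z) v + c * frechet_derivative f (at z) w) * inverse 2) differentiable at z" for v w c
    using differentiable_mult[OF differentiable_add[OF d[of v] differentiable_mult[OF differentiable_const[of c] d[of w]]]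
        differentiable_const[of "inverse 2"]] .
  from this[of "axis i 1" "- \<i>" "axis i \<i>"] this[of "axis i 1" "\<i>" "axis i \<i>"]
  show "dz i f differentiable at z" "dzb i f differentiable at z"
    by (simp_all add: dz_def[abs_def] dzb_def[abs_def])
qed

lemma twice_differentiable_onI:
  assumes "open U" and d: "\<And>z. z \<in> U \<Longrightarrow> (f has_derivative f' z) (at z)"
    and d2: "\<And>z v. z \<in> U \<Longrightarrow> (\<lambda>z. f' z v) differentiable at z"
  shows "twice_differentiable_on U f"
  unfolding twice_differentiable_on_def
proof (intro ballI conjI allI)
  fix z v assume z: "z \<in> U"
  show "f differentiable at z"
    using d[OF z] differentiable_def by blast
  show "(\<lambda>z. frechet_derivative f (at z) v) differentiable at z"
    by (rule differentiable_transform_open[OF d2[OF z] assms(1) z])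
      (rule fun_cong[OF frechet_derivative_eqI[OF d], symmetric])
qed

lemma twice_differentiable_onD':
  "twice_differentiable_on U f \<Longrightarrow> z \<in> U \<Longrightarrow> (f has_derivative frechet_derivative f (at z)) (at z)"
  by (rule frechet_has_derivative[OF twice_differentiable_onD(1)])

lemma twice_differentiable_on_const [simp]: "twice_differentiable_on U (\<lambda>z. c)"
  by (simp add: twice_differentiable_on_def)

lemma twice_differentiable_on_add:
  assumes "open U" "twice_differentiable_on U f" "twice_differentiable_on U g"
  shows "twice_differentiable_on U (\<lambda>z. f z + g z)"
  by (rule twice_differentiable_onI[OF assms(1) has_derivative_add[OF
          twice_differentiable_onD'[OF assms(2)] twice_differentiable_onD'[OF assms(3)]]])
    (assumption | rule differentiable_add twice_differentiable_onD(2)[OF assms(2)]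
      twice_differentiable_onD(2)[OF assms(3)])+

lemma twice_differentiable_on_mult:
  fixes f g :: "'a::real_normed_vector \<Rightarrow> 'b::real_normed_algebra"
  assumes "open U" "twice_differentiable_on U f" "twice_differentiable_on U g"
  shows "twice_differentiable_on U (\<lambda>z. f z * g z)"
  by (rule twice_differentiable_onI[OF assms(1) has_derivative_mult[OF
          twice_differentiable_onD'[OF assms(2)] twice_differentiable_onD'[OF assms(3)]]])
    (assumption | rule twice_differentiable_onD(2)[OF assms(2)]
      twice_differentiable_onD(2)[OF assms(3)] twice_differentiable_onD(1)[OF assms(2)]
      twice_differentiable_onD(1)[OF assms(3)] differentiable_add differentiable_mult)+

lemma twice_differentiable_on_cnj:
  assumes "open U" "twice_differentiable_on U f"
  shows "twice_differentiable_on U (\<lambda>z. cnj (f z))"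
  by (rule twice_differentiable_onI[OF assms(1) has_derivative_cnj[OF
          twice_differentiable_onD'[OF assms(2)]]])
    (assumption | rule differentiable_cnj twice_differentiable_onD(2)[OF assms(2)])+

lemma twice_differentiable_on_sum:
  assumes "open U" "\<And>k. k \<in> K \<Longrightarrow> twice_differentiable_on U (f k)"
  shows "twice_differentiable_on U (\<lambda>z. \<Sum>k\<in>K. f k z)"
  using assms(2) by (induction K rule: infinite_finite_induct) (auto intro: twice_differentiable_on_add assms(1))

lemma twice_differentiable_on_prod:
  fixes f :: "'k \<Rightarrow> 'a::real_normed_vector \<Rightarrow> complex"
  assumes "open U" "\<And>k. k \<in> K \<Longrightarrow> twice_differentiable_on U (f k)"
  shows "twice_differentiable_on U (\<lambda>z. \<Prod>k\<in>K. f k z)"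
  using assms(2) by (induction K rule: infinite_finite_induct) (auto intro: twice_differentiable_on_mult assms(1))

lemma smooth_on_twice_differentiable: "smooth_on U f \<Longrightarrow> twice_differentiable_on U f"
  unfolding twice_differentiable_on_def
  using smooth_on_differentiable smooth_on_derivative by metis

section \<open>The maximum principle for positive definite Levi operators\<close>

lemma DERIV_along_line:
  fixes f :: "'a::real_normed_vector \<Rightarrow> real"
  assumes "(f has_derivative D) (at (p + s *\<^sub>R v))"
  shows "((\<lambda>s. f (p + s *\<^sub>R v)) has_real_derivative D v) (at s)"
proof -
  have "((\<lambda>s. f (p + s *\<^sub>R v)) has_derivative (\<lambda>r. D (r *\<^sub>R v))) (at s)"
    by (rule has_derivative_compose[of "\<lambda>s. p + s *\<^sub>R v" "\<lambda>r. r *\<^sub>R v" s UNIV f D])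
      (auto intro!: derivative_eq_intros assms)
  moreover have "D (r *\<^sub>R v) = D v * r" for r
    using linear_cmul[OF has_derivative_linear[OF assms], of r v] by simp
  ultimately show ?thesis by (simp add: has_field_derivative_def)
qed

text \<open>Two applications of the mean value theorem: to the difference of f along two parallel
  segments in direction v, then to the v-derivative along w. The left-hand side of the equation is
  symmetric in v and w, which is what the symmetry of second derivatives rests on.\<close>

lemma second_difference_mvt:
  fixes f :: "'a::real_normed_vector \<Rightarrow> real"
  assumes h: "h > 0"
    and U: "\<And>s t. 0 \<le> s \<Longrightarrow> s \<le> h \<Longrightarrow> 0 \<le> t \<Longrightarrow> t \<le> h \<Longrightarrow> z + s *\<^sub>R v + t *\<^sub>R w \<in> U"
    and d: "\<And>y. y \<in> U \<Longrightarrow> (f has_derivative f' y) (at y)"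
    and d2: "\<And>y. y \<in> U \<Longrightarrow> ((\<lambda>y. f' y v) has_derivative fv y) (at y)"
  obtains s t where "0 < s" "s < h" "0 < t" "t < h"
    "f (z + h *\<^sub>R v + h *\<^sub>R w) - f (z + h *\<^sub>R v) - f (z + h *\<^sub>R w) + f z = h * h * fv (z + s *\<^sub>R v + t *\<^sub>R w) w"
proof -
  have D1: "((\<lambda>s. f (z + s *\<^sub>R v + t *\<^sub>R w)) has_real_derivative f' (z + s *\<^sub>R v + t *\<^sub>R w) v) (at s)"
    if "0 \<le> s" "s \<le> h" "0 \<le> t" "t \<le> h" for s t
    using DERIV_along_line[of f "f' (z + s *\<^sub>R v + t *\<^sub>R w)" "z + t *\<^sub>R w" s v] d[OF U[OF that]]
    by (simp add: algebra_simps)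
  have "\<exists>s>0. s < h \<and> (\<lambda>s. f (z + s *\<^sub>R v + h *\<^sub>R w) - f (z + s *\<^sub>R v + 0 *\<^sub>R w)) h
      - (\<lambda>s. f (z + s *\<^sub>R v + h *\<^sub>R w) - f (z + s *\<^sub>R v + 0 *\<^sub>R w)) 0
      = (h - 0) * (f' (z + s *\<^sub>R v + h *\<^sub>R w) v - f' (z + s *\<^sub>R v + 0 *\<^sub>R w) v)"
    using h by (intro MVT2 DERIV_diff D1) auto
  then obtain s where s: "0 < s" "s < h"
    and eq1: "f (z + h *\<^sub>R v + h *\<^sub>R w) - f (z + h *\<^sub>R v) - (f (z + h *\<^sub>R w) - f z)
      = h * (f' (z + s *\<^sub>R v + h *\<^sub>R w) v - f' (z + s *\<^sub>R v + 0 *\<^sub>R w) v)" by auto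
  have "\<exists>t>0. t < h \<and> f' (z + s *\<^sub>R v + h *\<^sub>R w) v - f' (z + s *\<^sub>R v + 0 *\<^sub>R w) v
      = (h - 0) * fv (z + s *\<^sub>R v + t *\<^sub>R w) w"
    using h s by (intro MVT2[of 0 h "\<lambda>t. f' (z + s *\<^sub>R v + t *\<^sub>R w) v"] DERIV_along_line d2 U) auto
  then obtain t where t: "0 < t" "t < h" and
    eq2: "f' (z + s *\<^sub>R v + h *\<^sub>R w) v - f' (z + s *\<^sub>R v + 0 *\<^sub>R w) v = h * fv (z + s *\<^sub>R v + t *\<^sub>R w) w"
    by auto
  show ?thesis
    using that[OF s t] eq1 unfolding eq2 by (simp add: algebra_simps)
qed

text \<open>The second difference computes both mixed derivatives, each at a point as close to z as
  desired; continuity carries the resulting equality to z.\<close>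

lemma second_derivative_symmetric_real:
  fixes f :: "'a::real_normed_vector \<Rightarrow> real"
  assumes U: "open U" "z \<in> U"
    and d: "\<And>y. y \<in> U \<Longrightarrow> (f has_derivative f' y) (at y)"
    and dv: "\<And>y. y \<in> U \<Longrightarrow> ((\<lambda>y. f' y v) has_derivative fv y) (at y)"
    and dw: "\<And>y. y \<in> U \<Longrightarrow> ((\<lambda>y. f' y w) has_derivative fw y) (at y)"
    and cont: "continuous_on U (\<lambda>y. fv y w)" "continuous_on U (\<lambda>y. fw y v)"
  shows "fv z w = fw z v"
proof (rule ccontr)
  assume ne: "fv z w \<noteq> fw z v"
  define e where "e = \<bar>fv z w - fw z v\<bar> / 2"
  have e: "e > 0" using ne by (simp add: e_def)
  have "isCont (\<lambda>y. fv y w) z" "isCont (\<lambda>y. fw y v) z"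
    using cont U by (auto simp: continuous_on_eq_continuous_at)
  then obtain r1 r2 where r: "r1 > 0" "\<And>y. dist y z < r1 \<Longrightarrow> dist (fv y w) (fv z w) < e"
     "r2 > 0" "\<And>y. dist y z < r2 \<Longrightarrow> dist (fw y v) (fw z v) < e"
    using e unfolding continuous_at_eps_delta by metis
  obtain r3 where r3: "r3 > 0" "ball z r3 \<subseteq> U" using U openE by blast
  define \<delta> where "\<delta> = min r1 (min r2 r3)"
  \<comment> \<open>The summand 1 keeps the denominator positive when v and w vanish and puts the
    closed parallelogram of side h strictly inside the ball of radius \<delta>.\<close>
  define h where "h = \<delta> / (norm v + norm w + 1)"
  have \<delta>: "\<delta> > 0" using r r3 by (simp add: \<delta>_def)
  then have h: "h > 0" by (simp add: h_def add_nonneg_pos)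
  have near: "dist (z + s *\<^sub>R v + t *\<^sub>R w) z < \<delta>" if "0 \<le> s" "s \<le> h" "0 \<le> t" "t \<le> h" for s t
  proof -
    have "norm (s *\<^sub>R v + t *\<^sub>R w) \<le> h * norm v + h * norm w"
      by (rule norm_triangle_le) (use that in \<open>auto intro!: add_mono mult_right_mono\<close>)
    also have "\<dots> < h * (norm v + norm w + 1)" using h by (simp add: algebra_simps)
    also have "\<dots> = \<delta>" using add_nonneg_pos[of "norm v + norm w" 1] by (simp add: h_def)
    finally show ?thesis by (simp add: dist_norm add.assoc)
  qed
  have inU: "z + s *\<^sub>R v + t *\<^sub>R w \<in> U" if "0 \<le> s" "s \<le> h" "0 \<le> t" "t \<le> h" for s t
    using near[OF that] r3(2) unfolding \<delta>_def ball_def by (auto simp: dist_commute)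
  obtain s t where st: "0 < s" "s < h" "0 < t" "t < h" and
    eq1: "f (z + h *\<^sub>R v + h *\<^sub>R w) - f (z + h *\<^sub>R v) - f (z + h *\<^sub>R w) + f z = h * h * fv (z + s *\<^sub>R v + t *\<^sub>R w) w"
    by (rule second_difference_mvt[of h z v w U f f' fv, OF h inU d dv]) auto
  have inU': "z + s *\<^sub>R w + t *\<^sub>R v \<in> U" if "0 \<le> s" "s \<le> h" "0 \<le> t" "t \<le> h" for s t
    using inU[of t s] that by (simp add: algebra_simps)
  obtain s' t' where st': "0 < s'" "s' < h" "0 < t'" "t' < h" and
    eq2: "f (z + h *\<^sub>R w + h *\<^sub>R v) - f (z + h *\<^sub>R w) - f (z + h *\<^sub>R v) + f z = h * h * fw (z + s' *\<^sub>R w + t' *\<^sub>R v) v"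
    by (rule second_difference_mvt[of h z w v U f f' fw, OF h inU' d dw]) auto
  have comm: "z + h *\<^sub>R w + h *\<^sub>R v = z + h *\<^sub>R v + h *\<^sub>R w" by (simp add: algebra_simps)
  have "h * h * fv (z + s *\<^sub>R v + t *\<^sub>R w) w = h * h * fw (z + s' *\<^sub>R w + t' *\<^sub>R v) v"
    using eq1 eq2 unfolding comm by linarith
  then have eq: "fv (z + s *\<^sub>R v + t *\<^sub>R w) w = fw (z + s' *\<^sub>R w + t' *\<^sub>R v) v"
    using h by simp
  have "dist (fv (z + s *\<^sub>R v + t *\<^sub>R w) w) (fv z w) < e"
    using near[of s t] st by (intro r(2)) (auto simp: \<delta>_def)
  moreover have "dist (z + s' *\<^sub>R w + t' *\<^sub>R v) z < \<delta>"
    using near[of t' s'] st' by (simp add: algebra_simps)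
  then have "dist (fw (z + s' *\<^sub>R w + t' *\<^sub>R v) v) (fw z v) < e"
    by (intro r(4)) (auto simp: \<delta>_def)
  ultimately have "dist (fv z w) (fw z v) < 2 * e"
    unfolding eq dist_real_def by linarith
  then show False by (simp add: e_def dist_real_def)
qed

lemma second_derivative_symmetric:
  fixes f :: "'a::real_normed_vector \<Rightarrow> complex"
  assumes U: "open U" "z \<in> U" and f: "smooth_on U f"
  shows "frechet_derivative (\<lambda>y. frechet_derivative f (at y) v) (at z) w
       = frechet_derivative (\<lambda>y. frechet_derivative f (at y) w) (at z) v"
proof -
  have d: "(f has_derivative frechet_derivative f (at y)) (at y)" if "y \<in> U" for y
    by (rule frechet_has_derivative[OF smooth_on_differentiable[OF f that]])
  have d2: "((\<lambda>y. frechet_derivative f (at y) v) has_derivative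
       frechet_derivative (\<lambda>y. frechet_derivative f (at y) v) (at y)) (at y)" if "y \<in> U" for y v
    by (rule frechet_has_derivative[OF smooth_on_differentiable[OF smooth_on_derivative[OF f] that]])
  have c: "continuous_on U (\<lambda>y. frechet_derivative (\<lambda>y. frechet_derivative f (at y) v) (at y) w)" for v w
    by (rule smooth_on_continuous_on[OF smooth_on_derivative[OF smooth_on_derivative[OF f]]])
  have R: "Re (frechet_derivative (\<lambda>y. frechet_derivative f (at y) v) (at z) w)
      = Re (frechet_derivative (\<lambda>y. frechet_derivative f (at y) w) (at z) v)"
    by (rule second_derivative_symmetric_real[OF U has_derivative_Re[OF d] has_derivative_Re[OF d2]
          has_derivative_Re[OF d2] continuous_on_Re[OF c] continuous_on_Re[OF c]])
  have I: "Im (frechet_derivative (\<lambda>y. frechet_derivative f (at y) v) (at z) w)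
      = Im (frechet_derivative (\<lambda>y. frechet_derivative f (at y) w) (at z) v)"
    by (rule second_derivative_symmetric_real[OF U has_derivative_Im[OF d] has_derivative_Im[OF d2]
          has_derivative_Im[OF d2] continuous_on_Im[OF c] continuous_on_Im[OF c]])
  show ?thesis using R I by (simp add: complex_eq_iff)
qed

text \<open>This cancels the second-order terms when covariant derivatives are commuted in
  \<open>nabla_commutator\<close>.\<close>

lemma dz_dzb_commute:
  assumes "open U" "z \<in> U" "smooth_on U f"
  shows "dz i (dzb j f) z = dzb j (dz i f) z"
proof -
  let ?S = "\<lambda>v w. frechet_derivative (\<lambda>y. frechet_derivative f (at y) v) (at z) w"
  have S: "((\<lambda>y. frechet_derivative f (at y) v) has_derivative ?S v) (at z)" for v
    by (rule frechet_has_derivative[OF smooth_on_differentiable[OF smooth_on_derivative[OF assms(3)] assms(2)]])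
  have D: "((\<lambda>y. (frechet_derivative f (at y) v + c * frechet_derivative f (at y) w) * (1/2)) has_derivative
      (\<lambda>u. (?S v u + c * ?S w u) * (1/2))) (at z)" for v w c
    by (intro has_derivative_mult_left has_derivative_add has_derivative_mult_right S)
  have sym: "?S v w = ?S w v" for v w
    by (rule second_derivative_symmetric[OF assms])
  have b: "(dzb j f has_derivative (\<lambda>u. (?S (axis j 1) u + \<i> * ?S (axis j \<i>) u) * (1/2))) (at z)"
    using D[of "axis j 1" \<i> "axis j \<i>"] by (simp add: dzb_def[abs_def])
  have a: "(dz i f has_derivative (\<lambda>u. (?S (axis i 1) u + (-\<i>) * ?S (axis i \<i>) u) * (1/2))) (at z)"
    using D[of "axis i 1" "-\<i>" "axis i \<i>"] by (simp add: dz_def[abs_def])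
  show ?thesis
    unfolding has_derivative_dz[OF a] has_derivative_dz[OF b] sym[of "axis i 1"] sym[of "axis i \<i>"]
    by (simp add: algebra_simps)
qed

text \<open>The derivative along v vanishes at z. If D v were positive, this derivative would be
  positive just beyond z, and the mean value theorem would give a larger value of u there.\<close>

lemma second_derivative_at_max:
  fixes u :: "'a::real_normed_vector \<Rightarrow> real"
  assumes U: "open U" "z \<in> U"
    and d: "\<And>y. y \<in> U \<Longrightarrow> (u has_derivative u' y) (at y)"
    and d2: "((\<lambda>y. u' y v) has_derivative D) (at z)"
    and max: "\<And>y. y \<in> U \<Longrightarrow> u y \<le> u z"
  shows "D v \<le> 0"
proof (rule ccontr)
  assume "\<not> D v \<le> 0"
  then have pos: "D v > 0" by simp
  have "open ((\<lambda>t. z + t *\<^sub>R v) -` U)"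
    by (intro open_vimage U continuous_intros)
  then obtain r where r: "r > 0" "ball 0 r \<subseteq> (\<lambda>t. z + t *\<^sub>R v) -` U"
    using U(2) by (metis (mono_tags, lifting) add.right_neutral openE scale_zero_left vimageI)
  have inU: "z + t *\<^sub>R v \<in> U" if "\<bar>t\<bar> < r" for t
    using r(2) that by (auto simp: subset_iff)
  have \<phi>: "((\<lambda>t. u (z + t *\<^sub>R v)) has_real_derivative u' (z + t *\<^sub>R v) v) (at t)" if "\<bar>t\<bar> < r" for t
    by (rule DERIV_along_line[OF d[OF inU[OF that]]])
  have "((\<lambda>t. u' (z + t *\<^sub>R v) v) has_real_derivative D v) (at 0)"
    using DERIV_along_line[of "\<lambda>y. u' y v" D z 0 v] d2 by simp
  from DERIV_pos_inc_right[OF this pos] obtain \<delta> where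
    \<delta>: "\<delta> > 0" "\<And>h. 0 < h \<Longrightarrow> h < \<delta> \<Longrightarrow> u' z v < u' (z + h *\<^sub>R v) v" by auto
  have "u' (z + 0 *\<^sub>R v) v = 0"
    using r(1) inU max by (intro DERIV_local_max[OF \<phi>[of 0] r(1)]) auto
  then have z0: "u' z v = 0" by simp
  define h where "h = min r \<delta> / 2"
  have h: "h > 0" "h < r" "h < \<delta>" using r(1) \<delta>(1) by (auto simp: h_def)
  have "\<exists>t>0. t < h \<and> u (z + h *\<^sub>R v) - u (z + 0 *\<^sub>R v) = (h - 0) * u' (z + t *\<^sub>R v) v"
    using h by (intro MVT2[of 0 h "\<lambda>t. u (z + t *\<^sub>R v)"] \<phi>) auto
  then obtain t where t: "0 < t" "t < h" "u (z + h *\<^sub>R v) - u z = h * u' (z + t *\<^sub>R v) v" by auto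
  have "u' (z + t *\<^sub>R v) v > 0" using \<delta>(2)[of t] t h z0 by simp
  then have "u (z + h *\<^sub>R v) > u z" using t(3) h(1) by (smt (verit) mult_pos_pos)
  then show False using max[OF inU[of h]] h by simp
qed

lemma vec_real_expansion:
  fixes w :: "complex ^ 'n::finite"
  shows "w = (\<Sum>i\<in>UNIV. Re (w $ i) *\<^sub>R axis i 1 + Im (w $ i) *\<^sub>R axis i \<i>)"
proof -
  have "(\<Sum>i\<in>UNIV. Re (w $ i) *\<^sub>R axis i 1 + Im (w $ i) *\<^sub>R axis i \<i>) $ k = w $ k" for k
  proof -
    have "(\<Sum>i\<in>UNIV. Re (w $ i) *\<^sub>R axis i 1 + Im (w $ i) *\<^sub>R axis i \<i>) $ k
      = (\<Sum>i\<in>UNIV. if i = k then w $ k else 0)"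
      unfolding sum_component by (intro sum.cong) (auto simp: axis_def complex_eq_iff)
    then show ?thesis by simp
  qed
  then show ?thesis by (simp add: vec_eq_iff)
qed

text \<open>The right-hand sides are the complex linear and the antilinear part of D at w. Sums over
  coordinates are thereby replaced by the two real directions w and \<i> w.\<close>

lemma linear_wirtinger:
  fixes D :: "complex ^ 'n::finite \<Rightarrow> complex"
  assumes "linear D"
  shows "(\<Sum>i\<in>UNIV. w $ i * ((D (axis i 1) - \<i> * D (axis i \<i>)) / 2)) = (D w - \<i> * D (\<i> *s w)) / 2"
    and "(\<Sum>i\<in>UNIV. cnj (w $ i) * ((D (axis i 1) + \<i> * D (axis i \<i>)) / 2)) = (D w + \<i> * D (\<i> *s w)) / 2"
proof -
  have "D w = (\<Sum>i\<in>UNIV. Re (w $ i) *\<^sub>R D (axis i 1) + Im (w $ i) *\<^sub>R D (axis i \<i>))" for w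
    by (subst vec_real_expansion[of w], subst linear_sum[OF assms])
      (simp only: linear_add[OF assms] linear_cmul[OF assms])
  then have e: "D w = (\<Sum>i\<in>UNIV. of_real (Re (w $ i)) * D (axis i 1) + of_real (Im (w $ i)) * D (axis i \<i>))" for w
    unfolding scaleR_conv_of_real .
  have c: "w $ i = of_real (Re (w $ i)) + \<i> * of_real (Im (w $ i))"
    "cnj (w $ i) = of_real (Re (w $ i)) - \<i> * of_real (Im (w $ i))" for i
    by (auto simp: complex_eq_iff)
  show "(\<Sum>i\<in>UNIV. w $ i * ((D (axis i 1) - \<i> * D (axis i \<i>)) / 2)) = (D w - \<i> * D (\<i> *s w)) / 2"
    unfolding e[of w] e[of "\<i> *s w"] sum_distrib_left sum_subtractf[symmetric] sum_divide_distrib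
    by (intro sum.cong refl, subst c(1)) (simp add: algebra_simps)
  show "(\<Sum>i\<in>UNIV. cnj (w $ i) * ((D (axis i 1) + \<i> * D (axis i \<i>)) / 2)) = (D w + \<i> * D (\<i> *s w)) / 2"
    unfolding e[of w] e[of "\<i> *s w"] sum_distrib_left sum.distrib[symmetric] sum_divide_distrib
    by (intro sum.cong refl, subst c(2)) (simp add: algebra_simps)
qed

lemma real_derivative_of_real_function:
  fixes f :: "'a::real_normed_vector \<Rightarrow> complex"
  assumes "open U" "z \<in> U" "(f has_derivative D) (at z)" "\<And>y. y \<in> U \<Longrightarrow> Im (f y) = 0"
  shows "Im (D v) = 0"
proof -
  have "((\<lambda>y. 0) has_derivative (\<lambda>v. Im (D v))) (at z)"
    by (rule has_derivative_transform_within_open[OF has_derivative_Im[OF assms(3)] assms(1,2)])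
      (use assms(4) in auto)
  then have "(\<lambda>v. Im (D v)) = (\<lambda>v. 0)"
    using has_derivative_unique has_derivative_const by blast
  then show ?thesis by metis
qed

text \<open>On w the complex Hessian is a quarter of the sum of the real second derivatives along w
  and \<i> w, and each of these is nonpositive at a maximum. The mixed second derivatives are real
  and carry a factor \<i>, so they disappear from the real part.\<close>

lemma levi_form_at_max:
  fixes u :: "complex ^ 'n::finite \<Rightarrow> complex"
  assumes U: "open U" "z \<in> U" and u: "twice_differentiable_on U u"
    and real: "\<And>y. y \<in> U \<Longrightarrow> Im (u y) = 0"
    and max: "\<And>y. y \<in> U \<Longrightarrow> Re (u y) \<le> Re (u z)"
  shows "Re (\<Sum>i\<in>UNIV. \<Sum>j\<in>UNIV. w $ i * cnj (w $ j) * dz i (dzb j u) z) \<le> 0"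
proof -
  let ?S = "\<lambda>v. frechet_derivative (\<lambda>y. frechet_derivative u (at y) v) (at z)"
  have d: "(u has_derivative frechet_derivative u (at y)) (at y)" if "y \<in> U" for y
    by (rule twice_differentiable_onD'[OF u that])
  have S: "((\<lambda>y. frechet_derivative u (at y) v) has_derivative ?S v) (at z)" for v
    by (rule frechet_has_derivative[OF twice_differentiable_onD(2)[OF u U(2)]])
  have D1: "((\<lambda>y. (frechet_derivative u (at y) w + \<i> * frechet_derivative u (at y) (\<i> *s w)) * (1/2)) has_derivative
      (\<lambda>v. (?S w v + \<i> * ?S (\<i> *s w) v) * (1/2))) (at z)"
    by (intro has_derivative_mult_left has_derivative_add has_derivative_mult_right S)
  have eq: "(\<Sum>j\<in>UNIV. cnj (w $ j) * dzb j u y)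
      = (frechet_derivative u (at y) w + \<i> * frechet_derivative u (at y) (\<i> *s w)) * (1/2)" if "y \<in> U" for y
    using linear_wirtinger(2)[OF has_derivative_linear[OF d[OF that]], of w] by (simp add: dzb_def)
  have D: "((\<lambda>y. \<Sum>j\<in>UNIV. cnj (w $ j) * dzb j u y) has_derivative
      (\<lambda>v. (?S w v + \<i> * ?S (\<i> *s w) v) * (1/2))) (at z)"
    by (rule has_derivative_transform_within_open[OF D1 U]) (simp add: eq)
  have "(\<Sum>i\<in>UNIV. \<Sum>j\<in>UNIV. w $ i * cnj (w $ j) * dz i (dzb j u) z)
      = (\<Sum>i\<in>UNIV. w $ i * dz i (\<lambda>y. \<Sum>j\<in>UNIV. cnj (w $ j) * dzb j u y) z)"
    using dz_differentiable(2)[OF u U(2)]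
    by (simp add: dz_sum(1) dz_cmult(1) sum_distrib_left mult.assoc)
  also have "\<dots> = ((?S w w + \<i> * ?S (\<i> *s w) w) * (1/2) - \<i> * ((?S w (\<i> *s w) + \<i> * ?S (\<i> *s w) (\<i> *s w)) * (1/2))) / 2"
    unfolding has_derivative_dz[OF D] by (rule linear_wirtinger(1)[OF has_derivative_linear[OF D]])
  finally have sum: "(\<Sum>i\<in>UNIV. \<Sum>j\<in>UNIV. w $ i * cnj (w $ j) * dz i (dzb j u) z) = \<dots>" .
  have im: "Im (?S v v') = 0" for v v'
    by (rule real_derivative_of_real_function[OF U S])
      (rule real_derivative_of_real_function[OF U(1) _ d real])
  have le: "Re (?S v v) \<le> 0" for v
    by (rule second_derivative_at_max[OF U has_derivative_Re[OF d] has_derivative_Re[OF S] max])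
  have "Re (((?S w w + \<i> * ?S (\<i> *s w) w) * (1/2) - \<i> * ((?S w (\<i> *s w) + \<i> * ?S (\<i> *s w) (\<i> *s w)) * (1/2))) / 2)
      = (Re (?S w w) + Re (?S (\<i> *s w) (\<i> *s w))) / 4"
    by (simp add: im field_simps)
  also have "\<dots> \<le> 0" using le[of w] le[of "\<i> *s w"] by simp
  finally show ?thesis unfolding sum .
qed

section \<open>Positive definite forms and ellipticity\<close>

text \<open>Induction on the index set: the new index a is eliminated, and the induction hypothesis
  is applied to the Schur complement \<open>H i j - H i a * H a j / d\<close>, which is again
  Hermitian and positive.\<close>

lemma cholesky:
  fixes H :: "'a \<Rightarrow> 'a \<Rightarrow> complex"
  assumes "finite S"
    and "\<And>i j. i \<in> S \<Longrightarrow> j \<in> S \<Longrightarrow> H j i = cnj (H i j)"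
    and "\<And>v. \<exists>i\<in>S. v i \<noteq> 0 \<Longrightarrow> 0 < Re (\<Sum>i\<in>S. \<Sum>j\<in>S. H i j * v i * cnj (v j))"
  shows "\<exists>w. \<forall>i\<in>S. \<forall>j\<in>S. H i j = (\<Sum>k\<in>S. w k i * cnj (w k j))"
  using assms
proof (induction S arbitrary: H rule: finite_induct)
  case (insert a S)
  define d where "d = Re (H a a)"
  have "Im (H a a) = 0"
    using insert.prems(1)[of a a] by (metis Reals_cnj_iff complex_is_Real_iff insertI1)
  then have Haa: "H a a = of_real d" by (simp add: d_def complex_eq_iff)
  have "0 < Re (\<Sum>i\<in>insert a S. \<Sum>j\<in>insert a S. H i j * (if i = a then 1 else 0) * cnj (if j = a then 1 else 0))"
    by (rule insert.prems(2)) auto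
  also have "(\<Sum>i\<in>insert a S. \<Sum>j\<in>insert a S. H i j * (if i = a then 1 else 0) * cnj (if j = a then 1 else 0)) = H a a"
  proof -
    have "(\<Sum>i\<in>insert a S. \<Sum>j\<in>insert a S. H i j * (if i = a then 1 else 0) * cnj (if j = a then 1 else 0))
      = (\<Sum>i\<in>insert a S. if i = a then H a a else 0)"
    proof (intro sum.cong refl)
      fix i
      have "(\<Sum>j\<in>insert a S. H i j * (if i = a then 1 else 0) * cnj (if j = a then 1 else 0))
        = (\<Sum>j\<in>insert a S. if j = a then (if i = a then H a a else 0) else 0)"
        by (intro sum.cong) auto
      then show "(\<Sum>j\<in>insert a S. H i j * (if i = a then 1 else 0) * cnj (if j = a then 1 else 0))
        = (if i = a then H a a else 0)" using insert.hyps by (simp only: sum.delta finite_insert) simp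
    qed
    then show ?thesis using insert.hyps by (simp only: sum.delta finite_insert) simp
  qed
  finally have d: "d > 0" by (simp add: d_def)
  let ?H = "\<lambda>i j. H i j - H i a * H a j / of_real d"
  have "\<exists>w. \<forall>i\<in>S. \<forall>j\<in>S. ?H i j = (\<Sum>k\<in>S. w k i * cnj (w k j))"
  proof (rule insert.IH)
    show "?H j i = cnj (?H i j)" if "i \<in> S" "j \<in> S" for i j
      using insert.prems(1)[of i j] insert.prems(1)[of a i] insert.prems(1)[of j a] that by simp
    show "0 < Re (\<Sum>i\<in>S. \<Sum>j\<in>S. ?H i j * v i * cnj (v j))" if "\<exists>i\<in>S. v i \<noteq> 0" for v
    proof -
      define b where "b = (\<Sum>i\<in>S. H i a * v i)"
      have cb: "(\<Sum>j\<in>S. H a j * cnj (v j)) = cnj b"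
        unfolding b_def cnj_sum complex_cnj_mult
        by (intro sum.cong refl, subst insert.prems(1)[of _ a]) auto
      \<comment> \<open>The value at a completes the square: it minimises the form among all
        extensions of v to a, and the minimum is the Schur complement evaluated at v.\<close>
      let ?v = "\<lambda>i. if i = a then - b / of_real d else v i"
      have vS: "?v i = v i" if "i \<in> S" for i using that insert.hyps by auto
      have "0 < Re (\<Sum>i\<in>insert a S. \<Sum>j\<in>insert a S. H i j * ?v i * cnj (?v j))"
        using that insert.hyps by (intro insert.prems(2)) auto
      also have "(\<Sum>i\<in>insert a S. \<Sum>j\<in>insert a S. H i j * ?v i * cnj (?v j))
         = H a a * ?v a * cnj (?v a) + (\<Sum>j\<in>S. H a j * ?v a * cnj (v j))
           + (\<Sum>i\<in>S. H i a * v i * cnj (?v a) + (\<Sum>j\<in>S. H i j * v i * cnj (v j)))"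
        using insert.hyps vS by (simp add: sum.insert cong: sum.cong)
      also have "\<dots> = H a a * ?v a * cnj (?v a) + ?v a * (\<Sum>j\<in>S. H a j * cnj (v j))
           + cnj (?v a) * (\<Sum>i\<in>S. H i a * v i) + (\<Sum>i\<in>S. \<Sum>j\<in>S. H i j * v i * cnj (v j))"
      proof -
        have "H a a * x * cnj x + (\<Sum>j\<in>S. H a j * x * cnj (v j))
           + (\<Sum>i\<in>S. H i a * v i * cnj x + (\<Sum>j\<in>S. H i j * v i * cnj (v j)))
          = H a a * x * cnj x + x * (\<Sum>j\<in>S. H a j * cnj (v j))
           + cnj x * (\<Sum>i\<in>S. H i a * v i) + (\<Sum>i\<in>S. \<Sum>j\<in>S. H i j * v i * cnj (v j))" for x
          by (simp add: sum.distrib sum_distrib_left mult_ac)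
        then show ?thesis .
      qed
      also have "\<dots> = (\<Sum>i\<in>S. \<Sum>j\<in>S. H i j * v i * cnj (v j)) - b * cnj b / of_real d"
        unfolding cb b_def[symmetric] Haa using d by (simp add: field_simps)
      also have "\<dots> = (\<Sum>i\<in>S. \<Sum>j\<in>S. ?H i j * v i * cnj (v j))"
      proof -
        have "(\<Sum>i\<in>S. \<Sum>j\<in>S. ?H i j * v i * cnj (v j)) = (\<Sum>i\<in>S. \<Sum>j\<in>S. H i j * v i * cnj (v j))
            - (\<Sum>i\<in>S. \<Sum>j\<in>S. (H i a * v i) * (H a j * cnj (v j))) / of_real d"
          by (simp add: sum_subtractf sum_divide_distrib left_diff_distrib right_diff_distrib mult_ac)
        then show ?thesis by (simp only: sum_product[symmetric] cb b_def[symmetric])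
      qed
      finally show ?thesis .
    qed
  qed
  then obtain w where w: "\<And>i j. i \<in> S \<Longrightarrow> j \<in> S \<Longrightarrow> ?H i j = (\<Sum>k\<in>S. w k i * cnj (w k j))" by blast
  \<comment> \<open>The vector with index a restores the rank-one part that was subtracted in the
    Schur complement; the others are extended by zero at a so that they do not disturb its row and
    column.\<close>
  define w' where "w' = (\<lambda>k i. if k = a then H i a / of_real (sqrt d) else if i = a then 0 else w k i)"
  have "H i j = (\<Sum>k\<in>insert a S. w' k i * cnj (w' k j))" if ij: "i \<in> insert a S" "j \<in> insert a S" for i j
  proof -
    have "cnj (H j a) = H a j" using insert.prems(1)[of j a] ij by simp
    moreover have "complex_of_real (sqrt d) * complex_of_real (sqrt d) = of_real d"
      using d by (simp flip: of_real_mult)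
    ultimately have wa: "w' a i * cnj (w' a j) = H i a * H a j / of_real d"
      by (simp add: w'_def)
    have "(\<Sum>k\<in>S. w' k i * cnj (w' k j)) = (if i = a \<or> j = a then 0 else (\<Sum>k\<in>S. w k i * cnj (w k j)))"
      using insert.hyps by (auto simp: w'_def intro!: sum.neutral sum.cong)
    then have "(\<Sum>k\<in>insert a S. w' k i * cnj (w' k j)) = H i a * H a j / of_real d
        + (if i = a \<or> j = a then 0 else (\<Sum>k\<in>S. w k i * cnj (w k j)))"
      using insert.hyps wa by simp
    then have sum_w': "(\<Sum>k\<in>insert a S. w' k i * cnj (w' k j)) = H i a * H a j / of_real d
        + (if i = a \<or> j = a then 0 else H i j - H i a * H a j / of_real d)"
      using w[of i j] ij by (cases "i = a \<or> j = a") (auto split: if_splits)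
    show ?thesis unfolding sum_w'
      using d Haa by (cases "i = a \<or> j = a") auto
  qed
  then show ?case by blast
qed auto

definition positive_definite :: "('n::finite \<Rightarrow> 'n \<Rightarrow> complex) \<Rightarrow> bool" where
  "positive_definite a \<longleftrightarrow> (\<forall>i j. a j i = cnj (a i j)) \<and>
     (\<forall>v. (\<exists>i. v i \<noteq> 0) \<longrightarrow> 0 < Re (\<Sum>i\<in>UNIV. \<Sum>j\<in>UNIV. a i j * v i * cnj (v j)))"

lemma positive_definite_nonneg:
  assumes "positive_definite a"
  shows "0 \<le> Re (\<Sum>i\<in>UNIV. \<Sum>j\<in>UNIV. a i j * v i * cnj (v j))"
proof (cases "\<exists>i. v i \<noteq> 0")
  case True
  then show ?thesis
    using assms unfolding positive_definite_def by (blast intro: less_imp_le)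
next
  case False
  then show ?thesis by simp
qed

text \<open>Writing a as a sum of rank-one forms turns the trace into a sum of Levi forms, one for
  each direction \<open>w k\<close>.\<close>

lemma elliptic_at_max:
  fixes u :: "complex ^ 'n::finite \<Rightarrow> complex"
  assumes U: "open U" "z \<in> U" and u: "twice_differentiable_on U u"
    and real: "\<And>y. y \<in> U \<Longrightarrow> Im (u y) = 0"
    and max: "\<And>y. y \<in> U \<Longrightarrow> Re (u y) \<le> Re (u z)"
    and a: "positive_definite a"
  shows "Re (\<Sum>i\<in>UNIV. \<Sum>j\<in>UNIV. a i j * dz i (dzb j u) z) \<le> 0"
proof -
  obtain w :: "'n \<Rightarrow> 'n \<Rightarrow> complex" where w: "\<And>i j. a i j = (\<Sum>k\<in>UNIV. w k i * cnj (w k j))"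
  proof -
    have herm: "a j i = cnj (a i j)" for i j
      using a unfolding positive_definite_def by blast
    have pos: "0 < Re (\<Sum>i\<in>UNIV. \<Sum>j\<in>UNIV. a i j * v i * cnj (v j))" if "\<exists>i\<in>UNIV. v i \<noteq> 0" for v
      using a that unfolding positive_definite_def by blast
    have "\<exists>w :: 'n \<Rightarrow> 'n \<Rightarrow> complex. \<forall>i\<in>UNIV. \<forall>j\<in>UNIV. a i j = (\<Sum>k\<in>UNIV. w k i * cnj (w k j))"
    proof (rule cholesky)
      show "finite (UNIV :: 'n set)" by simp
    qed (rule herm, erule pos)
    then show ?thesis using that by blast
  qed
  have "(\<Sum>i\<in>UNIV. \<Sum>j\<in>UNIV. a i j * dz i (dzb j u) z)
      = (\<Sum>i\<in>UNIV. \<Sum>j\<in>UNIV. \<Sum>k\<in>UNIV. w k i * cnj (w k j) * dz i (dzb j u) z)"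
    unfolding w sum_distrib_right ..
  also have "\<dots> = (\<Sum>k\<in>UNIV. \<Sum>i\<in>UNIV. \<Sum>j\<in>UNIV. w k i * cnj (w k j) * dz i (dzb j u) z)"
    by (subst sum.swap, rule sum.swap[THEN trans]) (auto intro!: sum.cong sum.swap[THEN trans])
  finally have eq: "(\<Sum>i\<in>UNIV. \<Sum>j\<in>UNIV. a i j * dz i (dzb j u) z) = \<dots>" .
  have "Re (\<Sum>i\<in>UNIV. \<Sum>j\<in>UNIV. w k i * cnj (w k j) * dz i (dzb j u) z) \<le> 0" for k
    using levi_form_at_max[OF U u real max, of "\<chi> i. w k i"] by simp
  then have "(\<Sum>k\<in>UNIV. Re (\<Sum>i\<in>UNIV. \<Sum>j\<in>UNIV. w k i * cnj (w k j) * dz i (dzb j u) z)) \<le> 0"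
    by (rule sum_nonpos)
  then show ?thesis unfolding eq by (subst Re_sum)
qed

section \<open>Hopf's barrier and the strong maximum principle\<close>

lemma has_derivative_component:
  "((\<lambda>z::complex ^ 'n::finite. z $ k) has_derivative (\<lambda>v. v $ k)) (at z)"
  by (rule bounded_linear.has_derivative[OF bounded_linear_vec_nth has_derivative_ident])

lemma twice_differentiable_on_component:
  assumes "open U"
  shows "twice_differentiable_on U (\<lambda>z::complex ^ 'n::finite. z $ k)"
  by (rule twice_differentiable_onI[OF assms has_derivative_component]) simp

lemma twice_differentiable_on_exp:
  fixes f :: "'a::real_normed_vector \<Rightarrow> complex"
  assumes U: "open U" and f: "twice_differentiable_on U f"
  shows "twice_differentiable_on U (\<lambda>z. exp (f z))"
proof -
  have d: "((\<lambda>z. exp (f z)) has_derivative (\<lambda>v. exp (f z) * frechet_derivative f (at z) v)) (at z)"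
    if "z \<in> U" for z
    using has_derivative_compose[OF twice_differentiable_onD'[OF f that], of exp "(*) (exp (f z))"]
      DERIV_exp[of "f z"] by (simp add: has_field_derivative_def)
  then have "(\<lambda>z. exp (f z)) differentiable at z" if "z \<in> U" for z
    using that differentiable_def by blast
  then show ?thesis
    by (intro twice_differentiable_onI[OF U d] differentiable_mult twice_differentiable_onD(2)[OF f])
qed

lemma dz_component: "dz i (\<lambda>z. z $ k) z = (if i = k then 1 else 0)" "dzb i (\<lambda>z. z $ k) z = 0"
  unfolding has_derivative_dz[OF has_derivative_component] by (auto simp: axis_def)

text \<open>Hopf's comparison function, a Gaussian centred at y. It is written with conjugates so
  that the Wirtinger product rule applies; \<open>barrier_eq\<close> gives its real form.\<close>

definition barrier :: "real \<Rightarrow> complex ^ 'n::finite \<Rightarrow> complex ^ 'n \<Rightarrow> complex" where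
  "barrier \<alpha> y z = exp (- of_real \<alpha> * (\<Sum>k\<in>UNIV. (z $ k - y $ k) * cnj (z $ k - y $ k)))"

lemma barrier_eq: "barrier \<alpha> y z = of_real (exp (- \<alpha> * (dist z y)\<^sup>2))"
proof -
  have "(\<Sum>k\<in>UNIV. (z $ k - y $ k) * cnj (z $ k - y $ k)) = of_real ((dist z y)\<^sup>2)"
    unfolding complex_norm_square[symmetric]
    by (simp add: dist_norm norm_vec_def L2_set_def sum_nonneg del: of_real_power)
  then show ?thesis unfolding barrier_def exp_of_real[symmetric] by (simp only: of_real_mult of_real_minus)
qed

lemma barrier_twice_differentiable:
  assumes "open U"
  shows "twice_differentiable_on U (barrier \<alpha> y)"
proof -
  \<comment> \<open>The difference is written as a sum because the closure rules at hand cover sums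
    and products.\<close>
  have "twice_differentiable_on U (\<lambda>z. z $ k + - y $ k)" for k
    by (intro twice_differentiable_on_add twice_differentiable_on_component
        twice_differentiable_on_const assms)
  then have "twice_differentiable_on U (\<lambda>z. exp (- of_real \<alpha> * (\<Sum>k\<in>UNIV. (z $ k + - y $ k) * cnj (z $ k + - y $ k))))"
    by (intro twice_differentiable_on_exp twice_differentiable_on_mult twice_differentiable_on_sum
        twice_differentiable_on_cnj twice_differentiable_on_const assms)
  then show ?thesis by (simp add: barrier_def[abs_def])
qed

lemma barrier_levi:
  "dz i (dzb j (barrier \<alpha> y)) z = barrier \<alpha> y z *
     (of_real (\<alpha>\<^sup>2) * cnj (z $ i - y $ i) * (z $ j - y $ j) - (if i = j then of_real \<alpha> else 0))"
proof -
  have td: "twice_differentiable_on UNIV (\<lambda>z::complex^'a. z $ k + - y $ k)" for k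
    by (intro twice_differentiable_on_add twice_differentiable_on_component
        twice_differentiable_on_const open_UNIV)
  have d1: "(\<lambda>z::complex^'a. z $ k + - y $ k) differentiable at z" for k z
    using twice_differentiable_onD(1)[OF td] by blast
  have dc: "(\<lambda>z::complex^'a. z $ k) differentiable at z" for k z
    using twice_differentiable_onD(1)[OF twice_differentiable_on_component[OF open_UNIV]] by blast
  have dzc: "dz i (\<lambda>z. z $ k + - y $ k) z = (if i = k then 1 else 0)" "dzb i (\<lambda>z. z $ k + - y $ k) z = 0" for i k z
    unfolding dz_add[OF dc differentiable_const] dz_component by simp_all
  let ?q = "\<lambda>z. - of_real \<alpha> * (\<Sum>k\<in>UNIV. (z $ k + - y $ k) * cnj (z $ k + - y $ k))"
  have d2: "(\<lambda>z. (z $ k + - y $ k) * cnj (z $ k + - y $ k)) differentiable at z" for k and z :: "complex^'a"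
    by (intro differentiable_mult differentiable_cnj d1)
  have d3: "(\<lambda>z. (\<Sum>k\<in>UNIV. (z $ k + - y $ k) * cnj (z $ k + - y $ k))) differentiable at z" for z :: "complex^'a"
    by (rule differentiable_sum[OF finite_class.finite_UNIV ballI], rule d2)
  have dq: "?q differentiable at z" for z
    by (intro differentiable_mult d3 differentiable_const)
  have q1: "dz i ?q z = - of_real \<alpha> * cnj (z $ i + - y $ i)" for i z
    unfolding dz_cmult(1)[OF d3] dz_sum(1)[OF d2] dz_mult(1)[OF d1 differentiable_cnj[OF d1]] dz_cnj(1)[OF d1] dzc
    by (simp add: if_distrib[of "\<lambda>x. x * _"] cong: if_cong)
  have q2: "dzb i ?q z = - of_real \<alpha> * (z $ i + - y $ i)" for i z
    unfolding dz_cmult(2)[OF d3] dz_sum(2)[OF d2] dz_mult(2)[OF d1 differentiable_cnj[OF d1]] dz_cnj(2)[OF d1] dzc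
    by (simp add: if_distrib[of cnj] if_distrib[of "\<lambda>x. _ * x"] cong: if_cong)
  have b: "barrier \<alpha> y = (\<lambda>z. exp (?q z))" by (simp add: barrier_def[abs_def])
  have db: "barrier \<alpha> y differentiable at z" for z
    using twice_differentiable_onD(1)[OF barrier_twice_differentiable[OF open_UNIV]] by blast
  have b1: "dz i (barrier \<alpha> y) z = barrier \<alpha> y z * (- of_real \<alpha> * cnj (z $ i + - y $ i))" for i z
    unfolding b dz_exp(1)[OF dq] q1 ..
  have b2: "dzb i (barrier \<alpha> y) z = barrier \<alpha> y z * (- of_real \<alpha> * (z $ i + - y $ i))" for i z
    unfolding b dz_exp(2)[OF dq] q2 ..
  have b2': "dzb j (barrier \<alpha> y) = (\<lambda>z. barrier \<alpha> y z * (- of_real \<alpha> * (z $ j + - y $ j)))"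
    using b2 by blast
  show ?thesis
    unfolding b2' dz_mult(1)[OF db differentiable_mult[OF differentiable_const d1]] b1 dz_cmult(1)[OF d1] dzc
    by (simp add: algebra_simps power2_eq_square)
qed

lemma positive_definiteD:
  "positive_definite a \<Longrightarrow> v k \<noteq> 0 \<Longrightarrow> 0 < Re (\<Sum>i\<in>UNIV. \<Sum>j\<in>UNIV. a i j * v i * cnj (v j))"
  unfolding positive_definite_def by blast

lemma positive_definite_hermitian: "positive_definite a \<Longrightarrow> cnj (a i j) = a j i"
  unfolding positive_definite_def by metis

text \<open>With the inverse metric for a this is the trace of the complex Hessian, the operator of
  the whole argument.\<close>

definition trace_levi ::
  "('n::finite \<Rightarrow> 'n \<Rightarrow> complex ^ 'n \<Rightarrow> complex) \<Rightarrow> (complex ^ 'n \<Rightarrow> complex) \<Rightarrow> complex ^ 'n \<Rightarrow> complex" where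
  "trace_levi a u z = (\<Sum>i\<in>UNIV. \<Sum>j\<in>UNIV. a i j z * dz i (dzb j u) z)"

lemma trace_levi_add_cmult:
  assumes "open U" "z \<in> U" "twice_differentiable_on U u" "twice_differentiable_on U v"
  shows "trace_levi a (\<lambda>z. u z + c * v z) z = trace_levi a u z + c * trace_levi a v z"
proof -
  have d: "u differentiable at y" "v differentiable at y" if "y \<in> U" for y
    using assms that twice_differentiable_onD(1) by blast+
  have e: "dzb j u y + c * dzb j v y = dzb j (\<lambda>z. u z + c * v z) y" if "y \<in> U" for y j
    using dz_add(2)[OF d(1)[OF that] differentiable_mult[OF differentiable_const d(2)[OF that], of c], of j]
      dz_cmult(2)[OF d(2)[OF that], of j c] by simp
  have "dz i (dzb j (\<lambda>z. u z + c * v z)) z = dz i (\<lambda>y. dzb j u y + c * dzb j v y) z" for i j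
    by (rule dz_transform(1)[OF assms(1,2)]) (simp add: e)
  also have "\<dots> i j = dz i (dzb j u) z + c * dz i (dzb j v) z" for i j
    using dz_add(1)[OF dz_differentiable(2)[OF assms(3,2)]
        differentiable_mult[OF differentiable_const dz_differentiable(2)[OF assms(4,2)], of c]]
      dz_cmult(1)[OF dz_differentiable(2)[OF assms(4,2)]] by simp
  finally have "dz i (dzb j (\<lambda>z. u z + c * v z)) z = dz i (dzb j u) z + c * dz i (dzb j v) z" for i j .
  then show ?thesis
    unfolding trace_levi_def by (simp add: distrib_left sum.distrib sum_distrib_left mult_ac)
qed

lemma trace_levi_barrier:
  "trace_levi a (barrier \<alpha> y) z = barrier \<alpha> y z * (of_real (\<alpha>\<^sup>2) *
     (\<Sum>i\<in>UNIV. \<Sum>j\<in>UNIV. a i j z * cnj (z $ i - y $ i) * (z $ j - y $ j)) - of_real \<alpha> * (\<Sum>i\<in>UNIV. a i i z))"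
proof -
  have "a i j z * dz i (dzb j (barrier \<alpha> y)) z = barrier \<alpha> y z * (of_real (\<alpha>\<^sup>2) *
     (a i j z * cnj (z $ i - y $ i) * (z $ j - y $ j)) - of_real \<alpha> * (if i = j then a i i z else 0))" for i j
    unfolding barrier_levi by (simp add: algebra_simps)
  then have "trace_levi a (barrier \<alpha> y) z = barrier \<alpha> y z * (of_real (\<alpha>\<^sup>2) *
     (\<Sum>i\<in>UNIV. \<Sum>j\<in>UNIV. a i j z * cnj (z $ i - y $ i) * (z $ j - y $ j))
       - of_real \<alpha> * (\<Sum>i\<in>UNIV. \<Sum>j\<in>UNIV. if i = j then a i i z else 0))"
    unfolding trace_levi_def by (simp only: sum_distrib_left sum_subtractf right_diff_distrib)
  then show ?thesis by simp
qed

text \<open>In \<open>trace_levi_barrier\<close> the quadratic form at z - y has the factor \<alpha>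
  squared and the trace of a only \<alpha>. On a compact set avoiding y the former is bounded below
  by a positive constant and the latter is bounded above, so a large \<alpha> decides the
  sign.\<close>

lemma barrier_strict_subsolution:
  assumes "compact K" and a: "\<And>z. z \<in> K \<Longrightarrow> positive_definite (\<lambda>i j. a i j z)"
    and cont: "\<And>i j. continuous_on K (a i j)" and "y \<notin> K"
  obtains \<alpha> where "\<alpha> > 0" "\<And>z. z \<in> K \<Longrightarrow> 0 < Re (trace_levi a (barrier \<alpha> y) z)"
proof (cases "K = {}")
  case True
  then show ?thesis using that[of 1] by auto
next
  case False
  let ?Q = "\<lambda>z. Re (\<Sum>i\<in>UNIV. \<Sum>j\<in>UNIV. a i j z * cnj (z $ i - y $ i) * (z $ j - y $ j))"
  let ?t = "\<lambda>z. Re (\<Sum>i\<in>UNIV. a i i z)"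
  have cQ: "continuous_on K ?Q" by (intro continuous_intros cont)
  have ct: "continuous_on K ?t" by (intro continuous_intros cont)
  obtain z0 where z0: "z0 \<in> K" "\<And>z. z \<in> K \<Longrightarrow> ?Q z0 \<le> ?Q z"
    using continuous_attains_inf[OF assms(1) False cQ] by blast
  obtain z1 where z1: "z1 \<in> K" "\<And>z. z \<in> K \<Longrightarrow> ?t z \<le> ?t z1"
    using continuous_attains_sup[OF assms(1) False ct] by blast
  have Q0: "0 < ?Q z0"
  proof -
    obtain i where "cnj (z0 $ i - y $ i) \<noteq> 0"
      using z0(1) assms(4) by (metis complex_cnj_zero_iff eq_iff_diff_eq_0 vec_eq_iff)
    \<comment> \<open>In the Levi form of the barrier the conjugated difference carries the
      holomorphic index, so the conjugate of z0 - y is the test vector.\<close>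
    then have "0 < Re (\<Sum>i\<in>UNIV. \<Sum>j\<in>UNIV. a i j z0 * cnj (z0 $ i - y $ i) * cnj (cnj (z0 $ j - y $ j)))"
      by (rule positive_definiteD[OF a[OF z0(1)], of "\<lambda>i. cnj (z0 $ i - y $ i)"])
    then show ?thesis by simp
  qed
  \<comment> \<open>Large enough for \<alpha> times the minimum of the quadratic form to exceed the
    maximum of the trace; the added 1 gives strictness and makes \<alpha> positive.\<close>
  define \<alpha> where "\<alpha> = (\<bar>?t z1\<bar> + 1) / ?Q z0"
  have \<alpha>: "\<alpha> > 0" using Q0 by (simp add: \<alpha>_def)
  moreover have "0 < Re (trace_levi a (barrier \<alpha> y) z)" if "z \<in> K" for z
  proof -
    have "?t z \<le> \<bar>?t z1\<bar>" using z1(2)[OF that] by linarith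
    also have "\<dots> < \<alpha> * ?Q z0" using Q0 by (simp add: \<alpha>_def)
    also have "\<dots> \<le> \<alpha> * ?Q z" using z0(2)[OF that] \<alpha> by (intro mult_left_mono) auto
    finally have "0 < \<alpha> * (\<alpha> * ?Q z - ?t z)" using \<alpha> by simp
    then have "0 < exp (- \<alpha> * (dist z y)\<^sup>2) * (\<alpha> * (\<alpha> * ?Q z - ?t z))" by simp
    also have "\<dots> = Re (trace_levi a (barrier \<alpha> y) z)"
      unfolding trace_levi_barrier barrier_eq minus_complex.sel Re_complex_of_real
        Re_divide times_complex.sel Im_complex_of_real
      by (simp add: algebra_simps power2_eq_square)
    finally show ?thesis .
  qed
  ultimately show ?thesis using that by blast
qed

lemma twice_differentiable_on_subset:
  "twice_differentiable_on U f \<Longrightarrow> V \<subseteq> U \<Longrightarrow> twice_differentiable_on V f"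
  unfolding twice_differentiable_on_def by blast

text \<open>Hopf's boundary point argument: a point where \<open>u\<close> is maximal cannot be the only maximum of \<open>u\<close>
  on a closed ball having it on its boundary.\<close>

lemma no_touching_ball:
  fixes u :: "complex ^ 'n::finite \<Rightarrow> complex"
  assumes U: "open U" and u: "twice_differentiable_on U u"
    and real: "\<And>z. z \<in> U \<Longrightarrow> Im (u z) = 0"
    and a: "\<And>z. z \<in> U \<Longrightarrow> positive_definite (\<lambda>i j. a i j z)"
    and cont: "\<And>i j. continuous_on U (a i j)"
    and sub: "\<And>z. z \<in> U \<Longrightarrow> 0 \<le> Re (trace_levi a u z)"
    and p: "p \<in> U" and R: "dist p y = R" "R > 0"
    and max: "\<And>z. z \<in> U \<Longrightarrow> Re (u z) \<le> Re (u p)"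
    and touch: "\<And>z. z \<in> U \<Longrightarrow> dist z y \<le> R \<Longrightarrow> z \<noteq> p \<Longrightarrow> Re (u z) < Re (u p)"
  shows False
proof -
  obtain r where r: "r > 0" "cball p r \<subseteq> U" using U p open_contains_cball by blast
  \<comment> \<open>A radius below R keeps y outside the closed ball about p, as the barrier
    requires.\<close>
  define \<rho> where "\<rho> = min r (R / 2)"
  have \<rho>: "\<rho> > 0" "\<rho> < R" "cball p \<rho> \<subseteq> U"
    using r R by (auto simp: \<rho>_def)
  have "y \<notin> cball p \<rho>" using R \<rho> by simp
  then obtain \<alpha> where \<alpha>: "\<alpha> > 0" "\<And>z. z \<in> cball p \<rho> \<Longrightarrow> 0 < Re (trace_levi a (barrier \<alpha> y) z)"
    using barrier_strict_subsolution[of "cball p \<rho>" a y] a cont \<rho>(3) continuous_on_subset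
    by (metis compact_cball subsetD)
  let ?E = "\<lambda>z. exp (- \<alpha> * (dist z y)\<^sup>2)"
  have cu: "continuous_on U (\<lambda>z. Re (u z))"
    by (intro continuous_on_Re continuous_at_imp_continuous_on ballI differentiable_imp_continuous_within
        twice_differentiable_onD(1)[OF u])
  let ?T = "sphere p \<rho> \<inter> cball y R"
  \<comment> \<open>This part of the small sphere is compact, lies in the touching ball and avoids
    p, so u stays below its maximum there by a fixed amount. If it is empty, any \<delta> will
    do.\<close>
  have "\<exists>\<delta>>0. \<forall>z\<in>?T. Re (u z) \<le> Re (u p) - \<delta>"
  proof (cases "?T = {}")
    case False
    have "compact ?T" by (intro compact_Int_closed) auto
    moreover have TU: "?T \<subseteq> U" using \<rho>(3) by (auto simp: subset_iff)
    ultimately obtain z where z: "z \<in> ?T" "\<And>x. x \<in> ?T \<Longrightarrow> Re (u x) \<le> Re (u z)"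
      using continuous_attains_sup[OF _ False continuous_on_subset[OF cu]] by blast
    have "Re (u z) < Re (u p)"
      using z(1) TU \<rho>(1) by (intro touch) (auto simp: dist_commute)
    then show ?thesis using z(2) by (intro exI[of _ "Re (u p) - Re (u z)"]) auto
  qed (intro exI[of _ 1], auto)
  then obtain \<delta> where \<delta>: "\<delta> > 0" "\<And>z. z \<in> ?T \<Longrightarrow> Re (u z) \<le> Re (u p) - \<delta>" by blast
  \<comment> \<open>The barrier is at most 1, so with the factor \<delta>/2 it cannot compensate the
    deficit \<delta> on the part of the sphere inside the touching ball. On the rest of the sphere
    the barrier is smaller than at p. Hence v exceeds its boundary values at p.\<close>
  define v where "v = (\<lambda>z. u z + of_real (\<delta> / 2) * barrier \<alpha> y z)"
  have Rev: "Re (v z) = Re (u z) + \<delta> / 2 * ?E z" for z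
    unfolding v_def barrier_eq by simp
  have bU: "ball p \<rho> \<subseteq> U" using \<rho>(3) ball_subset_cball by blast
  have tdU: "twice_differentiable_on (ball p \<rho>) u" by (rule twice_differentiable_on_subset[OF u bU])
  have tdb: "twice_differentiable_on (ball p \<rho>) (barrier \<alpha> y)"
    by (rule barrier_twice_differentiable[OF open_ball])
  have tdv: "twice_differentiable_on (ball p \<rho>) v"
    unfolding v_def by (intro twice_differentiable_on_add twice_differentiable_on_mult tdU tdb
        twice_differentiable_on_const open_ball)
  have bdry: "Re (v z) < Re (v p)" if z: "z \<in> sphere p \<rho>" for z
  proof (cases "dist z y \<le> R")
    case True
    then have "Re (u z) \<le> Re (u p) - \<delta>" using z by (intro \<delta>) (auto simp: dist_commute)
    moreover have "\<delta> / 2 * ?E z \<le> \<delta> / 2 * 1" using \<delta>(1) \<alpha>(1) by (intro mult_left_mono) auto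
    moreover have "0 < \<delta> / 2 * ?E p" using \<delta>(1) by simp
    ultimately show ?thesis unfolding Rev using \<delta>(1) by linarith
  next
    case False
    then have "R\<^sup>2 < (dist z y)\<^sup>2" using R by (intro power_strict_mono) auto
    then have "?E z < ?E p" using \<alpha>(1) R by simp
    then have "\<delta> / 2 * ?E z < \<delta> / 2 * ?E p" using \<delta>(1) by simp
    moreover have "Re (u z) \<le> Re (u p)" using z \<rho>(3) by (intro max) (auto simp: subset_iff)
    ultimately show ?thesis unfolding Rev by linarith
  qed
  have "continuous_on (cball p \<rho>) (\<lambda>z. Re (v z))"
    unfolding Rev by (intro continuous_intros continuous_on_subset[OF cu \<rho>(3)])
  then obtain z where z: "z \<in> cball p \<rho>" "\<And>x. x \<in> cball p \<rho> \<Longrightarrow> Re (v x) \<le> Re (v z)"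
    using continuous_attains_sup[of "cball p \<rho>" "\<lambda>z. Re (v z)"] \<rho>(1) by (metis cball_eq_empty compact_cball not_less_iff_gr_or_eq)
  have "z \<notin> sphere p \<rho>" using bdry z(2)[of p] \<rho>(1) by fastforce
  then have zb: "z \<in> ball p \<rho>" using z(1) by auto
  \<comment> \<open>An interior maximum of v is incompatible with v being a strict subsolution, the
    strictness coming from the barrier.\<close>
  have "Re (trace_levi a v z) \<le> 0"
    unfolding trace_levi_def
  proof (rule elliptic_at_max[OF open_ball zb tdv])
    show "Im (v y) = 0" if "y \<in> ball p \<rho>" for y
      using real bU that unfolding v_def barrier_eq by auto
    show "Re (v y) \<le> Re (v z)" if "y \<in> ball p \<rho>" for y
      using z(2) that by simp
    show "positive_definite (\<lambda>i j. a i j z)" using a zb bU by blast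
  qed
  moreover have "Re (trace_levi a v z) = Re (trace_levi a u z) + \<delta> / 2 * Re (trace_levi a (barrier \<alpha> y) z)"
    unfolding v_def trace_levi_add_cmult[OF open_ball zb tdU tdb] by simp
  moreover have "0 \<le> Re (trace_levi a u z)" using sub zb bU by blast
  moreover have "0 < \<delta> / 2 * Re (trace_levi a (barrier \<alpha> y) z)" using \<alpha>(2)[OF z(1)] \<delta>(1) by simp
  ultimately show False by linarith
qed

text \<open>Openness of the maximum set is the local form of the principle; connectedness enters
  only on the manifold. If the set is not open at p0, then a nonmaximal point near p0 has a nearest
  maximal point p, and a ball through p that otherwise avoids the maximum set contradicts
  \<open>no_touching_ball\<close>.\<close>

theorem strong_maximum_principle:
  fixes u :: "complex ^ 'n::finite \<Rightarrow> complex"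
  assumes U: "open U" and u: "twice_differentiable_on U u"
    and real: "\<And>z. z \<in> U \<Longrightarrow> Im (u z) = 0"
    and a: "\<And>z. z \<in> U \<Longrightarrow> positive_definite (\<lambda>i j. a i j z)"
    and cont: "\<And>i j. continuous_on U (a i j)"
    and sub: "\<And>z. z \<in> U \<Longrightarrow> 0 \<le> Re (trace_levi a u z)"
    and max: "\<And>z. z \<in> U \<Longrightarrow> Re (u z) \<le> m"
  shows "open {z \<in> U. Re (u z) = m}"
proof (rule ccontr)
  assume "\<not> open {z \<in> U. Re (u z) = m}"
  then obtain p0 where p0: "p0 \<in> U" "Re (u p0) = m" "\<And>e. e > 0 \<Longrightarrow> \<not> ball p0 e \<subseteq> {z \<in> U. Re (u z) = m}"
    unfolding open_contains_ball by blast
  \<comment> \<open>The radius is doubled because maximal points are sought around z1, which is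
    itself only known to lie within r of p0.\<close>
  obtain r where r: "r > 0" "cball p0 (2 * r) \<subseteq> U"
  proof -
    obtain e where "e > 0" "cball p0 e \<subseteq> U" using U p0(1) open_contains_cball by blast
    then show thesis using that[of "e / 2"] by simp
  qed
  obtain z1 where z1: "z1 \<in> ball p0 r" "Re (u z1) \<noteq> m"
  proof -
    have "ball p0 r \<subseteq> U" using r by (force simp: subset_iff)
    then show thesis using p0(3)[OF r(1)] that by blast
  qed
  have cu: "continuous_on U (\<lambda>z. Re (u z))"
    by (intro continuous_on_Re continuous_at_imp_continuous_on ballI differentiable_imp_continuous_within
        twice_differentiable_onD(1)[OF u])
  let ?M = "{z \<in> cball p0 (2 * r). Re (u z) = m}"
  have "closed ?M"
    by (rule continuous_closed_preimage_constant[OF continuous_on_subset[OF cu r(2)] closed_cball])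
  moreover have "p0 \<in> ?M" using p0 r by simp
  ultimately obtain p where p: "p \<in> ?M" "\<And>x. x \<in> ?M \<Longrightarrow> dist z1 p \<le> dist z1 x"
    using distance_attains_inf[of ?M z1] by blast
  have pU: "p \<in> U" using p(1) r(2) by auto
  define R where "R = dist z1 p / 2"
  \<comment> \<open>The ball around z1 reaching to p may meet the maximum set in several boundary
    points. The ball with the segment from z1 to p as diameter is internally tangent to it at p and
    meets the maximum set only there.\<close>
  define y where "y = midpoint z1 p"
  have "z1 \<noteq> p" using z1(2) p(1) by blast
  then have R: "R > 0" by (simp add: R_def)
  have py: "dist p y = R" "dist z1 y = R"
    unfolding y_def R_def by (simp_all add: dist_midpoint dist_commute)
  have small: "dist z1 p < r" using p(2)[OF \<open>p0 \<in> ?M\<close>] z1(1) by (simp add: dist_commute)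
  have touch: "Re (u z) < m" if z: "z \<in> U" "dist z y \<le> R" "z \<noteq> p" for z
  proof (rule ccontr)
    assume "\<not> Re (u z) < m"
    then have zm: "Re (u z) = m" using max[OF z(1)] by simp
    have zz1: "dist z1 z \<le> dist z1 y + dist z y" using dist_triangle[of z1 z y] by (simp add: dist_commute)
    have "dist p0 z \<le> dist p0 z1 + dist z1 z" by (rule dist_triangle)
    also have "\<dots> \<le> 2 * r" using z1(1) zz1 py z(2) small unfolding R_def by (simp add: dist_commute)
    finally have "z \<in> ?M" using zm by simp
    from p(2)[OF this] have ge: "2 * R \<le> dist z1 z" by (simp add: R_def)
    then have eq: "dist z y = R" "dist z1 z = 2 * R" using zz1 py z(2) by linarith+
    \<comment> \<open>Equality in the triangle inequality makes y the midpoint of z1 and z as well,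
      hence z = p.\<close>
    have "norm (z - y) + norm (y - z1) = norm ((z - y) + (y - z1))"
      using eq py by (simp add: dist_norm norm_minus_commute)
    then have "norm (z - y) *\<^sub>R (y - z1) = norm (y - z1) *\<^sub>R (z - y)"
      by (metis norm_triangle_eq)
    moreover have "norm (z - y) = R" "norm (y - z1) = R"
      using eq py by (simp_all add: dist_norm norm_minus_commute)
    ultimately have "y - z1 = z - y" using R by simp
    then have "z = 2 *\<^sub>R y - z1" by (simp add: algebra_simps scaleR_2)
    also have "\<dots> = p" by (simp add: y_def midpoint_def)
    finally show False using z(3) by simp
  qed
  have pm: "Re (u p) = m" using p(1) by simp
  show False
    by (rule no_touching_ball[OF U u real a cont sub pU py(1) R])
      (use max touch pm in auto)
qed

section \<open>The Bochner formula for alternating tensors\<close>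

text \<open>Tensors are indexed by all q-tuples, not only by increasing ones, so that operators act
  on each slot independently. Extensional functions make the tuples a finite set over which a
  product of sums expands.\<close>

abbreviation multi_index :: "nat \<Rightarrow> 'a set \<Rightarrow> (nat \<Rightarrow> 'a) set" where
  "multi_index q J \<equiv> {..<q} \<rightarrow>\<^sub>E J"

lemma finite_multi_index: "finite J \<Longrightarrow> finite (multi_index q J)"
  by (simp add: finite_PiE)

lemma sum_multi_index:
  fixes f :: "nat \<Rightarrow> 'a \<Rightarrow> 'b::comm_semiring_1"
  assumes "finite J"
  shows "(\<Sum>\<gamma>\<in>multi_index q J. \<Prod>k<q. f k (\<gamma> k)) = (\<Prod>k<q. \<Sum>c\<in>J. f k c)"
  using assms by (simp add: prod_sum_PiE)

text \<open>The matrix of a tensor product of q operators: X in slot k and Y in all others. For k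
  outside the range it is the q-th tensor power of Y.\<close>

definition at_slot :: "nat \<Rightarrow> nat \<Rightarrow> ('a \<Rightarrow> 'a \<Rightarrow> 'k::comm_ring_1) \<Rightarrow> ('a \<Rightarrow> 'a \<Rightarrow> 'k) \<Rightarrow> (nat \<Rightarrow> 'a) \<Rightarrow> (nat \<Rightarrow> 'a) \<Rightarrow> 'k" where
  "at_slot q k X Y \<alpha> \<beta> = (\<Prod>l<q. if l = k then X (\<alpha> l) (\<beta> l) else Y (\<alpha> l) (\<beta> l))"

definition kron :: "'a \<Rightarrow> 'a \<Rightarrow> 'k::comm_ring_1" where
  "kron a b = (if a = b then 1 else 0)"

text \<open>The action on the q-th tensor power induced by the matrix X through the Leibniz
  rule.\<close>

definition derivation :: "nat \<Rightarrow> ('a \<Rightarrow> 'a \<Rightarrow> 'k::comm_ring_1) \<Rightarrow> (nat \<Rightarrow> 'a) \<Rightarrow> (nat \<Rightarrow> 'a) \<Rightarrow> 'k" where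
  "derivation q X \<alpha> \<beta> = (\<Sum>k<q. at_slot q k X kron \<alpha> \<beta>)"

lemma at_slot_eq:
  assumes "k < q"
  shows "at_slot q k X Y \<alpha> \<beta> = X (\<alpha> k) (\<beta> k) * (\<Prod>l\<in>{..<q} - {k}. Y (\<alpha> l) (\<beta> l))"
  unfolding at_slot_def using assms by (subst prod.remove[of _ k]) auto

lemma sum_kron:
  assumes "finite J" "a \<in> J"
  shows "(\<Sum>c\<in>J. kron a c * f c) = f a" "(\<Sum>c\<in>J. f c * kron c a) = f a"
  using assms by (simp_all add: kron_def if_distrib[of "\<lambda>x. x * _"] if_distrib[of "\<lambda>x. _ * x"] cong: if_cong)

lemma multi_index_in: "\<alpha> \<in> multi_index q J \<Longrightarrow> k < q \<Longrightarrow> \<alpha> k \<in> J"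
  by auto

lemma sum_at_slot_mult:
  assumes "finite J"
  shows "(\<Sum>\<gamma>\<in>multi_index q J. at_slot q k X Y \<alpha> \<gamma> * at_slot q m X' Y' \<gamma> \<beta>)
    = (\<Prod>l<q. \<Sum>c\<in>J. (if l = k then X (\<alpha> l) c else Y (\<alpha> l) c) * (if l = m then X' c (\<beta> l) else Y' c (\<beta> l)))"
  unfolding at_slot_def prod.distrib[symmetric]
  by (rule sum_multi_index[OF assms, where q=q and f="\<lambda>l c. (if l = k then X (\<alpha> l) c else Y (\<alpha> l) c) * (if l = m then X' c (\<beta> l) else Y' c (\<beta> l))"])

text \<open>Lowering an index after a derivation lowers it in the one slot that the derivation
  touches. Used for the metric compatibility of the tensor power and to lower the index of its
  curvature.\<close>

lemma derivation_mult_prod: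
  assumes J: "finite J" and \<alpha>: "\<alpha> \<in> multi_index q J"
  shows "(\<Sum>\<gamma>\<in>multi_index q J. derivation q X \<alpha> \<gamma> * (\<Prod>l<q. g (\<gamma> l) (\<beta> l)))
    = (\<Sum>k<q. at_slot q k (\<lambda>a b. \<Sum>c\<in>J. X a c * g c b) g \<alpha> \<beta>)"
proof -
  \<comment> \<open>Slot q lies just beyond the last one: \<open>at_slot q q g g\<close> is the
    plain product, written so that \<open>sum_at_slot_mult\<close> applies.\<close>
  have "(\<Sum>\<gamma>\<in>multi_index q J. derivation q X \<alpha> \<gamma> * (\<Prod>l<q. g (\<gamma> l) (\<beta> l)))
    = (\<Sum>k<q. \<Sum>\<gamma>\<in>multi_index q J. at_slot q k X kron \<alpha> \<gamma> * at_slot q q g g \<gamma> \<beta>)"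
    unfolding derivation_def sum_distrib_right by (subst sum.swap) (simp add: at_slot_def)
  also have "\<dots> = (\<Sum>k<q. at_slot q k (\<lambda>a b. \<Sum>c\<in>J. X a c * g c b) g \<alpha> \<beta>)"
    unfolding sum_at_slot_mult[OF J] unfolding at_slot_def
  proof (intro sum.cong prod.cong refl)
    fix k l assume "l \<in> {..<q}"
    then show "(\<Sum>c\<in>J. (if l = k then X (\<alpha> l) c else kron (\<alpha> l) c) * (if l = q then g c (\<beta> l) else g c (\<beta> l)))
        = (if l = k then \<Sum>c\<in>J. X (\<alpha> l) c * g c (\<beta> l) else g (\<alpha> l) (\<beta> l))"
      using sum_kron(1)[OF J multi_index_in[OF \<alpha>, of l], of "\<lambda>c. g c (\<beta> l)"] by auto
  qed
  finally show ?thesis .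
qed

text \<open>The induced action is a homomorphism of Lie algebras: insertions of X and Y in different
  slots commute, so only terms with both in the same slot survive.\<close>

lemma derivation_commutator:
  assumes J: "finite J" and \<alpha>: "\<alpha> \<in> multi_index q J" and \<beta>: "\<beta> \<in> multi_index q J"
  shows "(\<Sum>\<gamma>\<in>multi_index q J. derivation q X \<alpha> \<gamma> * derivation q Y \<gamma> \<beta> - derivation q Y \<alpha> \<gamma> * derivation q X \<gamma> \<beta>)
    = derivation q (\<lambda>a b. \<Sum>c\<in>J. X a c * Y c b - Y a c * X c b) \<alpha> \<beta>"
proof -
  let ?XY = "\<lambda>a b. \<Sum>c\<in>J. X a c * Y c b" and ?YX = "\<lambda>a b. \<Sum>c\<in>J. Y a c * X c b"
  let ?C = "\<lambda>a b. \<Sum>c\<in>J. X a c * Y c b - Y a c * X c b"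
  \<comment> \<open>X sits in slot k and Y in slot m; Z stands for their product, in either order,
    when the two slots coincide.\<close>
  let ?M = "\<lambda>k m Z. \<Prod>l<q. if l = k then (if l = m then Z (\<alpha> l) (\<beta> l) else X (\<alpha> l) (\<beta> l))
      else if l = m then Y (\<alpha> l) (\<beta> l) else kron (\<alpha> l) (\<beta> l)"
  have XY: "(\<Sum>\<gamma>\<in>multi_index q J. derivation q X \<alpha> \<gamma> * derivation q Y \<gamma> \<beta>) = (\<Sum>k<q. \<Sum>m<q. ?M k m ?XY)"
  proof -
    have "(\<Sum>\<gamma>\<in>multi_index q J. derivation q X \<alpha> \<gamma> * derivation q Y \<gamma> \<beta>)
      = (\<Sum>k<q. \<Sum>m<q. \<Sum>\<gamma>\<in>multi_index q J. at_slot q k X kron \<alpha> \<gamma> * at_slot q m Y kron \<gamma> \<beta>)"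
      unfolding derivation_def sum_product
      by (subst sum.swap) (intro sum.cong refl sum.swap)
    also have "\<dots> = (\<Sum>k<q. \<Sum>m<q. ?M k m ?XY)"
      unfolding sum_at_slot_mult[OF J]
      by (intro sum.cong prod.cong refl)
        (auto simp: sum_kron[OF J multi_index_in[OF \<alpha>]] sum_kron[OF J multi_index_in[OF \<beta>]])
    finally show ?thesis .
  qed
  have YX: "(\<Sum>\<gamma>\<in>multi_index q J. derivation q Y \<alpha> \<gamma> * derivation q X \<gamma> \<beta>) = (\<Sum>k<q. \<Sum>m<q. ?M k m ?YX)"
  proof -
    have "(\<Sum>\<gamma>\<in>multi_index q J. derivation q Y \<alpha> \<gamma> * derivation q X \<gamma> \<beta>)
      = (\<Sum>m<q. \<Sum>k<q. \<Sum>\<gamma>\<in>multi_index q J. at_slot q m Y kron \<alpha> \<gamma> * at_slot q k X kron \<gamma> \<beta>)"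
      unfolding derivation_def sum_product
      by (subst sum.swap) (intro sum.cong refl sum.swap)
    also have "\<dots> = (\<Sum>m<q. \<Sum>k<q. ?M k m ?YX)"
      unfolding sum_at_slot_mult[OF J]
      by (intro sum.cong prod.cong refl)
        (auto simp: sum_kron[OF J multi_index_in[OF \<alpha>]] sum_kron[OF J multi_index_in[OF \<beta>]])
    also have "\<dots> = (\<Sum>k<q. \<Sum>m<q. ?M k m ?YX)" by (rule sum.swap)
    finally show ?thesis .
  qed
  have diff: "?M k m ?XY - ?M k m ?YX
      = (if m = k then at_slot q k ?C kron \<alpha> \<beta> else 0)" if "k < q" for k m
  proof (cases "m = k")
    case True
    have M: "?M k m Z = at_slot q k Z kron \<alpha> \<beta>" for Z
      unfolding at_slot_def using True by (intro prod.cong) auto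
    show ?thesis unfolding M[of ?XY] M[of ?YX] using True that by (simp add: at_slot_eq left_diff_distrib sum_subtractf)
  next
    case False
    then have "?M k m ?XY = ?M k m ?YX" by (intro prod.cong) auto
    then show ?thesis using False by simp
  qed
  have "(\<Sum>k<q. \<Sum>m<q. ?M k m ?XY) - (\<Sum>k<q. \<Sum>m<q. ?M k m ?YX)
      = (\<Sum>k<q. \<Sum>m<q. if m = k then at_slot q k ?C kron \<alpha> \<beta> else 0)"
    unfolding sum_subtractf[symmetric] by (intro sum.cong refl diff) simp
  also have "\<dots> = derivation q ?C \<alpha> \<beta>"
    unfolding derivation_def by (intro sum.cong refl) (simp add: sum.delta)
  finally show ?thesis
    unfolding sum_subtractf XY YX .
qed

section \<open>Hermitian pairings and coordinates of tensors\<close>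

definition hprod :: "'a set \<Rightarrow> ('a \<Rightarrow> 'a \<Rightarrow> complex) \<Rightarrow> ('a \<Rightarrow> complex) \<Rightarrow> ('a \<Rightarrow> complex) \<Rightarrow> complex" where
  "hprod J g x y = (\<Sum>a\<in>J. \<Sum>b\<in>J. x a * cnj (y b) * g a b)"

text \<open>Change of basis applied in every slot, \<open>e a u\<close> being the u-component of the
  old basis vector a. It serves both for passing to a unitary basis and, in \<open>T_change\<close>,
  for passing between frames.\<close>

definition tensor_coords :: "nat \<Rightarrow> 'a set \<Rightarrow> ('a \<Rightarrow> 'b \<Rightarrow> complex) \<Rightarrow> ((nat \<Rightarrow> 'a) \<Rightarrow> complex) \<Rightarrow> (nat \<Rightarrow> 'b) \<Rightarrow> complex" where
  "tensor_coords q J e x u = (\<Sum>\<alpha>\<in>multi_index q J. (\<Prod>k<q. e (\<alpha> k) (u k)) * x \<alpha>)"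

text \<open>If the forms in all slots are diagonal in one common basis, then so is their tensor
  product, with the products of the diagonal entries. The metric is the case of entries 1; the Ricci
  form occupies a single slot.\<close>

lemma hprod_slots:
  assumes J: "finite J" and K: "finite K"
    and X: "\<And>l a b. l < q \<Longrightarrow> a \<in> J \<Longrightarrow> b \<in> J \<Longrightarrow> X l a b = (\<Sum>u\<in>K. d l u * e a u * cnj (e b u))"
  shows "hprod (multi_index q J) (\<lambda>\<alpha> \<beta>. \<Prod>l<q. X l (\<alpha> l) (\<beta> l)) x y
    = (\<Sum>u\<in>multi_index q K. (\<Prod>l<q. d l (u l)) * tensor_coords q J e x u * cnj (tensor_coords q J e y u))"
proof -
  let ?I = "multi_index q J" and ?K = "multi_index q K"
  have P: "(\<Prod>l<q. X l (\<alpha> l) (\<beta> l)) = (\<Sum>u\<in>?K. (\<Prod>l<q. d l (u l)) * (\<Prod>l<q. e (\<alpha> l) (u l)) * cnj (\<Prod>l<q. e (\<beta> l) (u l)))"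
    if "\<alpha> \<in> ?I" "\<beta> \<in> ?I" for \<alpha> \<beta>
  proof -
    have "(\<Prod>l<q. X l (\<alpha> l) (\<beta> l)) = (\<Prod>l<q. \<Sum>u\<in>K. d l u * e (\<alpha> l) u * cnj (e (\<beta> l) u))"
      using that by (intro prod.cong refl X) auto
    also have "\<dots> = (\<Sum>u\<in>?K. \<Prod>l<q. d l (u l) * e (\<alpha> l) (u l) * cnj (e (\<beta> l) (u l)))"
      by (rule sum_multi_index[OF K, symmetric])
    finally show ?thesis by (simp add: prod.distrib)
  qed
  have "hprod ?I (\<lambda>\<alpha> \<beta>. \<Prod>l<q. X l (\<alpha> l) (\<beta> l)) x y
    = (\<Sum>\<alpha>\<in>?I. \<Sum>\<beta>\<in>?I. \<Sum>u\<in>?K. (\<Prod>l<q. d l (u l)) * ((\<Prod>l<q. e (\<alpha> l) (u l)) * x \<alpha>) * cnj ((\<Prod>l<q. e (\<beta> l) (u l)) * y \<beta>))"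
    unfolding hprod_def
  proof (intro sum.cong refl)
    fix \<alpha> \<beta> assume \<alpha>\<beta>: "\<alpha> \<in> ?I" "\<beta> \<in> ?I"
    show "x \<alpha> * cnj (y \<beta>) * (\<Prod>l<q. X l (\<alpha> l) (\<beta> l)) = (\<Sum>u\<in>?K. (\<Prod>l<q. d l (u l)) * ((\<Prod>l<q. e (\<alpha> l) (u l)) * x \<alpha>) * cnj ((\<Prod>l<q. e (\<beta> l) (u l)) * y \<beta>))"
      unfolding P[OF \<alpha>\<beta>] sum_distrib_left by (simp only: complex_cnj_mult) (simp only: mult_ac)
  qed
  also have "\<dots> = (\<Sum>\<alpha>\<in>?I. \<Sum>u\<in>?K. \<Sum>\<beta>\<in>?I. (\<Prod>l<q. d l (u l)) * ((\<Prod>l<q. e (\<alpha> l) (u l)) * x \<alpha>) * cnj ((\<Prod>l<q. e (\<beta> l) (u l)) * y \<beta>))"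
    by (intro sum.cong refl sum.swap)
  also have "\<dots> = (\<Sum>u\<in>?K. \<Sum>\<alpha>\<in>?I. \<Sum>\<beta>\<in>?I. (\<Prod>l<q. d l (u l)) * ((\<Prod>l<q. e (\<alpha> l) (u l)) * x \<alpha>) * cnj ((\<Prod>l<q. e (\<beta> l) (u l)) * y \<beta>))"
    by (rule sum.swap)
  also have "\<dots> = (\<Sum>u\<in>?K. (\<Prod>l<q. d l (u l)) * tensor_coords q J e x u * cnj (tensor_coords q J e y u))"
    unfolding tensor_coords_def cnj_sum
    by (simp only: sum_distrib_left sum_distrib_right mult.assoc) (rule sum.cong[OF refl], rule sum.swap)
  finally show ?thesis .
qed

text \<open>Inverting the basis change slot by slot recovers the components, so a tensor whose new
  coordinates all vanish is zero.\<close>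

lemma tensor_coords_inverse:
  assumes J: "finite J" and K: "finite K" and \<beta>: "\<beta> \<in> multi_index q J"
    and inv: "\<And>a b. a \<in> J \<Longrightarrow> b \<in> J \<Longrightarrow> (\<Sum>u\<in>K. e a u * e' u b) = kron a b"
  shows "(\<Sum>u\<in>multi_index q K. (\<Prod>k<q. e' (u k) (\<beta> k)) * tensor_coords q J e x u) = x \<beta>"
proof -
  let ?I = "multi_index q J" and ?K = "multi_index q K"
  have "(\<Sum>u\<in>?K. (\<Prod>k<q. e' (u k) (\<beta> k)) * tensor_coords q J e x u)
     = (\<Sum>u\<in>?K. \<Sum>\<alpha>\<in>?I. (\<Prod>k<q. e (\<alpha> k) (u k) * e' (u k) (\<beta> k)) * x \<alpha>)"
    unfolding tensor_coords_def sum_distrib_left prod.distrib by (simp only: mult_ac)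
  also have "\<dots> = (\<Sum>\<alpha>\<in>?I. (\<Sum>u\<in>?K. \<Prod>k<q. e (\<alpha> k) (u k) * e' (u k) (\<beta> k)) * x \<alpha>)"
    unfolding sum_distrib_right by (rule sum.swap)
  also have "\<dots> = (\<Sum>\<alpha>\<in>?I. if \<alpha> = \<beta> then x \<alpha> else 0)"
  proof (intro sum.cong refl)
    fix \<alpha> assume \<alpha>: "\<alpha> \<in> ?I"
    have "(\<Sum>u\<in>?K. \<Prod>k<q. e (\<alpha> k) (u k) * e' (u k) (\<beta> k)) = (\<Prod>k<q. \<Sum>u\<in>K. e (\<alpha> k) u * e' u (\<beta> k))"
      by (rule sum_multi_index[OF K, where q=q and f="\<lambda>k u. e (\<alpha> k) u * e' u (\<beta> k)"])
    also have "\<dots> = (\<Prod>k<q. kron (\<alpha> k) (\<beta> k))"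
      using \<alpha> \<beta> by (intro prod.cong refl inv) auto
    also have "\<dots> = (if \<alpha> = \<beta> then 1 else 0)"
    proof (cases "\<alpha> = \<beta>")
      case False
      then obtain k where "k < q" "\<alpha> k \<noteq> \<beta> k"
        using \<alpha> \<beta> by (metis PiE_ext lessThan_iff)
      then show ?thesis using False by (auto simp: kron_def)
    qed (simp add: kron_def)
    finally show "(\<Sum>u\<in>?K. \<Prod>k<q. e (\<alpha> k) (u k) * e' (u k) (\<beta> k)) * x \<alpha> = (if \<alpha> = \<beta> then x \<alpha> else 0)" by simp
  qed
  also have "\<dots> = x \<beta>" using \<beta> finite_multi_index[OF J] by (simp add: sum.delta)
  finally show ?thesis .
qed

definition alternating_on :: "nat \<Rightarrow> 'a set \<Rightarrow> ((nat \<Rightarrow> 'a) \<Rightarrow> complex) \<Rightarrow> bool" where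
  "alternating_on q J x \<longleftrightarrow>
     (\<forall>i<q. \<forall>j<q. i \<noteq> j \<longrightarrow> (\<forall>\<alpha>\<in>multi_index q J. x (\<alpha> \<circ> Transposition.transpose i j) = - x \<alpha>))"

text \<open>Reindexing the sum by the transposition of the two slots leaves the coefficient
  unchanged, because u repeats, and reverses the sign of x; so the coordinate equals its
  negative.\<close>

lemma tensor_coords_alternating:
  assumes x: "alternating_on q J x" and ij: "i < q" "j < q" "i \<noteq> j" and u: "u i = u j"
  shows "tensor_coords q J e x u = 0"
proof -
  let ?\<tau> = "Transposition.transpose i j"
  have \<tau>: "?\<tau> permutes {..<q}" using ij by (intro permutes_swap_id) auto
  have bij: "bij_betw (\<lambda>\<alpha>. \<alpha> \<circ> ?\<tau>) (multi_index q J) (multi_index q J)"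
  proof (rule bij_betwI[of _ _ _ "\<lambda>\<alpha>. \<alpha> \<circ> ?\<tau>"])
    show "(\<lambda>\<alpha>. \<alpha> \<circ> ?\<tau>) \<in> multi_index q J \<rightarrow> multi_index q J"
      using permutes_in_image[OF \<tau>] permutes_not_in[OF \<tau>] by (force simp: PiE_def extensional_def Pi_def)
    then show "(\<lambda>\<alpha>. \<alpha> \<circ> ?\<tau>) \<in> multi_index q J \<rightarrow> multi_index q J" .
  qed (auto simp: o_assoc[symmetric])
  have "tensor_coords q J e x u = (\<Sum>\<alpha>\<in>multi_index q J. (\<Prod>k<q. e (\<alpha> (?\<tau> k)) (u k)) * x (\<alpha> \<circ> ?\<tau>))"
    unfolding tensor_coords_def by (subst sum.reindex_bij_betw[OF bij, symmetric]) simp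
  also have "\<dots> = (\<Sum>\<alpha>\<in>multi_index q J. (\<Prod>k<q. e (\<alpha> k) (u k)) * (- x \<alpha>))"
  proof (intro sum.cong refl)
    fix \<alpha> assume \<alpha>: "\<alpha> \<in> multi_index q J"
    have "(\<Prod>k<q. e (\<alpha> (?\<tau> k)) (u k)) = (\<Prod>k<q. e (\<alpha> (?\<tau> k)) (u (?\<tau> k)))"
      using u by (intro prod.cong) (auto simp: Transposition.transpose_def)
    also have "\<dots> = (\<Prod>k<q. e (\<alpha> k) (u k))"
      by (rule prod.permute[OF \<tau>, symmetric, unfolded o_def])
    finally show "(\<Prod>k<q. e (\<alpha> (?\<tau> k)) (u k)) * x (\<alpha> \<circ> ?\<tau>) = (\<Prod>k<q. e (\<alpha> k) (u k)) * (- x \<alpha>)"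
      using x ij \<alpha> unfolding alternating_on_def by metis
  qed
  also have "\<dots> = - tensor_coords q J e x u"
    unfolding tensor_coords_def by (simp add: sum_negf)
  finally show ?thesis by simp
qed

text \<open>A metric connection in a local frame \<open>e\<close> over a coordinate domain: \<open>G a b\<close> is the Gram matrix,
  \<open>P i a b\<close> and \<open>N i a b\<close> are the components along \<open>e\<^sub>b\<close> of the covariant derivatives of \<open>e\<^sub>a\<close> in the
  directions \<open>\<partial>/\<partial>z\<^sup>i\<close> and its conjugate.\<close>

locale local_connection =
  fixes U :: "(complex ^ 'n::finite) set" and J :: "'a set"
    and G :: "'a \<Rightarrow> 'a \<Rightarrow> complex ^ 'n \<Rightarrow> complex"
    and P N :: "'n \<Rightarrow> 'a \<Rightarrow> 'a \<Rightarrow> complex ^ 'n \<Rightarrow> complex"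
  assumes U: "open U" and J: "finite J"
    and G: "\<And>a b. a \<in> J \<Longrightarrow> b \<in> J \<Longrightarrow> twice_differentiable_on U (G a b)"
    and P: "\<And>i a b z. a \<in> J \<Longrightarrow> b \<in> J \<Longrightarrow> z \<in> U \<Longrightarrow> P i a b differentiable at z"
    and N: "\<And>i a b z. a \<in> J \<Longrightarrow> b \<in> J \<Longrightarrow> z \<in> U \<Longrightarrow> N i a b differentiable at z"
    and herm: "\<And>a b z. a \<in> J \<Longrightarrow> b \<in> J \<Longrightarrow> z \<in> U \<Longrightarrow> cnj (G a b z) = G b a z"
    and compat: "\<And>i a b z. a \<in> J \<Longrightarrow> b \<in> J \<Longrightarrow> z \<in> U \<Longrightarrow>
      dz i (G a b) z = (\<Sum>c\<in>J. P i a c z * G c b z) + (\<Sum>c\<in>J. cnj (N i b c z) * G a c z)"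
begin

definition nabla :: "'n \<Rightarrow> ('a \<Rightarrow> complex ^ 'n \<Rightarrow> complex) \<Rightarrow> 'a \<Rightarrow> complex ^ 'n \<Rightarrow> complex" where
  "nabla i s b z = dz i (s b) z + (\<Sum>a\<in>J. s a z * P i a b z)"

definition nablab :: "'n \<Rightarrow> ('a \<Rightarrow> complex ^ 'n \<Rightarrow> complex) \<Rightarrow> 'a \<Rightarrow> complex ^ 'n \<Rightarrow> complex" where
  "nablab i s b z = dzb i (s b) z + (\<Sum>a\<in>J. s a z * N i a b z)"

text \<open>The curvature matrix on frame vectors, with i holomorphic and j antiholomorphic; its
  sign convention is the one of \<open>nabla_commutator\<close>.\<close>

definition curv :: "'n \<Rightarrow> 'n \<Rightarrow> 'a \<Rightarrow> 'a \<Rightarrow> complex ^ 'n \<Rightarrow> complex" where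
  "curv i j a b z = dz i (N j a b) z - dzb j (P i a b) z
     + (\<Sum>c\<in>J. N j a c z * P i c b z - P i a c z * N j c b z)"

definition inner_fun :: "('a \<Rightarrow> complex ^ 'n \<Rightarrow> complex) \<Rightarrow> ('a \<Rightarrow> complex ^ 'n \<Rightarrow> complex) \<Rightarrow> complex ^ 'n \<Rightarrow> complex" where
  "inner_fun s t z = hprod J (\<lambda>a b. G a b z) (\<lambda>a. s a z) (\<lambda>a. t a z)"

lemma G_differentiable: "a \<in> J \<Longrightarrow> b \<in> J \<Longrightarrow> z \<in> U \<Longrightarrow> G a b differentiable at z"
  using twice_differentiable_onD(1)[OF G] .

text \<open>The conjugate of \<open>compat\<close>: the Gram matrix is Hermitian, and conjugation
  exchanges the two Wirtinger operators and with them the roles of P and N.\<close>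

lemma compatb:
  assumes "a \<in> J" "b \<in> J" "z \<in> U"
  shows "dzb i (G a b) z = (\<Sum>c\<in>J. N i a c z * G c b z) + (\<Sum>c\<in>J. cnj (P i b c z) * G a c z)"
proof -
  have "dzb i (G a b) z = dzb i (\<lambda>z. cnj (G b a z)) z"
    by (rule dz_transform(2)[OF U assms(3)]) (simp add: herm assms)
  also have "\<dots> = cnj (dz i (G b a) z)"
    by (rule dz_cnj(2)[OF G_differentiable[OF assms(2,1,3)]])
  also have "\<dots> = (\<Sum>c\<in>J. cnj (P i b c z) * cnj (G c a z)) + (\<Sum>c\<in>J. N i a c z * cnj (G b c z))"
    unfolding compat[OF assms(2,1,3)] by simp
  also have "(\<Sum>c\<in>J. cnj (P i b c z) * cnj (G c a z)) = (\<Sum>c\<in>J. cnj (P i b c z) * G a c z)"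
    using assms by (intro sum.cong refl) (simp add: herm)
  also have "(\<Sum>c\<in>J. N i a c z * cnj (G b c z)) = (\<Sum>c\<in>J. N i a c z * G c b z)"
    using assms by (intro sum.cong refl) (simp add: herm)
  finally show ?thesis by (simp add: add.commute)
qed

lemma product_differentiable:
  assumes "a \<in> J" "b \<in> J" "z \<in> U" "s a differentiable at z" "t b differentiable at z"
  shows "(\<lambda>z. s a z * cnj (t b z)) differentiable at z"
    "(\<lambda>z. s a z * cnj (t b z) * G a b z) differentiable at z"
  by (intro differentiable_mult differentiable_cnj G_differentiable assms)+

text \<open>The index bookkeeping shared by both Wirtinger operators: D is either of them, A and B
  are the connection coefficients belonging to the linear and to the conjugated argument.\<close>

lemma leibniz_aux:
  fixes D :: "(complex ^ 'n \<Rightarrow> complex) \<Rightarrow> complex"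
  assumes z: "z \<in> U"
    and D: "\<And>a b. a \<in> J \<Longrightarrow> b \<in> J \<Longrightarrow> D (\<lambda>z. s a z * cnj (t b z) * G a b z)
        = ds a * cnj (t b z) * G a b z + s a z * cnj (dt b) * G a b z + s a z * cnj (t b z) * dG a b"
    and dG: "\<And>a b. a \<in> J \<Longrightarrow> b \<in> J \<Longrightarrow> dG a b = (\<Sum>c\<in>J. A a c * G c b z) + (\<Sum>c\<in>J. cnj (B b c) * G a c z)"
  shows "(\<Sum>a\<in>J. \<Sum>b\<in>J. D (\<lambda>z. s a z * cnj (t b z) * G a b z))
    = hprod J (\<lambda>a b. G a b z) (\<lambda>b. ds b + (\<Sum>a\<in>J. s a z * A a b)) (\<lambda>a. t a z)
    + hprod J (\<lambda>a b. G a b z) (\<lambda>a. s a z) (\<lambda>b. dt b + (\<Sum>a\<in>J. t a z * B a b))"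
proof -
  have "(\<Sum>a\<in>J. \<Sum>b\<in>J. D (\<lambda>z. s a z * cnj (t b z) * G a b z))
    = (\<Sum>a\<in>J. \<Sum>b\<in>J. ds a * cnj (t b z) * G a b z) + (\<Sum>a\<in>J. \<Sum>b\<in>J. s a z * cnj (dt b) * G a b z)
     + ((\<Sum>a\<in>J. \<Sum>b\<in>J. \<Sum>c\<in>J. s a z * cnj (t b z) * (A a c * G c b z))
      + (\<Sum>a\<in>J. \<Sum>b\<in>J. \<Sum>c\<in>J. s a z * cnj (t b z) * (cnj (B b c) * G a c z)))"
    by (simp add: D dG sum.distrib sum_distrib_left distrib_left)
  also have "(\<Sum>a\<in>J. \<Sum>b\<in>J. \<Sum>c\<in>J. s a z * cnj (t b z) * (A a c * G c b z))
      = (\<Sum>c\<in>J. \<Sum>b\<in>J. \<Sum>a\<in>J. s a z * cnj (t b z) * (A a c * G c b z))"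
    by (subst sum.swap, subst (2) sum.swap, subst sum.swap) (rule refl)
  also have "\<dots> = (\<Sum>c\<in>J. \<Sum>b\<in>J. (\<Sum>a\<in>J. s a z * A a c) * cnj (t b z) * G c b z)"
    unfolding sum_distrib_right by (simp only: mult_ac)
  also have "(\<Sum>a\<in>J. \<Sum>b\<in>J. \<Sum>c\<in>J. s a z * cnj (t b z) * (cnj (B b c) * G a c z))
      = (\<Sum>a\<in>J. \<Sum>c\<in>J. \<Sum>b\<in>J. s a z * cnj (t b z) * (cnj (B b c) * G a c z))"
    by (intro sum.cong refl sum.swap)
  also have "\<dots> = (\<Sum>a\<in>J. \<Sum>c\<in>J. s a z * cnj (\<Sum>b\<in>J. t b z * B b c) * G a c z)"
    unfolding cnj_sum complex_cnj_mult sum_distrib_left sum_distrib_right by (simp only: mult_ac)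
  finally show ?thesis
    unfolding hprod_def by (simp add: sum.distrib distrib_left distrib_right)
qed

lemma dz_inner_fun:
  assumes z: "z \<in> U" and s: "\<And>a. a \<in> J \<Longrightarrow> s a differentiable at z"
    and t: "\<And>a. a \<in> J \<Longrightarrow> t a differentiable at z"
  shows "dz i (inner_fun s t) z = inner_fun (nabla i s) t z + inner_fun s (nablab i t) z"
    and "dzb i (inner_fun s t) z = inner_fun (nablab i s) t z + inner_fun s (nabla i t) z"
proof -
  have d: "(\<lambda>z. s a z * cnj (t b z) * G a b z) differentiable at z" if "a \<in> J" "b \<in> J" for a b
    using product_differentiable(2)[of a b z s t] that z s t by blast
  have d': "(\<lambda>z. \<Sum>b\<in>J. s a z * cnj (t b z) * G a b z) differentiable at z" if "a \<in> J" for a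
    using d that J by (intro differentiable_sum) auto
  have f: "inner_fun s t = (\<lambda>z. \<Sum>a\<in>J. \<Sum>b\<in>J. s a z * cnj (t b z) * G a b z)"
    by (simp add: inner_fun_def[abs_def] hprod_def)
  have "dz i (inner_fun s t) z = (\<Sum>a\<in>J. \<Sum>b\<in>J. dz i (\<lambda>z. s a z * cnj (t b z) * G a b z) z)"
    unfolding f by (simp add: dz_sum(1) d d')
  also have "\<dots> = inner_fun (nabla i s) t z + inner_fun s (nablab i t) z"
    unfolding inner_fun_def nabla_def nablab_def
    by (rule leibniz_aux[OF z _ compat[OF _ _ z]])
      (use s t z in \<open>simp_all add: dz_mult(1) dz_cnj(1) product_differentiable differentiable_cnj G_differentiable algebra_simps\<close>)
  finally show "dz i (inner_fun s t) z = inner_fun (nabla i s) t z + inner_fun s (nablab i t) z" .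
  have "dzb i (inner_fun s t) z = (\<Sum>a\<in>J. \<Sum>b\<in>J. dzb i (\<lambda>z. s a z * cnj (t b z) * G a b z) z)"
    unfolding f by (simp add: dz_sum(2) d d')
  also have "\<dots> = inner_fun (nablab i s) t z + inner_fun s (nabla i t) z"
    unfolding inner_fun_def nabla_def nablab_def
    by (rule leibniz_aux[OF z _ compatb[OF _ _ z]])
      (use s t z in \<open>simp_all add: dz_mult(2) dz_cnj(2) product_differentiable differentiable_cnj G_differentiable algebra_simps\<close>)
  finally show "dzb i (inner_fun s t) z = inner_fun (nablab i s) t z + inner_fun s (nabla i t) z" .
qed

text \<open>Second-order terms cancel by symmetry, first-order terms occur in both orders of
  differentiation; what remains is linear in the values of s.\<close>

lemma nabla_commutator:
  assumes z: "z \<in> U" and b: "b \<in> J" and s: "\<And>a. a \<in> J \<Longrightarrow> smooth_on U (s a)"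
  shows "nabla i (nablab j s) b z - nablab j (nabla i s) b z = (\<Sum>a\<in>J. s a z * curv i j a b z)"
proof -
  have sd: "s a differentiable at z" if "a \<in> J" for a
    using smooth_on_differentiable[OF s[OF that] z] .
  have sd2: "dz k (s a) differentiable at z" "dzb k (s a) differentiable at z" if "a \<in> J" for a k
    using dz_differentiable[OF smooth_on_twice_differentiable[OF s[OF that]] z] .
  have sum_d: "(\<lambda>z. \<Sum>a\<in>J. s a z * P i a b z) differentiable at z"
       "(\<lambda>z. \<Sum>a\<in>J. s a z * N j a b z) differentiable at z"
    using sd P N z b J by (intro differentiable_sum ballI differentiable_mult; blast)+
  have A: "nabla i (nablab j s) b z = dz i (dzb j (s b)) z
      + (\<Sum>a\<in>J. dz i (s a) z * N j a b z + s a z * dz i (N j a b) z)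
      + (\<Sum>c\<in>J. (dzb j (s c) z + (\<Sum>a\<in>J. s a z * N j a c z)) * P i c b z)"
  proof -
    have "nablab j s b = (\<lambda>z. dzb j (s b) z + (\<Sum>a\<in>J. s a z * N j a b z))"
      by (simp add: nablab_def[abs_def])
    then show ?thesis unfolding nabla_def
      using sd N z b sum_d sd2 by (simp add: dz_add(1) dz_sum(1) dz_mult(1) differentiable_mult nablab_def)
  qed
  have B: "nablab j (nabla i s) b z = dzb j (dz i (s b)) z
      + (\<Sum>a\<in>J. dzb j (s a) z * P i a b z + s a z * dzb j (P i a b) z)
      + (\<Sum>c\<in>J. (dz i (s c) z + (\<Sum>a\<in>J. s a z * P i a c z)) * N j c b z)"
  proof -
    have "nabla i s b = (\<lambda>z. dz i (s b) z + (\<Sum>a\<in>J. s a z * P i a b z))"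
      by (simp add: nabla_def[abs_def])
    then show ?thesis unfolding nablab_def
      using sd P z b sum_d sd2 by (simp add: dz_add(2) dz_sum(2) dz_mult(2) differentiable_mult nabla_def)
  qed
  have sw: "(\<Sum>c\<in>J. (\<Sum>a\<in>J. s a z * X a c) * Y c) = (\<Sum>a\<in>J. s a z * (\<Sum>c\<in>J. X a c * Y c))" for X Y
    unfolding sum_distrib_left sum_distrib_right by (subst sum.swap) (simp only: mult.assoc)
  show ?thesis
    unfolding A B dz_dzb_commute[OF U z s[OF b]]
    by (simp add: distrib_right sum.distrib sw curv_def distrib_left right_diff_distrib sum_subtractf)
qed

text \<open>Closedness lets the antiholomorphic derivative reach only the conjugated argument, where
  it becomes \<open>nabla j s\<close>. The holomorphic one then produces the gradient term and
  \<open>nablab i (nabla j s)\<close>, which is a pure curvature term because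
  \<open>nablab i s\<close> vanishes near z. Conjugation in that argument is why the indices of
  \<open>curv\<close> appear in reversed order.\<close>

theorem bochner_formula:
  assumes z: "z \<in> U" and s: "\<And>a. a \<in> J \<Longrightarrow> smooth_on U (s a)"
    and closed: "\<And>j b z. b \<in> J \<Longrightarrow> z \<in> U \<Longrightarrow> nablab j s b z = 0"
  shows "dz i (dzb j (inner_fun s s)) z = inner_fun (nabla i s) (nabla j s) z
    - hprod J (\<lambda>a b. G a b z) (\<lambda>a. s a z) (\<lambda>b. \<Sum>a\<in>J. s a z * curv j i a b z)"
proof -
  have sd: "s a differentiable at z" if "a \<in> J" "z \<in> U" for a z
    using smooth_on_differentiable[OF s] that by blast
  have first: "dzb j (inner_fun s s) y = inner_fun s (nabla j s) y" if "y \<in> U" for y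
  proof -
    have "inner_fun (nablab j s) s y = 0"
      unfolding inner_fun_def hprod_def using closed[OF _ that] by simp
    then show ?thesis using dz_inner_fun(2)[OF that sd sd, where i=j] that by simp
  qed
  have nd: "nabla j s b differentiable at z" if "b \<in> J" for b
  proof -
    have "(\<lambda>z. dz j (s b) z + (\<Sum>a\<in>J. s a z * P j a b z)) differentiable at z"
      by (intro differentiable_add differentiable_sum ballI differentiable_mult J sd P that z
          dz_differentiable(1)[OF smooth_on_twice_differentiable[OF s]])
    then show ?thesis by (simp add: nabla_def[abs_def])
  qed
  have comm: "nablab i (nabla j s) b z = - (\<Sum>a\<in>J. s a z * curv j i a b z)" if b: "b \<in> J" for b
  proof -
    have "dz j (nablab i s b) z = dz j (\<lambda>z. 0) z"
      by (rule dz_transform(1)[OF U z]) (rule closed[OF b])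
    then have "nabla j (nablab i s) b z = 0"
      unfolding nabla_def using closed z by simp
    with nabla_commutator[OF z b s, where i=j and j=i] show ?thesis by (simp add: algebra_simps eq_neg_iff_add_eq_0)
  qed
  have "dz i (dzb j (inner_fun s s)) z = dz i (inner_fun s (nabla j s)) z"
    by (rule dz_transform(1)[OF U z first])
  also have "\<dots> = inner_fun (nabla i s) (nabla j s) z + inner_fun s (nablab i (nabla j s)) z"
    by (rule dz_inner_fun(1)[OF z sd[OF _ z] nd])
  also have "inner_fun s (nablab i (nabla j s)) z
     = - hprod J (\<lambda>a b. G a b z) (\<lambda>a. s a z) (\<lambda>b. \<Sum>a\<in>J. s a z * curv j i a b z)"
    unfolding inner_fun_def hprod_def by (simp add: comm sum_negf)
  finally show ?thesis by simp
qed

lemma inner_fun_twice_differentiable: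
  assumes "\<And>a. a \<in> J \<Longrightarrow> twice_differentiable_on U (s a)"
  shows "twice_differentiable_on U (inner_fun s s)"
proof -
  have "twice_differentiable_on U (\<lambda>z. \<Sum>a\<in>J. \<Sum>b\<in>J. s a z * cnj (s b z) * G a b z)"
    by (intro twice_differentiable_on_sum twice_differentiable_on_mult twice_differentiable_on_cnj U G assms)
  then show ?thesis by (simp add: inner_fun_def[abs_def] hprod_def)
qed

end

section \<open>The tensor power of a local connection\<close>

lemma sum_at_slot_add:
  fixes Y :: "'a \<Rightarrow> 'a \<Rightarrow> 'k::comm_ring_1"
  shows "(\<Sum>k<q. at_slot q k (\<lambda>a b. X a b + X' a b) Y \<alpha> \<beta>)
    = (\<Sum>k<q. at_slot q k X Y \<alpha> \<beta>) + (\<Sum>k<q. at_slot q k X' Y \<alpha> \<beta>)"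
  unfolding sum.distrib[symmetric] by (intro sum.cong refl) (simp add: at_slot_eq distrib_right)

lemma at_slot_cong:
  assumes "\<And>l. l < q \<Longrightarrow> X (\<alpha> l) (\<beta> l) = X' (\<alpha> l) (\<beta> l)" "\<And>l. l < q \<Longrightarrow> Y (\<alpha> l) (\<beta> l) = Y' (\<alpha> l) (\<beta> l)"
  shows "at_slot q k X Y \<alpha> \<beta> = at_slot q k X' Y' \<alpha> \<beta>"
  unfolding at_slot_def using assms by (intro prod.cong) auto

lemma cnj_derivation: "cnj (derivation q X \<alpha> \<beta>) = derivation q (\<lambda>a b. cnj (X a b)) \<alpha> \<beta>"
  unfolding derivation_def at_slot_def cnj_sum cnj_prod
  by (intro sum.cong prod.cong refl) (simp add: kron_def)

lemma dz_at_slot: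
  assumes "k < q" "X (\<alpha> k) (\<beta> k) differentiable at z"
  shows "(\<lambda>z. at_slot q k (\<lambda>a b. X a b z) kron \<alpha> \<beta>) differentiable at z"
    and "dz i (\<lambda>z. at_slot q k (\<lambda>a b. X a b z) kron \<alpha> \<beta>) z = at_slot q k (\<lambda>a b. dz i (X a b) z) kron \<alpha> \<beta>"
    and "dzb i (\<lambda>z. at_slot q k (\<lambda>a b. X a b z) kron \<alpha> \<beta>) z = at_slot q k (\<lambda>a b. dzb i (X a b) z) kron \<alpha> \<beta>"
  using assms by (simp_all add: at_slot_eq dz_mult(1,2) differentiable_mult)

lemma dz_derivation:
  assumes "\<And>k. k < q \<Longrightarrow> X (\<alpha> k) (\<beta> k) differentiable at z"
  shows "(\<lambda>z. derivation q (\<lambda>a b. X a b z) \<alpha> \<beta>) differentiable at z"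
    and "dz i (\<lambda>z. derivation q (\<lambda>a b. X a b z) \<alpha> \<beta>) z = derivation q (\<lambda>a b. dz i (X a b) z) \<alpha> \<beta>"
    and "dzb i (\<lambda>z. derivation q (\<lambda>a b. X a b z) \<alpha> \<beta>) z = derivation q (\<lambda>a b. dzb i (X a b) z) \<alpha> \<beta>"
proof -
  note slot = dz_at_slot[where X=X and q=q and \<alpha>=\<alpha> and \<beta>=\<beta>, OF _ assms]
  show "(\<lambda>z. derivation q (\<lambda>a b. X a b z) \<alpha> \<beta>) differentiable at z"
    unfolding derivation_def using slot(1) by (intro differentiable_sum) auto
  show "dz i (\<lambda>z. derivation q (\<lambda>a b. X a b z) \<alpha> \<beta>) z = derivation q (\<lambda>a b. dz i (X a b) z) \<alpha> \<beta>"
    unfolding derivation_def using slot by (subst dz_sum(1)) (auto intro!: sum.cong)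
  show "dzb i (\<lambda>z. derivation q (\<lambda>a b. X a b z) \<alpha> \<beta>) z = derivation q (\<lambda>a b. dzb i (X a b) z) \<alpha> \<beta>"
    unfolding derivation_def using slot by (subst dz_sum(2)) (auto intro!: sum.cong)
qed

context local_connection
begin

text \<open>The metric of the full tensor power; on alternating tensors it agrees with the usual
  metric of the exterior power up to a constant factor.\<close>

definition tensorG :: "nat \<Rightarrow> (nat \<Rightarrow> 'a) \<Rightarrow> (nat \<Rightarrow> 'a) \<Rightarrow> complex ^ 'n \<Rightarrow> complex" where
  "tensorG q \<alpha> \<beta> z = (\<Prod>l<q. G (\<alpha> l) (\<beta> l) z)"

definition tensorP :: "nat \<Rightarrow> 'n \<Rightarrow> (nat \<Rightarrow> 'a) \<Rightarrow> (nat \<Rightarrow> 'a) \<Rightarrow> complex ^ 'n \<Rightarrow> complex" where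
  "tensorP q i \<alpha> \<beta> z = derivation q (\<lambda>a b. P i a b z) \<alpha> \<beta>"

definition tensorN :: "nat \<Rightarrow> 'n \<Rightarrow> (nat \<Rightarrow> 'a) \<Rightarrow> (nat \<Rightarrow> 'a) \<Rightarrow> complex ^ 'n \<Rightarrow> complex" where
  "tensorN q i \<alpha> \<beta> z = derivation q (\<lambda>a b. N i a b z) \<alpha> \<beta>"

text \<open>The tensor power is again a metric connection in a frame, so the Bochner formula applies
  to it verbatim. Compatibility is the Leibniz rule for the product of Gram entries, regrouped by
  \<open>derivation_mult_prod\<close>.\<close>

lemma tensor_local_connection:
  "local_connection U (multi_index q J) (tensorG q) (tensorP q) (tensorN q)"
proof
  show "open U" by (rule U)
  show "finite (multi_index q J)" by (rule finite_multi_index[OF J])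
  fix \<alpha> \<beta> assume \<alpha>: "\<alpha> \<in> multi_index q J" and \<beta>: "\<beta> \<in> multi_index q J"
  have in_J: "\<alpha> l \<in> J" "\<beta> l \<in> J" if "l < q" for l
    using multi_index_in[OF \<alpha> that] multi_index_in[OF \<beta> that] .
  show "twice_differentiable_on U (tensorG q \<alpha> \<beta>)"
    unfolding tensorG_def by (intro twice_differentiable_on_prod U G in_J) auto
  fix i z assume z: "z \<in> U"
  show "tensorP q i \<alpha> \<beta> differentiable at z" "tensorN q i \<alpha> \<beta> differentiable at z"
    unfolding tensorP_def[abs_def] tensorN_def[abs_def]
    by (intro dz_derivation(1) P N in_J z; assumption)+
  show "cnj (tensorG q \<alpha> \<beta> z) = tensorG q \<beta> \<alpha> z"
    unfolding tensorG_def cnj_prod by (intro prod.cong refl herm in_J z) auto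
  have "dz i (tensorG q \<alpha> \<beta>) z = (\<Sum>k<q. at_slot q k (\<lambda>a b. dz i (G a b) z) (\<lambda>a b. G a b z) \<alpha> \<beta>)"
    unfolding tensorG_def[abs_def] at_slot_def
    by (subst dz_prod(2)) (auto intro!: sum.cong prod.cong G_differentiable in_J z)
  also have "\<dots> = (\<Sum>k<q. at_slot q k (\<lambda>a b. (\<Sum>c\<in>J. P i a c z * G c b z) + (\<Sum>c\<in>J. cnj (N i b c z) * G a c z)) (\<lambda>a b. G a b z) \<alpha> \<beta>)"
    by (intro sum.cong refl at_slot_cong compat in_J z)
  also have "\<dots> = (\<Sum>k<q. at_slot q k (\<lambda>a b. \<Sum>c\<in>J. P i a c z * G c b z) (\<lambda>a b. G a b z) \<alpha> \<beta>)
      + (\<Sum>k<q. at_slot q k (\<lambda>a b. \<Sum>c\<in>J. cnj (N i b c z) * G a c z) (\<lambda>a b. G a b z) \<alpha> \<beta>)"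
    by (rule sum_at_slot_add)
  also have "(\<Sum>k<q. at_slot q k (\<lambda>a b. \<Sum>c\<in>J. P i a c z * G c b z) (\<lambda>a b. G a b z) \<alpha> \<beta>)
      = (\<Sum>\<gamma>\<in>multi_index q J. tensorP q i \<alpha> \<gamma> z * tensorG q \<gamma> \<beta> z)"
    unfolding tensorP_def tensorG_def
    by (rule derivation_mult_prod[OF J \<alpha>, symmetric])
  \<comment> \<open>The slots are read from \<beta> to \<alpha>, since the conjugated coefficients
    act on the second argument of the metric.\<close>
  also have "(\<Sum>k<q. at_slot q k (\<lambda>a b. \<Sum>c\<in>J. cnj (N i b c z) * G a c z) (\<lambda>a b. G a b z) \<alpha> \<beta>)
     = (\<Sum>k<q. at_slot q k (\<lambda>b a. \<Sum>c\<in>J. cnj (N i b c z) * G a c z) (\<lambda>b a. G a b z) \<beta> \<alpha>)"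
    unfolding at_slot_def ..
  also have "\<dots> = (\<Sum>\<gamma>\<in>multi_index q J. cnj (tensorN q i \<beta> \<gamma> z) * tensorG q \<alpha> \<gamma> z)"
    unfolding tensorN_def tensorG_def cnj_derivation
    by (rule derivation_mult_prod[OF J \<beta>, where g = "\<lambda>c a. G a c z", symmetric])
  finally show "dz i (tensorG q \<alpha> \<beta>) z = (\<Sum>\<gamma>\<in>multi_index q J. tensorP q i \<alpha> \<gamma> z * tensorG q \<gamma> \<beta> z)
      + (\<Sum>\<gamma>\<in>multi_index q J. cnj (tensorN q i \<beta> \<gamma> z) * tensorG q \<alpha> \<gamma> z)" .
qed

text \<open>The terms with derivatives are linear in the coefficients and pass through the
  derivation; the quadratic terms do so by \<open>derivation_commutator\<close>.\<close>

lemma tensor_curv: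
  assumes \<alpha>: "\<alpha> \<in> multi_index q J" and \<beta>: "\<beta> \<in> multi_index q J" and z: "z \<in> U"
  shows "local_connection.curv (multi_index q J) (tensorP q) (tensorN q) i j \<alpha> \<beta> z
    = derivation q (\<lambda>a b. curv i j a b z) \<alpha> \<beta>"
proof -
  interpret tensor: local_connection U "multi_index q J" "tensorG q" "tensorP q" "tensorN q"
    by (rule tensor_local_connection)
  have in_J: "\<alpha> l \<in> J" "\<beta> l \<in> J" if "l < q" for l
    using multi_index_in[OF \<alpha> that] multi_index_in[OF \<beta> that] .
  have "tensor.curv i j \<alpha> \<beta> z = derivation q (\<lambda>a b. dz i (N j a b) z) \<alpha> \<beta> - derivation q (\<lambda>a b. dzb j (P i a b) z) \<alpha> \<beta>
     + derivation q (\<lambda>a b. \<Sum>c\<in>J. N j a c z * P i c b z - P i a c z * N j c b z) \<alpha> \<beta>"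
    unfolding tensor.curv_def unfolding tensorP_def[abs_def] tensorN_def[abs_def]
    using derivation_commutator[OF J \<alpha> \<beta>, of "\<lambda>a b. N j a b z" "\<lambda>a b. P i a b z"]
      dz_derivation(2)[of q "N j" \<alpha> \<beta> z i] dz_derivation(3)[of q "P i" \<alpha> \<beta> z j] N P in_J z by simp
  also have "\<dots> = derivation q (\<lambda>a b. curv i j a b z) \<alpha> \<beta>"
    unfolding derivation_def curv_def sum_subtractf[symmetric] sum.distrib[symmetric]
    by (intro sum.cong refl) (simp add: at_slot_eq algebra_simps)
  finally show ?thesis .
qed

end

section \<open>The Bochner formula in a unitary eigenbasis at a point\<close>

lemma sum_rotate:
  "(\<Sum>a\<in>A. \<Sum>b\<in>B. \<Sum>c\<in>C. f a b c) = (\<Sum>c\<in>C. \<Sum>a\<in>A. \<Sum>b\<in>B. f a b c)"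
proof -
  have "(\<Sum>a\<in>A. \<Sum>b\<in>B. \<Sum>c\<in>C. f a b c) = (\<Sum>a\<in>A. \<Sum>c\<in>C. \<Sum>b\<in>B. f a b c)"
    by (intro sum.cong refl sum.swap)
  also have "\<dots> = (\<Sum>c\<in>C. \<Sum>a\<in>A. \<Sum>b\<in>B. f a b c)" by (rule sum.swap)
  finally show ?thesis .
qed

lemma tensor_coords_not_inj:
  "alternating_on q J x \<Longrightarrow> \<not> inj_on u {..<q} \<Longrightarrow> tensor_coords q J e x u = 0"
  using tensor_coords_alternating unfolding inj_on_def by blast

lemma at_slot_sum2:
  assumes "k < q"
  shows "at_slot q k (\<lambda>a b. \<Sum>i\<in>I. \<Sum>j\<in>I'. w i j * X i j a b) Y \<alpha> \<beta>
    = (\<Sum>i\<in>I. \<Sum>j\<in>I'. w i j * at_slot q k (X i j) Y \<alpha> \<beta>)"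
  using assms by (simp add: at_slot_eq sum_distrib_right mult.assoc)

lemma hprod_sum2:
  "(\<Sum>i\<in>A. \<Sum>j\<in>B. w i j * hprod J (M i j) x y) = hprod J (\<lambda>a b. \<Sum>i\<in>A. \<Sum>j\<in>B. w i j * M i j a b) x y"
proof -
  have "(\<Sum>i\<in>A. \<Sum>j\<in>B. w i j * hprod J (M i j) x y)
      = (\<Sum>i\<in>A. \<Sum>j\<in>B. \<Sum>a\<in>J. \<Sum>b\<in>J. x a * cnj (y b) * (w i j * M i j a b))"
    unfolding hprod_def sum_distrib_left by (simp only: mult_ac)
  also have "\<dots> = (\<Sum>a\<in>J. \<Sum>i\<in>A. \<Sum>j\<in>B. \<Sum>b\<in>J. x a * cnj (y b) * (w i j * M i j a b))"
    by (rule sum_rotate)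
  also have "\<dots> = (\<Sum>a\<in>J. \<Sum>b\<in>J. \<Sum>i\<in>A. \<Sum>j\<in>B. x a * cnj (y b) * (w i j * M i j a b))"
    by (intro sum.cong refl sum_rotate)
  finally show ?thesis unfolding hprod_def sum_distrib_left .
qed

text \<open>The instance of \<open>hprod_slots\<close> with the eigenvalues as diagonal entries in
  slot k and 1 in the others.\<close>

lemma hprod_at_slot:
  assumes J: "finite J" and K: "finite K" and k: "k < q"
    and g: "\<And>a b. a \<in> J \<Longrightarrow> b \<in> J \<Longrightarrow> g a b = (\<Sum>u\<in>K. e a u * cnj (e b u))"
    and r: "\<And>a b. a \<in> J \<Longrightarrow> b \<in> J \<Longrightarrow> r a b = (\<Sum>u\<in>K. of_real (lam u) * e a u * cnj (e b u))"
  shows "hprod (multi_index q J) (at_slot q k r g) x x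
    = (\<Sum>u\<in>multi_index q K. of_real (lam (u k) * (cmod (tensor_coords q J e x u))\<^sup>2))"
proof -
  have "hprod (multi_index q J) (\<lambda>\<alpha> \<beta>. \<Prod>l<q. (if l = k then r else g) (\<alpha> l) (\<beta> l)) x x
    = (\<Sum>u\<in>multi_index q K. (\<Prod>l<q. (if l = k then of_real (lam (u l)) else 1)) * tensor_coords q J e x u * cnj (tensor_coords q J e x u))"
    using hprod_slots[OF J K, of q "\<lambda>l. if l = k then r else g" "\<lambda>l u. if l = k then of_real (lam u) else 1" e x x]
    by (simp add: g r if_distrib)
  moreover have "(\<Prod>l<q. (if l = k then of_real (lam (u l)) else (1::complex))) = of_real (lam (u k))" for u
    using k by (simp add: prod.delta)
  ultimately show ?thesis
    unfolding at_slot_def[abs_def] by (simp add: if_distribR mult.assoc complex_norm_square del: of_real_power)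
qed

context local_connection
begin

text \<open>K indexes the unitary eigenbasis at z: \<open>e b u\<close> is the component of the
  frame vector b along the eigenvector u, \<open>e'\<close> inverts this matrix, and
  \<open>lam u\<close> is the eigenvalue. Closedness is assumed on all of U because the formula
  differentiates it; the algebraic data refer to the point z only.\<close>

context
  fixes q :: nat and T :: "(nat \<Rightarrow> 'a) \<Rightarrow> complex ^ 'n \<Rightarrow> complex"
    and a :: "'n \<Rightarrow> 'n \<Rightarrow> complex ^ 'n \<Rightarrow> complex" and z :: "complex ^ 'n"
    and K :: "'b set" and e :: "'a \<Rightarrow> 'b \<Rightarrow> complex" and e' :: "'b \<Rightarrow> 'a \<Rightarrow> complex" and lam :: "'b \<Rightarrow> real"
  assumes T: "\<And>\<alpha>. \<alpha> \<in> multi_index q J \<Longrightarrow> smooth_on U (T \<alpha>)"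
    and closed: "\<And>j \<beta> z. \<beta> \<in> multi_index q J \<Longrightarrow> z \<in> U \<Longrightarrow>
      local_connection.nablab (multi_index q J) (tensorN q) j T \<beta> z = 0"
    and alt: "alternating_on q J (\<lambda>\<alpha>. T \<alpha> z)"
    and z: "z \<in> U" and a: "positive_definite (\<lambda>i j. a i j z)"
    and K: "finite K"
    and inv: "\<And>b c. b \<in> J \<Longrightarrow> c \<in> J \<Longrightarrow> (\<Sum>u\<in>K. e b u * e' u c) = kron b c"
    and G_eq: "\<And>b c. b \<in> J \<Longrightarrow> c \<in> J \<Longrightarrow> G b c z = (\<Sum>u\<in>K. e b u * cnj (e c u))"
    and ricci_eq: "\<And>b c. b \<in> J \<Longrightarrow> c \<in> J \<Longrightarrow>
      (\<Sum>i\<in>UNIV. \<Sum>j\<in>UNIV. a i j z * (\<Sum>d\<in>J. curv i j b d z * G d c z)) = (\<Sum>u\<in>K. of_real (lam u) * e b u * cnj (e c u))"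
begin

interpretation tensor: local_connection U "multi_index q J" "tensorG q" "tensorP q" "tensorN q"
  by (rule tensor_local_connection)

lemma trace_levi_tensor:
  "Re (trace_levi a (tensor.inner_fun T T) z)
   = (\<Sum>u\<in>multi_index q K. Re (\<Sum>i\<in>UNIV. \<Sum>j\<in>UNIV. a i j z
         * tensor_coords q J e (\<lambda>\<alpha>. tensor.nabla i T \<alpha> z) u * cnj (tensor_coords q J e (\<lambda>\<alpha>. tensor.nabla j T \<alpha> z) u)))
     - (\<Sum>u\<in>multi_index q K. (\<Sum>k<q. lam (u k)) * (cmod (tensor_coords q J e (\<lambda>\<alpha>. T \<alpha> z) u))\<^sup>2)"
proof -
  let ?I = "multi_index q J" and ?K = "multi_index q K"
  let ?x = "\<lambda>\<alpha>. T \<alpha> z" and ?d = "\<lambda>i \<alpha>. tensor.nabla i T \<alpha> z"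
  let ?R = "\<lambda>i j. hprod ?I (\<lambda>\<alpha> \<beta>. tensorG q \<alpha> \<beta> z) ?x (\<lambda>\<beta>. \<Sum>\<gamma>\<in>?I. T \<gamma> z * tensor.curv j i \<gamma> \<beta> z)"
  have "trace_levi a (tensor.inner_fun T T) z
      = (\<Sum>i\<in>UNIV. \<Sum>j\<in>UNIV. a i j z * tensor.inner_fun (tensor.nabla i T) (tensor.nabla j T) z)
        - (\<Sum>i\<in>UNIV. \<Sum>j\<in>UNIV. a i j z * ?R i j)"
  proof -
    have "dz i (dzb j (tensor.inner_fun T T)) z = tensor.inner_fun (tensor.nabla i T) (tensor.nabla j T) z - ?R i j" for i j
      by (rule tensor.bochner_formula[OF z]) (erule T, erule (1) closed)
    then show ?thesis
      unfolding trace_levi_def by (simp only: right_diff_distrib sum_subtractf)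
  qed
  moreover have "(\<Sum>i\<in>UNIV. \<Sum>j\<in>UNIV. a i j z * tensor.inner_fun (tensor.nabla i T) (tensor.nabla j T) z)
      = (\<Sum>u\<in>?K. \<Sum>i\<in>UNIV. \<Sum>j\<in>UNIV. a i j z * tensor_coords q J e (?d i) u * cnj (tensor_coords q J e (?d j) u))"
  proof -
    have "tensor.inner_fun (tensor.nabla i T) (tensor.nabla j T) z
        = (\<Sum>u\<in>?K. tensor_coords q J e (?d i) u * cnj (tensor_coords q J e (?d j) u))" for i j
      unfolding tensor.inner_fun_def tensorG_def
      using hprod_slots[OF J K, of q "\<lambda>l b c. G b c z" "\<lambda>_ _. 1" e] G_eq by simp
    then have "(\<Sum>i\<in>UNIV. \<Sum>j\<in>UNIV. a i j z * tensor.inner_fun (tensor.nabla i T) (tensor.nabla j T) z)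
      = (\<Sum>i\<in>UNIV. \<Sum>j\<in>UNIV. \<Sum>u\<in>?K. a i j z * tensor_coords q J e (?d i) u * cnj (tensor_coords q J e (?d j) u))"
      by (simp add: sum_distrib_left mult.assoc)
    also have "\<dots> = (\<Sum>i\<in>UNIV. \<Sum>u\<in>?K. \<Sum>j\<in>UNIV. a i j z * tensor_coords q J e (?d i) u * cnj (tensor_coords q J e (?d j) u))"
      by (intro sum.cong refl sum.swap)
    also have "\<dots> = (\<Sum>u\<in>?K. \<Sum>i\<in>UNIV. \<Sum>j\<in>UNIV. a i j z * tensor_coords q J e (?d i) u * cnj (tensor_coords q J e (?d j) u))"
      by (rule sum.swap)
    finally show ?thesis .
  qed
  \<comment> \<open>The curvature stands in the conjugated argument of the metric, so the conjugate
    sum is the convenient one; hermiticity of a then swaps i and j back into the order of the Ricci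
    form. The real part does not see the conjugation.\<close>
  moreover have "cnj (\<Sum>i\<in>UNIV. \<Sum>j\<in>UNIV. a i j z * ?R i j)
      = (\<Sum>u\<in>?K. of_real ((\<Sum>k<q. lam (u k)) * (cmod (tensor_coords q J e ?x u))\<^sup>2))"
  proof -
    let ?F = "\<lambda>i j b c. \<Sum>d\<in>J. curv i j b d z * G d c z" and ?g = "\<lambda>b c. G b c z"
    have R: "cnj (?R i j) = (\<Sum>k<q. hprod ?I (at_slot q k (?F j i) ?g) ?x ?x)" for i j
    proof -
      have "cnj (?R i j) = (\<Sum>\<alpha>\<in>?I. \<Sum>\<beta>\<in>?I. \<Sum>\<gamma>\<in>?I.
          cnj (T \<alpha> z) * T \<gamma> z * (derivation q (\<lambda>b c. curv j i b c z) \<gamma> \<beta> * tensorG q \<beta> \<alpha> z))"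
      proof -
        have "cnj (T \<alpha> z * cnj (\<Sum>\<gamma>\<in>?I. T \<gamma> z * tensor.curv j i \<gamma> \<beta> z) * tensorG q \<alpha> \<beta> z)
            = (\<Sum>\<gamma>\<in>?I. cnj (T \<alpha> z) * T \<gamma> z * (derivation q (\<lambda>b c. curv j i b c z) \<gamma> \<beta> * tensorG q \<beta> \<alpha> z))"
          if "\<alpha> \<in> ?I" "\<beta> \<in> ?I" for \<alpha> \<beta>
          by (simp add: tensor.herm that z tensor_curv sum_distrib_left sum_distrib_right mult_ac)
        then show ?thesis unfolding hprod_def cnj_sum by (simp cong: sum.cong)
      qed
      also have "\<dots> = (\<Sum>\<gamma>\<in>?I. \<Sum>\<alpha>\<in>?I. \<Sum>\<beta>\<in>?I.
          cnj (T \<alpha> z) * T \<gamma> z * (derivation q (\<lambda>b c. curv j i b c z) \<gamma> \<beta> * tensorG q \<beta> \<alpha> z))"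
        by (rule sum_rotate)
      also have "\<dots> = (\<Sum>\<gamma>\<in>?I. \<Sum>\<alpha>\<in>?I. cnj (T \<alpha> z) * T \<gamma> z * (\<Sum>k<q. at_slot q k (?F j i) ?g \<gamma> \<alpha>))"
        unfolding sum_distrib_left[symmetric] tensorG_def
        by (intro sum.cong refl arg_cong2[where f="(*)"] derivation_mult_prod[OF J])
      also have "\<dots> = (\<Sum>\<gamma>\<in>?I. \<Sum>\<alpha>\<in>?I. \<Sum>k<q. T \<gamma> z * cnj (T \<alpha> z) * at_slot q k (?F j i) ?g \<gamma> \<alpha>)"
        unfolding sum_distrib_left by (simp only: mult_ac)
      also have "\<dots> = (\<Sum>k<q. \<Sum>\<gamma>\<in>?I. \<Sum>\<alpha>\<in>?I. T \<gamma> z * cnj (T \<alpha> z) * at_slot q k (?F j i) ?g \<gamma> \<alpha>)"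
        by (rule sum_rotate)
      finally show ?thesis unfolding hprod_def .
    qed
    have "cnj (\<Sum>i\<in>UNIV. \<Sum>j\<in>UNIV. a i j z * ?R i j)
        = (\<Sum>i\<in>UNIV. \<Sum>j\<in>UNIV. a j i z * (\<Sum>k<q. hprod ?I (at_slot q k (?F j i) ?g) ?x ?x))"
      unfolding cnj_sum complex_cnj_mult R positive_definite_hermitian[OF a] ..
    also have "\<dots> = (\<Sum>i\<in>UNIV. \<Sum>j\<in>UNIV. a i j z * (\<Sum>k<q. hprod ?I (at_slot q k (?F i j) ?g) ?x ?x))"
      by (rule sum.swap)
    also have "\<dots> = (\<Sum>k<q. \<Sum>i\<in>UNIV. \<Sum>j\<in>UNIV. a i j z * hprod ?I (at_slot q k (?F i j) ?g) ?x ?x)"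
      unfolding sum_distrib_left by (rule sum_rotate)
    also have "\<dots> = (\<Sum>k<q. hprod ?I (at_slot q k (\<lambda>b c. \<Sum>i\<in>UNIV. \<Sum>j\<in>UNIV. a i j z * ?F i j b c) ?g) ?x ?x)"
      unfolding hprod_sum2 unfolding hprod_def
      by (intro sum.cong refl) (simp only: at_slot_sum2 lessThan_iff)
    also have "\<dots> = (\<Sum>k<q. \<Sum>u\<in>?K. of_real (lam (u k) * (cmod (tensor_coords q J e ?x u))\<^sup>2))"
      by (intro sum.cong refl hprod_at_slot[OF J K _ G_eq ricci_eq]) auto
    also have "\<dots> = (\<Sum>u\<in>?K. \<Sum>k<q. of_real (lam (u k) * (cmod (tensor_coords q J e ?x u))\<^sup>2))"
      by (rule sum.swap)
    finally show ?thesis by (simp only: of_real_sum sum_distrib_right)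
  qed
  from arg_cong[where f = Re, OF this]
  have "Re (\<Sum>i\<in>UNIV. \<Sum>j\<in>UNIV. a i j z * ?R i j)
      = (\<Sum>u\<in>?K. (\<Sum>k<q. lam (u k)) * (cmod (tensor_coords q J e ?x u))\<^sup>2)"
    unfolding cnj.simps(1) Re_sum Re_complex_of_real .
  ultimately show ?thesis
    by (simp only: minus_complex.sel Re_sum)
qed

lemma tensor_coords_zero_iff:
  assumes "\<And>u. u \<in> multi_index q K \<Longrightarrow> tensor_coords q J e x u = 0" "\<alpha> \<in> multi_index q J"
  shows "x \<alpha> = 0"
  using tensor_coords_inverse[OF J K assms(2) inv, of x] assms(1) by simp

lemma ricci_term_le:
  assumes "\<And>S. S \<subseteq> K \<Longrightarrow> card S = q \<Longrightarrow> sum lam S \<le> 0" and u: "u \<in> multi_index q K"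
  shows "(\<Sum>k<q. lam (u k)) * (cmod (tensor_coords q J e (\<lambda>\<alpha>. T \<alpha> z) u))\<^sup>2 \<le> 0"
proof (cases "inj_on u {..<q}")
  case True
  then have "(\<Sum>k<q. lam (u k)) = sum lam (u ` {..<q})" by (simp add: sum.reindex)
  also have "\<dots> \<le> 0"
    using u True by (intro assms(1)) (auto simp: card_image)
  finally show ?thesis by (intro mult_nonpos_nonneg) auto
next
  case False
  then show ?thesis
    using tensor_coords_not_inj[OF alt False] by simp
qed

lemma nabla_term_nonneg:
  "0 \<le> Re (\<Sum>i\<in>UNIV. \<Sum>j\<in>UNIV. a i j z
         * tensor_coords q J e (\<lambda>\<alpha>. tensor.nabla i T \<alpha> z) u * cnj (tensor_coords q J e (\<lambda>\<alpha>. tensor.nabla j T \<alpha> z) u))"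
  by (rule positive_definite_nonneg[OF a])

lemma nabla_sum_nonneg:
  "0 \<le> (\<Sum>u\<in>multi_index q K. Re (\<Sum>i\<in>UNIV. \<Sum>j\<in>UNIV. a i j z
         * tensor_coords q J e (\<lambda>\<alpha>. tensor.nabla i T \<alpha> z) u * cnj (tensor_coords q J e (\<lambda>\<alpha>. tensor.nabla j T \<alpha> z) u)))"
  by (rule sum_nonneg) (rule nabla_term_nonneg)

lemma ricci_sum_nonpos:
  assumes "\<And>S. S \<subseteq> K \<Longrightarrow> card S = q \<Longrightarrow> sum lam S \<le> 0"
  shows "(\<Sum>u\<in>multi_index q K. (\<Sum>k<q. lam (u k)) * (cmod (tensor_coords q J e (\<lambda>\<alpha>. T \<alpha> z) u))\<^sup>2) \<le> 0"
  by (rule sum_nonpos) (rule ricci_term_le[OF assms])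

lemma tensor_subsolution:
  assumes "\<And>S. S \<subseteq> K \<Longrightarrow> card S = q \<Longrightarrow> sum lam S \<le> 0"
  shows "0 \<le> Re (trace_levi a (tensor.inner_fun T T) z)"
  unfolding trace_levi_tensor
  using nabla_sum_nonneg ricci_sum_nonpos[OF assms] by linarith

text \<open>\<open>zero\<close> is opposite to \<open>tensor_subsolution\<close>. Together they make
  the gradient sum vanish; its terms are nonnegative, so each is zero, and positive definiteness of
  a then kills every coordinate of the derivative.\<close>

lemma tensor_parallel:
  assumes lam: "\<And>S. S \<subseteq> K \<Longrightarrow> card S = q \<Longrightarrow> sum lam S \<le> 0"
    and zero: "Re (trace_levi a (tensor.inner_fun T T) z) \<le> 0" and \<alpha>: "\<alpha> \<in> multi_index q J"
  shows "tensor.nabla i T \<alpha> z = 0"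
proof (rule tensor_coords_zero_iff[OF _ \<alpha>])
  fix u assume u: "u \<in> multi_index q K"
  let ?N = "\<lambda>u. Re (\<Sum>i\<in>UNIV. \<Sum>j\<in>UNIV. a i j z
         * tensor_coords q J e (\<lambda>\<alpha>. tensor.nabla i T \<alpha> z) u * cnj (tensor_coords q J e (\<lambda>\<alpha>. tensor.nabla j T \<alpha> z) u))"
  have "(\<Sum>u\<in>multi_index q K. ?N u) \<le> 0"
    using zero ricci_sum_nonpos[OF lam] unfolding trace_levi_tensor by linarith
  then have "(\<Sum>u\<in>multi_index q K. ?N u) = 0"
    using nabla_sum_nonneg by (rule order_antisym)
  then have "?N u = 0"
    using u finite_multi_index[OF K] nabla_term_nonneg by (simp add: sum_nonneg_eq_0_iff)
  then show "tensor_coords q J e (\<lambda>\<alpha>. tensor.nabla i T \<alpha> z) u = 0"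
    using positive_definiteD[OF a, of "\<lambda>i. tensor_coords q J e (\<lambda>\<alpha>. tensor.nabla i T \<alpha> z) u" i] by fastforce
qed

text \<open>The same squeeze applied to the curvature sum: a coordinate with distinct indices has a
  strictly negative weight and must vanish, and one with repeated indices vanishes by
  antisymmetry.\<close>

lemma tensor_vanishes:
  assumes lam: "\<And>S. S \<subseteq> K \<Longrightarrow> card S = q \<Longrightarrow> sum lam S < 0"
    and zero: "Re (trace_levi a (tensor.inner_fun T T) z) \<le> 0" and \<alpha>: "\<alpha> \<in> multi_index q J"
  shows "T \<alpha> z = 0"
proof (rule tensor_coords_zero_iff[OF _ \<alpha>])
  fix u assume u: "u \<in> multi_index q K"
  have lam': "sum lam S \<le> 0" if "S \<subseteq> K" "card S = q" for S
    using lam[OF that] by simp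
  let ?R = "\<lambda>u. (\<Sum>k<q. lam (u k)) * (cmod (tensor_coords q J e (\<lambda>\<alpha>. T \<alpha> z) u))\<^sup>2"
  have "0 \<le> (\<Sum>u\<in>multi_index q K. ?R u)"
    using zero nabla_sum_nonneg unfolding trace_levi_tensor by linarith
  then have "(\<Sum>u\<in>multi_index q K. - ?R u) = 0"
    using ricci_sum_nonpos[OF lam'] unfolding sum_negf by linarith
  then have R: "?R u = 0"
    using u finite_multi_index[OF K] ricci_term_le[OF lam'] by (subst (asm) sum_nonneg_eq_0_iff) auto
  show "tensor_coords q J e (\<lambda>\<alpha>. T \<alpha> z) u = 0"
  proof (cases "inj_on u {..<q}")
    case True
    then have "(\<Sum>k<q. lam (u k)) = sum lam (u ` {..<q})" by (simp add: sum.reindex)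
    also have "\<dots> < 0" using u True by (intro lam) (auto simp: card_image)
    finally show ?thesis using R by simp
  next
    case False
    then show ?thesis
      using tensor_coords_not_inj[OF alt False] by simp
  qed
qed

end

end

section \<open>Bundles and connections in local frames\<close>

text \<open>The part of \<open>vector_bundle\<close> on which the calculus of sections and
  connections rests. It asks no linear independence of the frames, so exterior powers become
  instances through \<open>ext_bundle\<close>.\<close>

locale bundle_space =
  fixes A :: "('m::topological_space, 'n::finite) chart set"
    and E :: "('k::real_normed_field, 'm, 'v::ab_group_add, 'i) vbundle"
  assumes atlas: "complex_atlas A" and vs: "vector_space (scl E)"
    and fibre_subspace: "\<And>x. module.subspace (scl E) (fibre E x)"
    and open_frame: "\<And>V e. (V, e) \<in> frames E \<Longrightarrow> open V"
begin

sublocale V: vector_space "scl E" by (rule vs)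

lemma smooth_sectionI:
  assumes "\<And>x. x \<in> W \<Longrightarrow> s x \<in> fibre E x"
    and "\<And>V e. (V, e) \<in> frames E \<Longrightarrow> \<exists>f. (\<forall>\<alpha>\<in>idx E. smooth_map A (W \<inter> V) (f \<alpha>)) \<and>
        (\<forall>x\<in>W \<inter> V. s x = (\<Sum>\<alpha>\<in>idx E. scl E (f \<alpha> x) (e \<alpha> x)))"
  shows "smooth_section A E W s"
  unfolding smooth_section_def using assms by blast

lemma smooth_section_in_fibre: "smooth_section A E W s \<Longrightarrow> x \<in> W \<Longrightarrow> s x \<in> fibre E x"
  unfolding smooth_section_def by blast

lemma smooth_section_coeffs:
  assumes "smooth_section A E W s" "(V, e) \<in> frames E"
  obtains f where "\<And>\<alpha>. \<alpha> \<in> idx E \<Longrightarrow> smooth_map A (W \<inter> V) (f \<alpha> :: 'm \<Rightarrow> 'k)"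
    "\<And>x. x \<in> W \<inter> V \<Longrightarrow> s x = (\<Sum>\<alpha>\<in>idx E. scl E (f \<alpha> x) (e \<alpha> x))"
proof -
  have "\<forall>(V, e)\<in>frames E. \<exists>f. (\<forall>\<alpha>\<in>idx E. smooth_map A (W \<inter> V) (f \<alpha> :: 'm \<Rightarrow> 'k)) \<and>
        (\<forall>x\<in>W \<inter> V. s x = (\<Sum>\<alpha>\<in>idx E. scl E (f \<alpha> x) (e \<alpha> x)))"
    using assms(1) unfolding smooth_section_def by blast
  from bspec[OF this assms(2), unfolded prod.case] that show thesis by blast
qed

lemma smooth_section_subset:
  assumes "smooth_section A E W s" "open W" "W' \<subseteq> W"
  shows "smooth_section A E W' s"
proof (rule smooth_sectionI)
  show "s x \<in> fibre E x" if "x \<in> W'" for x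
    using smooth_section_in_fibre[OF assms(1)] that assms(3) by blast
  fix V e assume V: "(V, e) \<in> frames E"
  then obtain f where f: "\<And>\<alpha>. \<alpha> \<in> idx E \<Longrightarrow> smooth_map A (W \<inter> V) (f \<alpha> :: 'm \<Rightarrow> 'k)"
    "\<And>x. x \<in> W \<inter> V \<Longrightarrow> s x = (\<Sum>\<alpha>\<in>idx E. scl E (f \<alpha> x) (e \<alpha> x))"
    using smooth_section_coeffs[OF assms(1)] by blast
  have "smooth_map A (W' \<inter> V) (f \<alpha>)" if "\<alpha> \<in> idx E" for \<alpha>
    using assms(3) by (intro smooth_map_subset[OF atlas _ f(1)[OF that]] open_Int assms(2) open_frame[OF V]) auto
  then show "\<exists>f. (\<forall>\<alpha>\<in>idx E. smooth_map A (W' \<inter> V) (f \<alpha> :: 'm \<Rightarrow> 'k)) \<and>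
        (\<forall>x\<in>W' \<inter> V. s x = (\<Sum>\<alpha>\<in>idx E. scl E (f \<alpha> x) (e \<alpha> x)))"
    using f(2) assms(3) by (intro exI[of _ f]) auto
qed

lemma smooth_section_add:
  assumes "open W" "smooth_section A E W s" "smooth_section A E W t"
  shows "smooth_section A E W (\<lambda>x. s x + t x)"
proof (rule smooth_sectionI)
  show "s x + t x \<in> fibre E x" if "x \<in> W" for x
    using assms(2,3)[THEN smooth_section_in_fibre, OF that] V.subspace_add[OF fibre_subspace] by blast
  fix V e assume V: "(V, e) \<in> frames E"
  obtain f where f: "\<And>\<alpha>. \<alpha> \<in> idx E \<Longrightarrow> smooth_map A (W \<inter> V) (f \<alpha> :: 'm \<Rightarrow> 'k)"
    "\<And>x. x \<in> W \<inter> V \<Longrightarrow> s x = (\<Sum>\<alpha>\<in>idx E. scl E (f \<alpha> x) (e \<alpha> x))"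
    using smooth_section_coeffs[OF assms(2) V] by blast
  obtain f' where f': "\<And>\<alpha>. \<alpha> \<in> idx E \<Longrightarrow> smooth_map A (W \<inter> V) (f' \<alpha> :: 'm \<Rightarrow> 'k)"
    "\<And>x. x \<in> W \<inter> V \<Longrightarrow> t x = (\<Sum>\<alpha>\<in>idx E. scl E (f' \<alpha> x) (e \<alpha> x))"
    using smooth_section_coeffs[OF assms(3) V] by blast
  have "smooth_map A (W \<inter> V) (\<lambda>x. f \<alpha> x + f' \<alpha> x)" if "\<alpha> \<in> idx E" for \<alpha>
    by (intro smooth_map_add atlas f f' that open_Int assms(1) open_frame[OF V])
  then show "\<exists>f. (\<forall>\<alpha>\<in>idx E. smooth_map A (W \<inter> V) (f \<alpha> :: 'm \<Rightarrow> 'k)) \<and>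
        (\<forall>x\<in>W \<inter> V. s x + t x = (\<Sum>\<alpha>\<in>idx E. scl E (f \<alpha> x) (e \<alpha> x)))"
    using f(2) f'(2) by (intro exI[of _ "\<lambda>\<alpha> x. f \<alpha> x + f' \<alpha> x"]) (auto simp: V.scale_left_distrib sum.distrib)
qed

lemma smooth_section_scale:
  assumes "open W" "smooth_map A W g" "smooth_section A E W s"
  shows "smooth_section A E W (\<lambda>x. scl E (g x) (s x))"
proof (rule smooth_sectionI)
  show "scl E (g x) (s x) \<in> fibre E x" if "x \<in> W" for x
    using smooth_section_in_fibre[OF assms(3) that] V.subspace_scale[OF fibre_subspace] by blast
  fix V e assume V: "(V, e) \<in> frames E"
  obtain f where f: "\<And>\<alpha>. \<alpha> \<in> idx E \<Longrightarrow> smooth_map A (W \<inter> V) (f \<alpha> :: 'm \<Rightarrow> 'k)"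
    "\<And>x. x \<in> W \<inter> V \<Longrightarrow> s x = (\<Sum>\<alpha>\<in>idx E. scl E (f \<alpha> x) (e \<alpha> x))"
    using smooth_section_coeffs[OF assms(3) V] by blast
  have g: "smooth_map A (W \<inter> V) g" by (rule smooth_map_subset[OF atlas assms(1,2)]) auto
  have "smooth_map A (W \<inter> V) (\<lambda>x. g x * f \<alpha> x)" if "\<alpha> \<in> idx E" for \<alpha>
    by (intro smooth_map_mult atlas f g that open_Int assms(1) open_frame[OF V])
  then show "\<exists>f. (\<forall>\<alpha>\<in>idx E. smooth_map A (W \<inter> V) (f \<alpha> :: 'm \<Rightarrow> 'k)) \<and>
        (\<forall>x\<in>W \<inter> V. scl E (g x) (s x) = (\<Sum>\<alpha>\<in>idx E. scl E (f \<alpha> x) (e \<alpha> x)))"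
    using f(2) by (intro exI[of _ "\<lambda>\<alpha> x. g x * f \<alpha> x"]) (auto simp: V.scale_sum_right)
qed

lemma smooth_section_zero: "smooth_section A E W (\<lambda>x. 0)"
  by (rule smooth_sectionI)
    (auto intro!: V.subspace_0 fibre_subspace exI[of _ "\<lambda>\<alpha> x. 0"])

lemma smooth_section_sum:
  assumes "open W" "\<And>i. i \<in> I \<Longrightarrow> smooth_section A E W (s i)"
  shows "smooth_section A E W (\<lambda>x. \<Sum>i\<in>I. s i x)"
  using assms(2)
proof (induction I rule: infinite_finite_induct)
  case (insert i I)
  then have "smooth_section A E W (\<lambda>x. s i x + (\<Sum>i\<in>I. s i x))"
    by (intro smooth_section_add assms(1)) auto
  with insert show ?case by simp
qed (simp_all add: smooth_section_zero)

context
  fixes D :: "('m, 'n, 'v) conn"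
  assumes D: "connection A E D"
begin

lemma conn_smooth:
  assumes "open W" "smooth_section A E W s" "c \<in> A"
  shows "smooth_section A E (W \<inter> fst c) (\<lambda>x. D s c x v)"
  by (rule D[unfolded connection_def, rule_format, OF conjI[OF assms(1,2)], THEN conjunct1, rule_format, OF assms(3)])

lemma
  assumes "open W" "smooth_section A E W s" "c \<in> A" "x \<in> W" "x \<in> fst c"
  shows conn_vec_add: "D s c x (v + w) = D s c x v + D s c x w"
    and conn_vec_scale: "D s c x (r *\<^sub>R v) = scl E (of_real r) (D s c x v)"
  using D[unfolded connection_def, rule_format, OF conjI[OF assms(1,2)], THEN conjunct2, THEN conjunct1, rule_format, OF assms(3) IntI[OF assms(4,5)]]
  by blast+

lemma
  assumes "open W" "smooth_section A E W s" "smooth_section A E W t" "c \<in> A" "x \<in> W" "x \<in> fst c"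
  shows conn_cong: "(\<And>y. y \<in> W \<Longrightarrow> s y = t y) \<Longrightarrow> D s c x v = D t c x v"
    and conn_add: "D (\<lambda>y. s y + t y) c x v = D s c x v + D t c x v"
  using D[unfolded connection_def, rule_format, OF conjI[OF assms(1,2)], THEN conjunct2, THEN conjunct2, THEN conjunct2, THEN conjunct1, rule_format, OF assms(3,4) IntI[OF assms(5,6)]]
  by blast+

lemma conn_scale:
  assumes "open W" "smooth_section A E W s" "smooth_map A W f" "c \<in> A" "x \<in> W" "x \<in> fst c"
  shows "D (\<lambda>y. scl E (f y) (s y)) c x v = scl E (dfun f c x v) (s x) + scl E (f x) (D s c x v)"
  by (rule D[unfolded connection_def, rule_format, OF conjI[OF assms(1,2)], THEN conjunct2, THEN conjunct2, THEN conjunct2, THEN conjunct2, rule_format, OF assms(3,4) IntI[OF assms(5,6)]])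

lemma conn_zero:
  assumes "c \<in> A" "x \<in> fst c"
  shows "D (\<lambda>y. 0) c x v = 0"
  using conn_add[OF open_UNIV smooth_section_zero smooth_section_zero assms(1) UNIV_I assms(2), of v] by simp

lemma conn_sum:
  assumes "open W" "\<And>i. i \<in> I \<Longrightarrow> smooth_section A E W (s i)" "c \<in> A" "x \<in> W" "x \<in> fst c"
  shows "D (\<lambda>y. \<Sum>i\<in>I. s i y) c x v = (\<Sum>i\<in>I. D (s i) c x v)"
  using assms(2)
proof (induction I rule: infinite_finite_induct)
  case (insert i I)
  then have "D (\<lambda>y. s i y + (\<Sum>i\<in>I. s i y)) c x v = D (s i) c x v + D (\<lambda>y. \<Sum>i\<in>I. s i y) c x v"
    by (intro conn_add[OF assms(1)] smooth_section_sum assms(1,3,4,5)) auto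
  with insert show ?case by simp
qed (use assms in \<open>auto intro: conn_zero\<close>)

lemma conn_linear_combination:
  assumes "open W" "\<And>i. i \<in> I \<Longrightarrow> smooth_map A W (f i)" "\<And>i. i \<in> I \<Longrightarrow> smooth_section A E W (s i)"
    "c \<in> A" "x \<in> W" "x \<in> fst c"
  shows "D (\<lambda>y. \<Sum>i\<in>I. scl E (f i y) (s i y)) c x v
    = (\<Sum>i\<in>I. scl E (dfun (f i) c x v) (s i x) + scl E (f i x) (D (s i) c x v))"
proof -
  have "D (\<lambda>y. \<Sum>i\<in>I. scl E (f i y) (s i y)) c x v = (\<Sum>i\<in>I. D (\<lambda>y. scl E (f i y) (s i y)) c x v)"
    by (intro conn_sum[OF assms(1)] smooth_section_scale assms)
  also have "\<dots> = (\<Sum>i\<in>I. scl E (dfun (f i) c x v) (s i x) + scl E (f i x) (D (s i) c x v))"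
    by (intro sum.cong refl conn_scale[where W=W] assms)
  finally show ?thesis .
qed

end

end

locale smooth_bundle =
  fixes A :: "('m::topological_space, 'n::finite) chart set"
    and E :: "('k::real_normed_field, 'm, 'v::ab_group_add, 'i) vbundle"
  assumes complex_atlas: "complex_atlas A" and is_bundle: "vector_bundle A E"
begin

lemma frame_props:
  assumes "(V, e) \<in> frames E"
  shows "open V" "x \<in> V \<Longrightarrow> inj_on (\<lambda>\<alpha>. e \<alpha> x) (idx E)"
    "x \<in> V \<Longrightarrow> \<not> module.dependent (scl E) ((\<lambda>\<alpha>. e \<alpha> x) ` idx E)"
    "x \<in> V \<Longrightarrow> module.span (scl E) ((\<lambda>\<alpha>. e \<alpha> x) ` idx E) = fibre E x"
  using is_bundle assms unfolding vector_bundle_def by (auto 0 3)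

sublocale bundle_space A E
proof
  show "complex_atlas A" by (rule complex_atlas)
  have "vector_space (scl E)" by (rule is_bundle[unfolded vector_bundle_def, THEN conjunct1])
  then show "\<And>a x y. scl E a (x + y) = scl E a x + scl E a y"
    "\<And>a b x. scl E (a + b) x = scl E a x + scl E b x"
    "\<And>a b x. scl E a (scl E b x) = scl E (a * b) x" "\<And>x. scl E 1 x = x"
    by (simp_all add: vector_space_def)
  show "module.subspace (scl E) (fibre E x)" for x
    by (rule is_bundle[unfolded vector_bundle_def, THEN conjunct2, THEN conjunct2, THEN conjunct1, THEN spec])
  show "(V, e) \<in> frames E \<Longrightarrow> open V" for V e by (rule frame_props)
qed

lemma finite_idx: "finite (idx E)"
  by (rule is_bundle[unfolded vector_bundle_def, THEN conjunct2, THEN conjunct1])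

lemma ex_frame: obtains V e where "(V, e) \<in> frames E" "x \<in> V"
proof -
  have "x \<in> (\<Union>(V, e)\<in>frames E. V)" using is_bundle[unfolded vector_bundle_def, THEN conjunct2, THEN conjunct2, THEN conjunct2, THEN conjunct1] by simp
  then show thesis using that by auto
qed

lemma frame_transition:
  assumes "(V, e) \<in> frames E" "(V', e') \<in> frames E"
  obtains t where "\<And>\<alpha> \<beta>. \<alpha> \<in> idx E \<Longrightarrow> \<beta> \<in> idx E \<Longrightarrow> smooth_map A (V \<inter> V') (t \<alpha> \<beta> :: 'm \<Rightarrow> 'k)"
    "\<And>x \<alpha>. x \<in> V \<inter> V' \<Longrightarrow> \<alpha> \<in> idx E \<Longrightarrow> e' \<alpha> x = (\<Sum>\<beta>\<in>idx E. scl E (t \<alpha> \<beta> x) (e \<beta> x))"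
proof -
  have "\<forall>(V, e)\<in>frames E. \<forall>(V', e')\<in>frames E. \<exists>t.
        (\<forall>\<alpha>\<in>idx E. \<forall>\<beta>\<in>idx E. smooth_map A (V \<inter> V') (t \<alpha> \<beta> :: 'm \<Rightarrow> 'k)) \<and>
        (\<forall>x\<in>V \<inter> V'. \<forall>\<alpha>\<in>idx E. e' \<alpha> x = (\<Sum>\<beta>\<in>idx E. scl E (t \<alpha> \<beta> x) (e \<beta> x)))"
    by (rule is_bundle[unfolded vector_bundle_def, THEN conjunct2, THEN conjunct2, THEN conjunct2, THEN conjunct2, THEN conjunct2])
  from bspec[OF bspec[OF this assms(1), unfolded prod.case] assms(2), unfolded prod.case] that
  show thesis by blast
qed

lemma frame_in_fibre:
  assumes "(V, e) \<in> frames E" "x \<in> V" "\<alpha> \<in> idx E"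
  shows "e \<alpha> x \<in> fibre E x"
  using V.span_base[of "e \<alpha> x" "(\<lambda>\<alpha>. e \<alpha> x) ` idx E"] frame_props(4)[OF assms(1,2)] assms(3) by auto

lemma frame_smooth:
  assumes "(V, e) \<in> frames E" "\<alpha> \<in> idx E"
  shows "smooth_section A E V (e \<alpha>)"
proof (rule smooth_sectionI)
  show "e \<alpha> x \<in> fibre E x" if "x \<in> V" for x using frame_in_fibre assms that by blast
  fix V' e' assume V': "(V', e') \<in> frames E"
  obtain t where t: "\<And>\<alpha> \<beta>. \<alpha> \<in> idx E \<Longrightarrow> \<beta> \<in> idx E \<Longrightarrow> smooth_map A (V' \<inter> V) (t \<alpha> \<beta> :: 'm \<Rightarrow> 'k)"
    "\<And>x \<alpha>. x \<in> V' \<inter> V \<Longrightarrow> \<alpha> \<in> idx E \<Longrightarrow> e \<alpha> x = (\<Sum>\<beta>\<in>idx E. scl E (t \<alpha> \<beta> x) (e' \<beta> x))"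
    using frame_transition[OF V' assms(1)] by blast
  then show "\<exists>f. (\<forall>\<beta>\<in>idx E. smooth_map A (V \<inter> V') (f \<beta> :: 'm \<Rightarrow> 'k)) \<and>
        (\<forall>x\<in>V \<inter> V'. e \<alpha> x = (\<Sum>\<beta>\<in>idx E. scl E (f \<beta> x) (e' \<beta> x)))"
    using assms(2) by (intro exI[of _ "t \<alpha>"]) (auto simp: Int_commute)
qed

lemma frame_coeff_sum:
  assumes V: "(V, e) \<in> frames E" and x: "x \<in> V" and \<beta>: "\<beta> \<in> idx E"
  shows "frame_coeff E e x (\<Sum>\<alpha>\<in>idx E. scl E (f \<alpha>) (e \<alpha> x)) \<beta> = f \<beta>"
proof -
  let ?B = "(\<lambda>\<alpha>. e \<alpha> x) ` idx E"
  have ind: "V.independent ?B" and inj: "inj_on (\<lambda>\<alpha>. e \<alpha> x) (idx E)"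
    using frame_props(2,3)[OF V x] by auto
  have "V.representation ?B (\<Sum>\<alpha>\<in>idx E. scl E (f \<alpha>) (e \<alpha> x)) (e \<beta> x)
      = (\<Sum>\<alpha>\<in>idx E. f \<alpha> * V.representation ?B (e \<alpha> x) (e \<beta> x))"
    using ind by (simp add: V.representation_sum V.representation_scale V.span_base V.span_scale)
  also have "\<dots> = (\<Sum>\<alpha>\<in>idx E. if \<alpha> = \<beta> then f \<alpha> else 0)"
  proof (intro sum.cong refl)
    fix \<alpha> assume \<alpha>: "\<alpha> \<in> idx E"
    then have "V.representation ?B (e \<alpha> x) (e \<beta> x) = (if e \<beta> x = e \<alpha> x then 1 else 0)"
      using ind by (simp add: V.representation_basis)
    then show "f \<alpha> * V.representation ?B (e \<alpha> x) (e \<beta> x) = (if \<alpha> = \<beta> then f \<alpha> else 0)"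
      using inj_on_eq_iff[OF inj \<beta> \<alpha>] by auto
  qed
  finally show ?thesis using \<beta> finite_idx by (simp add: frame_coeff_def)
qed

lemma frame_coeff_expansion:
  assumes V: "(V, e) \<in> frames E" and x: "x \<in> V" and u: "u \<in> fibre E x"
  shows "u = (\<Sum>\<alpha>\<in>idx E. scl E (frame_coeff E e x u \<alpha>) (e \<alpha> x))"
proof -
  let ?B = "(\<lambda>\<alpha>. e \<alpha> x) ` idx E"
  have ind: "V.independent ?B" and inj: "inj_on (\<lambda>\<alpha>. e \<alpha> x) (idx E)"
    using frame_props(2,3)[OF V x] by auto
  have "(\<Sum>b\<in>?B. scl E (V.representation ?B u b) b) = u"
    using ind u frame_props(4)[OF V x] finite_idx by (intro V.sum_representation_eq) auto
  then show ?thesis using inj by (simp add: sum.reindex frame_coeff_def)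
qed

lemma frame_coeff_unique:
  assumes "(V, e) \<in> frames E" "x \<in> V" "u = (\<Sum>\<alpha>\<in>idx E. scl E (f \<alpha>) (e \<alpha> x))" "\<beta> \<in> idx E"
  shows "frame_coeff E e x u \<beta> = f \<beta>"
  using frame_coeff_sum[OF assms(1,2,4)] assms(3) by simp

lemma frame_coeff_frame:
  assumes "(V, e) \<in> frames E" "x \<in> V" "\<alpha> \<in> idx E" "\<beta> \<in> idx E"
  shows "frame_coeff E e x (e \<alpha> x) \<beta> = kron \<alpha> \<beta>"
proof (rule frame_coeff_unique[OF assms(1,2) _ assms(4)])
  have "(\<Sum>\<gamma>\<in>idx E. scl E (kron \<alpha> \<gamma>) (e \<gamma> x)) = (\<Sum>\<gamma>\<in>idx E. if \<gamma> = \<alpha> then e \<gamma> x else 0)"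
    by (intro sum.cong) (auto simp: kron_def)
  then show "e \<alpha> x = (\<Sum>\<gamma>\<in>idx E. scl E (kron \<alpha> \<gamma>) (e \<gamma> x))"
    using assms(3) finite_idx by simp
qed

lemma frame_coeff_smooth:
  assumes "open W" "smooth_section A E W s" "(V, e) \<in> frames E" "\<alpha> \<in> idx E"
  shows "smooth_map A (W \<inter> V) (\<lambda>x. frame_coeff E e x (s x) \<alpha>)"
proof -
  obtain f where f: "\<And>\<alpha>. \<alpha> \<in> idx E \<Longrightarrow> smooth_map A (W \<inter> V) (f \<alpha> :: 'm \<Rightarrow> 'k)"
    "\<And>x. x \<in> W \<inter> V \<Longrightarrow> s x = (\<Sum>\<alpha>\<in>idx E. scl E (f \<alpha> x) (e \<alpha> x))"
    using smooth_section_coeffs[OF assms(2,3)] by blast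
  have "frame_coeff E e x (s x) \<alpha> = f \<alpha> x" if "x \<in> W \<inter> V" for x
    using that f(2) assms by (intro frame_coeff_unique[OF assms(3)]) auto
  then show ?thesis
    using smooth_map_cong[OF atlas open_Int[OF assms(1) frame_props(1)[OF assms(3)]], of "\<lambda>x. frame_coeff E e x (s x) \<alpha>" "f \<alpha>"]
      f(1)[OF assms(4)] by blast
qed

context
  fixes D :: "('m, 'n, 'v) conn"
  assumes D: "connection A E D"
begin

definition conn_coeff :: "('i \<Rightarrow> 'm \<Rightarrow> 'v) \<Rightarrow> ('m, 'n) chart \<Rightarrow> complex ^ 'n \<Rightarrow> 'i \<Rightarrow> 'i \<Rightarrow> 'm \<Rightarrow> 'k" where
  "conn_coeff e c v \<alpha> \<beta> x = frame_coeff E e x (D (e \<alpha>) c x v) \<beta>"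

lemma conn_coeff_smooth:
  assumes "(V, e) \<in> frames E" "c \<in> A" "\<alpha> \<in> idx E" "\<beta> \<in> idx E"
  shows "smooth_map A (V \<inter> fst c) (conn_coeff e c v \<alpha> \<beta>)"
proof -
  have "open (V \<inter> fst c)"
    by (intro open_Int frame_props(1)[OF assms(1)] open_chart_dom[OF atlas assms(2)])
  from frame_coeff_smooth[OF this conn_smooth[OF D frame_props(1)[OF assms(1)] frame_smooth[OF assms(1,3)] assms(2)] assms(1,4)]
  have "smooth_map A (V \<inter> fst c \<inter> V) (\<lambda>x. frame_coeff E e x (D (e \<alpha>) c x v) \<beta>)" .
  moreover have "V \<inter> fst c \<inter> V = V \<inter> fst c" by blast
  ultimately show ?thesis by (simp add: conn_coeff_def[abs_def])
qed

lemma conn_in_fibre: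
  assumes "open W" "smooth_section A E W s" "c \<in> A" "x \<in> W" "x \<in> fst c"
  shows "D s c x v \<in> fibre E x"
  using smooth_section_in_fibre[OF conn_smooth[OF D assms(1,2,3)]] assms(4,5) by blast

lemma conn_frame:
  assumes "(V, e) \<in> frames E" "c \<in> A" "\<alpha> \<in> idx E" "x \<in> V" "x \<in> fst c"
  shows "D (e \<alpha>) c x v = (\<Sum>\<beta>\<in>idx E. scl E (conn_coeff e c v \<alpha> \<beta> x) (e \<beta> x))"
  unfolding conn_coeff_def
  by (rule frame_coeff_expansion[OF assms(1,4) conn_in_fibre[OF frame_props(1)[OF assms(1)]
          frame_smooth[OF assms(1,3)] assms(2,4,5)]])

lemma conn_section:
  assumes V: "(V, e) \<in> frames E" and W: "open W" and s: "smooth_section A E W s"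
    and c: "c \<in> A" and x: "x \<in> W" "x \<in> V" "x \<in> fst c" and \<beta>: "\<beta> \<in> idx E"
  shows "frame_coeff E e x (D s c x v) \<beta> = dfun (\<lambda>y. frame_coeff E e y (s y) \<beta>) c x v
     + (\<Sum>\<alpha>\<in>idx E. frame_coeff E e x (s x) \<alpha> * conn_coeff e c v \<alpha> \<beta> x)"
proof -
  let ?f = "\<lambda>\<alpha> y. frame_coeff E e y (s y) \<alpha>"
  have open_WV: "open (W \<inter> V)" by (intro open_Int W frame_props(1)[OF V])
  have s': "smooth_section A E (W \<inter> V) s" by (rule smooth_section_subset[OF s W]) auto
  have f: "smooth_map A (W \<inter> V) (?f \<alpha>)" if "\<alpha> \<in> idx E" for \<alpha>
    by (rule frame_coeff_smooth[OF W s V that])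
  have e: "smooth_section A E (W \<inter> V) (e \<alpha>)" if "\<alpha> \<in> idx E" for \<alpha>
    by (rule smooth_section_subset[OF frame_smooth[OF V that] frame_props(1)[OF V]]) auto
  \<comment> \<open>Sections are total functions and the frame expansion holds on W \<inter> V only;
    locality of the connection permits the replacement.\<close>
  have "D s c x v = D (\<lambda>y. \<Sum>\<alpha>\<in>idx E. scl E (?f \<alpha> y) (e \<alpha> y)) c x v"
  proof (rule conn_cong[OF D open_WV s', rotated 4])
    show "smooth_section A E (W \<inter> V) (\<lambda>y. \<Sum>\<alpha>\<in>idx E. scl E (?f \<alpha> y) (e \<alpha> y))"
      by (intro smooth_section_sum smooth_section_scale open_WV f e)
    show "s y = (\<Sum>\<alpha>\<in>idx E. scl E (?f \<alpha> y) (e \<alpha> y))" if "y \<in> W \<inter> V" for y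
      using that smooth_section_in_fibre[OF s] by (intro frame_coeff_expansion[OF V]) auto
  qed (use x c in auto)
  also have "\<dots> = (\<Sum>\<alpha>\<in>idx E. scl E (dfun (?f \<alpha>) c x v) (e \<alpha> x) + scl E (?f \<alpha> x) (D (e \<alpha>) c x v))"
    using x by (intro conn_linear_combination[OF D open_WV] f e c) auto
  also have "\<dots> = (\<Sum>\<alpha>\<in>idx E. scl E (dfun (?f \<alpha>) c x v) (e \<alpha> x))
       + (\<Sum>\<alpha>\<in>idx E. \<Sum>\<beta>\<in>idx E. scl E (?f \<alpha> x * conn_coeff e c v \<alpha> \<beta> x) (e \<beta> x))"
    using conn_frame[OF V c _ x(2,3)] by (simp add: sum.distrib V.scale_sum_right)
  also have "(\<Sum>\<alpha>\<in>idx E. \<Sum>\<beta>\<in>idx E. scl E (?f \<alpha> x * conn_coeff e c v \<alpha> \<beta> x) (e \<beta> x))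
      = (\<Sum>\<beta>\<in>idx E. scl E (\<Sum>\<alpha>\<in>idx E. ?f \<alpha> x * conn_coeff e c v \<alpha> \<beta> x) (e \<beta> x))"
    by (subst sum.swap) (simp add: V.scale_sum_left)
  finally have "D s c x v = (\<Sum>\<beta>\<in>idx E. scl E (dfun (?f \<beta>) c x v
      + (\<Sum>\<alpha>\<in>idx E. ?f \<alpha> x * conn_coeff e c v \<alpha> \<beta> x)) (e \<beta> x))"
    by (simp add: V.scale_left_distrib sum.distrib)
  from frame_coeff_unique[OF V x(2) this \<beta>] show ?thesis .
qed

end

end

section \<open>The inverse of the metric on the manifold\<close>

text \<open>The indices are transposed as in \<open>ricci_comp\<close>. The inverse form at v is the
  form of H at the conjugate of y, where y solves H y = v; this gives its positivity.\<close>

lemma inverse_of_positive_hermitian: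
  fixes H :: "complex ^ 'n::finite ^ 'n"
  assumes herm: "\<And>i j. H $ j $ i = cnj (H $ i $ j)"
    and pos: "\<And>v. v \<noteq> 0 \<Longrightarrow> 0 < Re (sesq_form H v v)"
  shows "positive_definite (\<lambda>i j. matrix_inv H $ j $ i)" and "invertible H" and "det H \<noteq> 0"
proof -
  have ker: "y = 0" if "H *v y = 0" for y
  proof (rule ccontr)
    assume "y \<noteq> 0"
    \<comment> \<open>Matrix multiplication sums over the second index of H, which
      \<open>sesq_form\<close> pairs with a conjugated entry; hence y enters conjugated.\<close>
    let ?v = "\<chi> i. cnj (y $ i)"
    have "?v \<noteq> 0" using \<open>y \<noteq> 0\<close> by (auto simp: vec_eq_iff)
    have "sesq_form H ?v ?v = (\<Sum>i\<in>UNIV. cnj (y $ i) * (H *v y) $ i)"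
      unfolding sesq_form_def matrix_vector_mult_def by (simp add: sum_distrib_left mult_ac)
    then show False using pos[OF \<open>?v \<noteq> 0\<close>] that by simp
  qed
  then obtain B where "B ** H = mat 1" using matrix_left_invertible_ker by blast
  then have inv: "invertible H" using matrix_left_right_inverse unfolding invertible_def by blast
  then show "invertible H" "det H \<noteq> 0" by (simp_all add: invertible_det_nz[symmetric])
  let ?M = "matrix_inv H"
  have M: "H ** ?M = mat 1" "?M ** H = mat 1"
    using someI_ex[OF inv[unfolded invertible_def]] unfolding matrix_inv_def by blast+
  have MM: "?M $ i $ j = cnj (?M $ j $ i)" for i j
  proof -
    \<comment> \<open>The conjugate transpose of the inverse is another right inverse of the
      Hermitian matrix H and therefore coincides with it.\<close>
    let ?M' = "\<chi> i j. cnj (?M $ j $ i)"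
    have "(H ** ?M') $ i $ k = (mat 1 :: complex ^ 'n ^ 'n) $ i $ k" for i k
    proof -
      have "(H ** ?M') $ i $ k = (\<Sum>j\<in>UNIV. H $ i $ j * cnj (?M $ k $ j))"
        by (simp add: matrix_matrix_mult_def)
      also have "\<dots> = cnj ((?M ** H) $ k $ i)"
        unfolding matrix_matrix_mult_def
        by (simp, intro sum.cong refl, subst herm[of _ i]) simp
      finally show ?thesis by (simp add: M mat_def)
    qed
    then have "H ** ?M' = mat 1" by (simp add: vec_eq_iff)
    then have "?M' = ?M" by (metis M(2) matrix_mul_assoc matrix_mul_lid matrix_mul_rid)
    then show ?thesis by (metis (no_types, lifting) vec_lambda_beta)
  qed
  show "positive_definite (\<lambda>i j. ?M $ j $ i)"
    unfolding positive_definite_def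
  proof (intro conjI allI impI)
    show "?M $ i $ j = cnj (?M $ j $ i)" for i j by (rule MM)
    fix v :: "'n \<Rightarrow> complex" assume "\<exists>i. v i \<noteq> 0"
    let ?v = "\<chi> i. v i"
    define y where "y = ?M *v ?v"
    have Hy: "H *v y = ?v" unfolding y_def by (simp add: matrix_vector_mul_assoc M)
    have "?v \<noteq> 0" using \<open>\<exists>i. v i \<noteq> 0\<close> by (auto simp: vec_eq_iff)
    then have "y \<noteq> 0" using Hy by (metis matrix_vector_mult_0_right)
    then have ne: "(\<chi> i. cnj (y $ i)) \<noteq> 0" unfolding vec_eq_iff by simp
    have "(\<Sum>i\<in>UNIV. \<Sum>j\<in>UNIV. ?M $ j $ i * v i * cnj (v j)) = (\<Sum>j\<in>UNIV. y $ j * cnj (?v $ j))"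
      unfolding y_def by (subst sum.swap) (simp add: matrix_vector_mult_def sum_distrib_right)
    also have "\<dots> = (\<Sum>j\<in>UNIV. \<Sum>k\<in>UNIV. H $ k $ j * cnj (y $ k) * y $ j)"
      unfolding Hy[symmetric]
      by (simp add: matrix_vector_mult_def[of H] sum_distrib_left mult_ac flip: herm)
    also have "\<dots> = sesq_form H (\<chi> i. cnj (y $ i)) (\<chi> i. cnj (y $ i))"
      unfolding sesq_form_def by (subst sum.swap) simp
    finally show "0 < Re (\<Sum>i\<in>UNIV. \<Sum>j\<in>UNIV. ?M $ j $ i * v i * cnj (v j))" using pos[OF ne] by simp
  qed
qed

text \<open>Entries of the inverse as quotients of determinants, which are polynomial in the entries
  of H; continuity of the inverse metric follows from this.\<close>

lemma matrix_inv_cramer: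
  fixes H :: "complex ^ 'n::finite ^ 'n"
  assumes "invertible H" "det H \<noteq> 0"
  shows "matrix_inv H $ k $ j = det (\<chi> i l. if l = k then axis j 1 $ i else H $ i $ l) / det H"
proof -
  have M: "H ** matrix_inv H = mat 1"
    using someI_ex[OF assms(1)[unfolded invertible_def]] unfolding matrix_inv_def by blast
  have "H *v (matrix_inv H *v axis j 1) = axis j 1"
    by (simp add: matrix_vector_mul_assoc M)
  then have "matrix_inv H *v axis j 1 = (\<chi> k. det (\<chi> i l. if l = k then axis j 1 $ i else H $ i $ l) / det H)"
    using cramer[OF assms(2)] by blast
  moreover have "(matrix_inv H *v axis j 1) $ k = matrix_inv H $ k $ j"
    by (simp add: matrix_vector_mult_def axis_def if_distrib[of "\<lambda>x. _ * x"] cong: if_cong)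
  ultimately show ?thesis by simp
qed

lemma continuous_on_det_complex:
  fixes H :: "'a::topological_space \<Rightarrow> complex ^ 'n::finite ^ 'n"
  assumes "\<And>i j. continuous_on S (\<lambda>x. H x $ i $ j)"
  shows "continuous_on S (\<lambda>x. det (H x))"
  unfolding det_def by (intro continuous_intros assms)

lemma continuous_on_matrix_inv:
  fixes H :: "'a::topological_space \<Rightarrow> complex ^ 'n::finite ^ 'n"
  assumes H: "\<And>i j. continuous_on S (\<lambda>x. H x $ i $ j)"
    and inv: "\<And>x. x \<in> S \<Longrightarrow> invertible (H x)" "\<And>x. x \<in> S \<Longrightarrow> det (H x) \<noteq> 0"
  shows "continuous_on S (\<lambda>x. matrix_inv (H x) $ k $ j)"
proof -
  have "continuous_on S (\<lambda>x. (\<chi> i l. if l = k then axis j 1 $ i else H x $ i $ l) $ i $ l :: complex)" for i l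
    by (cases "l = k") (simp_all add: H)
  then have "continuous_on S (\<lambda>x. det (\<chi> i l. if l = k then axis j 1 $ i else H x $ i $ l) / det (H x))"
    by (intro continuous_on_divide continuous_on_det_complex H) (use inv(2) in auto)
  then show ?thesis
    by (rule continuous_on_eq) (simp add: matrix_inv_cramer inv)
qed

section \<open>Hermitian bundles: connection and curvature in a frame and a chart\<close>

locale metric_bundle =
  fixes A :: "('m::topological_space, 'n::finite) chart set"
    and h :: "('m, 'n) chart \<Rightarrow> 'm \<Rightarrow> complex ^ 'n ^ 'n"
    and E :: "(complex, 'm, 'v::ab_group_add, 'i) vbundle"
    and g :: "'m \<Rightarrow> 'v \<Rightarrow> 'v \<Rightarrow> complex"
    and D :: "('m, 'n, 'v) conn"
  assumes is_atlas: "complex_atlas A" and h: "hermitian_metric A h"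
    and herm_bundle: "hermitian_bundle A E g" and metric_conn: "metric_connection A E g D"
begin

sublocale smooth_bundle A E
  by unfold_locales (use is_atlas herm_bundle in \<open>simp_all add: hermitian_bundle_def\<close>)

lemma D: "connection A E D"
  using metric_conn by (simp add: metric_connection_def)

lemma g_axioms:
  assumes "u \<in> fibre E x" "v \<in> fibre E x" "w \<in> fibre E x"
  shows g_add: "g x (u + v) w = g x u w + g x v w"
    and g_scale: "g x (scl E a u) w = a * g x u w"
    and g_herm: "g x w u = cnj (g x u w)"
proof -
  have "fibre_metric cnj A E g" using herm_bundle by (simp add: hermitian_bundle_def)
  from this[unfolded fibre_metric_def, THEN conjunct1, rule_format, OF assms, of a]
  show "g x (u + v) w = g x u w + g x v w" "g x (scl E a u) w = a * g x u w" "g x w u = cnj (g x u w)"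
    by blast+
qed

lemma g_frame_smooth:
  assumes "(V, e) \<in> frames E" "\<alpha> \<in> idx E" "\<beta> \<in> idx E"
  shows "smooth_map A V (\<lambda>x. g x (e \<alpha> x) (e \<beta> x))"
proof -
  have "fibre_metric cnj A E g" using herm_bundle by (simp add: hermitian_bundle_def)
  from bspec[OF this[unfolded fibre_metric_def, THEN conjunct2, THEN conjunct2] assms(1), unfolded prod.case,
      rule_format, OF assms(2,3)]
  show ?thesis .
qed

lemma g_zero:
  assumes "w \<in> fibre E x" shows "g x 0 w = 0"
  using g_scale[OF assms assms assms, of 0] by simp

lemma sum_in_fibre:
  assumes "\<And>k. k \<in> I \<Longrightarrow> u k \<in> fibre E x"
  shows "(\<Sum>k\<in>I. scl E (a k) (u k)) \<in> fibre E x"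
  by (intro V.subspace_sum[OF fibre_subspace] V.subspace_scale[OF fibre_subspace] assms)

lemma g_sum_left:
  assumes "\<And>k. k \<in> I \<Longrightarrow> u k \<in> fibre E x" "w \<in> fibre E x"
  shows "g x (\<Sum>k\<in>I. scl E (a k) (u k)) w = (\<Sum>k\<in>I. a k * g x (u k) w)"
  using assms(1)
proof (induction I rule: infinite_finite_induct)
  case (insert k I)
  have "(\<Sum>k\<in>I. scl E (a k) (u k)) \<in> fibre E x" "scl E (a k) (u k) \<in> fibre E x"
    using insert.prems V.subspace_scale[OF fibre_subspace] by (auto intro!: sum_in_fibre)
  then show ?case
    using insert assms(2) g_scale[of "u k" x "u k" w] by (simp add: g_add)
qed (simp_all add: g_zero assms)

lemma g_sum_right:
  assumes "\<And>k. k \<in> I \<Longrightarrow> u k \<in> fibre E x" "w \<in> fibre E x"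
  shows "g x w (\<Sum>k\<in>I. scl E (a k) (u k)) = (\<Sum>k\<in>I. cnj (a k) * g x w (u k))"
proof -
  have *: "g x w v = cnj (g x v w)" if "v \<in> fibre E x" for v
    using g_herm[OF that that assms(2)] .
  have "g x w (\<Sum>k\<in>I. scl E (a k) (u k)) = cnj (g x (\<Sum>k\<in>I. scl E (a k) (u k)) w)"
    by (rule *[OF sum_in_fibre]) (rule assms)
  also have "\<dots> = (\<Sum>k\<in>I. cnj (a k) * cnj (g x (u k) w))"
    by (simp add: g_sum_left[OF assms])
  also have "\<dots> = (\<Sum>k\<in>I. cnj (a k) * g x w (u k))"
    by (intro sum.cong refl) (simp add: * assms(1))
  finally show ?thesis .
qed

lemma frame_coeff_linear:
  assumes V: "(V, e) \<in> frames E" and x: "x \<in> V" and u: "\<And>k. k \<in> I \<Longrightarrow> u k \<in> fibre E x" and \<beta>: "\<beta> \<in> idx E"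
  shows "frame_coeff E e x (\<Sum>k\<in>I. scl E (a k) (u k)) \<beta> = (\<Sum>k\<in>I. a k * frame_coeff E e x (u k) \<beta>)"
proof (rule frame_coeff_unique[OF V x _ \<beta>])
  have "(\<Sum>k\<in>I. scl E (a k) (u k)) = (\<Sum>k\<in>I. \<Sum>\<alpha>\<in>idx E. scl E (a k * frame_coeff E e x (u k) \<alpha>) (e \<alpha> x))"
  proof (intro sum.cong refl)
    fix k assume "k \<in> I"
    from arg_cong[OF frame_coeff_expansion[OF V x u[OF this]], of "scl E (a k)"]
    show "scl E (a k) (u k) = (\<Sum>\<alpha>\<in>idx E. scl E (a k * frame_coeff E e x (u k) \<alpha>) (e \<alpha> x))"
      by (simp add: V.scale_sum_right)
  qed
  also have "\<dots> = (\<Sum>\<alpha>\<in>idx E. scl E (\<Sum>k\<in>I. a k * frame_coeff E e x (u k) \<alpha>) (e \<alpha> x))"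
    by (subst sum.swap) (simp add: V.scale_sum_left)
  finally show "(\<Sum>k\<in>I. scl E (a k) (u k)) = (\<Sum>\<alpha>\<in>idx E. scl E (\<Sum>k\<in>I. a k * frame_coeff E e x (u k) \<alpha>) (e \<alpha> x))" .
qed

lemma frame_coeff_linear2:
  assumes V: "(V, e) \<in> frames E" and x: "x \<in> V" and u: "u \<in> fibre E x" "w \<in> fibre E x" and \<beta>: "\<beta> \<in> idx E"
  shows "frame_coeff E e x (scl E a u + scl E b w) \<beta> = a * frame_coeff E e x u \<beta> + b * frame_coeff E e x w \<beta>"
  using frame_coeff_linear[OF V x, of "UNIV :: bool set" "\<lambda>k. if k then u else w" \<beta> "\<lambda>k. if k then a else b"] u \<beta>
  by (simp add: UNIV_bool add.commute)

definition gram :: "('i \<Rightarrow> 'm \<Rightarrow> 'v) \<Rightarrow> 'i \<Rightarrow> 'i \<Rightarrow> 'm \<Rightarrow> complex" where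
  "gram e \<alpha> \<beta> x = g x (e \<alpha> x) (e \<beta> x)"

text \<open>With \<open>coeffN\<close>, the coefficients P and N of \<open>local_connection\<close>:
  the connection matrices in the two Wirtinger directions.\<close>

definition coeffP :: "('m, 'n) chart \<Rightarrow> ('i \<Rightarrow> 'm \<Rightarrow> 'v) \<Rightarrow> 'n \<Rightarrow> 'i \<Rightarrow> 'i \<Rightarrow> 'm \<Rightarrow> complex" where
  "coeffP c e i \<alpha> \<beta> x = (conn_coeff D e c (axis i 1) \<alpha> \<beta> x - \<i> * conn_coeff D e c (axis i \<i>) \<alpha> \<beta> x) / 2"

definition coeffN :: "('m, 'n) chart \<Rightarrow> ('i \<Rightarrow> 'm \<Rightarrow> 'v) \<Rightarrow> 'n \<Rightarrow> 'i \<Rightarrow> 'i \<Rightarrow> 'm \<Rightarrow> complex" where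
  "coeffN c e i \<alpha> \<beta> x = (conn_coeff D e c (axis i 1) \<alpha> \<beta> x + \<i> * conn_coeff D e c (axis i \<i>) \<alpha> \<beta> x) / 2"

abbreviation locG where "locG c e \<alpha> \<beta> \<equiv> gram e \<alpha> \<beta> \<circ> chart_inv c"
abbreviation locP where "locP c e i \<alpha> \<beta> \<equiv> coeffP c e i \<alpha> \<beta> \<circ> chart_inv c"
abbreviation locN where "locN c e i \<alpha> \<beta> \<equiv> coeffN c e i \<alpha> \<beta> \<circ> chart_inv c"

lemma dfun_gram:
  assumes V: "(V, e) \<in> frames E" and c: "c \<in> A" and x: "x \<in> V" "x \<in> fst c" and ab: "\<alpha> \<in> idx E" "\<beta> \<in> idx E"
  shows "dfun (gram e \<alpha> \<beta>) c x v = (\<Sum>\<gamma>\<in>idx E. conn_coeff D e c v \<alpha> \<gamma> x * gram e \<gamma> \<beta> x)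
     + (\<Sum>\<gamma>\<in>idx E. cnj (conn_coeff D e c v \<beta> \<gamma> x) * gram e \<alpha> \<gamma> x)"
proof -
  have "dfun (\<lambda>y. g y (e \<alpha> y) (e \<beta> y)) c x v = g x (D (e \<alpha>) c x v) (e \<beta> x) + g x (e \<alpha> x) (D (e \<beta>) c x v)"
    using metric_conn[unfolded metric_connection_def, THEN conjunct2, rule_format, OF conjI[OF frame_props(1)[OF V]
        conjI[OF frame_smooth[OF V ab(1)] frame_smooth[OF V ab(2)]]] c IntI[OF x]] .
  then show ?thesis
    unfolding conn_frame[OF D V c ab(1) x] conn_frame[OF D V c ab(2) x] gram_def[abs_def]
    by (simp add: g_sum_left g_sum_right frame_in_fibre[OF V x(1)] ab)
qed

text \<open>Metric compatibility along the two real coordinate directions combines to the Wirtinger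
  form: conjugating \<open>coeffN\<close> turns its plus sign into the minus sign of
  \<open>dz\<close>.\<close>

lemma local_conn:
  assumes V: "(V, e) \<in> frames E" and c: "c \<in> A"
  shows "local_connection (snd c ` (V \<inter> fst c)) (idx E) (locG c e) (locP c e) (locN c e)"
proof
  note oV = frame_props(1)[OF V]
  have oVc: "open (V \<inter> fst c)" by (intro open_Int oV open_chart_dom[OF atlas c])
  show "open (snd c ` (V \<inter> fst c))" by (rule open_chart_image[OF atlas c oV])
  show "finite (idx E)" by (rule finite_idx)
  fix \<alpha> \<beta> assume ab: "\<alpha> \<in> idx E" "\<beta> \<in> idx E"
  have "smooth_map A V (gram e \<alpha> \<beta>)"
    using g_frame_smooth[OF V ab] by (simp add: gram_def[abs_def])
  then have sG: "smooth_on (snd c ` (V \<inter> fst c)) (locG c e \<alpha> \<beta>)"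
    using c unfolding smooth_map_def by blast
  then show "twice_differentiable_on (snd c ` (V \<inter> fst c)) (locG c e \<alpha> \<beta>)"
    by (rule smooth_on_twice_differentiable)
  have sm: "smooth_map A (V \<inter> fst c) (\<lambda>x. (conn_coeff D e c (axis i 1) \<alpha> \<beta> x + k * conn_coeff D e c (axis i \<i>) \<alpha> \<beta> x) * (1/2))" for i k
    by (intro smooth_map_mult smooth_map_add smooth_map_const atlas oVc conn_coeff_smooth[OF D V c ab])
  fix i z assume z: "z \<in> snd c ` (V \<inter> fst c)"
  then obtain x where x: "x \<in> V" "x \<in> fst c" "z = snd c x" by blast
  have cx: "chart_inv c z = x" using chart_inv_inverse[OF atlas c x(2)] x(3) by simp
  show "locP c e i \<alpha> \<beta> differentiable at z"
    using smooth_map_differentiable[OF sm[of i "- \<i>"] c, of x] x by (simp add: coeffP_def[abs_def])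
  show "locN c e i \<alpha> \<beta> differentiable at z"
    using smooth_map_differentiable[OF sm[of i "\<i>"] c, of x] x by (simp add: coeffN_def[abs_def])
  show "cnj (locG c e \<alpha> \<beta> z) = locG c e \<beta> \<alpha> z"
    using g_herm[OF frame_in_fibre[OF V x(1) ab(1)] frame_in_fibre[OF V x(1) ab(1)] frame_in_fibre[OF V x(1) ab(2)]]
    by (simp add: gram_def cx)
  have "dz i (locG c e \<alpha> \<beta>) z = (dfun (gram e \<alpha> \<beta>) c x (axis i 1) - \<i> * dfun (gram e \<alpha> \<beta>) c x (axis i \<i>)) / 2"
    by (simp add: dz_def dfun_def x(3))
  also have "\<dots> = (\<Sum>\<gamma>\<in>idx E. coeffP c e i \<alpha> \<gamma> x * gram e \<gamma> \<beta> x) + (\<Sum>\<gamma>\<in>idx E. cnj (coeffN c e i \<beta> \<gamma> x) * gram e \<alpha> \<gamma> x)"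
  proof -
    have 1: "(\<Sum>\<gamma>\<in>idx E. coeffP c e i \<alpha> \<gamma> x * gram e \<gamma> \<beta> x)
      = ((\<Sum>\<gamma>\<in>idx E. conn_coeff D e c (axis i 1) \<alpha> \<gamma> x * gram e \<gamma> \<beta> x)
        - \<i> * (\<Sum>\<gamma>\<in>idx E. conn_coeff D e c (axis i \<i>) \<alpha> \<gamma> x * gram e \<gamma> \<beta> x)) / 2"
      unfolding coeffP_def sum_distrib_left sum_subtractf[symmetric] sum_divide_distrib
      by (intro sum.cong refl) (simp add: algebra_simps)
    have 2: "(\<Sum>\<gamma>\<in>idx E. cnj (coeffN c e i \<beta> \<gamma> x) * gram e \<alpha> \<gamma> x)
      = ((\<Sum>\<gamma>\<in>idx E. cnj (conn_coeff D e c (axis i 1) \<beta> \<gamma> x) * gram e \<alpha> \<gamma> x)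
        - \<i> * (\<Sum>\<gamma>\<in>idx E. cnj (conn_coeff D e c (axis i \<i>) \<beta> \<gamma> x) * gram e \<alpha> \<gamma> x)) / 2"
      unfolding coeffN_def sum_distrib_left sum_subtractf[symmetric] sum_divide_distrib
      by (intro sum.cong refl) (simp add: algebra_simps)
    show ?thesis unfolding 1 2 dfun_gram[OF V c x(1,2) ab]
      by (simp add: algebra_simps add_divide_distrib diff_divide_distrib)
  qed
  finally show "dz i (locG c e \<alpha> \<beta>) z = (\<Sum>\<gamma>\<in>idx E. locP c e i \<alpha> \<gamma> z * locG c e \<gamma> \<beta> z)
      + (\<Sum>\<gamma>\<in>idx E. cnj (locN c e i \<beta> \<gamma> z) * locG c e \<alpha> \<gamma> z)"
    by (simp add: cx)
qed

text \<open>\<open>del\<close> and \<open>delbar\<close> differ only in the sign of \<i>; the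
  parameter k treats them together.\<close>

definition wirt :: "complex \<Rightarrow> ('m \<Rightarrow> 'v) \<Rightarrow> ('m, 'n) chart \<Rightarrow> 'n \<Rightarrow> 'm \<Rightarrow> 'v" where
  "wirt k s c i x = scl E (1/2) (D s c x (axis i 1)) + scl E (k/2) (D s c x (axis i \<i>))"

lemma wirt_del: "del E D c s i x = wirt (-\<i>) s c i x" "delbar E D c s i x = wirt \<i> s c i x"
  unfolding del_def delbar_def wirt_def by simp_all

lemma wirt_smooth:
  assumes "open W" "smooth_section A E W s" "c \<in> A"
  shows "smooth_section A E (W \<inter> fst c) (wirt k s c i)"
proof -
  have "open (W \<inter> fst c)" by (intro open_Int assms(1) open_chart_dom[OF atlas assms(3)])
  then show ?thesis
    unfolding wirt_def[abs_def]
    by (intro smooth_section_add smooth_section_scale smooth_map_const conn_smooth[OF D assms])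
qed

lemma frame_coeff_wirt:
  assumes V: "(V, e) \<in> frames E" and W: "open W" and s: "smooth_section A E W s"
    and c: "c \<in> A" and x: "x \<in> W" "x \<in> V" "x \<in> fst c" and \<beta>: "\<beta> \<in> idx E"
  shows "frame_coeff E e x (wirt k s c i x) \<beta>
    = (dfun (\<lambda>y. frame_coeff E e y (s y) \<beta>) c x (axis i 1) + k * dfun (\<lambda>y. frame_coeff E e y (s y) \<beta>) c x (axis i \<i>)) / 2
     + (\<Sum>\<alpha>\<in>idx E. frame_coeff E e x (s x) \<alpha> * ((conn_coeff D e c (axis i 1) \<alpha> \<beta> x + k * conn_coeff D e c (axis i \<i>) \<alpha> \<beta> x) / 2))"
proof -
  have "frame_coeff E e x (wirt k s c i x) \<beta> = 1/2 * frame_coeff E e x (D s c x (axis i 1)) \<beta> + k/2 * frame_coeff E e x (D s c x (axis i \<i>)) \<beta>"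
    unfolding wirt_def
    by (intro frame_coeff_linear2[OF V x(2) _ _ \<beta>] conn_in_fibre[OF D W s c x(1,3)])
  also have "\<dots> = (dfun (\<lambda>y. frame_coeff E e y (s y) \<beta>) c x (axis i 1) + k * dfun (\<lambda>y. frame_coeff E e y (s y) \<beta>) c x (axis i \<i>)) / 2
     + ((\<Sum>\<alpha>\<in>idx E. frame_coeff E e x (s x) \<alpha> * conn_coeff D e c (axis i 1) \<alpha> \<beta> x)
        + k * (\<Sum>\<alpha>\<in>idx E. frame_coeff E e x (s x) \<alpha> * conn_coeff D e c (axis i \<i>) \<alpha> \<beta> x)) / 2"
    unfolding conn_section[OF D V W s c x \<beta>] by (simp add: algebra_simps add_divide_distrib)
  also have "((\<Sum>\<alpha>\<in>idx E. frame_coeff E e x (s x) \<alpha> * conn_coeff D e c (axis i 1) \<alpha> \<beta> x)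
        + k * (\<Sum>\<alpha>\<in>idx E. frame_coeff E e x (s x) \<alpha> * conn_coeff D e c (axis i \<i>) \<alpha> \<beta> x)) / 2
      = (\<Sum>\<alpha>\<in>idx E. frame_coeff E e x (s x) \<alpha> * ((conn_coeff D e c (axis i 1) \<alpha> \<beta> x + k * conn_coeff D e c (axis i \<i>) \<alpha> \<beta> x) / 2))"
    unfolding sum_distrib_left sum.distrib[symmetric] sum_divide_distrib
    by (intro sum.cong refl) (simp add: algebra_simps)
  finally show ?thesis .
qed

lemma frame_coeff_del:
  assumes V: "(V, e) \<in> frames E" and W: "open W" and s: "smooth_section A E W s"
    and c: "c \<in> A" and x: "x \<in> W" "x \<in> V" "x \<in> fst c" and \<beta>: "\<beta> \<in> idx E"
  shows "frame_coeff E e x (del E D c s i x) \<beta> = dz i ((\<lambda>y. frame_coeff E e y (s y) \<beta>) \<circ> chart_inv c) (snd c x)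
     + (\<Sum>\<alpha>\<in>idx E. frame_coeff E e x (s x) \<alpha> * coeffP c e i \<alpha> \<beta> x)"
    and "frame_coeff E e x (delbar E D c s i x) \<beta> = dzb i ((\<lambda>y. frame_coeff E e y (s y) \<beta>) \<circ> chart_inv c) (snd c x)
     + (\<Sum>\<alpha>\<in>idx E. frame_coeff E e x (s x) \<alpha> * coeffN c e i \<alpha> \<beta> x)"
  unfolding wirt_del frame_coeff_wirt[OF assms] by (simp_all add: dz_def dzb_def dfun_def coeffP_def coeffN_def)

lemma wirt_in_fibre:
  assumes "open W" "smooth_section A E W s" "c \<in> A" "x \<in> W" "x \<in> fst c"
  shows "wirt k s c i x \<in> fibre E x"
  using smooth_section_in_fibre[OF wirt_smooth[OF assms(1,2,3)]] assms(4,5) by blast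

lemma frame_coeff_wirt_frame:
  assumes V: "(V, e) \<in> frames E" and c: "c \<in> A" and x: "x \<in> V" "x \<in> fst c" and ab: "\<alpha> \<in> idx E" "\<beta> \<in> idx E"
  shows "frame_coeff E e x (wirt k (e \<alpha>) c i x) \<beta> = (conn_coeff D e c (axis i 1) \<alpha> \<beta> x + k * conn_coeff D e c (axis i \<i>) \<alpha> \<beta> x) / 2"
proof -
  have "frame_coeff E e x (wirt k (e \<alpha>) c i x) \<beta> = 1/2 * frame_coeff E e x (D (e \<alpha>) c x (axis i 1)) \<beta> + k/2 * frame_coeff E e x (D (e \<alpha>) c x (axis i \<i>)) \<beta>"
    unfolding wirt_def
    by (intro frame_coeff_linear2[OF V x(1) _ _ ab(2)] conn_in_fibre[OF D frame_props(1)[OF V] frame_smooth[OF V ab(1)] c x])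
  then show ?thesis by (simp add: conn_coeff_def[OF D] add_divide_distrib)
qed

text \<open>\<open>curvature_11\<close> iterates the operators on sections. The first derivative of
  a frame vector is a local section whose coefficients are those of the connection, so applying
  \<open>frame_coeff_del\<close> to it yields the terms of \<open>curv\<close>.\<close>

lemma curvature_frame:
  assumes V: "(V, e) \<in> frames E" and c: "c \<in> A" and x: "x \<in> V" "x \<in> fst c" and \<alpha>: "\<alpha> \<in> idx E"
  shows "curvature_11 E D c (e \<alpha>) i j x
    = (\<Sum>\<beta>\<in>idx E. scl E (local_connection.curv (idx E) (locP c e) (locN c e) i j \<alpha> \<beta> (snd c x)) (e \<beta> x))"
proof -
  interpret L: local_connection "snd c ` (V \<inter> fst c)" "idx E" "locG c e" "locP c e" "locN c e"
    by (rule local_conn[OF V c])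
  note oV = frame_props(1)[OF V]
  have oVc: "open (V \<inter> fst c)" by (intro open_Int oV open_chart_dom[OF atlas c])
  have xVc: "x \<in> V \<inter> fst c" using x by blast
  have cx: "chart_inv c (snd c x) = x" by (rule chart_inv_inverse[OF atlas c x(2)])
  have s: "smooth_section A E (V \<inter> fst c) (wirt k (e \<alpha>) c i)" for k i
    by (rule wirt_smooth[OF oV frame_smooth[OF V \<alpha>] c])
  have in_U: "snd c x \<in> snd c ` (V \<inter> fst c)" using xVc by blast
  \<comment> \<open>The coefficients are known on the frame and chart domain only, which is enough
    because \<open>dz\<close> and \<open>dzb\<close> are local.\<close>
  have tr: "dz i ((\<lambda>y. frame_coeff E e y (wirt k (e \<alpha>) c j y) \<beta>) \<circ> chart_inv c) (snd c x) = dz i (F \<circ> chart_inv c) (snd c x)"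
      "dzb i ((\<lambda>y. frame_coeff E e y (wirt k (e \<alpha>) c j y) \<beta>) \<circ> chart_inv c) (snd c x) = dzb i (F \<circ> chart_inv c) (snd c x)"
    if F: "\<And>y. y \<in> V \<inter> fst c \<Longrightarrow> frame_coeff E e y (wirt k (e \<alpha>) c j y) \<beta> = F y" for k i j \<beta> F
  proof -
    have *: "((\<lambda>y. frame_coeff E e y (wirt k (e \<alpha>) c j y) \<beta>) \<circ> chart_inv c) z = (F \<circ> chart_inv c) z"
      if z: "z \<in> snd c ` (V \<inter> fst c)" for z
    proof -
      obtain y where "y \<in> V \<inter> fst c" "z = snd c y" using z by blast
      then show ?thesis using F chart_inv_inverse[OF atlas c, of y] by simp
    qed
    show "dz i ((\<lambda>y. frame_coeff E e y (wirt k (e \<alpha>) c j y) \<beta>) \<circ> chart_inv c) (snd c x) = dz i (F \<circ> chart_inv c) (snd c x)"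
      "dzb i ((\<lambda>y. frame_coeff E e y (wirt k (e \<alpha>) c j y) \<beta>) \<circ> chart_inv c) (snd c x) = dzb i (F \<circ> chart_inv c) (snd c x)"
      by (rule dz_transform(1)[OF L.U in_U], erule *) (rule dz_transform(2)[OF L.U in_U], erule *)
  qed
  have cP: "frame_coeff E e y (wirt (-\<i>) (e \<alpha>) c i y) \<beta> = coeffP c e i \<alpha> \<beta> y" if "y \<in> V \<inter> fst c" "\<beta> \<in> idx E" for y \<beta> i
    using frame_coeff_wirt_frame[OF V c _ _ \<alpha> that(2)] that(1) by (simp add: coeffP_def)
  have cN: "frame_coeff E e y (wirt \<i> (e \<alpha>) c i y) \<beta> = coeffN c e i \<alpha> \<beta> y" if "y \<in> V \<inter> fst c" "\<beta> \<in> idx E" for y \<beta> i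
    using frame_coeff_wirt_frame[OF V c _ _ \<alpha> that(2)] that(1) by (simp add: coeffN_def)
  have a: "frame_coeff E e x (del E D c (wirt \<i> (e \<alpha>) c j) i x) \<beta>
      = dz i (locN c e j \<alpha> \<beta>) (snd c x) + (\<Sum>\<gamma>\<in>idx E. coeffN c e j \<alpha> \<gamma> x * coeffP c e i \<gamma> \<beta> x)" if b: "\<beta> \<in> idx E" for \<beta>
    using frame_coeff_del(1)[OF V oVc s c xVc x b, of \<i> j i] tr(1)[OF cN[OF _ b]] cN[OF xVc] by simp
  have b: "frame_coeff E e x (delbar E D c (wirt (-\<i>) (e \<alpha>) c i) j x) \<beta>
      = dzb j (locP c e i \<alpha> \<beta>) (snd c x) + (\<Sum>\<gamma>\<in>idx E. coeffP c e i \<alpha> \<gamma> x * coeffN c e j \<gamma> \<beta> x)" if b: "\<beta> \<in> idx E" for \<beta>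
    using frame_coeff_del(2)[OF V oVc s c xVc x b, of "-\<i>" i j] tr(2)[OF cP[OF _ b]] cP[OF xVc] by simp
  have fib: "del E D c (wirt \<i> (e \<alpha>) c j) i x \<in> fibre E x" "delbar E D c (wirt (-\<i>) (e \<alpha>) c i) j x \<in> fibre E x"
    unfolding wirt_del by (rule wirt_in_fibre[OF oVc s c xVc x(2)])+
  have eq: "curvature_11 E D c (e \<alpha>) i j x
      = scl E 1 (del E D c (wirt \<i> (e \<alpha>) c j) i x) + scl E (-1) (delbar E D c (wirt (-\<i>) (e \<alpha>) c i) j x)"
    unfolding curvature_11_def del_01_def delbar_10_def wirt_del(1)[abs_def] wirt_del(2)[abs_def] by simp
  have curv_fib: "curvature_11 E D c (e \<alpha>) i j x \<in> fibre E x"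
    unfolding eq by (intro V.subspace_add[OF fibre_subspace] V.subspace_scale[OF fibre_subspace] fib)
  have "frame_coeff E e x (curvature_11 E D c (e \<alpha>) i j x) \<beta> = L.curv i j \<alpha> \<beta> (snd c x)" if \<beta>: "\<beta> \<in> idx E" for \<beta>
    unfolding eq frame_coeff_linear2[OF V x(1) fib \<beta>] a[OF \<beta>] b[OF \<beta>]
    by (simp add: L.curv_def cx sum_subtractf)
  then show ?thesis
    by (subst frame_coeff_expansion[OF V x(1) curv_fib]) (simp cong: sum.cong)
qed

end

section \<open>From sums of p eigenvalues to sums of q\<close>

text \<open>Each of the q + 1 elements is omitted once and hence counted q times.\<close>

lemma sum_remove_each:
  fixes f :: "'a \<Rightarrow> real"
  assumes "finite S" "card S = Suc q"
  shows "(\<Sum>a\<in>S. sum f (S - {a})) = real q * sum f S"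
proof -
  have "(\<Sum>a\<in>S. sum f (S - {a})) = (\<Sum>a\<in>S. sum f S - f a)"
    using assms(1) by (intro sum.cong refl) (simp add: sum_diff1)
  then show ?thesis using assms by (simp add: sum_subtractf algebra_simps)
qed

text \<open>A sum over q + 1 elements is a positive multiple of the sum over all its subsums with
  one element removed. The bound on p from below ensures that the factor q is not zero.\<close>

lemma subset_sums_nonpos:
  fixes f :: "'a \<Rightarrow> real"
  assumes "p \<le> q" "1 \<le> p" "\<And>S. S \<subseteq> K \<Longrightarrow> card S = p \<Longrightarrow> sum f S \<le> 0"
  shows "S \<subseteq> K \<Longrightarrow> card S = q \<Longrightarrow> sum f S \<le> 0"
  using assms(1)
proof (induction q arbitrary: S rule: dec_induct)
  case (step q)
  have fin: "finite S" using step.prems(2) card.infinite by fastforce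
  have "(\<Sum>a\<in>S. sum f (S - {a})) \<le> 0"
    using step fin by (intro sum_nonpos step.IH) (auto simp: card_Diff_singleton)
  then have "real q * sum f S \<le> 0" using sum_remove_each[OF fin step.prems(2)] by simp
  moreover have "q > 0" using step assms(2) by linarith
  ultimately show ?case by (simp add: mult_le_0_iff)
qed (use assms(3) in auto)

lemma subset_sums_neg:
  fixes f :: "'a \<Rightarrow> real"
  assumes "p \<le> q" "1 \<le> p" "\<And>S. S \<subseteq> K \<Longrightarrow> card S = p \<Longrightarrow> sum f S < 0"
  shows "S \<subseteq> K \<Longrightarrow> card S = q \<Longrightarrow> sum f S < 0"
  using assms(1)
proof (induction q arbitrary: S rule: dec_induct)
  case (step q)
  have fin: "finite S" using step.prems(2) card.infinite by fastforce
  have "S \<noteq> {}" using step.prems(2) by auto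
  then have "(\<Sum>a\<in>S. sum f (S - {a})) < (\<Sum>a\<in>S. 0)"
    using step fin by (intro sum_strict_mono step.IH) (auto simp: card_Diff_singleton)
  then have "real q * sum f S < 0" using sum_remove_each[OF fin step.prems(2)] by simp
  then show ?case by (simp add: mult_less_0_iff)
qed (use assms(3) in auto)

text \<open>Successive basis changes multiply in each slot; needed to compare the norms computed in
  two frames.\<close>

lemma tensor_coords_compose:
  assumes J: "finite J" and J': "finite J'"
  shows "tensor_coords q J e (tensor_coords q J' t x) u = tensor_coords q J' (\<lambda>\<alpha> a. \<Sum>\<beta>\<in>J. t \<alpha> \<beta> * e \<beta> a) x u"
proof -
  have "tensor_coords q J e (tensor_coords q J' t x) u
      = (\<Sum>\<beta>\<in>multi_index q J. \<Sum>\<alpha>\<in>multi_index q J'. (\<Prod>k<q. t (\<alpha> k) (\<beta> k) * e (\<beta> k) (u k)) * x \<alpha>)"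
    unfolding tensor_coords_def sum_distrib_left prod.distrib by (simp only: mult_ac)
  also have "\<dots> = (\<Sum>\<alpha>\<in>multi_index q J'. (\<Sum>\<beta>\<in>multi_index q J. \<Prod>k<q. t (\<alpha> k) (\<beta> k) * e (\<beta> k) (u k)) * x \<alpha>)"
    unfolding sum_distrib_right by (rule sum.swap)
  also have "\<dots> = tensor_coords q J' (\<lambda>\<alpha> a. \<Sum>\<beta>\<in>J. t \<alpha> \<beta> * e \<beta> a) x u"
    unfolding tensor_coords_def
    by (intro sum.cong refl arg_cong2[where f="(*)"])
      (rule sum_multi_index[OF J, where f="\<lambda>k b. t (_ k) b * e b (u k)"])
  finally show ?thesis .
qed

section \<open>Orthonormal bases of the fibres and the diagonal Ricci form\<close>

context metric_bundle
begin

text \<open>The part of \<open>form_eigenvalues\<close> that concerns the metric alone, so that the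
  norm of a tensor can be discussed without reference to eigenvalues.\<close>

definition orthonormal_at :: "'m \<Rightarrow> (nat \<Rightarrow> 'v) \<Rightarrow> bool" where
  "orthonormal_at x u \<longleftrightarrow> (\<forall>a<bundle_rank E. u a \<in> fibre E x) \<and>
     (\<forall>a<bundle_rank E. \<forall>b<bundle_rank E. g x (u a) (u b) = (if a = b then 1 else 0))"

context
  fixes x :: 'm and u :: "nat \<Rightarrow> 'v"
  assumes u: "orthonormal_at x u"
begin

lemma u_fibre: "a < bundle_rank E \<Longrightarrow> u a \<in> fibre E x"
  using u unfolding orthonormal_at_def by blast

lemma u_orth: "a < bundle_rank E \<Longrightarrow> b < bundle_rank E \<Longrightarrow> g x (u a) (u b) = (if a = b then 1 else 0)"
  using u unfolding orthonormal_at_def by blast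

lemma u_coeff:
  assumes "b < bundle_rank E"
  shows "g x (\<Sum>a<bundle_rank E. scl E (k a) (u a)) (u b) = k b"
proof -
  have "g x (\<Sum>a<bundle_rank E. scl E (k a) (u a)) (u b) = (\<Sum>a<bundle_rank E. k a * g x (u a) (u b))"
    using assms by (intro g_sum_left u_fibre) auto
  also have "\<dots> = (\<Sum>a<bundle_rank E. if a = b then k b else 0)"
    using assms by (intro sum.cong) (auto simp: u_orth)
  finally show ?thesis using assms by simp
qed

lemma u_inj: "inj_on u {..<bundle_rank E}"
  using u_orth by (intro inj_onI) (metis lessThan_iff zero_neq_one)

text \<open>The system is independent and has as many members as a frame. A vector outside its span
  would extend it to an independent set larger than a spanning one.\<close>

lemma u_complete:
  assumes w: "w \<in> fibre E x"
  shows "w = (\<Sum>a<bundle_rank E. scl E (g x w (u a)) (u a))"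
proof -
  let ?r = "bundle_rank E" and ?B = "u ` {..<bundle_rank E}"
  obtain V e where V: "(V, e) \<in> frames E" and x: "x \<in> V" by (rule ex_frame)
  let ?C = "(\<lambda>\<alpha>. e \<alpha> x) ` idx E"
  have C: "V.span ?C = fibre E x" "card ?C = ?r" "finite ?C"
    using frame_props[OF V] x finite_idx by (auto simp: card_image bundle_rank_def)
  have sumB: "(\<Sum>v\<in>?B. scl E (k v) v) = (\<Sum>a<?r. scl E (k (u a)) (u a))" for k
    using u_inj by (simp add: sum.reindex)
  have indB: "V.independent ?B"
  proof (rule V.independent_if_scalars_zero)
    show "finite ?B" by simp
    fix k v assume z: "(\<Sum>v\<in>?B. scl E (k v) v) = 0" and "v \<in> ?B"
    then obtain b where b: "b < ?r" "v = u b" by auto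
    have "k (u b) = g x 0 (u b)" using u_coeff[OF b(1), of "\<lambda>a. k (u a)"] z unfolding sumB by simp
    then show "k v = 0" using g_zero[OF u_fibre[OF b(1)]] b by simp
  qed
  have "w \<in> V.span ?B"
  proof (rule ccontr)
    assume nw: "w \<notin> V.span ?B"
    then have ind: "V.independent (insert w ?B)" using indB by (simp add: V.independent_insert)
    have "insert w ?B \<subseteq> V.span ?C" using w u_fibre C(1) by auto
    from conjunct2[OF V.independent_span_bound[OF C(3) ind this]]
    have "card (insert w ?B) \<le> ?r" unfolding C(2) .
    moreover have "w \<notin> ?B"
    proof
      assume "w \<in> ?B"
      then have "w \<in> V.span ?B" by (rule V.span_base)
      with nw show False by contradiction
    qed
    then have "card (insert w ?B) = Suc (card ?B)" by (intro card_insert_disjoint) auto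
    moreover have "card ?B = ?r" using card_image[OF u_inj] by simp
    ultimately show False by simp
  qed
  then obtain k where k: "w = (\<Sum>v\<in>?B. scl E (k v) v)" using V.span_finite[of ?B] by auto
  then have w_eq: "w = (\<Sum>a<?r. scl E (k (u a)) (u a))" unfolding sumB .
  have co: "g x w (u a) = k (u a)" if "a < ?r" for a
    using u_coeff[OF that, of "\<lambda>a. k (u a)"] unfolding w_eq[symmetric] .
  have "(\<Sum>a<?r. scl E (g x w (u a)) (u a)) = (\<Sum>a<?r. scl E (k (u a)) (u a))"
    by (intro sum.cong refl) (simp add: co)
  then show ?thesis unfolding w_eq[symmetric] ..
qed

lemma u_gram:
  assumes "w \<in> fibre E x" "w' \<in> fibre E x"
  shows "g x w w' = (\<Sum>a<bundle_rank E. g x w (u a) * cnj (g x w' (u a)))"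
proof -
  have "g x w w' = g x (\<Sum>a<bundle_rank E. scl E (g x w (u a)) (u a)) w'"
    using u_complete[OF assms(1)] by simp
  also have "\<dots> = (\<Sum>a<bundle_rank E. g x w (u a) * g x (u a) w')"
    using assms u_fibre by (intro g_sum_left) auto
  also have "\<dots> = (\<Sum>a<bundle_rank E. g x w (u a) * cnj (g x w' (u a)))"
    using assms by (intro sum.cong refl arg_cong2[where f="(*)"] g_herm u_fibre) auto
  finally show ?thesis .
qed

lemma u_inverse:
  assumes V: "(V, e) \<in> frames E" and x: "x \<in> V" and ab: "\<alpha> \<in> idx E" "\<beta> \<in> idx E"
  shows "(\<Sum>a<bundle_rank E. g x (e \<alpha> x) (u a) * frame_coeff E e x (u a) \<beta>) = kron \<alpha> \<beta>"
proof -
  have "kron \<alpha> \<beta> = frame_coeff E e x (\<Sum>a<bundle_rank E. scl E (g x (e \<alpha> x) (u a)) (u a)) \<beta>"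
    using u_complete[OF frame_in_fibre[OF V x ab(1)]] frame_coeff_frame[OF V x ab] by simp
  also have "\<dots> = (\<Sum>a<bundle_rank E. g x (e \<alpha> x) (u a) * frame_coeff E e x (u a) \<beta>)"
    using u_fibre by (intro frame_coeff_linear[OF V x _ ab(2)]) auto
  finally show ?thesis ..
qed

lemma ricci_form_left_sum:
  assumes V: "(V, e) \<in> frames E" and x: "x \<in> V" and w: "w \<in> fibre E x"
  shows "ricci_form h E g D c e x w w' = (\<Sum>a<bundle_rank E. g x w (u a) * ricci_form h E g D c e x (u a) w')"
proof -
  have co: "frame_coeff E e x w \<alpha> = (\<Sum>a<bundle_rank E. g x w (u a) * frame_coeff E e x (u a) \<alpha>)" if "\<alpha> \<in> idx E" for \<alpha>
  proof -
    have "frame_coeff E e x w \<alpha> = frame_coeff E e x (\<Sum>a<bundle_rank E. scl E (g x w (u a)) (u a)) \<alpha>"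
      using u_complete[OF w] by simp
    also have "\<dots> = (\<Sum>a<bundle_rank E. g x w (u a) * frame_coeff E e x (u a) \<alpha>)"
      using u_fibre by (intro frame_coeff_linear[OF V x _ that]) auto
    finally show ?thesis .
  qed
  have "ricci_form h E g D c e x w w' = (\<Sum>\<alpha>\<in>idx E. \<Sum>\<beta>\<in>idx E. \<Sum>a<bundle_rank E. g x w (u a) *
      (ricci_comp h E g D c e \<alpha> \<beta> x * frame_coeff E e x (u a) \<alpha> * cnj (frame_coeff E e x w' \<beta>)))"
    unfolding ricci_form_def
    by (intro sum.cong refl) (simp add: co sum_distrib_left sum_distrib_right mult_ac)
  also have "\<dots> = (\<Sum>a<bundle_rank E. \<Sum>\<alpha>\<in>idx E. \<Sum>\<beta>\<in>idx E. g x w (u a) *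
      (ricci_comp h E g D c e \<alpha> \<beta> x * frame_coeff E e x (u a) \<alpha> * cnj (frame_coeff E e x w' \<beta>)))"
    by (rule sum_rotate)
  finally show ?thesis unfolding ricci_form_def sum_distrib_left .
qed

text \<open>Translates the eigenvector equation into the hypothesis \<open>ricci_eq\<close> of the
  pointwise argument: the first argument of the Ricci form is expanded in the eigenbasis, and the
  equation then applies with the frame vector in the second.\<close>

lemma ricci_diagonal:
  assumes V: "(V, e) \<in> frames E" and c: "c \<in> A" and x: "x \<in> V" "x \<in> fst c" and ab: "\<alpha> \<in> idx E" "\<beta> \<in> idx E"
    and eig: "\<And>a w. a < bundle_rank E \<Longrightarrow> w \<in> fibre E x \<Longrightarrow>
       ricci_form h E g D c e x (u a) w = of_real (ls ! a) * g x (u a) w"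
  shows "(\<Sum>i\<in>UNIV. \<Sum>j\<in>UNIV. matrix_inv (h c x) $ j $ i *
      (\<Sum>\<gamma>\<in>idx E. local_connection.curv (idx E) (locP c e) (locN c e) i j \<alpha> \<gamma> (snd c x) * gram e \<gamma> \<beta> x))
    = (\<Sum>a<bundle_rank E. of_real (ls ! a) * g x (e \<alpha> x) (u a) * cnj (g x (e \<beta> x) (u a)))"
proof -
  note fe = frame_in_fibre[OF V x(1)]
  have "curvature_comp E g D c e i j \<alpha> \<beta> x
      = (\<Sum>\<gamma>\<in>idx E. local_connection.curv (idx E) (locP c e) (locN c e) i j \<alpha> \<gamma> (snd c x) * gram e \<gamma> \<beta> x)" for i j
    unfolding curvature_comp_def curvature_frame[OF V c x ab(1)] gram_def
    by (intro g_sum_left fe ab)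
  then have "(\<Sum>i\<in>UNIV. \<Sum>j\<in>UNIV. matrix_inv (h c x) $ j $ i *
      (\<Sum>\<gamma>\<in>idx E. local_connection.curv (idx E) (locP c e) (locN c e) i j \<alpha> \<gamma> (snd c x) * gram e \<gamma> \<beta> x))
    = ricci_comp h E g D c e \<alpha> \<beta> x"
    unfolding ricci_comp_def by simp
  also have "\<dots> = ricci_form h E g D c e x (e \<alpha> x) (e \<beta> x)"
  proof -
    have "ricci_form h E g D c e x (e \<alpha> x) (e \<beta> x) = (\<Sum>\<alpha>'\<in>idx E. \<Sum>\<beta>'\<in>idx E.
       if \<beta>' = \<beta> then (if \<alpha>' = \<alpha> then ricci_comp h E g D c e \<alpha> \<beta> x else 0) else 0)"
      unfolding ricci_form_def
      by (intro sum.cong refl) (auto simp: frame_coeff_frame[OF V x(1)] ab kron_def)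
    then show ?thesis using ab finite_idx by simp
  qed
  also have "\<dots> = (\<Sum>a<bundle_rank E. g x (e \<alpha> x) (u a) * ricci_form h E g D c e x (u a) (e \<beta> x))"
    by (rule ricci_form_left_sum[OF V x(1) fe[OF ab(1)]])
  also have "\<dots> = (\<Sum>a<bundle_rank E. of_real (ls ! a) * g x (e \<alpha> x) (u a) * cnj (g x (e \<beta> x) (u a)))"
  proof (intro sum.cong refl)
    fix a assume "a \<in> {..<bundle_rank E}"
    then have a: "a < bundle_rank E" by simp
    show "g x (e \<alpha> x) (u a) * ricci_form h E g D c e x (u a) (e \<beta> x) = of_real (ls ! a) * g x (e \<alpha> x) (u a) * cnj (g x (e \<beta> x) (u a))"
      unfolding eig[OF a fe[OF ab(2)]] using g_herm[OF fe[OF ab(2)] fe[OF ab(2)] u_fibre[OF a]] by simp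
  qed
  finally show ?thesis .
qed

end

definition inv_metric :: "('m, 'n) chart \<Rightarrow> 'n \<Rightarrow> 'n \<Rightarrow> complex ^ 'n \<Rightarrow> complex" where
  "inv_metric c i j z = matrix_inv (h c (chart_inv c z)) $ j $ i"

lemma h_props:
  assumes "c \<in> A" "x \<in> fst c"
  shows "h c x $ j $ i = cnj (h c x $ i $ j)" "v \<noteq> 0 \<Longrightarrow> 0 < Re (sesq_form (h c x) v v)"
  using bspec[OF conjunct1[OF h[unfolded hermitian_metric_def]] assms(1)] assms(2) by blast+

lemma h_smooth: "c \<in> A \<Longrightarrow> smooth_map A (fst c) (h c)"
  using bspec[OF conjunct1[OF h[unfolded hermitian_metric_def]]] by blast

lemma inv_metric_positive:
  assumes "c \<in> A" "z \<in> snd c ` fst c"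
  shows "positive_definite (\<lambda>i j. inv_metric c i j z)"
proof -
  obtain x where x: "x \<in> fst c" "z = snd c x" using assms(2) by blast
  then show ?thesis
    unfolding inv_metric_def
    using inverse_of_positive_hermitian(1)[OF h_props[OF assms(1) x(1)]] chart_inv_inverse[OF atlas assms(1) x(1)] by simp
qed

lemma inv_metric_continuous:
  assumes "c \<in> A"
  shows "continuous_on (snd c ` fst c) (inv_metric c i j)"
proof -
  have ch: "chart_inv c z \<in> fst c" if "z \<in> snd c ` fst c" for z
    using that chart_inv_inverse[OF atlas assms] by auto
  have "smooth_on (snd c ` (fst c \<inter> fst c)) (h c \<circ> chart_inv c)"
    using h_smooth[OF assms] assms unfolding smooth_map_def by blast
  from smooth_on_continuous_on[OF this]
  have "continuous_on (snd c ` fst c) (h c \<circ> chart_inv c)" unfolding Int_absorb .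
  then have "continuous_on (snd c ` fst c) (\<lambda>z. h c (chart_inv c z) $ i $ j)" for i j
    by (intro continuous_on_component) (simp add: o_def)
  then show ?thesis
    unfolding inv_metric_def[abs_def]
    by (rule continuous_on_matrix_inv)
      (use inverse_of_positive_hermitian(2,3)[OF h_props[OF assms]] ch in blast)+
qed

end

section \<open>Closed tensors\<close>

text \<open>A section of the \<open>q\<close>-th exterior power of \<open>E\<close> (or of its complexification), given by its
  antisymmetric components \<open>T e x \<alpha>\<close> with respect to the frames \<open>e\<close> of \<open>E\<close>.\<close>

locale closed_tensor = metric_bundle A h E g D
  for A :: "('m::t2_space, 'n::finite) chart set"
    and h :: "('m, 'n) chart \<Rightarrow> 'm \<Rightarrow> complex ^ 'n ^ 'n"
    and E :: "(complex, 'm, 'v::ab_group_add, 'i) vbundle"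
    and g :: "'m \<Rightarrow> 'v \<Rightarrow> 'v \<Rightarrow> complex"
    and D :: "('m, 'n, 'v) conn" +
  fixes q :: nat and T :: "('i \<Rightarrow> 'm \<Rightarrow> 'v) \<Rightarrow> 'm \<Rightarrow> (nat \<Rightarrow> 'i) \<Rightarrow> complex"
  assumes T_smooth: "\<And>V e \<alpha>. (V, e) \<in> frames E \<Longrightarrow> \<alpha> \<in> multi_index q (idx E) \<Longrightarrow> smooth_map A V (\<lambda>x. T e x \<alpha>)"
    and T_alternating: "\<And>V e x. (V, e) \<in> frames E \<Longrightarrow> x \<in> V \<Longrightarrow> alternating_on q (idx E) (T e x)"
    and T_change: "\<And>V e V' e' x t \<beta>. (V, e) \<in> frames E \<Longrightarrow> (V', e') \<in> frames E \<Longrightarrow> x \<in> V \<Longrightarrow> x \<in> V' \<Longrightarrow>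
      (\<And>\<alpha>. \<alpha> \<in> idx E \<Longrightarrow> e' \<alpha> x = (\<Sum>\<beta>\<in>idx E. scl E (t \<alpha> \<beta>) (e \<beta> x))) \<Longrightarrow>
      \<beta> \<in> multi_index q (idx E) \<Longrightarrow> T e x \<beta> = tensor_coords q (idx E) t (T e' x) \<beta>"
    and T_closed: "\<And>V e c x \<beta> j. (V, e) \<in> frames E \<Longrightarrow> c \<in> A \<Longrightarrow> x \<in> V \<Longrightarrow> x \<in> fst c \<Longrightarrow> \<beta> \<in> multi_index q (idx E) \<Longrightarrow>
      dzb j ((\<lambda>y. T e y \<beta>) \<circ> chart_inv c) (snd c x)
        + (\<Sum>\<alpha>\<in>multi_index q (idx E). T e x \<alpha> * derivation q (\<lambda>a b. coeffN c e j a b x) \<alpha> \<beta>) = 0"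
begin

definition sq_norm :: "('i \<Rightarrow> 'm \<Rightarrow> 'v) \<Rightarrow> 'm \<Rightarrow> complex" where
  "sq_norm e x = hprod (multi_index q (idx E)) (\<lambda>\<alpha> \<beta>. \<Prod>l<q. gram e (\<alpha> l) (\<beta> l) x) (T e x) (T e x)"

lemma sq_norm_orthonormal:
  assumes V: "(V, e) \<in> frames E" and x: "x \<in> V" and u: "orthonormal_at x u"
  shows "sq_norm e x = (\<Sum>a\<in>multi_index q {..<bundle_rank E}.
    of_real ((cmod (tensor_coords q (idx E) (\<lambda>\<alpha> a. g x (e \<alpha> x) (u a)) (T e x) a))\<^sup>2))"
proof -
  have "sq_norm e x = (\<Sum>a\<in>multi_index q {..<bundle_rank E}. (\<Prod>l<q. 1) *
      tensor_coords q (idx E) (\<lambda>\<alpha> a. g x (e \<alpha> x) (u a)) (T e x) a *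
      cnj (tensor_coords q (idx E) (\<lambda>\<alpha> a. g x (e \<alpha> x) (u a)) (T e x) a))"
    unfolding sq_norm_def
    by (rule hprod_slots[OF finite_idx, where d = "\<lambda>l a. 1"])
      (simp_all add: gram_def u_gram[OF u] frame_in_fibre[OF V x])
  then show ?thesis by (simp add: complex_norm_square del: of_real_power)
qed

text \<open>Passing from one frame to the other and then to the unitary basis is the same as passing
  there directly, so both frames yield the same unitary coordinates.\<close>

lemma sq_norm_unique:
  assumes V: "(V, e) \<in> frames E" and V': "(V', e') \<in> frames E" and x: "x \<in> V" "x \<in> V'" and u: "orthonormal_at x u"
  shows "sq_norm e x = sq_norm e' x"
proof -
  obtain t' where t': "\<And>y \<alpha>. y \<in> V \<inter> V' \<Longrightarrow> \<alpha> \<in> idx E \<Longrightarrow> e' \<alpha> y = (\<Sum>\<beta>\<in>idx E. scl E (t' \<alpha> \<beta> y) (e \<beta> y))"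
    using frame_transition[OF V V'] by metis
  define t where "t = (\<lambda>\<alpha> \<beta>. t' \<alpha> \<beta> x)"
  have t: "e' \<alpha> x = (\<Sum>\<beta>\<in>idx E. scl E (t \<alpha> \<beta>) (e \<beta> x))" if "\<alpha> \<in> idx E" for \<alpha>
    using t'[of x \<alpha>] x that by (simp add: t_def)
  have "tensor_coords q (idx E) (\<lambda>\<alpha> a. g x (e \<alpha> x) (u a)) (T e x) a
      = tensor_coords q (idx E) (\<lambda>\<alpha> a. g x (e' \<alpha> x) (u a)) (T e' x) a"
    if a: "a \<in> multi_index q {..<bundle_rank E}" for a
  proof -
    have "tensor_coords q (idx E) (\<lambda>\<alpha> a. g x (e \<alpha> x) (u a)) (T e x) a
      = tensor_coords q (idx E) (\<lambda>\<alpha> a. g x (e \<alpha> x) (u a)) (tensor_coords q (idx E) t (T e' x)) a"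
      unfolding tensor_coords_def[where x = "T e x"] tensor_coords_def[where x = "tensor_coords q (idx E) t (T e' x)"]
      by (intro sum.cong refl) (simp add: T_change[OF V V' x t])
    also have "\<dots> = tensor_coords q (idx E) (\<lambda>\<alpha> a. \<Sum>\<beta>\<in>idx E. t \<alpha> \<beta> * g x (e \<beta> x) (u a)) (T e' x) a"
      by (rule tensor_coords_compose[OF finite_idx finite_idx])
    also have "\<dots> = tensor_coords q (idx E) (\<lambda>\<alpha> a. g x (e' \<alpha> x) (u a)) (T e' x) a"
    proof -
      have "(\<Sum>\<beta>\<in>idx E. t \<alpha> \<beta> * g x (e \<beta> x) (u b)) = g x (e' \<alpha> x) (u b)"
        if "\<alpha> \<in> idx E" "b < bundle_rank E" for \<alpha> b
        unfolding t[OF that(1)]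
        by (rule g_sum_left[symmetric]) (auto intro: frame_in_fibre[OF V x(1)] u_fibre[OF u that(2)])
      then show ?thesis
        unfolding tensor_coords_def using a
        by (intro sum.cong refl arg_cong2[where f="(*)"] prod.cong) auto
    qed
    finally show ?thesis .
  qed
  then show ?thesis
    unfolding sq_norm_orthonormal[OF V x(1) u] sq_norm_orthonormal[OF V' x(2) u] by (simp cong: sum.cong)
qed

lemma sq_norm_zero:
  assumes V: "(V, e) \<in> frames E" and x: "x \<in> V" and u: "orthonormal_at x u"
    and zero: "Re (sq_norm e x) = 0" and \<alpha>: "\<alpha> \<in> multi_index q (idx E)"
  shows "T e x \<alpha> = 0"
proof -
  let ?t = "tensor_coords q (idx E) (\<lambda>\<alpha> a. g x (e \<alpha> x) (u a)) (T e x)"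
  let ?K = "multi_index q {..<bundle_rank E}"
  have "(\<Sum>a\<in>?K. (cmod (?t a))\<^sup>2) = 0"
    using zero unfolding sq_norm_orthonormal[OF V x u] by (simp only: Re_sum Re_complex_of_real)
  then have "?t a = 0" if "a \<in> ?K" for a
    using that finite_multi_index[of "{..<bundle_rank E}" q] by (subst (asm) sum_nonneg_eq_0_iff) auto
  moreover have "(\<Sum>a\<in>?K. (\<Prod>k<q. frame_coeff E e x (u (a k)) (\<alpha> k)) * ?t a) = T e x \<alpha>"
    by (rule tensor_coords_inverse[OF finite_idx finite_lessThan \<alpha>, where e' = "\<lambda>a \<beta>. frame_coeff E e x (u a) \<beta>"])
      (rule u_inverse[OF u V x])
  ultimately show ?thesis by simp
qed

section \<open>The local Bochner inequality\<close>

context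
  fixes V :: "'m set" and e :: "'i \<Rightarrow> 'm \<Rightarrow> 'v" and c :: "('m, 'n) chart"
  assumes V: "(V, e) \<in> frames E" and c: "c \<in> A"
begin

abbreviation Tl :: "(nat \<Rightarrow> 'i) \<Rightarrow> complex ^ 'n \<Rightarrow> complex" where
  "Tl \<alpha> \<equiv> (\<lambda>y. T e y \<alpha>) \<circ> chart_inv c"

interpretation L: local_connection "snd c ` (V \<inter> fst c)" "idx E" "locG c e" "locP c e" "locN c e"
  by (rule local_conn[OF V c])

interpretation tensor: local_connection "snd c ` (V \<inter> fst c)" "multi_index q (idx E)" "L.tensorG q" "L.tensorP q" "L.tensorN q"
  by (rule L.tensor_local_connection)

lemma Tl_smooth: "\<alpha> \<in> multi_index q (idx E) \<Longrightarrow> smooth_on (snd c ` (V \<inter> fst c)) (Tl \<alpha>)"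
  using T_smooth[OF V] c unfolding smooth_map_def by blast

lemma Tl_closed:
  assumes "\<beta> \<in> multi_index q (idx E)" "z \<in> snd c ` (V \<inter> fst c)"
  shows "tensor.nablab j Tl \<beta> z = 0"
proof -
  obtain x where x: "x \<in> V" "x \<in> fst c" "z = snd c x" using assms(2) by blast
  have cx: "chart_inv c z = x" using chart_inv_inverse[OF atlas c x(2)] x(3) by simp
  show ?thesis
    unfolding tensor.nablab_def L.tensorN_def
    using T_closed[OF V c x(1,2) assms(1), of j] unfolding x(3)[symmetric] by (simp add: cx)
qed

definition loc_norm :: "complex ^ 'n \<Rightarrow> complex" where
  "loc_norm = tensor.inner_fun Tl Tl"

lemma loc_norm_eq:
  assumes "x \<in> fst c"
  shows "loc_norm (snd c x) = sq_norm e x"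
  using chart_inv_inverse[OF atlas c assms]
  by (simp add: loc_norm_def tensor.inner_fun_def sq_norm_def L.tensorG_def)

lemma loc_norm_twice_differentiable: "twice_differentiable_on (snd c ` (V \<inter> fst c)) loc_norm"
  unfolding loc_norm_def
  by (intro tensor.inner_fun_twice_differentiable smooth_on_twice_differentiable Tl_smooth)

text \<open>Fits the eigenbasis u at x into the pointwise argument: metric products with u are the
  components of the frame vectors, frame coefficients of u form the inverse matrix. The last two
  claims take the reverse inequality as a premise; it becomes available through the constancy of the
  norm.\<close>

lemma local_bochner:
  assumes x: "x \<in> V" "x \<in> fst c"
    and eig: "form_eigenvalues (fibre E x) (bundle_rank E) (g x) (ricci_form h E g D c e x) ls"
    and nonpos: "\<And>S. S \<subseteq> {..<bundle_rank E} \<Longrightarrow> card S = q \<Longrightarrow> (\<Sum>a\<in>S. ls ! a) \<le> 0"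
  shows "0 \<le> Re (trace_levi (inv_metric c) loc_norm (snd c x))"
    and "Re (trace_levi (inv_metric c) loc_norm (snd c x)) \<le> 0 \<Longrightarrow> \<beta> \<in> multi_index q (idx E) \<Longrightarrow>
      dz i (Tl \<beta>) (snd c x) + (\<Sum>\<alpha>\<in>multi_index q (idx E). T e x \<alpha> * derivation q (\<lambda>a b. coeffP c e i a b x) \<alpha> \<beta>) = 0"
    and "Re (trace_levi (inv_metric c) loc_norm (snd c x)) \<le> 0 \<Longrightarrow>
      (\<And>S. S \<subseteq> {..<bundle_rank E} \<Longrightarrow> card S = q \<Longrightarrow> (\<Sum>a\<in>S. ls ! a) < 0) \<Longrightarrow>
      \<beta> \<in> multi_index q (idx E) \<Longrightarrow> T e x \<beta> = 0"
proof -
  obtain u where u: "orthonormal_at x u"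
    and u_eig: "\<And>a w. a < bundle_rank E \<Longrightarrow> w \<in> fibre E x \<Longrightarrow>
       ricci_form h E g D c e x (u a) w = of_real (ls ! a) * g x (u a) w"
    using eig unfolding form_eigenvalues_def orthonormal_at_def by blast
  have cx: "chart_inv c (snd c x) = x" by (rule chart_inv_inverse[OF atlas c x(2)])
  have z: "snd c x \<in> snd c ` (V \<inter> fst c)" using x by blast
  let ?e = "\<lambda>\<alpha> a. g x (e \<alpha> x) (u a)" and ?e' = "\<lambda>a \<beta>. frame_coeff E e x (u a) \<beta>"
  have alt: "alternating_on q (idx E) (\<lambda>\<alpha>. Tl \<alpha> (snd c x))"
    using T_alternating[OF V x(1)] by (simp add: cx)
  have a: "positive_definite (\<lambda>i j. inv_metric c i j (snd c x))"
    using x by (intro inv_metric_positive c) auto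
  have inv: "(\<Sum>a<bundle_rank E. ?e \<alpha> a * ?e' a \<beta>) = kron \<alpha> \<beta>" if "\<alpha> \<in> idx E" "\<beta> \<in> idx E" for \<alpha> \<beta>
    by (rule u_inverse[OF u V x(1) that])
  have G: "locG c e \<alpha> \<beta> (snd c x) = (\<Sum>a<bundle_rank E. ?e \<alpha> a * cnj (?e \<beta> a))" if "\<alpha> \<in> idx E" "\<beta> \<in> idx E" for \<alpha> \<beta>
    using u_gram[OF u frame_in_fibre[OF V x(1) that(1)] frame_in_fibre[OF V x(1) that(2)]]
    by (simp add: cx gram_def)
  have R: "(\<Sum>i\<in>UNIV. \<Sum>j\<in>UNIV. inv_metric c i j (snd c x) *
      (\<Sum>\<gamma>\<in>idx E. L.curv i j \<alpha> \<gamma> (snd c x) * locG c e \<gamma> \<beta> (snd c x)))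
    = (\<Sum>a<bundle_rank E. of_real (ls ! a) * ?e \<alpha> a * cnj (?e \<beta> a))" if "\<alpha> \<in> idx E" "\<beta> \<in> idx E" for \<alpha> \<beta>
    using ricci_diagonal[OF u V c x that u_eig] by (simp add: inv_metric_def cx)
  show "0 \<le> Re (trace_levi (inv_metric c) loc_norm (snd c x))"
    unfolding loc_norm_def
    by (rule L.tensor_subsolution[where e = ?e and e' = ?e' and lam = "(!) ls" and K = "{..<bundle_rank E}"])
      (fact Tl_smooth Tl_closed alt z a finite_lessThan inv G R nonpos)+
  show "dz i (Tl \<beta>) (snd c x) + (\<Sum>\<alpha>\<in>multi_index q (idx E). T e x \<alpha> * derivation q (\<lambda>a b. coeffP c e i a b x) \<alpha> \<beta>) = 0"
    if zero: "Re (trace_levi (inv_metric c) loc_norm (snd c x)) \<le> 0" and \<beta>: "\<beta> \<in> multi_index q (idx E)"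
  proof -
    have "tensor.nabla i Tl \<beta> (snd c x) = 0"
      by (rule L.tensor_parallel[where e = ?e and e' = ?e' and lam = "(!) ls" and K = "{..<bundle_rank E}" and a = "inv_metric c"])
        (fact Tl_smooth Tl_closed alt z a finite_lessThan inv G R nonpos zero[unfolded loc_norm_def] \<beta>)+
    then show ?thesis unfolding tensor.nabla_def L.tensorP_def by (simp add: cx)
  qed
  show "T e x \<beta> = 0"
    if zero: "Re (trace_levi (inv_metric c) loc_norm (snd c x)) \<le> 0" and \<beta>: "\<beta> \<in> multi_index q (idx E)"
      and neg: "\<And>S. S \<subseteq> {..<bundle_rank E} \<Longrightarrow> card S = q \<Longrightarrow> (\<Sum>a\<in>S. ls ! a) < 0"
  proof -
    have "Tl \<beta> (snd c x) = 0"
      by (rule L.tensor_vanishes[where e = ?e and e' = ?e' and lam = "(!) ls" and K = "{..<bundle_rank E}" and a = "inv_metric c"])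
        (fact Tl_smooth Tl_closed alt z a finite_lessThan inv G R neg zero[unfolded loc_norm_def] \<beta>)+
    then show ?thesis by (simp add: cx)
  qed
qed

end

section \<open>Constancy of the norm on the manifold\<close>

context
  fixes p :: nat
  assumes cpt: "compact (UNIV :: 'm set)" and conn: "connected (UNIV :: 'm set)"
    and pq: "1 \<le> p" "p \<le> q"
    and nonpos: "\<And>x. ricci_p_nonpositive p A h E g D x"
begin

lemma eigenvalues:
  assumes V: "(V, e) \<in> frames E" and c: "c \<in> A" and x: "x \<in> V" "x \<in> fst c"
  obtains ls where "form_eigenvalues (fibre E x) (bundle_rank E) (g x) (ricci_form h E g D c e x) ls"
    "\<And>S. S \<subseteq> {..<bundle_rank E} \<Longrightarrow> card S = q \<Longrightarrow> (\<Sum>a\<in>S. ls ! a) \<le> 0"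
proof -
  have "form_p_nonpositive p (fibre E x) (bundle_rank E) (g x) (ricci_form h E g D c e x)"
    using bspec[OF bspec[OF nonpos[of x, unfolded ricci_p_nonpositive_def] c] V, unfolded prod.case] x by blast
  then obtain ls where ls: "form_eigenvalues (fibre E x) (bundle_rank E) (g x) (ricci_form h E g D c e x) ls"
    "\<And>S. S \<subseteq> {..<bundle_rank E} \<Longrightarrow> card S = p \<Longrightarrow> (\<Sum>a\<in>S. ls ! a) \<le> 0"
    unfolding form_p_nonpositive_def by blast
  have "(\<Sum>a\<in>S. ls ! a) \<le> 0" if "S \<subseteq> {..<bundle_rank E}" "card S = q" for S
    by (rule subset_sums_nonpos[OF pq(2,1) ls(2) that])
  then show thesis using that ls(1) by blast
qed

text \<open>No orthonormalisation is carried out: the eigenvalue data in the curvature hypothesis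
  contain such a basis at every point.\<close>

lemma ex_orthonormal: obtains u where "orthonormal_at x u"
proof -
  obtain V e where V: "(V, e) \<in> frames E" "x \<in> V" by (rule ex_frame)
  obtain c where c: "c \<in> A" "x \<in> fst c" by (rule ex_chart[OF atlas])
  obtain ls where "form_eigenvalues (fibre E x) (bundle_rank E) (g x) (ricci_form h E g D c e x) ls"
    by (rule eigenvalues[OF V(1) c(1) V(2) c(2)])
  then show thesis using that unfolding form_eigenvalues_def orthonormal_at_def by blast
qed

text \<open>The frame is chosen separately at each point. By \<open>sq_norm_unique\<close> the
  choice does not affect the value, so the function is locally given by
  \<open>loc_norm\<close>.\<close>

definition norm_fun :: "'m \<Rightarrow> real" where
  "norm_fun x = Re (sq_norm (snd (SOME f. f \<in> frames E \<and> x \<in> fst f)) x)"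

lemma norm_fun_eq:
  assumes "(V, e) \<in> frames E" "x \<in> V"
  shows "norm_fun x = Re (sq_norm e x)"
proof -
  define f where "f = (SOME f. f \<in> frames E \<and> x \<in> fst f)"
  have "f \<in> frames E \<and> x \<in> fst f"
    unfolding f_def by (rule someI[of _ "(V, e)"]) (use assms in simp)
  then have f: "(fst f, snd f) \<in> frames E" "x \<in> fst f" by simp_all
  obtain u where u: "orthonormal_at x u" by (rule ex_orthonormal)
  show ?thesis
    unfolding norm_fun_def f_def[symmetric] using sq_norm_unique[OF f(1) assms(1) f(2) assms(2) u] by simp
qed

lemma sq_norm_real:
  assumes "(V, e) \<in> frames E" "x \<in> V"
  shows "Im (sq_norm e x) = 0"
proof -
  obtain u where u: "orthonormal_at x u" by (rule ex_orthonormal)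
  show ?thesis unfolding sq_norm_orthonormal[OF assms u] by (simp only: Im_sum Im_complex_of_real sum.neutral_const)
qed

lemma norm_fun_loc:
  assumes V: "(V, e) \<in> frames E" and c: "c \<in> A" and x: "x \<in> V" "x \<in> fst c"
  shows "Re (loc_norm e c (snd c x)) = norm_fun x" "Im (loc_norm e c (snd c x)) = 0"
  using loc_norm_eq[OF V c x(2)] norm_fun_eq[OF V x(1)] sq_norm_real[OF V x(1)] by simp_all

lemma continuous_chart:
  assumes "c \<in> A" shows "continuous_on (fst c) (snd c)"
  using is_atlas assms unfolding complex_atlas_def homeomorphism_def by blast

lemma norm_fun_continuous: "continuous_on UNIV norm_fun"
proof -
  have "\<exists>S. open S \<and> x \<in> S \<and> continuous_on S norm_fun" for x
  proof -
    obtain V e where V: "(V, e) \<in> frames E" "x \<in> V" by (rule ex_frame)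
    obtain c where c: "c \<in> A" "x \<in> fst c" by (rule ex_chart[OF atlas])
    have "open (V \<inter> fst c)"
      by (intro open_Int frame_props(1)[OF V(1)] open_chart_dom[OF atlas c(1)])
    moreover have "continuous_on (V \<inter> fst c) norm_fun"
    proof -
      have "continuous_on (snd c ` (V \<inter> fst c)) (loc_norm e c)"
        by (intro continuous_at_imp_continuous_on ballI differentiable_imp_continuous_within
            twice_differentiable_onD(1)[OF loc_norm_twice_differentiable[OF V(1) c(1)]])
      then have "continuous_on (V \<inter> fst c) (\<lambda>y. Re (loc_norm e c (snd c y)))"
        by (intro continuous_on_Re continuous_on_compose2[OF _ continuous_on_subset[OF continuous_chart[OF c(1)]]]) auto
      then show ?thesis
        by (rule continuous_on_eq) (auto simp: norm_fun_loc[OF V(1) c(1)])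
    qed
    ultimately show ?thesis using V c by blast
  qed
  then have "isCont norm_fun x" for x
    using continuous_on_eq_continuous_at by blast
  then show ?thesis by (simp add: continuous_at_imp_continuous_on)
qed

lemma norm_fun_constant: obtains m where "\<And>x. norm_fun x = m"
proof -
  obtain x0 where x0: "\<And>x. norm_fun x \<le> norm_fun x0"
    using continuous_attains_sup[OF cpt UNIV_not_empty norm_fun_continuous] by blast
  let ?M = "{x. norm_fun x = norm_fun x0}"
  have "closed ?M"
    using continuous_closed_preimage_constant[OF norm_fun_continuous closed_UNIV, of "norm_fun x0"] by simp
  moreover have "open ?M"
  proof (subst open_subopen, intro ballI)
    fix x assume x: "x \<in> ?M"
    obtain V e where V: "(V, e) \<in> frames E" "x \<in> V" by (rule ex_frame)
    obtain c where c: "c \<in> A" "x \<in> fst c" by (rule ex_chart[OF atlas])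
    let ?U = "snd c ` (V \<inter> fst c)"
    let ?S = "{z \<in> ?U. Re (loc_norm e c z) = norm_fun x0}"
    have oU: "open ?U" by (rule open_chart_image[OF atlas c(1) frame_props(1)[OF V(1)]])
    \<comment> \<open>The global maximum bounds the norm on the whole coordinate domain; the
      preimage of this set under the chart is the required neighbourhood of x.\<close>
    have "open ?S"
    proof (rule strong_maximum_principle[OF oU loc_norm_twice_differentiable[OF V(1) c(1)], where a = "inv_metric c"])
      show "positive_definite (\<lambda>i j. inv_metric c i j z)" if "z \<in> ?U" for z
        using that by (intro inv_metric_positive[OF c(1)]) auto
      show "continuous_on ?U (inv_metric c i j)" for i j
        by (rule continuous_on_subset[OF inv_metric_continuous[OF c(1)]]) auto
      fix z assume "z \<in> ?U"
      then obtain y where y: "y \<in> V" "y \<in> fst c" "z = snd c y" by blast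
      show "Im (loc_norm e c z) = 0" "Re (loc_norm e c z) \<le> norm_fun x0"
        unfolding y(3) norm_fun_loc[OF V(1) c(1) y(1,2)] by (simp_all add: x0)
      obtain ls where ls: "form_eigenvalues (fibre E y) (bundle_rank E) (g y) (ricci_form h E g D c e y) ls"
        "\<And>S. S \<subseteq> {..<bundle_rank E} \<Longrightarrow> card S = q \<Longrightarrow> (\<Sum>a\<in>S. ls ! a) \<le> 0"
        using eigenvalues[OF V(1) c(1) y(1,2)] by blast
      show "0 \<le> Re (trace_levi (inv_metric c) (loc_norm e c) z)"
        unfolding y(3) by (rule local_bochner(1)[OF V(1) c(1) y(1,2) ls])
    qed
    moreover have oVc: "open (V \<inter> fst c)"
      by (intro open_Int frame_props(1)[OF V(1)] open_chart_dom[OF atlas c(1)])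
    ultimately have "open ((V \<inter> fst c) \<inter> snd c -` ?S)"
      by (intro continuous_open_preimage continuous_on_subset[OF continuous_chart[OF c(1)]]) auto
    moreover have "x \<in> (V \<inter> fst c) \<inter> snd c -` ?S"
      using x V c norm_fun_loc[OF V(1) c(1) V(2) c(2)] by auto
    moreover have "(V \<inter> fst c) \<inter> snd c -` ?S \<subseteq> ?M"
    proof
      fix y assume "y \<in> (V \<inter> fst c) \<inter> snd c -` ?S"
      then have "y \<in> V" "y \<in> fst c" "Re (loc_norm e c (snd c y)) = norm_fun x0" by simp_all
      then show "y \<in> ?M" using norm_fun_loc(1)[OF V(1) c(1)] by simp
    qed
    ultimately show "\<exists>S. open S \<and> x \<in> S \<and> S \<subseteq> ?M" by blast
  qed
  moreover have "x0 \<in> ?M" by simp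
  moreover have "openin (top_of_set UNIV) M \<longleftrightarrow> open M" "closedin (top_of_set UNIV) M \<longleftrightarrow> closed M" for M :: "'m set"
    by simp_all
  ultimately have "?M = UNIV"
    using conn[unfolded connected_clopen, THEN spec, of ?M] by blast
  then show thesis using that by blast
qed

text \<open>A constant function has a maximum at every point, which supplies the inequality opposite
  to the Bochner estimate.\<close>

lemma trace_levi_nonpos:
  assumes V: "(V, e) \<in> frames E" and c: "c \<in> A" and x: "x \<in> V" "x \<in> fst c"
  shows "Re (trace_levi (inv_metric c) (loc_norm e c) (snd c x)) \<le> 0"
  unfolding trace_levi_def
proof (rule elliptic_at_max[OF open_chart_image[OF atlas c frame_props(1)[OF V]] _ loc_norm_twice_differentiable[OF V c]])
  obtain m where m: "\<And>x. norm_fun x = m" by (rule norm_fun_constant) blast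
  show "snd c x \<in> snd c ` (V \<inter> fst c)" using x by blast
  show "positive_definite (\<lambda>i j. inv_metric c i j (snd c x))"
    using x by (intro inv_metric_positive[OF c]) auto
  fix z assume "z \<in> snd c ` (V \<inter> fst c)"
  then obtain y where y: "y \<in> V" "y \<in> fst c" "z = snd c y" by blast
  show "Im (loc_norm e c z) = 0" "Re (loc_norm e c z) \<le> Re (loc_norm e c (snd c x))"
    unfolding y(3) norm_fun_loc[OF V c y(1,2)] norm_fun_loc[OF V c x] by (simp_all add: m)
qed

theorem closed_tensor_parallel:
  assumes V: "(V, e) \<in> frames E" and c: "c \<in> A" and x: "x \<in> V" "x \<in> fst c" and \<beta>: "\<beta> \<in> multi_index q (idx E)"
  shows "dz i ((\<lambda>y. T e y \<beta>) \<circ> chart_inv c) (snd c x)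
    + (\<Sum>\<alpha>\<in>multi_index q (idx E). T e x \<alpha> * derivation q (\<lambda>a b. coeffP c e i a b x) \<alpha> \<beta>) = 0"
proof -
  obtain ls where ls: "form_eigenvalues (fibre E x) (bundle_rank E) (g x) (ricci_form h E g D c e x) ls"
    "\<And>S. S \<subseteq> {..<bundle_rank E} \<Longrightarrow> card S = q \<Longrightarrow> (\<Sum>a\<in>S. ls ! a) \<le> 0"
    using eigenvalues[OF V c x] by blast
  show ?thesis
    by (rule local_bochner(2)[OF V c x ls trace_levi_nonpos[OF V c x] \<beta>])
qed

theorem closed_tensor_vanishes:
  assumes neg: "ricci_p_negative p A h E g D x0"
    and V: "(V, e) \<in> frames E" and x: "x \<in> V" and \<beta>: "\<beta> \<in> multi_index q (idx E)"
  shows "T e x \<beta> = 0"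
proof -
  obtain m where m: "\<And>x. norm_fun x = m" by (rule norm_fun_constant) blast
  obtain V0 e0 where V0: "(V0, e0) \<in> frames E" "x0 \<in> V0" by (rule ex_frame)
  obtain c where c: "c \<in> A" "x0 \<in> fst c" by (rule ex_chart[OF atlas])
  have "form_p_negative p (fibre E x0) (bundle_rank E) (g x0) (ricci_form h E g D c e0 x0)"
    using bspec[OF bspec[OF neg[unfolded ricci_p_negative_def] c(1)] V0(1), unfolded prod.case] V0(2) c(2) by blast
  then obtain ls where ls: "form_eigenvalues (fibre E x0) (bundle_rank E) (g x0) (ricci_form h E g D c e0 x0) ls"
    "\<And>S. S \<subseteq> {..<bundle_rank E} \<Longrightarrow> card S = p \<Longrightarrow> (\<Sum>a\<in>S. ls ! a) < 0"
    unfolding form_p_negative_def by blast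
  have lt: "(\<Sum>a\<in>S. ls ! a) < 0" if "S \<subseteq> {..<bundle_rank E}" "card S = q" for S
    by (rule subset_sums_neg[OF pq(2,1) ls(2) that])
  have "T e0 x0 \<alpha> = 0" if "\<alpha> \<in> multi_index q (idx E)" for \<alpha>
    by (rule local_bochner(3)[OF V0(1) c(1) V0(2) c(2) ls(1) less_imp_le[OF lt]
          trace_levi_nonpos[OF V0(1) c(1) V0(2) c(2)] lt that])
  then have "sq_norm e0 x0 = 0" by (simp add: sq_norm_def hprod_def)
  then have "m = 0" using norm_fun_eq[OF V0] m by simp
  then have "Re (sq_norm e x) = 0" using norm_fun_eq[OF V x] m by simp
  moreover obtain u where "orthonormal_at x u" by (rule ex_orthonormal)
  ultimately show ?thesis using sq_norm_zero[OF V x _ _ \<beta>] by blast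
qed

end

end

section \<open>Sections of the bundle as tensors of degree one\<close>

lemma sum_multi_index_1:
  fixes f :: "'a \<Rightarrow> 'k::comm_semiring_1"
  assumes "finite J"
  shows "(\<Sum>\<alpha>\<in>multi_index (Suc 0) J. f (\<alpha> 0)) = (\<Sum>a\<in>J. f a)"
  using sum_multi_index[OF assms, where q = "Suc 0" and f = "\<lambda>_. f"] by simp

lemma derivation_1: "derivation (Suc 0) X \<alpha> \<beta> = X (\<alpha> 0) (\<beta> 0)"
  by (simp add: derivation_def at_slot_def)

lemma (in bundle_space) conn_zero_if_axes:
  assumes D: "connection A E D" and s: "open W" "smooth_section A E W s" and x: "c \<in> A" "x \<in> W" "x \<in> fst c"
    and zero: "\<And>i. D s c x (axis i 1) = 0" "\<And>i. D s c x (axis i \<i>) = 0"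
  shows "D s c x v = 0"
proof -
  have D0: "D s c x 0 = 0" using conn_vec_scale[OF D s x, of 0 0] by simp
  have "D s c x (\<Sum>i\<in>I. Re (v $ i) *\<^sub>R axis i 1 + Im (v $ i) *\<^sub>R axis i \<i>) = 0" for I
    by (induction I rule: infinite_finite_induct)
      (simp_all add: D0 conn_vec_add[OF D s x] conn_vec_scale[OF D s x] zero)
  then show ?thesis by (subst vec_real_expansion[of v])
qed

context
  fixes A :: "('m::t2_space, 'n::finite) chart set"
    and h :: "('m, 'n) chart \<Rightarrow> 'm \<Rightarrow> complex ^ 'n ^ 'n"
    and E :: "(complex, 'm, 'v::ab_group_add, 'i) vbundle"
    and g :: "'m \<Rightarrow> 'v \<Rightarrow> 'v \<Rightarrow> complex"
    and D :: "('m, 'n, 'v) conn" and s :: "'m \<Rightarrow> 'v"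
  assumes mb: "metric_bundle A h E g D" and s: "s \<in> H0 A E D"
begin

interpretation metric_bundle A h E g D by (rule mb)

lemma H0_smooth: "smooth_section A E UNIV s"
  using s unfolding H0_def by blast

lemma H0_closed: "c \<in> A \<Longrightarrow> x \<in> fst c \<Longrightarrow> delbar E D c s j x = 0"
  using s unfolding H0_def by blast

lemma frame_coeff_0:
  assumes V: "(V, e) \<in> frames E" and x: "x \<in> V" and \<beta>: "\<beta> \<in> idx E"
  shows "frame_coeff E e x 0 \<beta> = 0"
  using frame_coeff_sum[OF V x \<beta>, of "\<lambda>_. 0"] by simp

text \<open>For q = 1 the alternating condition is void and the components are the frame
  coefficients, so sections enter directly and not through the first exterior power.\<close>

lemma section_closed_tensor:
  "closed_tensor A h E g D (Suc 0) (\<lambda>e x \<alpha>. frame_coeff E e x (s x) (\<alpha> 0))"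
proof
  show "smooth_map A V (\<lambda>x. frame_coeff E e x (s x) (\<alpha> 0))"
    if "(V, e) \<in> frames E" "\<alpha> \<in> multi_index (Suc 0) (idx E)" for V e \<alpha>
    using frame_coeff_smooth[OF open_UNIV H0_smooth that(1), of "\<alpha> 0"] that(2) by auto
  show "alternating_on (Suc 0) (idx E) (\<lambda>\<alpha>. frame_coeff E e x (s x) (\<alpha> 0))" for e x
    by (simp add: alternating_on_def)
  show "frame_coeff E e x (s x) (\<beta> 0) = tensor_coords (Suc 0) (idx E) t (\<lambda>\<alpha>. frame_coeff E e' x (s x) (\<alpha> 0)) \<beta>"
    if V: "(V, e) \<in> frames E" "(V', e') \<in> frames E" and x: "x \<in> V" "x \<in> V'"
      and t: "\<And>\<alpha>. \<alpha> \<in> idx E \<Longrightarrow> e' \<alpha> x = (\<Sum>\<beta>\<in>idx E. scl E (t \<alpha> \<beta>) (e \<beta> x))"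
      and \<beta>: "\<beta> \<in> multi_index (Suc 0) (idx E)" for V V' e e' x t \<beta>
  proof -
    have \<beta>0: "\<beta> 0 \<in> idx E" using \<beta> by auto
    let ?f = "frame_coeff E e' x (s x)"
    have "s x = (\<Sum>\<alpha>\<in>idx E. scl E (?f \<alpha>) (e' \<alpha> x))"
      using smooth_section_in_fibre[OF H0_smooth] by (intro frame_coeff_expansion[OF V(2) x(2)]) auto
    also have "\<dots> = (\<Sum>\<alpha>\<in>idx E. \<Sum>\<beta>\<in>idx E. scl E (?f \<alpha> * t \<alpha> \<beta>) (e \<beta> x))"
      by (intro sum.cong refl) (simp add: t V.scale_sum_right)
    also have "\<dots> = (\<Sum>\<beta>\<in>idx E. scl E (\<Sum>\<alpha>\<in>idx E. ?f \<alpha> * t \<alpha> \<beta>) (e \<beta> x))"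
      by (subst sum.swap) (simp add: V.scale_sum_left)
    finally have "frame_coeff E e x (s x) (\<beta> 0) = (\<Sum>\<alpha>\<in>idx E. ?f \<alpha> * t \<alpha> (\<beta> 0))"
      by (rule frame_coeff_unique[OF V(1) x(1) _ \<beta>0])
    then show ?thesis
      unfolding tensor_coords_def using sum_multi_index_1[OF finite_idx, of "\<lambda>a. t a (\<beta> 0) * ?f a"]
      by (simp add: mult.commute)
  qed
  show "dzb j ((\<lambda>y. frame_coeff E e y (s y) (\<beta> 0)) \<circ> chart_inv c) (snd c x)
      + (\<Sum>\<alpha>\<in>multi_index (Suc 0) (idx E). frame_coeff E e x (s x) (\<alpha> 0) * derivation (Suc 0) (\<lambda>a b. coeffN c e j a b x) \<alpha> \<beta>) = 0"
    if V: "(V, e) \<in> frames E" and c: "c \<in> A" and x: "x \<in> V" "x \<in> fst c" and \<beta>: "\<beta> \<in> multi_index (Suc 0) (idx E)"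
    for V e c x \<beta> j
  proof -
    have \<beta>0: "\<beta> 0 \<in> idx E" using \<beta> by auto
    show ?thesis
      unfolding derivation_1 sum_multi_index_1[OF finite_idx, of "\<lambda>a. frame_coeff E e x (s x) a * coeffN c e j a (\<beta> 0) x"]
      using frame_coeff_del(2)[OF V open_UNIV H0_smooth c UNIV_I x \<beta>0, of j]
      unfolding H0_closed[OF c x(2)] frame_coeff_0[OF V x(1) \<beta>0] by simp
  qed
qed

context
  fixes p :: nat
  assumes cpt: "compact (UNIV :: 'm set)" and conn: "connected (UNIV :: 'm set)"
    and nonpos: "\<And>x. ricci_p_nonpositive 1 A h E g D x"
begin

theorem H0_parallel: "parallel_section A D s"
  unfolding parallel_section_def
proof (intro ballI allI)
  fix c x v assume c: "c \<in> A" and x: "x \<in> fst c"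
  obtain V e where V: "(V, e) \<in> frames E" "x \<in> V" by (rule ex_frame)
  interpret T: closed_tensor A h E g D "Suc 0" "\<lambda>e x \<alpha>. frame_coeff E e x (s x) (\<alpha> 0)"
    by (rule section_closed_tensor)
  have fib: "wirt k s c i x \<in> fibre E x" for k i
    by (rule wirt_in_fibre[OF open_UNIV H0_smooth c UNIV_I x])
  have del0: "del E D c s i x = 0" for i
  proof -
    have "frame_coeff E e x (del E D c s i x) b = 0" if b: "b \<in> idx E" for b
    proof -
      let ?\<beta> = "\<lambda>k\<in>{..<Suc 0}. b"
      have \<beta>: "?\<beta> \<in> multi_index (Suc 0) (idx E)" using b by auto
      show ?thesis
        using T.closed_tensor_parallel[OF cpt conn order_refl _ nonpos V(1) c V(2) x \<beta>, of i]
        unfolding derivation_1 sum_multi_index_1[OF finite_idx, of "\<lambda>a. frame_coeff E e x (s x) a * coeffP c e i a (?\<beta> 0) x"]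
        using frame_coeff_del(1)[OF V(1) open_UNIV H0_smooth c UNIV_I V(2) x b, of i] by simp
    qed
    then show ?thesis
      using frame_coeff_expansion[OF V, of "del E D c s i x"] fib unfolding wirt_del by simp
  qed
  note delbar0 = H0_closed[OF c x]
  \<comment> \<open>The vanishing of both parts gives the real derivative along
    \<open>axis i 1\<close> as their sum; the one along \<open>axis i \<i>\<close> is then read off
    from \<open>delbar\<close>.\<close>
  have "del E D c s i x + delbar E D c s i x = D s c x (axis i 1)" for i
    unfolding del_def delbar_def using V.scale_left_distrib[of "1/2" "1/2" "D s c x (axis i 1)"] by (simp add: algebra_simps)
  then have a: "D s c x (axis i 1) = 0" for i using del0 delbar0 by (metis add.right_neutral)
  have "scl E (\<i>/2) (D s c x (axis i \<i>)) = 0" for i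
    using delbar0[of i] unfolding delbar_def a by simp
  then have b: "D s c x (axis i \<i>) = 0" for i by simp
  show "D s c x v = 0"
    by (rule conn_zero_if_axes[OF D open_UNIV H0_smooth c UNIV_I x a b])
qed

theorem H0_vanishes:
  assumes "ricci_p_negative 1 A h E g D x0"
  shows "s = (\<lambda>x. 0)"
proof
  fix x
  obtain V e where V: "(V, e) \<in> frames E" "x \<in> V" by (rule ex_frame)
  interpret T: closed_tensor A h E g D "Suc 0" "\<lambda>e x \<alpha>. frame_coeff E e x (s x) (\<alpha> 0)"
    by (rule section_closed_tensor)
  have "frame_coeff E e x (s x) b = 0" if b: "b \<in> idx E" for b
  proof -
    let ?\<beta> = "\<lambda>k\<in>{..<Suc 0}. b"
    have "?\<beta> \<in> multi_index (Suc 0) (idx E)" using b by auto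
    from T.closed_tensor_vanishes[OF cpt conn order_refl _ nonpos assms V this]
    show ?thesis by simp
  qed
  then show "s x = 0"
    using frame_coeff_expansion[OF V, of "s x"] smooth_section_in_fibre[OF H0_smooth] by simp
qed

end

end

section \<open>Exterior powers\<close>

lemma vector_space_field: "vector_space ((*) :: 'k::field \<Rightarrow> 'k \<Rightarrow> 'k)"
  by unfold_locales (simp_all add: algebra_simps)

lemma vector_space_fun_scl: "vector_space (fun_scl :: 'k::real_normed_field \<Rightarrow> ('a \<Rightarrow> 'k) \<Rightarrow> 'a \<Rightarrow> 'k)"
  by unfold_locales (simp_all add: fun_scl_def fun_eq_iff algebra_simps)

interpretation fun_vs: vector_space "fun_scl :: 'k::real_normed_field \<Rightarrow> ('a \<Rightarrow> 'k) \<Rightarrow> 'a \<Rightarrow> 'k"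
  by (rule vector_space_fun_scl)

lemma sum_fun_apply: "(\<Sum>i\<in>I. f i) y = (\<Sum>i\<in>I. f i y)" for f :: "'i \<Rightarrow> 'a \<Rightarrow> 'b::comm_monoid_add"
  by (induction I rule: infinite_finite_induct) auto

lemma sum_fun_scl_apply: "(\<Sum>i\<in>I. fun_scl (a i) (f i)) y = (\<Sum>i\<in>I. a i * f i y)"
  by (simp add: sum_fun_apply fun_scl_def)

text \<open>\<open>wedge\<close> works on lists and the tensor calculus on functions of the slot
  number; this translates between them.\<close>

abbreviation tabulate :: "nat \<Rightarrow> (nat \<Rightarrow> 'a) \<Rightarrow> 'a list" where
  "tabulate q f \<equiv> map f [0..<q]"

lemma list_tabulate: "length xs = q \<Longrightarrow> xs = tabulate q ((!) xs)"
  by (intro nth_equalityI) auto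

lemma prod_reindex_permutation:
  fixes f :: "nat \<Rightarrow> nat \<Rightarrow> 'k::comm_monoid_mult"
  assumes "\<sigma> permutes {..<q}"
  shows "(\<Prod>k<q. f k (\<sigma> k)) = (\<Prod>l<q. f (inv \<sigma> l) l)"
  using prod.permute[OF permutes_inv[OF assms], of "\<lambda>k. f k (\<sigma> k)"]
  by (simp add: o_def permutes_inverses[OF assms])

context smooth_bundle
begin

abbreviation W :: "'v list \<Rightarrow> ('v \<Rightarrow> 'k) list \<Rightarrow> 'k" where "W \<equiv> wedge (scl E)"

abbreviation lin :: "('v \<Rightarrow> 'k) \<Rightarrow> bool" where "lin \<equiv> Vector_Spaces.linear (scl E) (*)"

lemma lin_sum_scale:
  assumes "lin \<zeta>"
  shows "\<zeta> (\<Sum>i\<in>I. scl E (a i) (v i)) = (\<Sum>i\<in>I. a i * \<zeta> (v i))"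
proof -
  interpret \<zeta>: Vector_Spaces.linear "scl E" "(*)" \<zeta> by (rule assms)
  show ?thesis by (simp add: \<zeta>.sum \<zeta>.scale)
qed

lemma wedge_eval:
  assumes "\<And>k. k < q \<Longrightarrow> lin (\<zeta> k)"
  shows "W (tabulate q v) (tabulate q \<zeta>) = (\<Sum>\<sigma> | \<sigma> permutes {..<q}. of_int (sign \<sigma>) * (\<Prod>k<q. \<zeta> (\<sigma> k) (v k)))"
proof -
  have "W (tabulate q v) (tabulate q \<zeta>)
      = (\<Sum>\<sigma> | \<sigma> permutes {..<q}. of_int (sign \<sigma>) * (\<Prod>k<q. (tabulate q \<zeta> ! \<sigma> k) (tabulate q v ! k)))"
    using assms unfolding wedge_def by simp
  also have "\<dots> = (\<Sum>\<sigma> | \<sigma> permutes {..<q}. of_int (sign \<sigma>) * (\<Prod>k<q. \<zeta> (\<sigma> k) (v k)))"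
  proof (intro sum.cong refl arg_cong2[where f="(*)"] prod.cong)
    fix \<sigma> k assume "\<sigma> \<in> {\<sigma>. \<sigma> permutes {..<q}}" "k \<in> {..<q}"
    then have "\<sigma> k < q" "k < q" using permutes_in_image[of \<sigma> "{..<q}" k] by simp_all
    then show "(tabulate q \<zeta> ! \<sigma> k) (tabulate q v ! k) = \<zeta> (\<sigma> k) (v k)" by simp
  qed
  finally show ?thesis .
qed

lemma wedge_ill_formed:
  assumes "length vs = q" "\<not> (length \<zeta>s = q \<and> (\<forall>\<xi>\<in>set \<zeta>s. lin \<xi>))"
  shows "W vs \<zeta>s = 0"
  using assms unfolding wedge_def by auto

text \<open>Wedges are total and take the value 0 on lists of the wrong length or with nonlinear
  entries, so equality requires a separate check there.\<close>

lemma wedge_eqI: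
  assumes "\<And>\<zeta>. (\<And>k. k < q \<Longrightarrow> lin (\<zeta> k)) \<Longrightarrow> X (tabulate q \<zeta>) = Y (tabulate q \<zeta>)"
    and "\<And>\<zeta>s. \<not> (length \<zeta>s = q \<and> (\<forall>\<xi>\<in>set \<zeta>s. lin \<xi>)) \<Longrightarrow> X \<zeta>s = Y \<zeta>s"
  shows "X = Y"
proof
  fix \<zeta>s
  show "X \<zeta>s = Y \<zeta>s"
  proof (cases "length \<zeta>s = q \<and> (\<forall>\<xi>\<in>set \<zeta>s. lin \<xi>)")
    case True
    then have "X (tabulate q ((!) \<zeta>s)) = Y (tabulate q ((!) \<zeta>s))" by (intro assms(1)) simp
    then show ?thesis using list_tabulate[of \<zeta>s q] True by simp
  qed (rule assms(2))
qed

lemma wedge_permute: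
  assumes \<pi>: "\<pi> permutes {..<q}"
  shows "W (tabulate q (\<lambda>k. v (\<pi> k))) = fun_scl (of_int (sign \<pi>)) (W (tabulate q v))"
proof (rule wedge_eqI[where q = q])
  fix \<zeta> assume \<zeta>: "\<And>k. k < q \<Longrightarrow> lin (\<zeta> k)"
  let ?S = "{\<sigma>. \<sigma> permutes {..<q}}"
  have "W (tabulate q (\<lambda>k. v (\<pi> k))) (tabulate q \<zeta>)
      = (\<Sum>\<sigma>\<in>?S. of_int (sign \<sigma>) * (\<Prod>k<q. \<zeta> (\<sigma> k) (v (\<pi> k))))"
    by (rule wedge_eval[OF \<zeta>])
  also have "\<dots> = (\<Sum>\<sigma>\<in>?S. of_int (sign (\<sigma> \<circ> \<pi>)) * (\<Prod>k<q. \<zeta> ((\<sigma> \<circ> \<pi>) k) (v (\<pi> k))))"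
    by (rule sum_permutations_compose_right[OF \<pi>])
  also have "\<dots> = (\<Sum>\<sigma>\<in>?S. of_int (sign \<pi>) * (of_int (sign \<sigma>) * (\<Prod>k<q. \<zeta> (\<sigma> k) (v k))))"
  proof (intro sum.cong refl)
    fix \<sigma> assume "\<sigma> \<in> ?S"
    then have "sign (\<sigma> \<circ> \<pi>) = sign \<sigma> * sign \<pi>"
      using \<pi> by (intro sign_compose permutation_permutes[THEN iffD2]) auto
    moreover have "(\<Prod>k<q. \<zeta> ((\<sigma> \<circ> \<pi>) k) (v (\<pi> k))) = (\<Prod>k<q. \<zeta> (\<sigma> k) (v k))"
      using prod.permute[OF \<pi>, of "\<lambda>k. \<zeta> (\<sigma> k) (v k)"] by (simp add: o_def)
    ultimately show "of_int (sign (\<sigma> \<circ> \<pi>)) * (\<Prod>k<q. \<zeta> ((\<sigma> \<circ> \<pi>) k) (v (\<pi> k))) = of_int (sign \<pi>) * (of_int (sign \<sigma>) * (\<Prod>k<q. \<zeta> (\<sigma> k) (v k)))"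
      by (simp add: mult_ac)
  qed
  also have "\<dots> = fun_scl (of_int (sign \<pi>)) (W (tabulate q v)) (tabulate q \<zeta>)"
    by (simp add: fun_scl_def wedge_eval[OF \<zeta>] sum_distrib_left)
  finally show "W (tabulate q (\<lambda>k. v (\<pi> k))) (tabulate q \<zeta>) = fun_scl (of_int (sign \<pi>)) (W (tabulate q v)) (tabulate q \<zeta>)" .
qed (simp add: fun_scl_def wedge_ill_formed)

text \<open>The counterpart of \<open>wedge_permute\<close> on the side of the linear forms; it
  makes the components of an element of the exterior power alternating.\<close>

lemma wedge_permute_forms:
  assumes \<pi>: "\<pi> permutes {..<q}" and \<zeta>: "\<And>k. k < q \<Longrightarrow> lin (\<zeta> k)"
  shows "W (tabulate q v) (tabulate q (\<lambda>k. \<zeta> (\<pi> k))) = of_int (sign \<pi>) * W (tabulate q v) (tabulate q \<zeta>)"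
proof -
  let ?S = "{\<sigma>. \<sigma> permutes {..<q}}"
  have \<zeta>': "lin (\<zeta> (\<pi> k))" if "k < q" for k
    using permutes_in_image[OF \<pi>, of k] that by (intro \<zeta>) simp
  have "W (tabulate q v) (tabulate q (\<lambda>k. \<zeta> (\<pi> k))) = (\<Sum>\<sigma>\<in>?S. of_int (sign \<sigma>) * (\<Prod>k<q. \<zeta> (\<pi> (\<sigma> k)) (v k)))"
    by (rule wedge_eval[OF \<zeta>'])
  also have "\<dots> = (\<Sum>\<sigma>\<in>?S. of_int (sign \<pi>) * (of_int (sign (\<pi> \<circ> \<sigma>)) * (\<Prod>k<q. \<zeta> ((\<pi> \<circ> \<sigma>) k) (v k))))"
  proof (intro sum.cong refl)
    fix \<sigma> assume "\<sigma> \<in> ?S"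
    then have "sign (\<pi> \<circ> \<sigma>) = sign \<pi> * sign \<sigma>"
      using \<pi> by (intro sign_compose permutation_permutes[THEN iffD2]) auto
    then have "of_int (sign \<pi>) * of_int (sign (\<pi> \<circ> \<sigma>)) = (of_int (sign \<sigma>) :: 'k)"
      by (simp add: sign_def)
    then show "of_int (sign \<sigma>) * (\<Prod>k<q. \<zeta> (\<pi> (\<sigma> k)) (v k)) = of_int (sign \<pi>) * (of_int (sign (\<pi> \<circ> \<sigma>)) * (\<Prod>k<q. \<zeta> ((\<pi> \<circ> \<sigma>) k) (v k)))"
      by (simp add: mult.assoc[symmetric])
  qed
  also have "\<dots> = (\<Sum>\<sigma>\<in>?S. of_int (sign \<pi>) * (of_int (sign \<sigma>) * (\<Prod>k<q. \<zeta> (\<sigma> k) (v k))))"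
    by (rule setum_permutations_compose_left[OF \<pi>, symmetric])
  finally show ?thesis by (simp add: wedge_eval[OF \<zeta>] sum_distrib_left)
qed

text \<open>The expansion produces all tuples. Those with repetitions are removed by
  \<open>wedge_not_inj\<close>, the others are brought into increasing order by
  \<open>wedge_sorted\<close>.\<close>

lemma wedge_multilinear:
  assumes I: "finite I"
  shows "W (tabulate q (\<lambda>k. \<Sum>b\<in>I. scl E (t k b) (u b)))
    = (\<Sum>\<beta>\<in>multi_index q I. fun_scl (\<Prod>k<q. t k (\<beta> k)) (W (tabulate q (\<lambda>k. u (\<beta> k)))))"
proof (rule wedge_eqI[where q = q])
  fix \<zeta> assume \<zeta>: "\<And>k. k < q \<Longrightarrow> lin (\<zeta> k)"
  let ?S = "{\<sigma>. \<sigma> permutes {..<q}}"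
  have eval: "W (tabulate q v) (tabulate q \<zeta>) = (\<Sum>\<sigma>\<in>?S. of_int (sign \<sigma>) * (\<Prod>k<q. \<zeta> (\<sigma> k) (v k)))" for v
    by (rule wedge_eval[OF \<zeta>])
  have "W (tabulate q (\<lambda>k. \<Sum>b\<in>I. scl E (t k b) (u b))) (tabulate q \<zeta>)
     = (\<Sum>\<sigma>\<in>?S. of_int (sign \<sigma>) * (\<Prod>k<q. \<Sum>b\<in>I. t k b * \<zeta> (\<sigma> k) (u b)))"
    unfolding eval
  proof (intro sum.cong refl arg_cong2[where f="(*)"] prod.cong)
    fix \<sigma> k assume "\<sigma> \<in> ?S" "k \<in> {..<q}"
    then have "\<sigma> k < q" using permutes_in_image[of \<sigma> "{..<q}" k] by simp
    then show "\<zeta> (\<sigma> k) (\<Sum>b\<in>I. scl E (t k b) (u b)) = (\<Sum>b\<in>I. t k b * \<zeta> (\<sigma> k) (u b))"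
      by (intro lin_sum_scale \<zeta>)
  qed
  also have "\<dots> = (\<Sum>\<sigma>\<in>?S. \<Sum>\<beta>\<in>multi_index q I. (\<Prod>k<q. t k (\<beta> k)) * (of_int (sign \<sigma>) * (\<Prod>k<q. \<zeta> (\<sigma> k) (u (\<beta> k)))))"
  proof (intro sum.cong refl)
    fix \<sigma>
    have "(\<Prod>k<q. \<Sum>b\<in>I. t k b * \<zeta> (\<sigma> k) (u b)) = (\<Sum>\<beta>\<in>multi_index q I. \<Prod>k<q. t k (\<beta> k) * \<zeta> (\<sigma> k) (u (\<beta> k)))"
      by (rule sum_multi_index[OF I, where f = "\<lambda>k b. t k b * \<zeta> (\<sigma> k) (u b)", symmetric])
    then show "of_int (sign \<sigma>) * (\<Prod>k<q. \<Sum>b\<in>I. t k b * \<zeta> (\<sigma> k) (u b)) =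
       (\<Sum>\<beta>\<in>multi_index q I. (\<Prod>k<q. t k (\<beta> k)) * (of_int (sign \<sigma>) * (\<Prod>k<q. \<zeta> (\<sigma> k) (u (\<beta> k)))))"
      by (simp only: sum_distrib_left prod.distrib mult_ac)
  qed
  also have "\<dots> = (\<Sum>\<beta>\<in>multi_index q I. (\<Prod>k<q. t k (\<beta> k)) * W (tabulate q (\<lambda>k. u (\<beta> k))) (tabulate q \<zeta>))"
    unfolding eval sum_distrib_left by (rule sum.swap)
  finally show "W (tabulate q (\<lambda>k. \<Sum>b\<in>I. scl E (t k b) (u b))) (tabulate q \<zeta>)
    = (\<Sum>\<beta>\<in>multi_index q I. fun_scl (\<Prod>k<q. t k (\<beta> k)) (W (tabulate q (\<lambda>k. u (\<beta> k))))) (tabulate q \<zeta>)"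
    unfolding sum_fun_scl_apply .
qed (simp add: sum_fun_scl_apply wedge_ill_formed)

text \<open>Transposing two equal vectors changes nothing and reverses the sign, so the wedge equals
  its own negative.\<close>

lemma wedge_not_inj:
  assumes "\<not> inj_on \<beta> {..<q}"
  shows "W (tabulate q (\<lambda>k. u (\<beta> k))) = 0"
proof -
  obtain i j where ij: "i < q" "j < q" "i \<noteq> j" "\<beta> i = \<beta> j"
    using assms unfolding inj_on_def by auto
  let ?\<tau> = "Transposition.transpose i j"
  have \<tau>: "?\<tau> permutes {..<q}" using ij by (intro permutes_swap_id) auto
  have "(\<lambda>k. u (\<beta> (?\<tau> k))) = (\<lambda>k. u (\<beta> k))" using ij(4) by (auto simp: Transposition.transpose_def)
  then have "W (tabulate q (\<lambda>k. u (\<beta> k))) = fun_scl (of_int (sign ?\<tau>)) (W (tabulate q (\<lambda>k. u (\<beta> k))))"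
    using wedge_permute[OF \<tau>, of "\<lambda>k. u (\<beta> k)"] by simp
  then have "W (tabulate q (\<lambda>k. u (\<beta> k))) \<zeta>s = - W (tabulate q (\<lambda>k. u (\<beta> k))) \<zeta>s" for \<zeta>s
    using ij(3) by (simp add: sign_swap_id fun_scl_def fun_eq_iff)
  then have "2 * W (tabulate q (\<lambda>k. u (\<beta> k))) \<zeta>s = 0" for \<zeta>s
    by (metis add.right_inverse mult_2)
  then show ?thesis by (simp add: fun_eq_iff)
qed

end

text \<open>The frames of \<open>ext_power\<close> are indexed by increasing lists. The sign depends
  only on the order of the indices, hence a single \<pi> serves for all vectors u.\<close>

lemma (in smooth_bundle) wedge_sorted:
  fixes \<beta> :: "nat \<Rightarrow> 'j::linorder"
  assumes "inj_on \<beta> {..<q}"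
  obtains I and \<pi> :: "nat \<Rightarrow> nat" where "length I = q" "set I = \<beta> ` {..<q}" "sorted_wrt (<) I"
    "\<And>u. W (tabulate q (\<lambda>k. u (\<beta> k))) = fun_scl (of_int (sign \<pi>)) (W (map u I))"
proof -
  define I where "I = sorted_list_of_set (\<beta> ` {..<q})"
  have I: "length I = q" "set I = \<beta> ` {..<q}" "sorted_wrt (<) I"
    using assms by (simp_all add: I_def card_image)
  \<comment> \<open>The position of \<beta> k in the sorted list; the identity from q on, as a
    permutation of the slots requires.\<close>
  define \<rho> where "\<rho> k = (if k < q then (THE l. l < q \<and> I ! l = \<beta> k) else k)" for k
  have dist: "distinct I" using I(3) strict_sorted_iff by blast
  have \<rho>: "\<rho> k < q \<and> I ! \<rho> k = \<beta> k" if "k < q" for k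
  proof -
    have "\<exists>!l. l < q \<and> I ! l = \<beta> k"
    proof -
      have "\<beta> k \<in> set I" using I(2) that by auto
      then obtain l where l: "l < q" "I ! l = \<beta> k" using I(1) by (auto simp: in_set_conv_nth)
      show ?thesis
      proof (rule ex1I[of _ l])
        show "l < q \<and> I ! l = \<beta> k" using l by (rule conjI)
        show "l' = l" if "l' < q \<and> I ! l' = \<beta> k" for l'
          using nth_eq_iff_index_eq[OF dist, of l' l] that l I(1) by simp
      qed
    qed
    from theI'[OF this] show ?thesis using that by (simp add: \<rho>_def)
  qed
  have perm: "\<rho> permutes {..<q}"
  proof (rule bij_imp_permutes)
    have "inj_on \<rho> {..<q}"
      using \<rho> assms by (intro inj_onI) (metis inj_on_def lessThan_iff)
    moreover have "\<rho> ` {..<q} \<subseteq> {..<q}" using \<rho> by auto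
    ultimately show "bij_betw \<rho> {..<q} {..<q}"
      by (simp add: bij_betw_def endo_inj_surj)
  qed (simp add: \<rho>_def)
  have "W (tabulate q (\<lambda>k. u (\<beta> k))) = fun_scl (of_int (sign \<rho>)) (W (map u I))" for u
  proof -
    have "tabulate q (\<lambda>k. u (\<beta> k)) = tabulate q (\<lambda>k. u (I ! \<rho> k))" using \<rho> by simp
    moreover have "tabulate q (\<lambda>k. u (I ! k)) = map u I"
      using I(1) by (intro nth_equalityI) auto
    ultimately show ?thesis using wedge_permute[OF perm, of "\<lambda>k. u (I ! k)"] by (simp only:)
  qed
  from that[OF I this] show thesis .
qed

section \<open>Dual frames and components of wedges\<close>

context smooth_bundle
begin

text \<open>\<open>wedge\<close> takes linear forms on the whole ambient space, while the frame
  determines them on the fibre only; the extension is arbitrary and therefore chosen.\<close>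

definition dualf :: "('i \<Rightarrow> 'm \<Rightarrow> 'v) \<Rightarrow> 'm \<Rightarrow> 'i \<Rightarrow> 'v \<Rightarrow> 'k" where
  "dualf e x \<beta> = (SOME \<xi>. lin \<xi> \<and> (\<forall>\<alpha>\<in>idx E. \<xi> (e \<alpha> x) = kron \<alpha> \<beta>))"

lemma dualf:
  assumes V: "(V, e) \<in> frames E" and x: "x \<in> V"
  shows "lin (dualf e x \<beta>)" "\<alpha> \<in> idx E \<Longrightarrow> dualf e x \<beta> (e \<alpha> x) = kron \<alpha> \<beta>"
proof -
  interpret P: vector_space_pair "scl E" "(*) :: 'k \<Rightarrow> 'k \<Rightarrow> 'k"
    by (intro vector_space_pair.intro vs vector_space_field)
  let ?B = "(\<lambda>\<alpha>. e \<alpha> x) ` idx E"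
  obtain \<xi> where \<xi>: "lin \<xi>" "\<forall>b\<in>?B. \<xi> b = kron (inv_into (idx E) (\<lambda>\<alpha>. e \<alpha> x) b) \<beta>"
    using P.linear_independent_extend[OF frame_props(3)[OF V x], of "\<lambda>b. kron (inv_into (idx E) (\<lambda>\<alpha>. e \<alpha> x) b) \<beta>"] by blast
  have "\<xi> (e \<alpha> x) = kron \<alpha> \<beta>" if "\<alpha> \<in> idx E" for \<alpha>
    using \<xi>(2) that inv_into_f_f[OF frame_props(2)[OF V x] that] by simp
  then have "\<exists>\<xi>. lin \<xi> \<and> (\<forall>\<alpha>\<in>idx E. \<xi> (e \<alpha> x) = kron \<alpha> \<beta>)" using \<xi>(1) by blast
  from someI_ex[OF this] show "lin (dualf e x \<beta>)" "\<alpha> \<in> idx E \<Longrightarrow> dualf e x \<beta> (e \<alpha> x) = kron \<alpha> \<beta>"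
    unfolding dualf_def by blast+
qed

text \<open>Restricted to the fibre, every linear form is a combination of the dual frame. Outside
  the fibre the chosen extensions need not satisfy such a relation.\<close>

lemma lin_expansion:
  assumes V: "(V, e) \<in> frames E" and x: "x \<in> V" and \<zeta>: "lin \<zeta>" and v: "v \<in> fibre E x"
  shows "\<zeta> v = (\<Sum>a\<in>idx E. \<zeta> (e a x) * dualf e x a v)"
proof -
  let ?f = "frame_coeff E e x v"
  have v_eq: "v = (\<Sum>a\<in>idx E. scl E (?f a) (e a x))" by (rule frame_coeff_expansion[OF V x v])
  have "dualf e x a v = ?f a" if "a \<in> idx E" for a
  proof -
    have "dualf e x a v = (\<Sum>b\<in>idx E. ?f b * dualf e x a (e b x))"
      by (subst v_eq, rule lin_sum_scale[OF dualf(1)[OF V x]])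
    also have "\<dots> = (\<Sum>b\<in>idx E. ?f b * kron b a)" by (simp add: dualf(2)[OF V x])
    finally show ?thesis using sum_kron(2)[OF finite_idx that, of ?f] by simp
  qed
  moreover have "\<zeta> v = (\<Sum>a\<in>idx E. ?f a * \<zeta> (e a x))"
    by (subst v_eq, rule lin_sum_scale[OF \<zeta>])
  ultimately show ?thesis by (simp add: mult.commute cong: sum.cong)
qed

text \<open>The components of an element of the exterior power as an alternating tensor over the
  frame e; this is the passage from \<open>ext_power\<close> to
  \<open>closed_tensor\<close>.\<close>

definition wcomp :: "nat \<Rightarrow> ('i \<Rightarrow> 'm \<Rightarrow> 'v) \<Rightarrow> 'm \<Rightarrow> (('v \<Rightarrow> 'k) list \<Rightarrow> 'k) \<Rightarrow> (nat \<Rightarrow> 'i) \<Rightarrow> 'k" where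
  "wcomp q e x \<omega> \<beta> = \<omega> (tabulate q (\<lambda>k. dualf e x (\<beta> k)))"

lemma wcomp_linear: "wcomp q e x (\<Sum>i\<in>I. fun_scl (a i) (\<omega> i)) \<beta> = (\<Sum>i\<in>I. a i * wcomp q e x (\<omega> i) \<beta>)"
  by (simp add: wcomp_def sum_fun_scl_apply)

lemma wcomp_add: "wcomp q e x (\<omega> + \<omega>') \<beta> = wcomp q e x \<omega> \<beta> + wcomp q e x \<omega>' \<beta>"
  by (simp add: wcomp_def)

lemma wcomp_fun_scl: "wcomp q e x (fun_scl a \<omega>) \<beta> = a * wcomp q e x \<omega> \<beta>"
  by (simp add: wcomp_def fun_scl_def)

text \<open>The values on all lists of linear forms are determined by those on the dual frame, so
  the components determine the element.\<close>

lemma wedge_expand: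
  assumes V: "(V, e) \<in> frames E" and x: "x \<in> V" and v: "\<And>k. k < q \<Longrightarrow> v k \<in> fibre E x"
    and \<zeta>: "\<And>k. k < q \<Longrightarrow> lin (\<zeta> k)"
  shows "W (tabulate q v) (tabulate q \<zeta>)
    = (\<Sum>\<alpha>\<in>multi_index q (idx E). (\<Prod>k<q. \<zeta> k (e (\<alpha> k) x)) * wcomp q e x (W (tabulate q v)) \<alpha>)"
proof -
  let ?S = "{\<sigma>. \<sigma> permutes {..<q}}" and ?I = "multi_index q (idx E)"
  have "(\<Sum>\<alpha>\<in>?I. (\<Prod>k<q. \<zeta> k (e (\<alpha> k) x)) * wcomp q e x (W (tabulate q v)) \<alpha>)
     = (\<Sum>\<alpha>\<in>?I. \<Sum>\<sigma>\<in>?S. of_int (sign \<sigma>) * ((\<Prod>k<q. \<zeta> k (e (\<alpha> k) x)) * (\<Prod>k<q. dualf e x (\<alpha> (\<sigma> k)) (v k))))"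
    unfolding wcomp_def
    by (subst wedge_eval) (simp_all add: dualf(1)[OF V x] sum_distrib_left mult_ac)
  also have "\<dots> = (\<Sum>\<sigma>\<in>?S. \<Sum>\<alpha>\<in>?I. of_int (sign \<sigma>) * ((\<Prod>k<q. \<zeta> k (e (\<alpha> k) x)) * (\<Prod>k<q. dualf e x (\<alpha> (\<sigma> k)) (v k))))"
    by (rule sum.swap)
  also have "\<dots> = (\<Sum>\<sigma>\<in>?S. of_int (sign \<sigma>) * (\<Prod>k<q. \<zeta> (\<sigma> k) (v k)))"
  proof (intro sum.cong refl)
    fix \<sigma> assume "\<sigma> \<in> ?S"
    then have \<sigma>: "\<sigma> permutes {..<q}" by simp
    \<comment> \<open>Moving the permutation from the index tuple to the vectors makes each factor
      depend on one slot of \<alpha>, so the sum over tuples factors.\<close>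
    have "(\<Sum>\<alpha>\<in>?I. (\<Prod>k<q. \<zeta> k (e (\<alpha> k) x)) * (\<Prod>k<q. dualf e x (\<alpha> (\<sigma> k)) (v k)))
        = (\<Sum>\<alpha>\<in>?I. \<Prod>k<q. \<zeta> k (e (\<alpha> k) x) * dualf e x (\<alpha> k) (v (inv \<sigma> k)))"
      unfolding prod_reindex_permutation[OF \<sigma>, where f = "\<lambda>k l. dualf e x (_ l) (v k)"] prod.distrib ..
    also have "\<dots> = (\<Prod>k<q. \<Sum>a\<in>idx E. \<zeta> k (e a x) * dualf e x a (v (inv \<sigma> k)))"
      by (rule sum_multi_index[OF finite_idx, where f = "\<lambda>k a. \<zeta> k (e a x) * dualf e x a (v (inv \<sigma> k))"])
    also have "\<dots> = (\<Prod>k<q. \<zeta> k (v (inv \<sigma> k)))"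
      using permutes_in_image[OF permutes_inv[OF \<sigma>]]
      by (intro prod.cong refl lin_expansion[OF V x, symmetric] \<zeta> v) auto
    also have "\<dots> = (\<Prod>k<q. \<zeta> (\<sigma> k) (v k))"
      by (rule prod_reindex_permutation[OF \<sigma>, where f = "\<lambda>k l. \<zeta> l (v k)", symmetric])
    finally show "(\<Sum>\<alpha>\<in>?I. of_int (sign \<sigma>) * ((\<Prod>k<q. \<zeta> k (e (\<alpha> k) x)) * (\<Prod>k<q. dualf e x (\<alpha> (\<sigma> k)) (v k))))
       = of_int (sign \<sigma>) * (\<Prod>k<q. \<zeta> (\<sigma> k) (v k))"
      by (simp only: sum_distrib_left[symmetric])
  qed
  also have "\<dots> = W (tabulate q v) (tabulate q \<zeta>)" by (rule wedge_eval[OF \<zeta>, symmetric])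
  finally show ?thesis ..
qed

end

lemma dfun_cong:
  assumes "complex_atlas A" "c \<in> A" "open S" "x \<in> S" "x \<in> fst c" "\<And>y. y \<in> S \<Longrightarrow> f y = g y"
  shows "dfun f c x v = dfun g c x v"
proof -
  let ?U = "snd c ` (S \<inter> fst c)"
  have U: "open ?U" "snd c x \<in> ?U" using open_chart_image[OF assms(1-3)] assms(4,5) by auto
  have eq: "(f \<circ> chart_inv c) z = (g \<circ> chart_inv c) z" if "z \<in> ?U" for z
    using that assms(6) chart_inv_inverse[OF assms(1,2)] by auto
  have *: "(u has_derivative F) (at (snd c x))"
    if "(w has_derivative F) (at (snd c x))" "\<And>z. z \<in> ?U \<Longrightarrow> w z = u z" for F u w
    by (rule has_derivative_transform_within_open[OF that(1) U that(2)])
  have "((f \<circ> chart_inv c) has_derivative F) (at (snd c x)) \<longleftrightarrow> ((g \<circ> chart_inv c) has_derivative F) (at (snd c x))" for F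
    using *[of "f \<circ> chart_inv c" F "g \<circ> chart_inv c"] *[of "g \<circ> chart_inv c" F "f \<circ> chart_inv c"] eq by metis
  then show ?thesis unfolding dfun_def frechet_derivative_def by presburger
qed

lemma dfun_sum_const:
  fixes f :: "'i \<Rightarrow> 'm \<Rightarrow> 'k::real_normed_field"
  assumes "\<And>i. i \<in> I \<Longrightarrow> (f i \<circ> chart_inv c) differentiable (at (snd c x))"
  shows "dfun (\<lambda>y. \<Sum>i\<in>I. f i y * k i) c x v = (\<Sum>i\<in>I. dfun (f i) c x v * k i)"
proof -
  have "((\<lambda>z. \<Sum>i\<in>I. (f i \<circ> chart_inv c) z * k i) has_derivative
      (\<lambda>v. \<Sum>i\<in>I. frechet_derivative (f i \<circ> chart_inv c) (at (snd c x)) v * k i)) (at (snd c x))"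
    by (intro has_derivative_sum has_derivative_mult_left frechet_has_derivative assms)
  from frechet_derivative_eqI[OF this] show ?thesis
    by (simp add: dfun_def o_def)
qed

section \<open>The exterior power bundle and its induced connection\<close>

locale ext_bundle = smooth_bundle A E
  for A :: "('m::topological_space, 'n::finite) chart set"
    and E :: "('k::real_normed_field, 'm, 'v::ab_group_add, 'i::linorder) vbundle" +
  fixes q :: nat
begin

abbreviation \<Lambda> where "\<Lambda> \<equiv> ext_power q E"

abbreviation wframe :: "('i \<Rightarrow> 'm \<Rightarrow> 'v) \<Rightarrow> 'i list \<Rightarrow> 'm \<Rightarrow> ('v \<Rightarrow> 'k) list \<Rightarrow> 'k" where
  "wframe e \<equiv> (\<lambda>\<alpha>s x. W (map (\<lambda>\<alpha>. e \<alpha> x) \<alpha>s))"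

lemma ext_sel [simp]:
  "scl \<Lambda> = fun_scl"
  "fibre \<Lambda> x = fun_vs.span {W vs | vs. length vs = q \<and> set vs \<subseteq> fibre E x}"
  "idx \<Lambda> = {\<alpha>s. length \<alpha>s = q \<and> set \<alpha>s \<subseteq> idx E \<and> sorted_wrt (<) \<alpha>s}"
  by (simp_all add: ext_power_def)

lemma ext_frames: "(V, e) \<in> frames E \<Longrightarrow> (V, wframe e) \<in> frames \<Lambda>"
  unfolding ext_power_def by (auto intro!: rev_image_eqI[of "(V, e)"])

lemma ext_framesE:
  assumes "(V, w) \<in> frames \<Lambda>"
  obtains e where "(V, e) \<in> frames E" "w = wframe e"
  using assms unfolding ext_power_def by auto

sublocale X: bundle_space A \<Lambda>
proof
  show "complex_atlas A" by (rule atlas)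
  have "vector_space (scl \<Lambda>)" unfolding ext_sel by (rule vector_space_fun_scl)
  then show "\<And>a x y. scl \<Lambda> a (x + y) = scl \<Lambda> a x + scl \<Lambda> a y"
    "\<And>a b x. scl \<Lambda> (a + b) x = scl \<Lambda> a x + scl \<Lambda> b x"
    "\<And>a b x. scl \<Lambda> a (scl \<Lambda> b x) = scl \<Lambda> (a * b) x" "\<And>x. scl \<Lambda> 1 x = x"
    by (simp_all add: vector_space_def)
  show "module.subspace (scl \<Lambda>) (fibre \<Lambda> x)" for x
    unfolding ext_sel by (rule fun_vs.subspace_span)
  show "open V" if "(V, w) \<in> frames \<Lambda>" for V w
    using that by (rule ext_framesE) (rule frame_props(1))
qed

lemma finite_ext_idx: "finite (idx \<Lambda>)"
  unfolding ext_sel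
  by (rule finite_subset[OF _ finite_lists_length_eq[OF finite_idx, of q]]) auto

lemma ext_idx_nth: "I \<in> idx \<Lambda> \<Longrightarrow> k < q \<Longrightarrow> I ! k \<in> idx E"
  unfolding ext_sel by (auto simp: subset_iff)

lemma wframe_tabulate: "I \<in> idx \<Lambda> \<Longrightarrow> wframe e I x = W (tabulate q (\<lambda>k. e (I ! k) x))"
  unfolding ext_sel by (intro arg_cong[where f = W] nth_equalityI) auto

lemma wframe_in_fibre:
  assumes "(V, e) \<in> frames E" "x \<in> V" "I \<in> idx \<Lambda>"
  shows "wframe e I x \<in> fibre \<Lambda> x"
proof -
  have "length (map (\<lambda>\<alpha>. e \<alpha> x) I) = q" "set (map (\<lambda>\<alpha>. e \<alpha> x) I) \<subseteq> fibre E x"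
    using assms(3) frame_in_fibre[OF assms(1,2)] unfolding ext_sel by auto
  then show ?thesis unfolding ext_sel by (intro fun_vs.span_base) blast
qed

text \<open>Fibres are spans of decomposable vectors, so linear identities between components need
  to be verified on these alone.\<close>

lemma ext_fibre_induct [consumes 1, case_names zero add scale wedge]:
  assumes \<omega>: "\<omega> \<in> fibre \<Lambda> x" and "P 0" and "\<And>\<omega> \<omega>'. P \<omega> \<Longrightarrow> P \<omega>' \<Longrightarrow> P (\<omega> + \<omega>')"
    and "\<And>a \<omega>. P \<omega> \<Longrightarrow> P (fun_scl a \<omega>)"
    and gen: "\<And>v. (\<And>k. k < q \<Longrightarrow> v k \<in> fibre E x) \<Longrightarrow> P (W (tabulate q v))"
  shows "P \<omega>"
proof -
  have "fun_vs.subspace (Collect P)"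
    unfolding fun_vs.subspace_def using assms(2-4) by blast
  moreover have "{W vs | vs. length vs = q \<and> set vs \<subseteq> fibre E x} \<subseteq> Collect P"
  proof clarify
    fix vs assume vs: "set vs \<subseteq> fibre E x" "q = length vs"
    have "P (W (tabulate q ((!) vs)))" using vs by (intro gen) auto
    then show "P (W vs)" using list_tabulate[of vs q] vs(2) by simp
  qed
  ultimately show ?thesis
    using fun_vs.span_minimal \<omega> unfolding ext_sel by blast
qed

lemma ext_ill_formed:
  assumes "\<omega> \<in> fibre \<Lambda> x" "\<not> (length \<zeta>s = q \<and> (\<forall>\<xi>\<in>set \<zeta>s. lin \<xi>))"
  shows "\<omega> \<zeta>s = 0"
  using assms(1)
proof (induction rule: ext_fibre_induct)
  case (wedge v)
  show ?case by (rule wedge_ill_formed[OF _ assms(2)]) simp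
qed (simp_all add: fun_scl_def)

lemma ext_expand:
  assumes "\<omega> \<in> fibre \<Lambda> x" and V: "(V, e) \<in> frames E" and x: "x \<in> V" and \<zeta>: "\<And>k. k < q \<Longrightarrow> lin (\<zeta> k)"
  shows "\<omega> (tabulate q \<zeta>) = (\<Sum>\<alpha>\<in>multi_index q (idx E). (\<Prod>k<q. \<zeta> k (e (\<alpha> k) x)) * wcomp q e x \<omega> \<alpha>)"
  using assms(1)
proof (induction rule: ext_fibre_induct)
  case add
  then show ?case by (simp add: wcomp_def distrib_left sum.distrib)
next
  case scale
  then show ?case by (simp add: wcomp_def fun_scl_def sum_distrib_left mult_ac)
next
  case (wedge v)
  then show ?case by (rule wedge_expand[OF V x _ \<zeta>])
qed (simp add: wcomp_def)

lemma wcomp_zero_imp: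
  assumes "\<omega> \<in> fibre \<Lambda> x" and V: "(V, e) \<in> frames E" and x: "x \<in> V"
    and "\<And>\<alpha>. \<alpha> \<in> multi_index q (idx E) \<Longrightarrow> wcomp q e x \<omega> \<alpha> = 0"
  shows "\<omega> = 0"
proof (rule wedge_eqI[where q = q])
  show "\<omega> (tabulate q \<zeta>) = 0 (tabulate q \<zeta>)" if "\<And>k. k < q \<Longrightarrow> lin (\<zeta> k)" for \<zeta>
    using ext_expand[OF assms(1) V x that] assms(4) by simp
  show "\<omega> \<zeta>s = 0 \<zeta>s" if "\<not> (length \<zeta>s = q \<and> (\<forall>\<xi>\<in>set \<zeta>s. lin \<xi>))" for \<zeta>s
    using ext_ill_formed[OF assms(1) that] by simp
qed

lemma wcomp_alternating:
  assumes "\<omega> \<in> fibre \<Lambda> x" and V: "(V, e) \<in> frames E" and x: "x \<in> V" and ij: "i < q" "j < q" "i \<noteq> j"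
  shows "wcomp q e x \<omega> (\<alpha> \<circ> Transposition.transpose i j) = - wcomp q e x \<omega> \<alpha>"
  using assms(1)
proof (induction rule: ext_fibre_induct)
  case add
  then show ?case by (simp add: wcomp_def)
next
  case scale
  then show ?case by (simp add: wcomp_def fun_scl_def)
next
  case (wedge v)
  have \<tau>: "Transposition.transpose i j permutes {..<q}" using ij by (intro permutes_swap_id) auto
  show ?case
    using wedge_permute_forms[OF \<tau>, of "\<lambda>k. dualf e x (\<alpha> k)" v] dualf(1)[OF V x] ij(3)
    by (simp add: wcomp_def sign_swap_id)
qed (simp add: wcomp_def)

text \<open>The expansion in the frame e', evaluated at the forms dual to e: their values on e' are
  the transition coefficients.\<close>

lemma wcomp_change:
  assumes \<omega>: "\<omega> \<in> fibre \<Lambda> x" and V: "(V, e) \<in> frames E" "x \<in> V" and V': "(V', e') \<in> frames E" "x \<in> V'"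
    and t: "\<And>\<alpha>. \<alpha> \<in> idx E \<Longrightarrow> e' \<alpha> x = (\<Sum>\<beta>\<in>idx E. scl E (t \<alpha> \<beta>) (e \<beta> x))" and \<beta>: "\<beta> \<in> multi_index q (idx E)"
  shows "wcomp q e x \<omega> \<beta> = (\<Sum>\<alpha>\<in>multi_index q (idx E). (\<Prod>k<q. t (\<alpha> k) (\<beta> k)) * wcomp q e' x \<omega> \<alpha>)"
proof -
  have d: "dualf e x b (e' a x) = t a b" if "a \<in> idx E" "b \<in> idx E" for a b
  proof -
    have "dualf e x b (e' a x) = (\<Sum>c\<in>idx E. t a c * dualf e x b (e c x))"
      unfolding t[OF that(1)] by (rule lin_sum_scale[OF dualf(1)[OF V]])
    also have "\<dots> = (\<Sum>c\<in>idx E. t a c * kron c b)" by (simp add: dualf(2)[OF V])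
    finally show ?thesis using sum_kron(2)[OF finite_idx that(2), of "t a"] by simp
  qed
  have "wcomp q e x \<omega> \<beta> = (\<Sum>\<alpha>\<in>multi_index q (idx E). (\<Prod>k<q. dualf e x (\<beta> k) (e' (\<alpha> k) x)) * wcomp q e' x \<omega> \<alpha>)"
    unfolding wcomp_def[of q e] by (rule ext_expand[OF \<omega> V' dualf(1)[OF V]])
  also have "\<dots> = (\<Sum>\<alpha>\<in>multi_index q (idx E). (\<Prod>k<q. t (\<alpha> k) (\<beta> k)) * wcomp q e' x \<omega> \<alpha>)"
    using \<beta> by (intro sum.cong refl arg_cong2[where f="(*)"] prod.cong d) auto
  finally show ?thesis .
qed

text \<open>The factor a and the list J depend on \<beta> alone, not on the frame or the point; this
  keeps the coefficients in \<open>wframe_smooth\<close> smooth.\<close>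

lemma wframe_reorder:
  assumes "\<beta> \<in> multi_index q (idx E)"
  shows "\<exists>a J. (J \<in> idx \<Lambda> \<or> a = 0) \<and> (\<forall>e x. W (tabulate q (\<lambda>k. e (\<beta> k) x)) = fun_scl (a :: 'k) (wframe e J x))"
proof (cases "inj_on \<beta> {..<q}")
  case True
  obtain J and \<pi> :: "nat \<Rightarrow> nat" where J: "length J = q" "set J = \<beta> ` {..<q}" "sorted_wrt (<) J"
    "\<And>u. W (tabulate q (\<lambda>k. u (\<beta> k))) = fun_scl (of_int (sign \<pi>)) (W (map u J))"
    by (rule wedge_sorted[OF True]) blast
  have "J \<in> idx \<Lambda>" using J assms unfolding ext_sel by auto
  then show ?thesis
    by (intro exI[of _ "of_int (sign \<pi>)"] exI[of _ J] conjI disjI1 allI) (assumption, rule J(4))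
next
  case False
  \<comment> \<open>A tuple with repetitions gets the factor 0; the empty list is then a dummy and
    need not be an index of the exterior power.\<close>
  have "W (tabulate q (\<lambda>k. e (\<beta> k) x)) = fun_scl 0 (wframe e [] x)" for e :: "'i \<Rightarrow> 'm \<Rightarrow> 'v" and x
    using wedge_not_inj[OF False, of "\<lambda>b. e b x"] by (simp add: fun_scl_def fun_eq_iff)
  then show ?thesis
    by (intro exI[of _ 0] exI[of _ "[]"] conjI disjI2 allI) (rule refl)
qed

text \<open>Frame elements of the exterior power transform by the minors of the transition matrix,
  which are polynomials in smooth functions.\<close>

lemma wframe_smooth:
  assumes V: "(V, e) \<in> frames E" and I: "I \<in> idx \<Lambda>"
  shows "smooth_section A \<Lambda> V (wframe e I)"
proof (rule X.smooth_sectionI)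
  show "wframe e I x \<in> fibre \<Lambda> x" if "x \<in> V" for x by (rule wframe_in_fibre[OF V that I])
  fix V' w assume "(V', w) \<in> frames \<Lambda>"
  then obtain e' where V': "(V', e') \<in> frames E" and w: "w = wframe e'" by (rule ext_framesE)
  obtain t where t: "\<And>\<alpha> \<beta>. \<alpha> \<in> idx E \<Longrightarrow> \<beta> \<in> idx E \<Longrightarrow> smooth_map A (V' \<inter> V) (t \<alpha> \<beta> :: 'm \<Rightarrow> 'k)"
    "\<And>x \<alpha>. x \<in> V' \<inter> V \<Longrightarrow> \<alpha> \<in> idx E \<Longrightarrow> e \<alpha> x = (\<Sum>\<beta>\<in>idx E. scl E (t \<alpha> \<beta> x) (e' \<beta> x))"
    using frame_transition[OF V' V] by blast
  let ?TI = "multi_index q (idx E)"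
  obtain a J where aJ: "\<And>\<beta>. \<beta> \<in> ?TI \<Longrightarrow> J \<beta> \<in> idx \<Lambda> \<or> a \<beta> = 0"
    "\<And>\<beta> x. \<beta> \<in> ?TI \<Longrightarrow> W (tabulate q (\<lambda>k. e' (\<beta> k) x)) = fun_scl (a \<beta> :: 'k) (wframe e' (J \<beta>) x)"
  proof -
    have "\<forall>\<beta>\<in>?TI. \<exists>aJ. (snd aJ \<in> idx \<Lambda> \<or> fst aJ = 0) \<and>
        (\<forall>x. W (tabulate q (\<lambda>k. e' (\<beta> k) x)) = fun_scl (fst aJ :: 'k) (wframe e' (snd aJ) x))"
    proof
      fix \<beta> assume "\<beta> \<in> ?TI"
      from wframe_reorder[OF this] obtain a J where "J \<in> idx \<Lambda> \<or> a = 0"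
        "\<And>e x. W (tabulate q (\<lambda>k. e (\<beta> k) x)) = fun_scl (a :: 'k) (wframe e J x)" by blast
      then show "\<exists>aJ. (snd aJ \<in> idx \<Lambda> \<or> fst aJ = 0) \<and>
        (\<forall>x. W (tabulate q (\<lambda>k. e' (\<beta> k) x)) = fun_scl (fst aJ :: 'k) (wframe e' (snd aJ) x))"
        by (intro exI[of _ "(a, J)"]) (simp del: ext_sel)
    qed
    from bchoice[OF this] obtain f where "\<forall>\<beta>\<in>?TI. (snd (f \<beta>) \<in> idx \<Lambda> \<or> fst (f \<beta>) = 0) \<and>
        (\<forall>x. W (tabulate q (\<lambda>k. e' (\<beta> k) x)) = fun_scl (fst (f \<beta>) :: 'k) (wframe e' (snd (f \<beta>)) x))" by blast
    then show thesis using that[of "\<lambda>\<beta>. snd (f \<beta>)" "\<lambda>\<beta>. fst (f \<beta>)"] by blast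
  qed
  \<comment> \<open>Collects, with signs, all tuples that sort to K: the minor of the transition
    matrix with rows I and columns K.\<close>
  define f where "f K x = (\<Sum>\<beta>\<in>?TI. (if K = J \<beta> then a \<beta> else 0) * (\<Prod>k<q. t (I ! k) (\<beta> k) x))" for K x
  have oVV: "open (V' \<inter> V)" by (intro open_Int frame_props(1)[OF V] frame_props(1)[OF V'])
  have "smooth_map A (V' \<inter> V) (f K)" for K
    unfolding f_def
    by (intro smooth_map_sum smooth_map_mult smooth_map_prod smooth_map_const atlas oVV t(1) ext_idx_nth[OF I]) auto
  moreover have "wframe e I x = (\<Sum>K\<in>idx \<Lambda>. scl \<Lambda> (f K x) (w K x))" if x: "x \<in> V' \<inter> V" for x
  proof -
    have "wframe e I x = W (tabulate q (\<lambda>k. \<Sum>b\<in>idx E. scl E (t (I ! k) b x) (e' b x)))"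
      unfolding wframe_tabulate[OF I] using t(2)[OF x ext_idx_nth[OF I]]
      by (intro arg_cong[where f = W] map_cong refl) simp
    also have "\<dots> = (\<Sum>\<beta>\<in>?TI. fun_scl (\<Prod>k<q. t (I ! k) (\<beta> k) x) (W (tabulate q (\<lambda>k. e' (\<beta> k) x))))"
      by (rule wedge_multilinear[OF finite_idx, where t = "\<lambda>k b. t (I ! k) b x" and u = "\<lambda>b. e' b x"])
    also have "\<dots> = (\<Sum>\<beta>\<in>?TI. \<Sum>K\<in>idx \<Lambda>. if K = J \<beta> then fun_scl (a \<beta> * (\<Prod>k<q. t (I ! k) (\<beta> k) x)) (w K x) else 0)"
    proof (intro sum.cong refl)
      fix \<beta> assume \<beta>: "\<beta> \<in> ?TI"
      have "fun_scl (\<Prod>k<q. t (I ! k) (\<beta> k) x) (W (tabulate q (\<lambda>k. e' (\<beta> k) x)))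
          = fun_scl (a \<beta> * (\<Prod>k<q. t (I ! k) (\<beta> k) x)) (w (J \<beta>) x)"
        unfolding aJ(2)[OF \<beta>] w by (simp add: mult.commute)
      then show "fun_scl (\<Prod>k<q. t (I ! k) (\<beta> k) x) (W (tabulate q (\<lambda>k. e' (\<beta> k) x)))
          = (\<Sum>K\<in>idx \<Lambda>. if K = J \<beta> then fun_scl (a \<beta> * (\<Prod>k<q. t (I ! k) (\<beta> k) x)) (w K x) else 0)"
        using aJ(1)[OF \<beta>] finite_ext_idx by (auto simp del: ext_sel)
    qed
    also have "\<dots> = (\<Sum>K\<in>idx \<Lambda>. \<Sum>\<beta>\<in>?TI. fun_scl ((if K = J \<beta> then a \<beta> else 0) * (\<Prod>k<q. t (I ! k) (\<beta> k) x)) (w K x))"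
      by (subst sum.swap) (intro sum.cong refl, simp)
    also have "\<dots> = (\<Sum>K\<in>idx \<Lambda>. scl \<Lambda> (f K x) (w K x))"
      unfolding ext_sel(1) f_def fun_vs.scale_sum_left ..
    finally show ?thesis .
  qed
  ultimately show "\<exists>f. (\<forall>K\<in>idx \<Lambda>. smooth_map A (V \<inter> V') (f K :: 'm \<Rightarrow> 'k)) \<and>
        (\<forall>x\<in>V \<inter> V'. wframe e I x = (\<Sum>K\<in>idx \<Lambda>. scl \<Lambda> (f K x) (w K x)))"
    unfolding Int_commute[of V V'] by blast
qed

text \<open>The components of the frame element with index I, a determinant of Kronecker deltas.
  Being constant in the point, they are left alone by differentiation.\<close>

definition wedge_const :: "'i list \<Rightarrow> (nat \<Rightarrow> 'i) \<Rightarrow> 'k" where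
  "wedge_const I \<beta> = (\<Sum>\<sigma> | \<sigma> permutes {..<q}. of_int (sign \<sigma>) * (\<Prod>k<q. kron (I ! k) (\<beta> (\<sigma> k))))"

lemma wcomp_wframe:
  assumes V: "(V, e) \<in> frames E" and x: "x \<in> V" and I: "I \<in> idx \<Lambda>"
  shows "wcomp q e x (wframe e I x) \<beta> = wedge_const I \<beta>"
  unfolding wframe_tabulate[OF I] wcomp_def wedge_const_def
  by (subst wedge_eval) (auto simp: dualf[OF V x] ext_idx_nth[OF I] simp del: ext_sel intro!: sum.cong prod.cong)

lemma section_wcomp:
  assumes V: "(V, e) \<in> frames E" and S: "open S" and s: "smooth_section A \<Lambda> S s"
  obtains f where "\<And>I. I \<in> idx \<Lambda> \<Longrightarrow> smooth_map A (S \<inter> V) (f I :: 'm \<Rightarrow> 'k)"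
    "\<And>x. x \<in> S \<inter> V \<Longrightarrow> s x = (\<Sum>I\<in>idx \<Lambda>. fun_scl (f I x) (wframe e I x))"
    "\<And>x \<beta>. x \<in> S \<inter> V \<Longrightarrow> wcomp q e x (s x) \<beta> = (\<Sum>I\<in>idx \<Lambda>. f I x * wedge_const I \<beta>)"
proof -
  obtain f where f: "\<And>I. I \<in> idx \<Lambda> \<Longrightarrow> smooth_map A (S \<inter> V) (f I :: 'm \<Rightarrow> 'k)"
    "\<And>x. x \<in> S \<inter> V \<Longrightarrow> s x = (\<Sum>I\<in>idx \<Lambda>. scl \<Lambda> (f I x) (wframe e I x))"
    using X.smooth_section_coeffs[OF s ext_frames[OF V]] by blast
  have "wcomp q e x (s x) \<beta> = (\<Sum>I\<in>idx \<Lambda>. f I x * wedge_const I \<beta>)" if x: "x \<in> S \<inter> V" for x \<beta>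
    unfolding f(2)[OF x] ext_sel(1) wcomp_linear
    using x by (intro sum.cong refl) (simp add: wcomp_wframe[OF V] del: ext_sel)
  then show thesis using that f unfolding ext_sel(1) by blast
qed

lemma wcomp_smooth:
  assumes V: "(V, e) \<in> frames E" and S: "open S" and s: "smooth_section A \<Lambda> S s"
  shows "smooth_map A (S \<inter> V) (\<lambda>x. wcomp q e x (s x) \<beta>)"
proof -
  obtain f where f: "\<And>I. I \<in> idx \<Lambda> \<Longrightarrow> smooth_map A (S \<inter> V) (f I :: 'm \<Rightarrow> 'k)"
    "\<And>x \<beta>. x \<in> S \<inter> V \<Longrightarrow> wcomp q e x (s x) \<beta> = (\<Sum>I\<in>idx \<Lambda>. f I x * wedge_const I \<beta>)"
    by (rule section_wcomp[OF V S s]) blast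
  have oSV: "open (S \<inter> V)" by (intro open_Int S frame_props(1)[OF V])
  have "smooth_map A (S \<inter> V) (\<lambda>x. \<Sum>I\<in>idx \<Lambda>. f I x * wedge_const I \<beta>)"
    by (intro smooth_map_sum smooth_map_mult smooth_map_const atlas oSV f(1))
  then show ?thesis
    by (rule smooth_map_cong[OF atlas oSV f(2), THEN iffD2, rotated])
qed

text \<open>A derivation acts on a decomposable vector through its vectors or, dually, through the linear
  forms at which it is evaluated.\<close>

lemma wedge_const_derivation:
  assumes I: "I \<in> idx \<Lambda>" and \<beta>: "\<beta> \<in> multi_index q (idx E)"
  shows "(\<Sum>k<q. \<Sum>\<sigma> | \<sigma> permutes {..<q}. of_int (sign \<sigma>) *
      (\<Prod>l<q. if l = k then X (I ! k) (\<beta> (\<sigma> k)) else kron (I ! l) (\<beta> (\<sigma> l))))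
    = (\<Sum>\<alpha>\<in>multi_index q (idx E). wedge_const I \<alpha> * derivation q X \<alpha> \<beta>)"
proof -
  let ?TI = "multi_index q (idx E)" and ?S = "{\<sigma>. \<sigma> permutes {..<q}}"
  have "(\<Sum>\<alpha>\<in>?TI. wedge_const I \<alpha> * derivation q X \<alpha> \<beta>)
     = (\<Sum>\<alpha>\<in>?TI. \<Sum>\<sigma>\<in>?S. of_int (sign \<sigma>) * ((\<Prod>k<q. kron (I ! k) (\<alpha> (\<sigma> k))) * derivation q X \<alpha> \<beta>))"
    unfolding wedge_const_def sum_distrib_right by (simp only: mult.assoc)
  also have "\<dots> = (\<Sum>\<sigma>\<in>?S. of_int (sign \<sigma>) * (\<Sum>\<alpha>\<in>?TI. (\<Prod>k<q. kron (I ! k) (\<alpha> (\<sigma> k))) * derivation q X \<alpha> \<beta>))"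
    by (subst sum.swap) (simp only: sum_distrib_left)
  also have "\<dots> = (\<Sum>\<sigma>\<in>?S. of_int (sign \<sigma>) * (\<Sum>k<q. \<Prod>l<q. if l = k then X (I ! k) (\<beta> (\<sigma> k)) else kron (I ! l) (\<beta> (\<sigma> l))))"
  proof (intro sum.cong refl arg_cong2[where f="(*)"])
    fix \<sigma> assume "\<sigma> \<in> ?S"
    then have \<sigma>: "\<sigma> permutes {..<q}" by simp
    have inI: "I ! inv \<sigma> l \<in> idx E" if "l < q" for l
      using permutes_in_image[OF permutes_inv[OF \<sigma>], of l] that by (intro ext_idx_nth[OF I]) simp
    have "(\<Sum>\<alpha>\<in>?TI. (\<Prod>k<q. kron (I ! k) (\<alpha> (\<sigma> k))) * derivation q X \<alpha> \<beta>)
       = (\<Sum>m<q. \<Sum>\<alpha>\<in>?TI. \<Prod>l<q. kron (I ! inv \<sigma> l) (\<alpha> l) * (if l = m then X (\<alpha> l) (\<beta> l) else kron (\<alpha> l) (\<beta> l)))"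
      unfolding prod_reindex_permutation[OF \<sigma>, where f = "\<lambda>k l. kron (I ! k) (_ l)"] derivation_def at_slot_def
        sum_distrib_left prod.distrib by (rule sum.swap)
    also have "\<dots> = (\<Sum>m<q. \<Prod>l<q. \<Sum>a\<in>idx E. kron (I ! inv \<sigma> l) a * (if l = m then X a (\<beta> l) else kron a (\<beta> l)))"
      by (intro sum.cong refl sum_multi_index[OF finite_idx, where f = "\<lambda>l a. kron (I ! inv \<sigma> l) a * (if l = _ then X a (\<beta> l) else kron a (\<beta> l))"])
    also have "\<dots> = (\<Sum>m<q. \<Prod>l<q. if l = m then X (I ! inv \<sigma> l) (\<beta> l) else kron (I ! inv \<sigma> l) (\<beta> l))"
      by (intro sum.cong prod.cong refl) (simp add: sum_kron(1)[OF finite_idx inI])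
    also have "\<dots> = (\<Sum>m<q. \<Prod>k<q. if \<sigma> k = m then X (I ! k) (\<beta> (\<sigma> k)) else kron (I ! k) (\<beta> (\<sigma> k)))"
      using prod_reindex_permutation[OF \<sigma>, where f = "\<lambda>k l. if l = _ then X (I ! k) (\<beta> l) else kron (I ! k) (\<beta> l)"] by simp
    also have "\<dots> = (\<Sum>k'<q. \<Prod>k<q. if \<sigma> k = \<sigma> k' then X (I ! k) (\<beta> (\<sigma> k)) else kron (I ! k) (\<beta> (\<sigma> k)))"
      by (rule sum.reindex_bij_betw[OF permutes_imp_bij[OF \<sigma>], symmetric])
    also have "\<dots> = (\<Sum>k<q. \<Prod>l<q. if l = k then X (I ! k) (\<beta> (\<sigma> k)) else kron (I ! l) (\<beta> (\<sigma> l)))"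
      using inj_eq[OF permutes_inj[OF \<sigma>]] by (intro sum.cong prod.cong refl) auto
    finally show "(\<Sum>\<alpha>\<in>?TI. (\<Prod>k<q. kron (I ! k) (\<alpha> (\<sigma> k))) * derivation q X \<alpha> \<beta>)
      = (\<Sum>k<q. \<Prod>l<q. if l = k then X (I ! k) (\<beta> (\<sigma> k)) else kron (I ! l) (\<beta> (\<sigma> l)))" .
  qed
  also have "\<dots> = (\<Sum>k<q. \<Sum>\<sigma>\<in>?S. of_int (sign \<sigma>) * (\<Prod>l<q. if l = k then X (I ! k) (\<beta> (\<sigma> k)) else kron (I ! l) (\<beta> (\<sigma> l))))"
    unfolding sum_distrib_left by (rule sum.swap)
  finally show ?thesis ..
qed

context
  fixes D :: "('m, 'n, 'v) conn" and L :: "('m, 'n, ('v \<Rightarrow> 'k) list \<Rightarrow> 'k) conn"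
  assumes D: "connection A E D" and L: "induced_connection A E D q L"
begin

lemma L_connection: "connection A \<Lambda> L"
  using L unfolding induced_connection_def by blast

lemma wcomp_conn_wframe:
  assumes V: "(V, e) \<in> frames E" and c: "c \<in> A" and x: "x \<in> V" "x \<in> fst c" and I: "I \<in> idx \<Lambda>"
    and \<beta>: "\<beta> \<in> multi_index q (idx E)"
  shows "wcomp q e x (L (wframe e I) c x v) \<beta>
    = (\<Sum>\<alpha>\<in>multi_index q (idx E). wedge_const I \<alpha> * derivation q (\<lambda>a b. conn_coeff D e c v a b x) \<alpha> \<beta>)"
proof -
  let ?ss = "map e I"
  let ?u = "\<lambda>k l. if l = k then D (e (I ! k)) c x v else e (I ! l) x"
  have len: "length I = q" and setI: "set I \<subseteq> idx E" using I unfolding ext_sel by auto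
  have "L (\<lambda>y. W (map (\<lambda>s. s y) ?ss)) c x v = (\<Sum>k<q. W ((map (\<lambda>s. s x) ?ss)[k := D (?ss ! k) c x v]))"
    using L[unfolded induced_connection_def, THEN conjunct2, rule_format, of V ?ss c x v]
      frame_props(1)[OF V] len setI frame_smooth[OF V] c x by auto
  \<comment> \<open>The factor 1 brings the sum into the form of a linear combination to which
    \<open>wcomp_linear\<close> applies.\<close>
  also have "\<dots> = (\<Sum>k<q. fun_scl 1 (W (tabulate q (?u k))))"
  proof (intro sum.cong refl)
    fix k assume "k \<in> {..<q}"
    then have "(map (\<lambda>s. s x) ?ss)[k := D (?ss ! k) c x v] = tabulate q (?u k)"
      using len by (intro nth_equalityI) auto
    then show "W ((map (\<lambda>s. s x) ?ss)[k := D (?ss ! k) c x v]) = fun_scl 1 (W (tabulate q (?u k)))"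
      by simp
  qed
  finally have "L (wframe e I) c x v = (\<Sum>k<q. fun_scl 1 (W (tabulate q (?u k))))" by (simp add: o_def)
  then have "wcomp q e x (L (wframe e I) c x v) \<beta> = (\<Sum>k<q. wcomp q e x (W (tabulate q (?u k))) \<beta>)"
    using wcomp_linear[of q e x "\<lambda>_. 1" "\<lambda>k. W (tabulate q (?u k))" "{..<q}" \<beta>] by simp
  also have "\<dots> = (\<Sum>k<q. \<Sum>\<sigma> | \<sigma> permutes {..<q}. of_int (sign \<sigma>) *
      (\<Prod>l<q. if l = k then conn_coeff D e c v (I ! k) (\<beta> (\<sigma> k)) x else kron (I ! l) (\<beta> (\<sigma> l))))"
  proof (intro sum.cong refl)
    fix k assume "k \<in> {..<q}"
    then have k: "I ! k \<in> idx E" using ext_idx_nth[OF I] by simp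
    have d: "dualf e x b (D (e (I ! k)) c x v) = conn_coeff D e c v (I ! k) b x" if "b \<in> idx E" for b
    proof -
      have "dualf e x b (D (e (I ! k)) c x v) = (\<Sum>a\<in>idx E. conn_coeff D e c v (I ! k) a x * dualf e x b (e a x))"
        unfolding conn_frame[OF D V c k x] by (rule lin_sum_scale[OF dualf(1)[OF V x(1)]])
      also have "\<dots> = (\<Sum>a\<in>idx E. conn_coeff D e c v (I ! k) a x * kron a b)" by (simp add: dualf(2)[OF V x(1)])
      finally show ?thesis using sum_kron(2)[OF finite_idx that] by simp
    qed
    have "wcomp q e x (W (tabulate q (?u k))) \<beta>
       = (\<Sum>\<sigma> | \<sigma> permutes {..<q}. of_int (sign \<sigma>) * (\<Prod>l<q. dualf e x (\<beta> (\<sigma> l)) (?u k l)))"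
      unfolding wcomp_def by (rule wedge_eval[OF dualf(1)[OF V x(1)]])
    also have "\<dots> = (\<Sum>\<sigma> | \<sigma> permutes {..<q}. of_int (sign \<sigma>) *
      (\<Prod>l<q. if l = k then conn_coeff D e c v (I ! k) (\<beta> (\<sigma> k)) x else kron (I ! l) (\<beta> (\<sigma> l))))"
    proof (intro sum.cong refl arg_cong2[where f="(*)"] prod.cong)
      fix \<sigma> l assume "\<sigma> \<in> {\<sigma>. \<sigma> permutes {..<q}}" "l \<in> {..<q}"
      then have l: "l < q" "\<beta> (\<sigma> l) \<in> idx E"
        using permutes_in_image[of \<sigma> "{..<q}" l] \<beta> by auto
      then show "dualf e x (\<beta> (\<sigma> l)) (?u k l) = (if l = k then conn_coeff D e c v (I ! k) (\<beta> (\<sigma> k)) x else kron (I ! l) (\<beta> (\<sigma> l)))"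
        using d dualf(2)[OF V x(1) ext_idx_nth[OF I l(1)]] by auto
    qed
    finally show "wcomp q e x (W (tabulate q (?u k))) \<beta> = (\<Sum>\<sigma> | \<sigma> permutes {..<q}. of_int (sign \<sigma>) *
      (\<Prod>l<q. if l = k then conn_coeff D e c v (I ! k) (\<beta> (\<sigma> k)) x else kron (I ! l) (\<beta> (\<sigma> l))))" .
  qed
  also have "\<dots> = (\<Sum>\<alpha>\<in>multi_index q (idx E). wedge_const I \<alpha> * derivation q (\<lambda>a b. conn_coeff D e c v a b x) \<alpha> \<beta>)"
    by (rule wedge_const_derivation[OF I \<beta>])
  finally show ?thesis .
qed

text \<open>\<open>induced_connection\<close> prescribes L on wedges of sections only. Expanding s
  in the frames of the exterior power and using the Leibniz rule for functions extends the formula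
  to all sections, in the component form that \<open>T_closed\<close> demands.\<close>

theorem wcomp_conn:
  assumes V: "(V, e) \<in> frames E" and S: "open S" and s: "smooth_section A \<Lambda> S s"
    and c: "c \<in> A" and x: "x \<in> S" "x \<in> V" "x \<in> fst c" and \<beta>: "\<beta> \<in> multi_index q (idx E)"
  shows "wcomp q e x (L s c x v) \<beta> = dfun (\<lambda>y. wcomp q e y (s y) \<beta>) c x v
    + (\<Sum>\<alpha>\<in>multi_index q (idx E). wcomp q e x (s x) \<alpha> * derivation q (\<lambda>a b. conn_coeff D e c v a b x) \<alpha> \<beta>)"
proof -
  let ?der = "derivation q (\<lambda>a b. conn_coeff D e c v a b x)"
  obtain f where f: "\<And>I. I \<in> idx \<Lambda> \<Longrightarrow> smooth_map A (S \<inter> V) (f I :: 'm \<Rightarrow> 'k)"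
    "\<And>x. x \<in> S \<inter> V \<Longrightarrow> s x = (\<Sum>I\<in>idx \<Lambda>. fun_scl (f I x) (wframe e I x))"
    "\<And>x \<beta>. x \<in> S \<inter> V \<Longrightarrow> wcomp q e x (s x) \<beta> = (\<Sum>I\<in>idx \<Lambda>. f I x * wedge_const I \<beta>)"
    by (rule section_wcomp[OF V S s]) blast
  have oSV: "open (S \<inter> V)" by (intro open_Int S frame_props(1)[OF V])
  have xSV: "x \<in> S \<inter> V" using x by blast
  have w: "smooth_section A \<Lambda> (S \<inter> V) (wframe e I)" if "I \<in> idx \<Lambda>" for I
    by (rule X.smooth_section_subset[OF wframe_smooth[OF V that] frame_props(1)[OF V]]) auto
  have sm: "smooth_section A \<Lambda> (S \<inter> V) (\<lambda>y. \<Sum>I\<in>idx \<Lambda>. scl \<Lambda> (f I y) (wframe e I y))"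
    by (intro X.smooth_section_sum X.smooth_section_scale oSV f(1) w)
  have "L s c x v = L (\<lambda>y. \<Sum>I\<in>idx \<Lambda>. scl \<Lambda> (f I y) (wframe e I y)) c x v"
    by (rule X.conn_cong[OF L_connection oSV X.smooth_section_subset[OF s S] sm c xSV x(3)])
      (simp_all add: f(2) del: ext_sel(2,3))
  also have "\<dots> = (\<Sum>I\<in>idx \<Lambda>. scl \<Lambda> (dfun (f I) c x v) (wframe e I x) + scl \<Lambda> (f I x) (L (wframe e I) c x v))"
    by (rule X.conn_linear_combination[OF L_connection oSV f(1) w c xSV x(3)])
  also have "\<dots> = (\<Sum>I\<in>idx \<Lambda>. fun_scl (dfun (f I) c x v) (wframe e I x)) + (\<Sum>I\<in>idx \<Lambda>. fun_scl (f I x) (L (wframe e I) c x v))"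
    by (simp only: ext_sel(1) sum.distrib)
  finally have "wcomp q e x (L s c x v) \<beta> = (\<Sum>I\<in>idx \<Lambda>. dfun (f I) c x v * wcomp q e x (wframe e I x) \<beta>)
      + (\<Sum>I\<in>idx \<Lambda>. f I x * wcomp q e x (L (wframe e I) c x v) \<beta>)"
    by (simp only: wcomp_add wcomp_linear)
  also have "(\<Sum>I\<in>idx \<Lambda>. dfun (f I) c x v * wcomp q e x (wframe e I x) \<beta>) = dfun (\<lambda>y. wcomp q e y (s y) \<beta>) c x v"
  proof -
    have "dfun (\<lambda>y. wcomp q e y (s y) \<beta>) c x v = dfun (\<lambda>y. \<Sum>I\<in>idx \<Lambda>. f I y * wedge_const I \<beta>) c x v"
      by (rule dfun_cong[OF atlas c oSV xSV x(3) f(3)])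
    also have "\<dots> = (\<Sum>I\<in>idx \<Lambda>. dfun (f I) c x v * wedge_const I \<beta>)"
      by (rule dfun_sum_const) (rule smooth_map_differentiable[OF f(1) c xSV x(3)])
    also have "\<dots> = (\<Sum>I\<in>idx \<Lambda>. dfun (f I) c x v * wcomp q e x (wframe e I x) \<beta>)"
      by (intro sum.cong refl) (simp only: wcomp_wframe[OF V x(2)])
    finally show ?thesis ..
  qed
  also have "(\<Sum>I\<in>idx \<Lambda>. f I x * wcomp q e x (L (wframe e I) c x v) \<beta>)
     = (\<Sum>I\<in>idx \<Lambda>. f I x * (\<Sum>\<alpha>\<in>multi_index q (idx E). wedge_const I \<alpha> * ?der \<alpha> \<beta>))"
    by (intro sum.cong refl) (simp only: wcomp_conn_wframe[OF V c x(2,3) _ \<beta>])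
  also have "\<dots> = (\<Sum>\<alpha>\<in>multi_index q (idx E). (\<Sum>I\<in>idx \<Lambda>. f I x * wedge_const I \<alpha>) * ?der \<alpha> \<beta>)"
    unfolding sum_distrib_left sum_distrib_right by (subst sum.swap) (simp only: mult.assoc)
  finally show ?thesis unfolding f(3)[OF xSV] .
qed

end

end

lemma derivation_half_sum:
  "derivation q (\<lambda>a b. (X a b + k * Y a b) / 2) \<alpha> \<beta> = (derivation q X \<alpha> \<beta> + k * derivation q Y \<alpha> \<beta>) / (2 :: complex)"
  unfolding derivation_def sum_distrib_left sum.distrib[symmetric] sum_divide_distrib
  by (intro sum.cong refl) (simp add: at_slot_eq distrib_right mult.assoc)

lemma dzb_dfun: "dzb j (f \<circ> chart_inv c) (snd c x) = (dfun f c x (axis j 1) + \<i> * dfun f c x (axis j \<i>)) / 2"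
  by (simp add: dzb_def dfun_def)

text \<open>Here a and b are components of the covariant derivatives along \<open>axis j 1\<close>
  and \<open>axis j \<i>\<close>; the combination annihilated by \<open>delbar\<close> is passed on
  to derivatives and connection coefficients separately.\<close>

lemma closed_components:
  fixes X Y :: "'a \<Rightarrow> 'a \<Rightarrow> complex"
  assumes "a + \<i> * b = 0" "a = d + (\<Sum>\<alpha>\<in>I. T \<alpha> * derivation q X \<alpha> \<beta>)" "b = d' + (\<Sum>\<alpha>\<in>I. T \<alpha> * derivation q Y \<alpha> \<beta>)"
  shows "(d + \<i> * d') / 2 + (\<Sum>\<alpha>\<in>I. T \<alpha> * derivation q (\<lambda>a b. (X a b + \<i> * Y a b) / 2) \<alpha> \<beta>) = 0"
proof -
  have "(\<Sum>\<alpha>\<in>I. T \<alpha> * derivation q (\<lambda>a b. (X a b + \<i> * Y a b) / 2) \<alpha> \<beta>)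
      = ((\<Sum>\<alpha>\<in>I. T \<alpha> * derivation q X \<alpha> \<beta>) + \<i> * (\<Sum>\<alpha>\<in>I. T \<alpha> * derivation q Y \<alpha> \<beta>)) / 2"
    unfolding derivation_half_sum sum_distrib_left sum.distrib[symmetric] sum_divide_distrib
    by (intro sum.cong refl) (simp add: algebra_simps)
  then have "(d + \<i> * d') / 2 + (\<Sum>\<alpha>\<in>I. T \<alpha> * derivation q (\<lambda>a b. (X a b + \<i> * Y a b) / 2) \<alpha> \<beta>)
      = (a + \<i> * b) / 2"
    unfolding assms(2,3) by (simp add: algebra_simps add_divide_distrib)
  then show ?thesis using assms(1) by simp
qed

lemma H0_eq_zeroI:
  assumes "bundle_space A E" "connection A E D" "\<And>s. s \<in> H0 A E D \<Longrightarrow> s = (\<lambda>x. 0)"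
  shows "H0 A E D = {\<lambda>x. 0}"
proof -
  interpret bundle_space A E by (rule assms(1))
  have "delbar E D c (\<lambda>x. 0) j x = 0" if "c \<in> A" "x \<in> fst c" for c j x
    unfolding delbar_def conn_zero[OF assms(2) that] by simp
  then have "(\<lambda>x. 0) \<in> H0 A E D"
    unfolding H0_def using smooth_section_zero by blast
  then show ?thesis using assms(3) by blast
qed

section \<open>Closed sections of exterior powers in the Hermitian case\<close>

context
  fixes A :: "('m::t2_space, 'n::finite) chart set"
    and h :: "('m, 'n) chart \<Rightarrow> 'm \<Rightarrow> complex ^ 'n ^ 'n"
    and E :: "(complex, 'm, 'v::ab_group_add, 'i::linorder) vbundle"
    and g :: "'m \<Rightarrow> 'v \<Rightarrow> 'v \<Rightarrow> complex"
    and D :: "('m, 'n, 'v) conn"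
    and L :: "('m, 'n, ('v \<Rightarrow> complex) list \<Rightarrow> complex) conn" and q :: nat and s
  assumes mb: "metric_bundle A h E g D" and L: "induced_connection A E D q L"
    and s: "s \<in> H0 A (ext_power q E) L"
begin

interpretation metric_bundle A h E g D by (rule mb)
interpretation X: ext_bundle A E q ..

lemma ext_H0_smooth: "smooth_section A (ext_power q E) UNIV s"
  using s unfolding H0_def by blast

lemma ext_H0_fibre: "s x \<in> fibre (ext_power q E) x"
  using X.X.smooth_section_in_fibre[OF ext_H0_smooth UNIV_I] .

lemma ext_closed_tensor: "closed_tensor A h E g D q (\<lambda>e x. wcomp q e x (s x))"
proof
  show "smooth_map A V (\<lambda>x. wcomp q e x (s x) \<alpha>)" if "(V, e) \<in> frames E" for V e \<alpha>
    using X.wcomp_smooth[OF that open_UNIV ext_H0_smooth] by simp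
  show "alternating_on q (idx E) (wcomp q e x (s x))" if "(V, e) \<in> frames E" "x \<in> V" for V e x
    unfolding alternating_on_def using X.wcomp_alternating[OF ext_H0_fibre that] by blast
  show "wcomp q e x (s x) \<beta> = tensor_coords q (idx E) t (wcomp q e' x (s x)) \<beta>"
    if V: "(V, e) \<in> frames E" "(V', e') \<in> frames E" and x: "x \<in> V" "x \<in> V'"
      and t: "\<And>\<alpha>. \<alpha> \<in> idx E \<Longrightarrow> e' \<alpha> x = (\<Sum>\<beta>\<in>idx E. scl E (t \<alpha> \<beta>) (e \<beta> x))"
      and \<beta>: "\<beta> \<in> multi_index q (idx E)" for V V' e e' x t \<beta>
    unfolding tensor_coords_def by (rule X.wcomp_change[OF ext_H0_fibre V(1) x(1) V(2) x(2) t \<beta>])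
  show "dzb j ((\<lambda>y. wcomp q e y (s y) \<beta>) \<circ> chart_inv c) (snd c x)
      + (\<Sum>\<alpha>\<in>multi_index q (idx E). wcomp q e x (s x) \<alpha> * derivation q (\<lambda>a b. coeffN c e j a b x) \<alpha> \<beta>) = 0"
    if V: "(V, e) \<in> frames E" and c: "c \<in> A" and x: "x \<in> V" "x \<in> fst c" and \<beta>: "\<beta> \<in> multi_index q (idx E)"
    for V e c x \<beta> j
    unfolding dzb_dfun coeffN_def
  proof (rule closed_components)
    have "delbar (ext_power q E) L c s j x = 0" using s c x(2) unfolding H0_def by blast
    then have "wcomp q e x (fun_scl (1/2) (L s c x (axis j 1)) + fun_scl (\<i>/2) (L s c x (axis j \<i>))) \<beta> = wcomp q e x 0 \<beta>"
      unfolding delbar_def X.ext_sel(1) by (rule arg_cong)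
    then have "2 * (1/2 * wcomp q e x (L s c x (axis j 1)) \<beta> + \<i>/2 * wcomp q e x (L s c x (axis j \<i>)) \<beta>) = 2 * wcomp q e x 0 \<beta>"
      unfolding wcomp_add wcomp_fun_scl by (rule arg_cong)
    moreover have "wcomp q e x 0 \<beta> = 0" by (simp add: wcomp_def)
    ultimately show "wcomp q e x (L s c x (axis j 1)) \<beta> + \<i> * wcomp q e x (L s c x (axis j \<i>)) \<beta> = 0"
      by (simp add: distrib_left)
  qed (rule X.wcomp_conn[OF D L V open_UNIV ext_H0_smooth c UNIV_I x \<beta>])+
qed

theorem ext_H0_vanishes:
  assumes "compact (UNIV :: 'm set)" "connected (UNIV :: 'm set)" "1 \<le> p" "p \<le> q"
    and "\<And>x. ricci_p_nonpositive p A h E g D x" "ricci_p_negative p A h E g D x0"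
  shows "s = (\<lambda>x. 0)"
proof
  fix x
  obtain V e where V: "(V, e) \<in> frames E" "x \<in> V" by (rule ex_frame)
  interpret T: closed_tensor A h E g D q "\<lambda>e x. wcomp q e x (s x)" by (rule ext_closed_tensor)
  show "s x = 0"
    by (rule X.wcomp_zero_imp[OF ext_H0_fibre V]) (rule T.closed_tensor_vanishes[OF assms V])
qed

end

section \<open>Complexification\<close>

locale real_metric_bundle =
  fixes A :: "('m::topological_space, 'n::finite) chart set"
    and F :: "(real, 'm, 'w::ab_group_add, 'i) vbundle"
    and g :: "'m \<Rightarrow> 'w \<Rightarrow> 'w \<Rightarrow> real"
    and D :: "('m, 'n, 'w) conn"
  assumes is_atlas: "complex_atlas A"
    and riem_bundle: "riemannian_bundle A F g" and metric_conn: "metric_connection A F g D"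
begin

sublocale smooth_bundle A F
  by unfold_locales (use is_atlas riem_bundle in \<open>simp_all add: riemannian_bundle_def\<close>)

lemma D: "connection A F D"
  using metric_conn by (simp add: metric_connection_def)

lemma fm: "fibre_metric (\<lambda>a. a) A F g"
  using riem_bundle by (simp add: riemannian_bundle_def)

lemma g_axioms:
  assumes "u \<in> fibre F x" "v \<in> fibre F x" "w \<in> fibre F x"
  shows g_add: "g x (u + v) w = g x u w + g x v w"
    and g_scale: "g x (scl F a u) w = a * g x u w"
    and g_sym: "g x w u = g x u w"
  using fm[unfolded fibre_metric_def, THEN conjunct1, rule_format, OF assms, of a] by blast+

lemma g_pos:
  assumes "u \<in> fibre F x" "u \<noteq> 0"
  shows "0 < g x u u"
  using fm[unfolded fibre_metric_def, THEN conjunct2, THEN conjunct1, rule_format, OF assms] by auto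

lemma g_frame_smooth:
  assumes "(V, e) \<in> frames F" "\<alpha> \<in> idx F" "\<beta> \<in> idx F"
  shows "smooth_map A V (\<lambda>x. g x (e \<alpha> x) (e \<beta> x))"
  using bspec[OF fm[unfolded fibre_metric_def, THEN conjunct2, THEN conjunct2] assms(1), unfolded prod.case,
      rule_format, OF assms(2,3)] .

lemma fibre_0: "0 \<in> fibre F x" by (rule V.subspace_0[OF fibre_subspace])
lemma fibre_add: "u \<in> fibre F x \<Longrightarrow> v \<in> fibre F x \<Longrightarrow> u + v \<in> fibre F x" by (rule V.subspace_add[OF fibre_subspace])
lemma fibre_scale: "u \<in> fibre F x \<Longrightarrow> scl F a u \<in> fibre F x" by (rule V.subspace_scale[OF fibre_subspace])
lemma fibre_diff: "u \<in> fibre F x \<Longrightarrow> v \<in> fibre F x \<Longrightarrow> u - v \<in> fibre F x" by (rule V.subspace_diff[OF fibre_subspace])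

lemma g_scale_right:
  assumes "u \<in> fibre F x" "w \<in> fibre F x"
  shows "g x w (scl F a u) = a * g x w u"
  using g_scale[OF assms(1) assms] g_sym[OF assms(1) assms] g_sym[OF fibre_scale[OF assms(1)] assms] by simp

lemma g_diff:
  assumes "u \<in> fibre F x" "v \<in> fibre F x" "w \<in> fibre F x"
  shows "g x (u - v) w = g x u w - g x v w"
  using g_add[OF assms(1) fibre_scale[OF assms(2), of "-1"] assms(3)] g_scale[OF assms(2,2,3), of "-1"] by simp

lemma g_zero: "w \<in> fibre F x \<Longrightarrow> g x 0 w = 0"
  using g_scale[of w x w w 0] by simp

lemma g_zero_right: "w \<in> fibre F x \<Longrightarrow> g x w 0 = 0"
  using g_scale_right[of w x w 0] by simp

lemma g_sum:
  assumes "\<And>k. k \<in> I \<Longrightarrow> u k \<in> fibre F x" "w \<in> fibre F x"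
  shows "(\<Sum>k\<in>I. scl F (a k) (u k)) \<in> fibre F x \<and> g x (\<Sum>k\<in>I. scl F (a k) (u k)) w = (\<Sum>k\<in>I. a k * g x (u k) w)"
  using assms(1)
  by (induction I rule: infinite_finite_induct)
    (use assms(2) in \<open>simp_all add: fibre_0 g_zero fibre_add fibre_scale g_add g_scale\<close>)

text \<open>\<open>fibre_metric\<close> grants smoothness on frame vectors only, so both sections
  are expanded in a frame. The result lets the derivative of the complexified metric be split into
  its four real terms.\<close>

lemma g_sections_smooth:
  assumes S: "open S" and s: "smooth_section A F S s" "smooth_section A F S t"
    and c: "c \<in> A" and x: "x \<in> S" "x \<in> fst c"
  shows "((\<lambda>y. g y (s y) (t y)) \<circ> chart_inv c) differentiable (at (snd c x))"
proof -
  obtain V e where V: "(V, e) \<in> frames F" and xV: "x \<in> V" by (rule ex_frame)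
  let ?f = "\<lambda>\<alpha> y. frame_coeff F e y (s y) \<alpha>" and ?f' = "\<lambda>\<alpha> y. frame_coeff F e y (t y) \<alpha>"
  have oSV: "open (S \<inter> V)" by (intro open_Int S frame_props(1)[OF V])
  have gV: "smooth_map A (S \<inter> V) (\<lambda>y. g y (e \<alpha> y) (e \<beta> y))" if "\<alpha> \<in> idx F" "\<beta> \<in> idx F" for \<alpha> \<beta>
    by (rule smooth_map_subset[OF atlas frame_props(1)[OF V] g_frame_smooth[OF V that]]) auto
  have sm: "smooth_map A (S \<inter> V) (\<lambda>y. \<Sum>\<alpha>\<in>idx F. ?f \<alpha> y * (\<Sum>\<beta>\<in>idx F. ?f' \<beta> y * g y (e \<beta> y) (e \<alpha> y)))"
    by (intro smooth_map_sum smooth_map_mult atlas oSV gV frame_coeff_smooth[OF S _ V] s)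
  have eq: "g y (s y) (t y) = (\<Sum>\<alpha>\<in>idx F. ?f \<alpha> y * (\<Sum>\<beta>\<in>idx F. ?f' \<beta> y * g y (e \<beta> y) (e \<alpha> y)))"
    if y: "y \<in> S \<inter> V" for y
  proof -
    have ys: "s y \<in> fibre F y" "t y \<in> fibre F y" "y \<in> V" using y s smooth_section_in_fibre by blast+
    note fe = frame_in_fibre[OF V ys(3)]
    have "g y (s y) (t y) = g y (\<Sum>\<alpha>\<in>idx F. scl F (?f \<alpha> y) (e \<alpha> y)) (t y)"
      using frame_coeff_expansion[OF V ys(3,1)] by simp
    also have "\<dots> = (\<Sum>\<alpha>\<in>idx F. ?f \<alpha> y * g y (e \<alpha> y) (t y))"
      by (rule g_sum[THEN conjunct2]) (rule fe ys(2); assumption?)+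
    also have "\<dots> = (\<Sum>\<alpha>\<in>idx F. ?f \<alpha> y * (\<Sum>\<beta>\<in>idx F. ?f' \<beta> y * g y (e \<beta> y) (e \<alpha> y)))"
    proof (intro sum.cong refl arg_cong2[where f="(*)"])
      fix \<alpha> assume \<alpha>: "\<alpha> \<in> idx F"
      have "g y (e \<alpha> y) (t y) = g y (\<Sum>\<beta>\<in>idx F. scl F (?f' \<beta> y) (e \<beta> y)) (e \<alpha> y)"
        using g_sym[OF ys(2,2) fe[OF \<alpha>]] frame_coeff_expansion[OF V ys(3,2)] by simp
      also have "\<dots> = (\<Sum>\<beta>\<in>idx F. ?f' \<beta> y * g y (e \<beta> y) (e \<alpha> y))"
        by (rule g_sum[THEN conjunct2]) (rule fe fe[OF \<alpha>]; assumption?)+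
      finally show "g y (e \<alpha> y) (t y) = (\<Sum>\<beta>\<in>idx F. ?f' \<beta> y * g y (e \<beta> y) (e \<alpha> y))" .
    qed
    finally show ?thesis .
  qed
  have "smooth_map A (S \<inter> V) (\<lambda>y. g y (s y) (t y))"
    by (rule smooth_map_cong[OF atlas oSV eq, THEN iffD2, OF _ sm])
  from smooth_map_differentiable[OF this c] show ?thesis using x xV by blast
qed

abbreviation CF where "CF \<equiv> cplx_bundle F"
abbreviation cframe :: "('i \<Rightarrow> 'm \<Rightarrow> 'w) \<Rightarrow> 'i \<Rightarrow> 'm \<Rightarrow> 'w \<times> 'w" where
  "cframe e \<equiv> (\<lambda>\<alpha> x. (e \<alpha> x, 0))"

lemma cplx_sel [simp]:
  "fibre CF x = fibre F x \<times> fibre F x" "idx CF = idx F"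
  "scl CF z u = (scl F (Re z) (fst u) - scl F (Im z) (snd u), scl F (Re z) (snd u) + scl F (Im z) (fst u))"
  by (simp_all add: cplx_bundle_def case_prod_unfold)

lemma cplx_frames: "(V, e) \<in> frames F \<Longrightarrow> (V, cframe e) \<in> frames CF"
  by (auto simp: cplx_bundle_def intro!: rev_image_eqI[of "(V, e)"])

lemma cplx_framesE:
  assumes "(V, e') \<in> frames CF" obtains e where "(V, e) \<in> frames F" "e' = cframe e"
  using assms by (auto simp: cplx_bundle_def)

lemma sum_prod: "(\<Sum>k\<in>I. (a k, b k)) = (\<Sum>k\<in>I. a k, \<Sum>k\<in>I. b k)"
  by (induction I rule: infinite_finite_induct) (auto simp: zero_prod_def)

lemma cplx_vector_space: "vector_space (scl CF)"
proof
  fix a b :: complex and u w :: "'w \<times> 'w"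
  show "scl CF a (u + w) = scl CF a u + scl CF a w" "scl CF (a + b) u = scl CF a u + scl CF b u" "scl CF 1 u = u"
    by (simp_all add: V.scale_right_distrib V.scale_left_distrib prod_eq_iff)
  show "scl CF a (scl CF b u) = scl CF (a * b) u"
    by (simp add: V.scale_right_distrib V.scale_right_diff_distrib V.scale_left_distrib V.scale_left_diff_distrib prod_eq_iff)
qed

interpretation C: vector_space "scl CF" by (rule cplx_vector_space)

text \<open>A real frame is a complex frame of the complexification: a complex relation between the
  vectors (e, 0) is a pair of real relations, and spanning is likewise checked on the two
  parts.\<close>

lemma cplx_vector_bundle: "vector_bundle A CF"
  unfolding vector_bundle_def
proof (intro conjI)
  show "vector_space (scl CF)" by (rule cplx_vector_space)
  show "finite (idx CF)" using finite_idx by simp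
  show sub: "\<forall>x. C.subspace (fibre CF x)"
    by (auto simp: C.subspace_def fibre_0 fibre_add fibre_scale fibre_diff zero_prod_def)
  show "(\<Union>(V, e)\<in>frames CF. V) = UNIV"
  proof -
    have "x \<in> (\<Union>(V, e)\<in>frames CF. V)" for x
      by (rule ex_frame[of x], drule cplx_frames) blast
    then show ?thesis by blast
  qed
  show "\<forall>(V, e)\<in>frames CF. open V \<and> (\<forall>x\<in>V. inj_on (\<lambda>\<alpha>. e \<alpha> x) (idx CF) \<and>
      \<not> C.dependent ((\<lambda>\<alpha>. e \<alpha> x) ` idx CF) \<and> C.span ((\<lambda>\<alpha>. e \<alpha> x) ` idx CF) = fibre CF x)"
  proof (intro ballI, clarify, intro conjI ballI)
    fix V e' assume "(V, e') \<in> frames CF"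
    then obtain e where V: "(V, e) \<in> frames F" and e': "e' = cframe e" by (rule cplx_framesE)
    show "open V" by (rule frame_props(1)[OF V])
    fix x assume x: "x \<in> V"
    have inj: "inj_on (\<lambda>\<alpha>. e' \<alpha> x) (idx CF)"
      using frame_props(2)[OF V x] unfolding e' by (auto simp: inj_on_def)
    then show "inj_on (\<lambda>\<alpha>. e' \<alpha> x) (idx CF)" .
    let ?B = "(\<lambda>\<alpha>. e' \<alpha> x) ` idx CF"
    have coeff: "f \<beta> = 0" if "(\<Sum>\<alpha>\<in>idx F. scl F (f \<alpha>) (e \<alpha> x)) = 0" "\<beta> \<in> idx F" for f \<beta>
      using frame_coeff_sum[OF V x that(2), of f] frame_coeff_sum[OF V x that(2), of "\<lambda>_. 0"] that(1) by simp
    show "C.independent ?B"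
    proof (rule C.independent_if_scalars_zero)
      show "finite ?B" using finite_idx by simp
      fix k v assume z: "(\<Sum>v\<in>?B. scl CF (k v) v) = 0" and "v \<in> ?B"
      then obtain \<beta> where \<beta>: "\<beta> \<in> idx F" "v = e' \<beta> x" by auto
      have "(\<Sum>\<alpha>\<in>idx F. scl F (Re (k (e' \<alpha> x))) (e \<alpha> x), \<Sum>\<alpha>\<in>idx F. scl F (Im (k (e' \<alpha> x))) (e \<alpha> x)) = 0"
        using z unfolding sum.reindex[OF inj] by (simp add: e' o_def sum_prod)
      then have "Re (k (e' \<beta> x)) = 0" "Im (k (e' \<beta> x)) = 0"
        using coeff[OF _ \<beta>(1)] by (auto simp: zero_prod_def)
      then show "k v = 0" using \<beta>(2) by (simp add: complex_eq_iff)
    qed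
    show "C.span ?B = fibre CF x"
    proof
      have "?B \<subseteq> fibre CF x" using frame_in_fibre[OF V x] fibre_0 by (auto simp: e')
      then show "C.span ?B \<subseteq> fibre CF x" using sub by (intro C.span_minimal) auto
      show "fibre CF x \<subseteq> C.span ?B"
      proof
        fix u assume "u \<in> fibre CF x"
        then have u: "fst u \<in> fibre F x" "snd u \<in> fibre F x" by auto
        let ?z = "\<lambda>\<alpha>. Complex (frame_coeff F e x (fst u) \<alpha>) (frame_coeff F e x (snd u) \<alpha>)"
        have "(\<Sum>\<alpha>\<in>idx F. scl CF (?z \<alpha>) (cframe e \<alpha> x))
            = (\<Sum>\<alpha>\<in>idx F. scl F (frame_coeff F e x (fst u) \<alpha>) (e \<alpha> x), \<Sum>\<alpha>\<in>idx F. scl F (frame_coeff F e x (snd u) \<alpha>) (e \<alpha> x))"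
          by (simp add: sum_prod)
        also have "\<dots> = u"
          by (simp only: frame_coeff_expansion[OF V x u(1), symmetric] frame_coeff_expansion[OF V x u(2), symmetric] prod.collapse)
        finally have "u = (\<Sum>\<alpha>\<in>idx F. scl CF (?z \<alpha>) (cframe e \<alpha> x))" by (rule sym)
        also have "\<dots> \<in> C.span ?B"
          by (intro C.span_sum C.span_scale C.span_base) (simp add: e')
        finally show "u \<in> C.span ?B" .
      qed
    qed
  qed
  show "\<forall>(V, e)\<in>frames CF. \<forall>(V', e')\<in>frames CF. \<exists>t.
        (\<forall>\<alpha>\<in>idx CF. \<forall>\<beta>\<in>idx CF. smooth_map A (V \<inter> V') (t \<alpha> \<beta> :: 'm \<Rightarrow> complex)) \<and>
        (\<forall>x\<in>V \<inter> V'. \<forall>\<alpha>\<in>idx CF. e' \<alpha> x = (\<Sum>\<beta>\<in>idx CF. scl CF (t \<alpha> \<beta> x) (e \<beta> x)))"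
  proof (intro ballI case_prodI2)
    fix f f' V e1 V' e1' assume "f \<in> frames CF" "f = (V, e1)" "f' \<in> frames CF" "f' = (V', e1')"
    then have "(V, e1) \<in> frames CF" "(V', e1') \<in> frames CF" by simp_all
    then obtain e e' where V: "(V, e) \<in> frames F" "(V', e') \<in> frames F" and e: "e1 = cframe e" "e1' = cframe e'"
      by (metis cplx_framesE)
    obtain t where t: "\<And>\<alpha> \<beta>. \<alpha> \<in> idx F \<Longrightarrow> \<beta> \<in> idx F \<Longrightarrow> smooth_map A (V \<inter> V') (t \<alpha> \<beta> :: 'm \<Rightarrow> real)"
      "\<And>x \<alpha>. x \<in> V \<inter> V' \<Longrightarrow> \<alpha> \<in> idx F \<Longrightarrow> e' \<alpha> x = (\<Sum>\<beta>\<in>idx F. scl F (t \<alpha> \<beta> x) (e \<beta> x))"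
      using frame_transition[OF V] by blast
    have oVV: "open (V \<inter> V')" by (intro open_Int frame_props(1)[OF V(1)] frame_props(1)[OF V(2)])
    have "smooth_map A (V \<inter> V') (\<lambda>x. complex_of_real (t \<alpha> \<beta> x))" if "\<alpha> \<in> idx F" "\<beta> \<in> idx F" for \<alpha> \<beta>
      by (rule smooth_map_bounded_linear[OF bounded_linear_of_real atlas oVV t(1)[OF that]])
    moreover have "e1' \<alpha> x = (\<Sum>\<beta>\<in>idx CF. scl CF (of_real (t \<alpha> \<beta> x)) (e1 \<beta> x))" if "x \<in> V \<inter> V'" "\<alpha> \<in> idx F" for x \<alpha>
      unfolding e using t(2)[OF that] by (simp add: sum_prod)
    ultimately show "\<exists>t. (\<forall>\<alpha>\<in>idx CF. \<forall>\<beta>\<in>idx CF. smooth_map A (V \<inter> V') (t \<alpha> \<beta> :: 'm \<Rightarrow> complex)) \<and>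
        (\<forall>x\<in>V \<inter> V'. \<forall>\<alpha>\<in>idx CF. e1' \<alpha> x = (\<Sum>\<beta>\<in>idx CF. scl CF (t \<alpha> \<beta> x) (e1 \<beta> x)))"
      by (intro exI[of _ "\<lambda>\<alpha> \<beta> x. of_real (t \<alpha> \<beta> x)"]) (simp del: cplx_sel(1,3))
  qed
qed

end

section \<open>The complexified metric and connection\<close>

lemma dfun_has_derivative:
  assumes "((f \<circ> chart_inv c) has_derivative F) (at (snd c x))"
  shows "dfun f c x v = F v"
  using frechet_derivative_eqI[OF assms] by (simp add: dfun_def)

lemma dfun_bounded_linear:
  assumes "bounded_linear \<phi>" "(f \<circ> chart_inv c) differentiable (at (snd c x))"
  shows "dfun (\<lambda>y. \<phi> (f y)) c x v = \<phi> (dfun f c x v)"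
  using dfun_has_derivative[of "\<lambda>y. \<phi> (f y)" c "\<lambda>v. \<phi> (dfun f c x v)" x v]
    bounded_linear.has_derivative[OF assms(1) frechet_has_derivative[OF assms(2)]] by (simp add: dfun_def o_def)

lemma dfun_add:
  assumes "(f \<circ> chart_inv c) differentiable (at (snd c x))" "(f' \<circ> chart_inv c) differentiable (at (snd c x))"
  shows "dfun (\<lambda>y. f y + f' y) c x v = dfun f c x v + dfun f' c x v"
  using dfun_has_derivative[of "\<lambda>y. f y + f' y" c "\<lambda>v. dfun f c x v + dfun f' c x v" x v]
    has_derivative_add[OF frechet_has_derivative[OF assms(1)] frechet_has_derivative[OF assms(2)]] by (simp add: dfun_def o_def)

lemma dfun_diff:
  assumes "(f \<circ> chart_inv c) differentiable (at (snd c x))" "(f' \<circ> chart_inv c) differentiable (at (snd c x))"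
  shows "dfun (\<lambda>y. f y - f' y) c x v = dfun f c x v - dfun f' c x v"
  using dfun_has_derivative[of "\<lambda>y. f y - f' y" c "\<lambda>v. dfun f c x v - dfun f' c x v" x v]
    has_derivative_diff[OF frechet_has_derivative[OF assms(1)] frechet_has_derivative[OF assms(2)]] by (simp add: dfun_def o_def)

lemma dfun_Complex:
  assumes "(f \<circ> chart_inv c) differentiable (at (snd c x))" "(f' \<circ> chart_inv c) differentiable (at (snd c x))"
  shows "dfun (\<lambda>y. Complex (f y) (f' y)) c x v = Complex (dfun f c x v) (dfun f' c x v)"
proof -
  have "((\<lambda>z. of_real ((f \<circ> chart_inv c) z) + \<i> * of_real ((f' \<circ> chart_inv c) z)) has_derivative
     (\<lambda>v. of_real (dfun f c x v) + \<i> * of_real (dfun f' c x v))) (at (snd c x))"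
    unfolding dfun_def
    by (intro has_derivative_add has_derivative_mult_right has_derivative_of_real frechet_has_derivative assms)
  then show ?thesis
    by (intro dfun_has_derivative) (simp add: Complex_eq o_def)
qed

text \<open>Stated for \<open>bundle_space\<close> because it is applied to a real bundle and also
  to its exterior power.\<close>

lemma cplx_section_parts:
  fixes F :: "(real, 'm::topological_space, 'w::ab_group_add, 'i) vbundle" and A :: "('m, 'n::finite) chart set"
  assumes F: "bundle_space A F" and S: "open S" and s: "smooth_section A (cplx_bundle F) S s"
  shows "smooth_section A F S (fst \<circ> s)" "smooth_section A F S (snd \<circ> s)"
proof -
  interpret bundle_space A F by (rule F)
  have "\<exists>f. (\<forall>\<alpha>\<in>idx F. smooth_map A (S \<inter> V) (f \<alpha> :: 'm \<Rightarrow> complex)) \<and>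
        (\<forall>x\<in>S \<inter> V. s x = (\<Sum>\<alpha>\<in>idx F. scl F (Re (f \<alpha> x)) (e \<alpha> x), \<Sum>\<alpha>\<in>idx F. scl F (Im (f \<alpha> x)) (e \<alpha> x)))"
    if V: "(V, e) \<in> frames F" for V e
  proof -
    have "(V, \<lambda>\<alpha> x. (e \<alpha> x, 0)) \<in> frames (cplx_bundle F)"
      using V by (auto simp: cplx_bundle_def intro!: rev_image_eqI[of "(V, e)"])
    from bspec[OF s[unfolded smooth_section_def, THEN conjunct2] this, unfolded prod.case]
    have "\<exists>f. (\<forall>\<alpha>\<in>idx F. smooth_map A (S \<inter> V) (f \<alpha> :: 'm \<Rightarrow> complex)) \<and>
        (\<forall>x\<in>S \<inter> V. s x = (\<Sum>\<alpha>\<in>idx F. (scl F (Re (f \<alpha> x)) (e \<alpha> x), scl F (Im (f \<alpha> x)) (e \<alpha> x))))"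
      by (simp add: cplx_bundle_def)
    moreover have "(\<Sum>k\<in>I. (a k, b k)) = (\<Sum>k\<in>I. a k, \<Sum>k\<in>I. b k)" for I and a b :: "'i \<Rightarrow> 'w"
      by (induction I rule: infinite_finite_induct) (auto simp: zero_prod_def)
    ultimately show ?thesis by simp
  qed
  note parts = this
  have fib: "s x \<in> fibre F x \<times> fibre F x" if "x \<in> S" for x
    using s that unfolding smooth_section_def by (simp add: cplx_bundle_def)
  have sm: "smooth_map A (S \<inter> V) (\<lambda>x. Re (f x))" "smooth_map A (S \<inter> V) (\<lambda>x. Im (f x))"
    if "(V, e) \<in> frames F" "smooth_map A (S \<inter> V) f" for V e f
    by (intro smooth_map_bounded_linear[OF bounded_linear_Re atlas _ that(2)]
        smooth_map_bounded_linear[OF bounded_linear_Im atlas _ that(2)] open_Int S open_frame[OF that(1)])+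
  show "smooth_section A F S (fst \<circ> s)"
  proof (rule smooth_sectionI)
    show "(fst \<circ> s) x \<in> fibre F x" if "x \<in> S" for x using fib[OF that] by auto
    fix V e assume V: "(V, e) \<in> frames F"
    obtain f where f: "\<forall>\<alpha>\<in>idx F. smooth_map A (S \<inter> V) (f \<alpha> :: 'm \<Rightarrow> complex)"
        "\<forall>x\<in>S \<inter> V. s x = (\<Sum>\<alpha>\<in>idx F. scl F (Re (f \<alpha> x)) (e \<alpha> x), \<Sum>\<alpha>\<in>idx F. scl F (Im (f \<alpha> x)) (e \<alpha> x))"
      using parts[OF V] by blast
    then show "\<exists>f. (\<forall>\<alpha>\<in>idx F. smooth_map A (S \<inter> V) (f \<alpha>)) \<and> (\<forall>x\<in>S \<inter> V. (fst \<circ> s) x = (\<Sum>\<alpha>\<in>idx F. scl F (f \<alpha> x) (e \<alpha> x)))"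
      by (intro exI[of _ "\<lambda>\<alpha> x. Re (f \<alpha> x)"]) (simp add: sm(1)[OF V])
  qed
  show "smooth_section A F S (snd \<circ> s)"
  proof (rule smooth_sectionI)
    show "(snd \<circ> s) x \<in> fibre F x" if "x \<in> S" for x using fib[OF that] by auto
    fix V e assume V: "(V, e) \<in> frames F"
    obtain f where f: "\<forall>\<alpha>\<in>idx F. smooth_map A (S \<inter> V) (f \<alpha> :: 'm \<Rightarrow> complex)"
        "\<forall>x\<in>S \<inter> V. s x = (\<Sum>\<alpha>\<in>idx F. scl F (Re (f \<alpha> x)) (e \<alpha> x), \<Sum>\<alpha>\<in>idx F. scl F (Im (f \<alpha> x)) (e \<alpha> x))"
      using parts[OF V] by blast
    then show "\<exists>f. (\<forall>\<alpha>\<in>idx F. smooth_map A (S \<inter> V) (f \<alpha>)) \<and> (\<forall>x\<in>S \<inter> V. (snd \<circ> s) x = (\<Sum>\<alpha>\<in>idx F. scl F (f \<alpha> x) (e \<alpha> x)))"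
      by (intro exI[of _ "\<lambda>\<alpha> x. Im (f \<alpha> x)"]) (simp add: sm(2)[OF V])
  qed
qed

lemma (in bundle_space) conn_change:
  assumes D: "connection A E D" and "open W" "smooth_section A E W s" "c \<in> A" "c' \<in> A" "x \<in> W" "x \<in> fst c" "x \<in> fst c'"
  shows "D s c x v = D s c' x (change_coords c c' x v)"
  by (rule D[unfolded connection_def, rule_format, OF conjI[OF assms(2,3)], THEN conjunct2, THEN conjunct2,
      THEN conjunct1, rule_format, OF assms(4,5) IntI[OF IntI[OF assms(6,7)] assms(8)]])

context real_metric_bundle
begin

lemma self_space: "bundle_space A F" ..

interpretation CB: smooth_bundle A CF
  by unfold_locales (rule is_atlas, rule cplx_vector_bundle)

lemma cplx_sectionI:
  assumes S: "open S" and s: "smooth_section A F S s" "smooth_section A F S t"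
  shows "smooth_section A CF S (\<lambda>x. (s x, t x))"
proof (rule CB.smooth_sectionI)
  show "(s x, t x) \<in> fibre CF x" if "x \<in> S" for x
    using s[THEN smooth_section_in_fibre, OF that] by simp
  fix V e' assume "(V, e') \<in> frames CF"
  then obtain e where V: "(V, e) \<in> frames F" and e': "e' = cframe e" by (rule cplx_framesE)
  have oSV: "open (S \<inter> V)" by (intro open_Int S frame_props(1)[OF V])
  obtain f where f: "\<And>\<alpha>. \<alpha> \<in> idx F \<Longrightarrow> smooth_map A (S \<inter> V) (f \<alpha> :: 'm \<Rightarrow> real)"
    "\<And>x. x \<in> S \<inter> V \<Longrightarrow> s x = (\<Sum>\<alpha>\<in>idx F. scl F (f \<alpha> x) (e \<alpha> x))"
    using smooth_section_coeffs[OF s(1) V] by blast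
  obtain f' where f': "\<And>\<alpha>. \<alpha> \<in> idx F \<Longrightarrow> smooth_map A (S \<inter> V) (f' \<alpha> :: 'm \<Rightarrow> real)"
    "\<And>x. x \<in> S \<inter> V \<Longrightarrow> t x = (\<Sum>\<alpha>\<in>idx F. scl F (f' \<alpha> x) (e \<alpha> x))"
    using smooth_section_coeffs[OF s(2) V] by blast
  have "smooth_map A (S \<inter> V) (\<lambda>x. of_real (f \<alpha> x) + \<i> * of_real (f' \<alpha> x))" if "\<alpha> \<in> idx F" for \<alpha>
    by (intro smooth_map_add smooth_map_mult smooth_map_const atlas oSV
        smooth_map_bounded_linear[OF bounded_linear_of_real] f(1)[OF that] f'(1)[OF that])
  then show "\<exists>f. (\<forall>\<alpha>\<in>idx CF. smooth_map A (S \<inter> V) (f \<alpha>)) \<and>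
        (\<forall>x\<in>S \<inter> V. (s x, t x) = (\<Sum>\<alpha>\<in>idx CF. scl CF (f \<alpha> x) (e' \<alpha> x)))"
    using f(2) f'(2)
    by (intro exI[of _ "\<lambda>\<alpha> x. of_real (f \<alpha> x) + \<i> * of_real (f' \<alpha> x)"]) (simp add: e' sum_prod)
qed

lemma cplx_metric_eq: "cplx_metric g x u w
    = Complex (g x (fst u) (fst w) + g x (snd u) (snd w)) (g x (snd u) (fst w) - g x (fst u) (snd w))"
  by (simp add: cplx_metric_def case_prod_unfold)

lemma cplx_hermitian_bundle: "hermitian_bundle A CF (cplx_metric g)"
proof -
  have form: "cplx_metric g x (u + v) w = cplx_metric g x u w + cplx_metric g x v w \<and>
      cplx_metric g x (scl CF a u) w = a * cplx_metric g x u w \<and> cplx_metric g x w u = cnj (cplx_metric g x u w)"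
    if u: "u \<in> fibre CF x" and v: "v \<in> fibre CF x" and w: "w \<in> fibre CF x" for x u v w a
  proof (intro conjI)
  have uvw: "fst u \<in> fibre F x" "snd u \<in> fibre F x" "fst v \<in> fibre F x" "snd v \<in> fibre F x"
    "fst w \<in> fibre F x" "snd w \<in> fibre F x"
    using u v w by auto
  have sym: "g x (fst w) (fst u) = g x (fst u) (fst w)" "g x (snd w) (snd u) = g x (snd u) (snd w)"
    "g x (snd w) (fst u) = g x (fst u) (snd w)" "g x (fst w) (snd u) = g x (snd u) (fst w)"
    by (rule g_sym; rule uvw)+
  have g_scale': "g x (scl F b y) y' = b * g x y y'" if "y \<in> fibre F x" "y' \<in> fibre F x" for b y y'
    by (rule g_scale[OF that(1,1,2)])
  show "cplx_metric g x (u + v) w = cplx_metric g x u w + cplx_metric g x v w"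
    by (simp add: cplx_metric_eq g_add uvw complex_eq_iff)
  show "cplx_metric g x (scl CF a u) w = a * cplx_metric g x u w"
    by (simp add: cplx_metric_eq g_diff g_add g_scale' fibre_scale uvw complex_eq_iff algebra_simps)
  show "cplx_metric g x w u = cnj (cplx_metric g x u w)"
    by (simp add: cplx_metric_eq sym complex_eq_iff)
  qed
  have pos: "\<exists>r>0. cplx_metric g x u u = of_real r" if u: "u \<in> fibre CF x" "u \<noteq> 0" for x u
  proof -
  have uf: "fst u \<in> fibre F x" "snd u \<in> fibre F x" using u(1) by auto
  have nn: "0 \<le> g x y y" if "y \<in> fibre F x" for y
    using g_pos[OF that] g_zero[OF fibre_0] by (cases "y = 0") (auto intro: less_imp_le)
  have "0 < g x (fst u) (fst u) + g x (snd u) (snd u)"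
  proof (cases "fst u = 0")
    case True
    then have "snd u \<noteq> 0" using u(2) by (simp add: prod_eq_iff)
    then show ?thesis using g_pos[OF uf(2)] nn[OF uf(1)] by simp
  next
    case False
    then show ?thesis using g_pos[OF uf(1)] nn[OF uf(2)] by simp
  qed
  moreover have "g x (snd u) (fst u) = g x (fst u) (snd u)" by (rule g_sym; rule uf)
  ultimately show "\<exists>r>0. cplx_metric g x u u = of_real r"
    by (intro exI[of _ "g x (fst u) (fst u) + g x (snd u) (snd u)"]) (simp add: cplx_metric_eq complex_eq_iff)
  qed
  have "\<forall>(V, e)\<in>frames CF. \<forall>\<alpha>\<in>idx CF. \<forall>\<beta>\<in>idx CF. smooth_map A V (\<lambda>x. cplx_metric g x (e \<alpha> x) (e \<beta> x))"
  proof (intro ballI case_prodI2)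
    fix p V e' \<alpha> \<beta> assume "p \<in> frames CF" "p = (V, e')" and ab: "\<alpha> \<in> idx CF" "\<beta> \<in> idx CF"
    then obtain e where V: "(V, e) \<in> frames F" and e': "e' = cframe e" using cplx_framesE by blast
    have "smooth_map A V (\<lambda>x. complex_of_real (g x (e \<alpha> x) (e \<beta> x)))"
      using ab by (intro smooth_map_bounded_linear[OF bounded_linear_of_real atlas frame_props(1)[OF V]] g_frame_smooth[OF V]) simp_all
    then show "smooth_map A V (\<lambda>x. cplx_metric g x (e' \<alpha> x) (e' \<beta> x))"
    proof (rule smooth_map_cong[OF atlas frame_props(1)[OF V], THEN iffD1, rotated])
      fix x assume x: "x \<in> V"
      have "e \<alpha> x \<in> fibre F x" "e \<beta> x \<in> fibre F x" using frame_in_fibre[OF V x] ab by auto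
      then show "complex_of_real (g x (e \<alpha> x) (e \<beta> x)) = cplx_metric g x (e' \<alpha> x) (e' \<beta> x)"
        by (simp add: cplx_metric_eq e' g_zero g_zero_right fibre_0 complex_eq_iff)
    qed
  qed
  with form pos show ?thesis
    unfolding hermitian_bundle_def fibre_metric_def using cplx_vector_bundle by blast
qed

lemma cplx_connection: "connection A CF (cplx_conn D)"
  unfolding connection_def
proof (intro allI impI, elim conjE, intro conjI)
  fix S s assume S: "open S" and s: "smooth_section A CF S s"
  note s1 = cplx_section_parts(1)[OF self_space S s] and s2 = cplx_section_parts(2)[OF self_space S s]
  have oSc: "open (S \<inter> fst c)" if "c \<in> A" for c by (intro open_Int S open_chart_dom[OF atlas that])
  show "\<forall>c\<in>A. \<forall>v. smooth_section A CF (S \<inter> fst c) (\<lambda>x. cplx_conn D s c x v)"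
    unfolding cplx_conn_def
    by (intro ballI allI cplx_sectionI oSc conn_smooth[OF D S] s1 s2)
  show "\<forall>c\<in>A. \<forall>x\<in>S \<inter> fst c. \<forall>v w r. cplx_conn D s c x (v + w) = cplx_conn D s c x v + cplx_conn D s c x w \<and>
           cplx_conn D s c x (r *\<^sub>R v) = scl CF (of_real r) (cplx_conn D s c x v)"
  proof (intro ballI allI)
    fix c x v w and r :: real assume c: "c \<in> A" and "x \<in> S \<inter> fst c"
    then have x: "x \<in> S" "x \<in> fst c" by auto
    show "cplx_conn D s c x (v + w) = cplx_conn D s c x v + cplx_conn D s c x w \<and>
           cplx_conn D s c x (r *\<^sub>R v) = scl CF (of_real r) (cplx_conn D s c x v)"
      unfolding cplx_conn_def
      using conn_vec_add[OF D S s1 c x, of v w] conn_vec_add[OF D S s2 c x, of v w]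
        conn_vec_scale[OF D S s1 c x, of r v] conn_vec_scale[OF D S s2 c x, of r v] by simp
  qed
  show "\<forall>c\<in>A. \<forall>c'\<in>A. \<forall>x\<in>S \<inter> fst c \<inter> fst c'. \<forall>v. cplx_conn D s c x v = cplx_conn D s c' x (change_coords c c' x v)"
  proof (intro ballI allI)
    fix c c' x v assume c: "c \<in> A" "c' \<in> A" and "x \<in> S \<inter> fst c \<inter> fst c'"
    then have x: "x \<in> S" "x \<in> fst c" "x \<in> fst c'" by blast+
    show "cplx_conn D s c x v = cplx_conn D s c' x (change_coords c c' x v)"
      unfolding cplx_conn_def using conn_change[OF D S s1 c x, of v] conn_change[OF D S s2 c x, of v] by simp
  qed
  show "\<forall>t. smooth_section A CF S t \<longrightarrow> (\<forall>c\<in>A. \<forall>x\<in>S \<inter> fst c. \<forall>v.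
           ((\<forall>y\<in>S. s y = t y) \<longrightarrow> cplx_conn D s c x v = cplx_conn D t c x v) \<and>
           cplx_conn D (\<lambda>y. s y + t y) c x v = cplx_conn D s c x v + cplx_conn D t c x v)"
  proof (intro allI impI ballI conjI)
    fix t c x v assume t: "smooth_section A CF S t" and c: "c \<in> A" and "x \<in> S \<inter> fst c"
    then have x: "x \<in> S" "x \<in> fst c" by auto
    note t1 = cplx_section_parts(1)[OF self_space S t] and t2 = cplx_section_parts(2)[OF self_space S t]
    show "cplx_conn D s c x v = cplx_conn D t c x v" if "\<forall>y\<in>S. s y = t y"
      unfolding cplx_conn_def
      using conn_cong[OF D S s1 t1 c x, of v] conn_cong[OF D S s2 t2 c x, of v] that by simp
    have eq: "fst \<circ> (\<lambda>y. s y + t y) = (\<lambda>y. (fst \<circ> s) y + (fst \<circ> t) y)" "snd \<circ> (\<lambda>y. s y + t y) = (\<lambda>y. (snd \<circ> s) y + (snd \<circ> t) y)"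
      by auto
    show "cplx_conn D (\<lambda>y. s y + t y) c x v = cplx_conn D s c x v + cplx_conn D t c x v"
      unfolding cplx_conn_def eq conn_add[OF D S s1 t1 c x] conn_add[OF D S s2 t2 c x] by simp
  qed
  show "\<forall>f. smooth_map A S f \<longrightarrow> (\<forall>c\<in>A. \<forall>x\<in>S \<inter> fst c. \<forall>v. cplx_conn D (\<lambda>y. scl CF (f y) (s y)) c x v =
           scl CF (dfun f c x v) (s x) + scl CF (f x) (cplx_conn D s c x v))"
  proof (intro allI impI ballI)
    fix f :: "'m \<Rightarrow> complex" and c x v assume f: "smooth_map A S f" and c: "c \<in> A" and "x \<in> S \<inter> fst c"
    then have x: "x \<in> S" "x \<in> fst c" by auto
    have fd: "(f \<circ> chart_inv c) differentiable (at (snd c x))" by (rule smooth_map_differentiable[OF f c x])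
    have bl: "bounded_linear Re" "bounded_linear Im" "bounded_linear (\<lambda>z. - Im z)"
      by (intro bounded_linear_Re bounded_linear_Im bounded_linear_minus)+
    have fs: "smooth_map A S (\<lambda>y. Re (f y))" "smooth_map A S (\<lambda>y. Im (f y))" "smooth_map A S (\<lambda>y. - Im (f y))"
      by (rule smooth_map_bounded_linear[OF bl(1) atlas S f] smooth_map_bounded_linear[OF bl(2) atlas S f]
          smooth_map_bounded_linear[OF bl(3) atlas S f])+
    note df = dfun_bounded_linear[OF bl(1) fd, of v] dfun_bounded_linear[OF bl(2) fd, of v] dfun_bounded_linear[OF bl(3) fd, of v]
    \<comment> \<open>The minus sign is put into the coefficient, so that the sum and Leibniz rules
      of the real connection apply to both parts.\<close>
    have eq: "fst \<circ> (\<lambda>y. scl CF (f y) (s y)) = (\<lambda>y. scl F (Re (f y)) ((fst \<circ> s) y) + scl F (- Im (f y)) ((snd \<circ> s) y))"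
      "snd \<circ> (\<lambda>y. scl CF (f y) (s y)) = (\<lambda>y. scl F (Re (f y)) ((snd \<circ> s) y) + scl F (Im (f y)) ((fst \<circ> s) y))"
      by auto
    have 1: "D (fst \<circ> (\<lambda>y. scl CF (f y) (s y))) c x v = (scl F (Re (dfun f c x v)) ((fst \<circ> s) x) + scl F (Re (f x)) (D (fst \<circ> s) c x v))
        + (scl F (- Im (dfun f c x v)) ((snd \<circ> s) x) + scl F (- Im (f x)) (D (snd \<circ> s) c x v))"
      unfolding eq(1) conn_add[OF D S smooth_section_scale[OF S fs(1) s1] smooth_section_scale[OF S fs(3) s2] c x]
        conn_scale[OF D S s1 fs(1) c x] conn_scale[OF D S s2 fs(3) c x] df ..
    have 2: "D (snd \<circ> (\<lambda>y. scl CF (f y) (s y))) c x v = (scl F (Re (dfun f c x v)) ((snd \<circ> s) x) + scl F (Re (f x)) (D (snd \<circ> s) c x v))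
        + (scl F (Im (dfun f c x v)) ((fst \<circ> s) x) + scl F (Im (f x)) (D (fst \<circ> s) c x v))"
      unfolding eq(2) conn_add[OF D S smooth_section_scale[OF S fs(1) s2] smooth_section_scale[OF S fs(2) s1] c x]
        conn_scale[OF D S s2 fs(1) c x] conn_scale[OF D S s1 fs(2) c x] df ..
    show "cplx_conn D (\<lambda>y. scl CF (f y) (s y)) c x v = scl CF (dfun f c x v) (s x) + scl CF (f x) (cplx_conn D s c x v)"
      unfolding cplx_conn_def 1 2 by (simp add: algebra_simps)
  qed
qed

lemma dfun_g:
  assumes "open S" "smooth_section A F S s" "smooth_section A F S t" "c \<in> A" "x \<in> S" "x \<in> fst c"
  shows "dfun (\<lambda>y. g y (s y) (t y)) c x v = g x (D s c x v) (t x) + g x (s x) (D t c x v)"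
  using metric_conn[unfolded metric_connection_def, THEN conjunct2, rule_format, OF conjI[OF assms(1)
        conjI[OF assms(2,3)]] assms(4) IntI[OF assms(5,6)]] .

lemma cplx_metric_connection: "metric_connection A CF (cplx_metric g) (cplx_conn D)"
  unfolding metric_connection_def
proof (intro conjI cplx_connection allI impI ballI, elim conjE)
  fix S s t c x v
  assume c: "c \<in> A" and "x \<in> S \<inter> fst c" and S: "open S" and s: "smooth_section A CF S s" and t: "smooth_section A CF S t"
  then have x: "x \<in> S" "x \<in> fst c" by auto
  note s1 = cplx_section_parts(1)[OF self_space S s] and s2 = cplx_section_parts(2)[OF self_space S s]
  note t1 = cplx_section_parts(1)[OF self_space S t] and t2 = cplx_section_parts(2)[OF self_space S t]
  let ?s1 = "fst \<circ> s" and ?s2 = "snd \<circ> s" and ?t1 = "fst \<circ> t" and ?t2 = "snd \<circ> t"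
  note diff = g_sections_smooth[OF S _ _ c x]
  note d11 = diff[OF s1 t1] and d22 = diff[OF s2 t2] and d21 = diff[OF s2 t1] and d12 = diff[OF s1 t2]
  have "dfun (\<lambda>y. cplx_metric g y (s y) (t y)) c x v
     = dfun (\<lambda>y. Complex (g y (?s1 y) (?t1 y) + g y (?s2 y) (?t2 y)) (g y (?s2 y) (?t1 y) - g y (?s1 y) (?t2 y))) c x v"
    by (simp add: cplx_metric_eq)
  also have "\<dots> = Complex (dfun (\<lambda>y. g y (?s1 y) (?t1 y) + g y (?s2 y) (?t2 y)) c x v) (dfun (\<lambda>y. g y (?s2 y) (?t1 y) - g y (?s1 y) (?t2 y)) c x v)"
  proof (rule dfun_Complex)
    show "((\<lambda>y. g y (?s1 y) (?t1 y) + g y (?s2 y) (?t2 y)) \<circ> chart_inv c) differentiable at (snd c x)"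
      using differentiable_add[OF d11 d22] by (simp add: o_def)
    show "((\<lambda>y. g y (?s2 y) (?t1 y) - g y (?s1 y) (?t2 y)) \<circ> chart_inv c) differentiable at (snd c x)"
      using differentiable_diff[OF d21 d12] by (simp add: o_def)
  qed
  also have "\<dots> = cplx_metric g x (cplx_conn D s c x v) (t x) + cplx_metric g x (s x) (cplx_conn D t c x v)"
    unfolding dfun_add[OF d11 d22] dfun_diff[OF d21 d12] dfun_g[OF S s1 t1 c x] dfun_g[OF S s2 t2 c x]
      dfun_g[OF S s2 t1 c x] dfun_g[OF S s1 t2 c x]
    by (simp add: cplx_metric_eq cplx_conn_def complex_eq_iff)
  finally show "dfun (\<lambda>y. cplx_metric g y (s y) (t y)) c x v
     = cplx_metric g x (cplx_conn D s c x v) (t x) + cplx_metric g x (s x) (cplx_conn D t c x v)" .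
qed

lemma cplx_metric_bundle:
  assumes "hermitian_metric A h"
  shows "metric_bundle A h CF (cplx_metric g) (cplx_conn D)"
  by unfold_locales (rule is_atlas assms cplx_hermitian_bundle cplx_metric_connection)+

text \<open>In a real frame the connection matrix stays real. It therefore acts on the real and
  imaginary parts of a complex tensor separately.\<close>

lemma cplx_conn_coeff:
  assumes V: "(V, e) \<in> frames F" and c: "c \<in> A" and x: "x \<in> V" "x \<in> fst c" and ab: "\<alpha> \<in> idx F" "\<beta> \<in> idx F"
  shows "CB.conn_coeff (cplx_conn D) (cframe e) c v \<alpha> \<beta> x = of_real (conn_coeff D e c v \<alpha> \<beta> x)"
  unfolding CB.conn_coeff_def[OF cplx_connection]
proof (rule CB.frame_coeff_unique[OF cplx_frames[OF V] x(1)])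
  have eq: "fst \<circ> cframe e \<alpha> = e \<alpha>" "snd \<circ> cframe e \<alpha> = (\<lambda>x. 0)" by auto
  show "cplx_conn D (cframe e \<alpha>) c x v = (\<Sum>\<beta>\<in>idx CF. scl CF (of_real (conn_coeff D e c v \<alpha> \<beta> x)) (e \<beta> x, 0))"
    unfolding cplx_conn_def eq conn_zero[OF D c x(2)] conn_frame[OF D V c ab(1) x] by (simp add: sum_prod)
  show "\<beta> \<in> idx CF" using ab by simp
qed

end

lemma derivation_of_real:
  fixes Y :: "'a \<Rightarrow> 'a \<Rightarrow> real"
  assumes "\<And>a b. a \<in> J \<Longrightarrow> b \<in> J \<Longrightarrow> X a b = (of_real (Y a b) :: complex)"
    and "\<alpha> \<in> multi_index q J" "\<beta> \<in> multi_index q J"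
  shows "derivation q X \<alpha> \<beta> = of_real (derivation q Y \<alpha> \<beta>)"
  unfolding derivation_def at_slot_def of_real_sum of_real_prod
  by (intro sum.cong prod.cong refl) (use assms in \<open>auto simp: kron_def PiE_iff\<close>)

section \<open>Complexified exterior powers of real bundles\<close>

context
  fixes A :: "('m::t2_space, 'n::finite) chart set"
    and h :: "('m, 'n) chart \<Rightarrow> 'm \<Rightarrow> complex ^ 'n ^ 'n"
    and F :: "(real, 'm, 'w::ab_group_add, 'j::linorder) vbundle"
    and g :: "'m \<Rightarrow> 'w \<Rightarrow> 'w \<Rightarrow> real"
    and D :: "('m, 'n, 'w) conn"
    and L :: "('m, 'n, ('w \<Rightarrow> real) list \<Rightarrow> real) conn" and q :: nat
  assumes h: "hermitian_metric A h" and F: "real_metric_bundle A F g D" and L: "induced_connection A F D q L"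
begin

interpretation real_metric_bundle A F g D by (rule F)
interpretation X: ext_bundle A F q ..
interpretation C: metric_bundle A h CF "cplx_metric g" "cplx_conn D" by (rule cplx_metric_bundle[OF h])

text \<open>Verified directly, since \<open>H0_eq_zeroI\<close> would ask for the complexified
  exterior power to be a \<open>bundle_space\<close>.\<close>

lemma cplx_ext_zero_in_H0: "(\<lambda>x. 0) \<in> H0 A (cplx_bundle X.\<Lambda>) (cplx_conn L)"
proof -
  have 1: "fst \<circ> (\<lambda>x::'m. 0) = (\<lambda>x. 0 :: ('w \<Rightarrow> real) list \<Rightarrow> real)" "snd \<circ> (\<lambda>x::'m. 0) = (\<lambda>x. 0 :: ('w \<Rightarrow> real) list \<Rightarrow> real)"
    by auto
  have f0: "0 \<in> fibre X.\<Lambda> x" for x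
    using X.X.smooth_section_in_fibre[OF X.X.smooth_section_zero UNIV_I] .
  have "smooth_section A (cplx_bundle X.\<Lambda>) UNIV (\<lambda>x. 0)"
    unfolding smooth_section_def
  proof (intro conjI ballI case_prodI2)
    show "0 \<in> fibre (cplx_bundle X.\<Lambda>) x" for x
      using f0 unfolding cplx_bundle_def zero_prod_def by simp
    fix p V e
    show "\<exists>f. (\<forall>\<alpha>\<in>idx (cplx_bundle X.\<Lambda>). smooth_map A (UNIV \<inter> V) (f \<alpha> :: 'm \<Rightarrow> complex)) \<and>
      (\<forall>x\<in>UNIV \<inter> V. 0 = (\<Sum>\<alpha>\<in>idx (cplx_bundle X.\<Lambda>). scl (cplx_bundle X.\<Lambda>) (f \<alpha> x) (e \<alpha> x)))"
      by (intro exI[of _ "\<lambda>\<alpha> x. 0"]) (auto simp: cplx_bundle_def fun_scl_def zero_prod_def sum_prod fun_eq_iff case_prod_unfold zero_fun_def)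
  qed
  moreover have "delbar (cplx_bundle X.\<Lambda>) (cplx_conn L) c (\<lambda>x. 0) j x = 0" if "c \<in> A" "x \<in> fst c" for c j x
    unfolding delbar_def cplx_conn_def 1 X.X.conn_zero[OF X.L_connection[OF D L] that]
    by (simp add: cplx_bundle_def fun_scl_def zero_prod_def zero_fun_def)
  ultimately show ?thesis unfolding H0_def by blast
qed

context
  fixes s
  assumes s: "s \<in> H0 A (cplx_bundle (ext_power q F)) (cplx_conn L)"
begin

lemma parts_smooth: "smooth_section A X.\<Lambda> UNIV (fst \<circ> s)" "smooth_section A X.\<Lambda> UNIV (snd \<circ> s)"
  using cplx_section_parts[OF X.X.bundle_space_axioms open_UNIV] s unfolding H0_def by blast+

lemma parts_fibre: "fst (s x) \<in> fibre X.\<Lambda> x" "snd (s x) \<in> fibre X.\<Lambda> x"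
  using parts_smooth[THEN X.X.smooth_section_in_fibre, OF UNIV_I] by simp_all

text \<open>A section is a pair of sections of the real exterior power; their components in a real
  frame become real and imaginary part of one complex tensor over the complexified bundle. The
  exterior power of the complexification is never formed. The first projection recovers the real
  frame from its complexified version.\<close>

abbreviation CT :: "('j \<Rightarrow> 'm \<Rightarrow> 'w \<times> 'w) \<Rightarrow> 'm \<Rightarrow> (nat \<Rightarrow> 'j) \<Rightarrow> complex" where
  "CT e x \<alpha> \<equiv> Complex (wcomp q (\<lambda>a y. fst (e a y)) x (fst (s x)) \<alpha>) (wcomp q (\<lambda>a y. fst (e a y)) x (snd (s x)) \<alpha>)"

lemma parts_wcomp_smooth:
  assumes V: "(V, e) \<in> frames F"
  shows "smooth_map A V (\<lambda>x. wcomp q e x (fst (s x)) \<alpha>)" "smooth_map A V (\<lambda>x. wcomp q e x (snd (s x)) \<alpha>)"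
  using X.wcomp_smooth[OF V open_UNIV parts_smooth(1)] X.wcomp_smooth[OF V open_UNIV parts_smooth(2)] by simp_all

lemma CT_conn:
  assumes V: "(V, e) \<in> frames F" and c: "c \<in> A" and x: "x \<in> V" "x \<in> fst c" and \<beta>: "\<beta> \<in> multi_index q (idx F)"
  shows "Complex (wcomp q e x (L (fst \<circ> s) c x v) \<beta>) (wcomp q e x (L (snd \<circ> s) c x v) \<beta>)
    = dfun (\<lambda>y. CT (cframe e) y \<beta>) c x v
      + (\<Sum>\<alpha>\<in>multi_index q (idx F). CT (cframe e) x \<alpha> * derivation q (\<lambda>a b. C.conn_coeff (cplx_conn D) (cframe e) c v a b x) \<alpha> \<beta>)"
proof -
  let ?der = "derivation q (\<lambda>a b. conn_coeff D e c v a b x)"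
  have der: "derivation q (\<lambda>a b. C.conn_coeff (cplx_conn D) (cframe e) c v a b x) \<alpha> \<beta> = of_real (?der \<alpha> \<beta>)"
    if "\<alpha> \<in> multi_index q (idx F)" for \<alpha>
    by (rule derivation_of_real[OF _ that \<beta>]) (rule cplx_conn_coeff[OF V c x])
  have "dfun (\<lambda>y. CT (cframe e) y \<beta>) c x v
      = Complex (dfun (\<lambda>y. wcomp q e y (fst (s y)) \<beta>) c x v) (dfun (\<lambda>y. wcomp q e y (snd (s y)) \<beta>) c x v)"
    unfolding fst_conv by (intro dfun_Complex smooth_map_differentiable[OF parts_wcomp_smooth(1)[OF V] c x]
      smooth_map_differentiable[OF parts_wcomp_smooth(2)[OF V] c x])
  moreover have "(\<Sum>\<alpha>\<in>multi_index q (idx F). CT (cframe e) x \<alpha> * derivation q (\<lambda>a b. C.conn_coeff (cplx_conn D) (cframe e) c v a b x) \<alpha> \<beta>)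
      = Complex (\<Sum>\<alpha>\<in>multi_index q (idx F). wcomp q e x (fst (s x)) \<alpha> * ?der \<alpha> \<beta>)
          (\<Sum>\<alpha>\<in>multi_index q (idx F). wcomp q e x (snd (s x)) \<alpha> * ?der \<alpha> \<beta>)"
    by (simp add: complex_eq_iff der)
  moreover note X.wcomp_conn[OF D L V open_UNIV parts_smooth(1) c UNIV_I x \<beta>, of v]
    X.wcomp_conn[OF D L V open_UNIV parts_smooth(2) c UNIV_I x \<beta>, of v]
  ultimately show ?thesis by (simp add: complex_eq_iff)
qed

lemma cplx_ext_closed_tensor: "closed_tensor A h CF (cplx_metric g) (cplx_conn D) q CT"
proof
  fix V e' assume "(V, e') \<in> frames CF"
  then obtain e where V: "(V, e) \<in> frames F" and e': "e' = cframe e" by (rule cplx_framesE)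
  have "smooth_map A V (\<lambda>x. of_real (wcomp q e x (fst (s x)) \<alpha>) + \<i> * of_real (wcomp q e x (snd (s x)) \<alpha>))" for \<alpha>
    by (intro smooth_map_add smooth_map_mult smooth_map_const smooth_map_bounded_linear[OF bounded_linear_of_real]
        parts_wcomp_smooth[OF V] atlas frame_props(1)[OF V])
  then show "smooth_map A V (\<lambda>x. CT e' x \<alpha>)" for \<alpha>
    unfolding Complex_eq e' fst_conv .
  show "alternating_on q (idx CF) (CT e' x)" if x: "x \<in> V" for x
    unfolding alternating_on_def e' fst_conv
    using X.wcomp_alternating[OF parts_fibre(1) V x] X.wcomp_alternating[OF parts_fibre(2) V x]
    by (simp add: complex_eq_iff)
  show "dzb j ((\<lambda>y. CT e' y \<beta>) \<circ> chart_inv c) (snd c x)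
      + (\<Sum>\<alpha>\<in>multi_index q (idx CF). CT e' x \<alpha> * derivation q (\<lambda>a b. C.coeffN c e' j a b x) \<alpha> \<beta>) = 0"
    if c: "c \<in> A" and x: "x \<in> V" "x \<in> fst c" and "\<beta> \<in> multi_index q (idx CF)" for c x \<beta> j
  proof -
    have \<beta>: "\<beta> \<in> multi_index q (idx F)" using that(4) by simp
    let ?a = "\<lambda>v. Complex (wcomp q e x (L (fst \<circ> s) c x v) \<beta>) (wcomp q e x (L (snd \<circ> s) c x v) \<beta>)"
    have "delbar (cplx_bundle X.\<Lambda>) (cplx_conn L) c s j x = 0" using s c x(2) unfolding H0_def by blast
    \<comment> \<open>The complex equation splits into two real ones: multiplication by \<i>
      exchanges the parts and explains the signs.\<close>
    then have "fun_scl (1/2) (L (fst \<circ> s) c x (axis j 1)) = fun_scl (1/2) (L (snd \<circ> s) c x (axis j \<i>))"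
      "fun_scl (1/2) (L (snd \<circ> s) c x (axis j 1)) + fun_scl (1/2) (L (fst \<circ> s) c x (axis j \<i>)) = 0"
      by (auto simp: delbar_def cplx_conn_def cplx_bundle_def zero_prod_def)
    from this[THEN arg_cong[where f="\<lambda>\<omega>. 2 * wcomp q e x \<omega> \<beta>"]]
    have z: "?a (axis j 1) + \<i> * ?a (axis j \<i>) = 0"
      unfolding wcomp_add wcomp_fun_scl by (simp add: complex_eq_iff wcomp_def)
    show ?thesis
      unfolding dzb_dfun C.coeffN_def e' cplx_sel(2)
      by (rule closed_components[OF z CT_conn[OF V c x \<beta>] CT_conn[OF V c x \<beta>]])
  qed
next
  fix V e1 V' e1' x t \<beta>
  assume V1: "(V, e1) \<in> frames CF" and V2: "(V', e1') \<in> frames CF" and x: "x \<in> V" "x \<in> V'"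
    and t: "\<And>\<alpha>. \<alpha> \<in> idx CF \<Longrightarrow> e1' \<alpha> x = (\<Sum>\<beta>\<in>idx CF. scl CF (t \<alpha> \<beta>) (e1 \<beta> x))"
    and "\<beta> \<in> multi_index q (idx CF)"
  then have \<beta>: "\<beta> \<in> multi_index q (idx F)" by simp
  obtain e where Ve: "(V, e) \<in> frames F" and e1: "e1 = cframe e" by (rule cplx_framesE[OF V1])
  obtain e' where Ve': "(V', e') \<in> frames F" and e1': "e1' = cframe e'" by (rule cplx_framesE[OF V2])
  note V = Ve Ve' and e = e1 e1'
  have tr: "e' a x = (\<Sum>b\<in>idx F. scl F (Re (t a b)) (e b x))" "(\<Sum>b\<in>idx F. scl F (Im (t a b)) (e b x)) = 0"
    if "a \<in> idx F" for a
    using t[of a] that unfolding e by (simp_all add: sum_prod zero_prod_def)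
  \<comment> \<open>The transition coefficients are given as complex numbers between two real
    frames; independence of the real frame forces their imaginary parts to vanish.\<close>
  have "Im (t a b) = 0" if "a \<in> idx F" "b \<in> idx F" for a b
    using frame_coeff_sum[OF V(1) x(1) that(2), of "\<lambda>b. Im (t a b)"] frame_coeff_sum[OF V(1) x(1) that(2), of "\<lambda>_. 0"]
      tr(2)[OF that(1)] by simp
  then have t_real: "t a b = of_real (Re (t a b))" if "a \<in> idx F" "b \<in> idx F" for a b
    using that by (simp add: complex_eq_iff)
  have prod_real: "(\<Prod>k<q. t (\<alpha> k) (\<beta> k)) = of_real (\<Prod>k<q. Re (t (\<alpha> k) (\<beta> k)))" if "\<alpha> \<in> multi_index q (idx F)" for \<alpha>
    unfolding of_real_prod using that \<beta> by (intro prod.cong refl t_real) (auto simp: PiE_iff)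
  have "Re (\<Prod>k<q. t (\<alpha> k) (\<beta> k)) = (\<Prod>k<q. Re (t (\<alpha> k) (\<beta> k)))" "Im (\<Prod>k<q. t (\<alpha> k) (\<beta> k)) = 0"
    if "\<alpha> \<in> multi_index q (idx F)" for \<alpha>
    unfolding prod_real[OF that] by (rule Re_complex_of_real Im_complex_of_real)+
  moreover have "wcomp q e x \<omega> \<beta> = (\<Sum>\<alpha>\<in>multi_index q (idx F). (\<Prod>k<q. Re (t (\<alpha> k) (\<beta> k))) * wcomp q e' x \<omega> \<alpha>)"
    if "\<omega> \<in> fibre X.\<Lambda> x" for \<omega>
    by (rule X.wcomp_change[OF that V(1) x(1) V(2) x(2) tr(1) \<beta>])
  ultimately show "CT e1 x \<beta> = tensor_coords q (idx CF) t (CT e1' x) \<beta>"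
    unfolding tensor_coords_def e fst_conv cplx_sel(2)
    by (simp add: complex_eq_iff parts_fibre del: X.ext_sel)
qed

lemma cplx_ext_section_zero:
  assumes "compact (UNIV :: 'm set)" "connected (UNIV :: 'm set)" "1 \<le> p" "p \<le> q"
    and "\<And>x. ricci_p_nonpositive p A h CF (cplx_metric g) (cplx_conn D) x"
    and "ricci_p_negative p A h CF (cplx_metric g) (cplx_conn D) x0"
  shows "s = (\<lambda>x. 0)"
proof
  fix x
  obtain V e where V: "(V, e) \<in> frames F" "x \<in> V" by (rule ex_frame)
  interpret T: closed_tensor A h CF "cplx_metric g" "cplx_conn D" q CT by (rule cplx_ext_closed_tensor)
  have "CT (cframe e) x \<alpha> = 0" if "\<alpha> \<in> multi_index q (idx F)" for \<alpha>
    using T.closed_tensor_vanishes[OF assms cplx_frames[OF V(1)] V(2)] that by simp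
  then have "wcomp q e x (fst (s x)) \<alpha> = 0" "wcomp q e x (snd (s x)) \<alpha> = 0" if "\<alpha> \<in> multi_index q (idx F)" for \<alpha>
    using that by (simp_all add: complex_eq_iff)
  then have "fst (s x) = 0" "snd (s x) = 0"
    by (auto intro!: X.wcomp_zero_imp[OF _ V] parts_fibre simp del: X.ext_sel)
  then show "s x = 0" by (simp add: prod_eq_iff)
qed

end

theorem cplx_ext_H0_vanishes:
  assumes "compact (UNIV :: 'm set)" "connected (UNIV :: 'm set)" "1 \<le> p" "p \<le> q"
    and "\<And>x. ricci_p_nonpositive p A h CF (cplx_metric g) (cplx_conn D) x"
    and "ricci_p_negative p A h CF (cplx_metric g) (cplx_conn D) x0"
  shows "H0 A (cplx_bundle (ext_power q F)) (cplx_conn L) = {\<lambda>x. 0}"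
  using cplx_ext_zero_in_H0 cplx_ext_section_zero[OF _ assms] by blast

end

section \<open>The Hermitian and the Riemannian case combined\<close>

theorem theorem1p1:
  fixes A :: "('m::t2_space, 'n::finite) chart set"
    and h :: "('m, 'n) chart \<Rightarrow> 'm \<Rightarrow> complex ^ 'n ^ 'n"
    and E :: "(complex, 'm, 'v::ab_group_add, 'i::linorder) vbundle"
    and gE :: "'m \<Rightarrow> 'v \<Rightarrow> 'v \<Rightarrow> complex"
    and DE :: "('m, 'n, 'v) conn"
    and F :: "(real, 'm, 'w::ab_group_add, 'j::linorder) vbundle"
    and gF :: "'m \<Rightarrow> 'w \<Rightarrow> 'w \<Rightarrow> real"
    and DF :: "('m, 'n, 'w) conn"
  assumes "compact (UNIV :: 'm set)" and "connected (UNIV :: 'm set)"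
    and "complex_atlas A" and "hermitian_metric A h"
  shows
    "(hermitian_bundle A E gE \<and> metric_connection A E gE DE \<longrightarrow>
       ((\<forall>x. ricci_p_nonpositive 1 A h E gE DE x) \<longrightarrow>
          (\<forall>s\<in>H0 A E DE. parallel_section A DE s)) \<and>
       ((\<forall>x. ricci_p_nonpositive 1 A h E gE DE x) \<and> (\<exists>x. ricci_p_negative 1 A h E gE DE x) \<longrightarrow>
          H0 A E DE = {\<lambda>x. 0}) \<and>
       (\<forall>p\<ge>1. (\<forall>x. ricci_p_nonpositive p A h E gE DE x) \<and> (\<exists>x. ricci_p_negative p A h E gE DE x) \<longrightarrow>
          (\<forall>q L. p \<le> q \<and> q \<le> bundle_rank E \<and> induced_connection A E DE q L \<longrightarrow>
             H0 A (ext_power q E) L = {\<lambda>x. 0})))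
     \<and>
     (riemannian_bundle A F gF \<and> metric_connection A F gF DF \<longrightarrow>
       ((\<forall>x. ricci_p_nonpositive 1 A h (cplx_bundle F) (cplx_metric gF) (cplx_conn DF) x) \<longrightarrow>
          (\<forall>s\<in>H0 A (cplx_bundle F) (cplx_conn DF). parallel_section A (cplx_conn DF) s)) \<and>
       ((\<forall>x. ricci_p_nonpositive 1 A h (cplx_bundle F) (cplx_metric gF) (cplx_conn DF) x) \<and>
        (\<exists>x. ricci_p_negative 1 A h (cplx_bundle F) (cplx_metric gF) (cplx_conn DF) x) \<longrightarrow>
          H0 A (cplx_bundle F) (cplx_conn DF) = {\<lambda>x. 0}) \<and>
       (\<forall>p\<ge>1. (\<forall>x. ricci_p_nonpositive p A h (cplx_bundle F) (cplx_metric gF) (cplx_conn DF) x) \<and>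
               (\<exists>x. ricci_p_negative p A h (cplx_bundle F) (cplx_metric gF) (cplx_conn DF) x) \<longrightarrow>
          (\<forall>q L. p \<le> q \<and> q \<le> bundle_rank F \<and> induced_connection A F DF q L \<longrightarrow>
             H0 A (cplx_bundle (ext_power q F)) (cplx_conn L) = {\<lambda>x. 0})))"
  proof ((rule conjI; rule impI), goal_cases)
  case 1
  then have mb: "metric_bundle A h E gE DE"
    by unfold_locales (use assms in auto)
  interpret metric_bundle A h E gE DE by (rule mb)
  note base = assms(1,2)
  show ?case
  proof (intro conjI impI allI ballI; (elim conjE exE)?)
    show "parallel_section A DE s" if "\<forall>x. ricci_p_nonpositive 1 A h E gE DE x" "s \<in> H0 A E DE" for s
      using H0_parallel[OF mb that(2) base] that(1) by blast
    show "H0 A E DE = {\<lambda>x. 0}"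
      if "\<forall>x. ricci_p_nonpositive 1 A h E gE DE x" "ricci_p_negative 1 A h E gE DE x0" for x0
      by (rule H0_eq_zeroI[OF bundle_space_axioms D H0_vanishes[OF mb _ base]]) (use that in blast)+
    show "H0 A (ext_power q E) L = {\<lambda>x. 0}"
      if p: "1 \<le> p" and neg: "\<forall>x. ricci_p_nonpositive p A h E gE DE x" "ricci_p_negative p A h E gE DE x0"
        and q: "p \<le> q" and L: "induced_connection A E DE q L" for p q L x0
    proof -
      interpret X: ext_bundle A E q ..
      show ?thesis
        by (rule H0_eq_zeroI[OF X.X.bundle_space_axioms X.L_connection[OF D L]
              ext_H0_vanishes[OF mb L _ base p q neg(1)[rule_format] neg(2)]])
    qed
  qed
next
  case 2
  then have F: "real_metric_bundle A F gF DF"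
    by unfold_locales (use assms in auto)
  then interpret real_metric_bundle A F gF DF .
  have mb: "metric_bundle A h CF (cplx_metric gF) (cplx_conn DF)"
    by (rule cplx_metric_bundle[OF assms(4)])
  then interpret C: metric_bundle A h CF "cplx_metric gF" "cplx_conn DF" .
  note base = assms(1,2)
  show ?case
  proof (intro conjI impI allI ballI; (elim conjE exE)?)
    show "parallel_section A (cplx_conn DF) s"
      if "\<forall>x. ricci_p_nonpositive 1 A h CF (cplx_metric gF) (cplx_conn DF) x" "s \<in> H0 A CF (cplx_conn DF)" for s
      using H0_parallel[OF mb that(2) base] that(1) by blast
    show "H0 A CF (cplx_conn DF) = {\<lambda>x. 0}"
      if "\<forall>x. ricci_p_nonpositive 1 A h CF (cplx_metric gF) (cplx_conn DF) x"
        "ricci_p_negative 1 A h CF (cplx_metric gF) (cplx_conn DF) x0" for x0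
      by (rule H0_eq_zeroI[OF C.bundle_space_axioms C.D H0_vanishes[OF mb _ base]]) (use that in blast)+
    show "H0 A (cplx_bundle (ext_power q F)) (cplx_conn L) = {\<lambda>x. 0}"
      if p: "1 \<le> p" and neg: "\<forall>x. ricci_p_nonpositive p A h CF (cplx_metric gF) (cplx_conn DF) x"
          "ricci_p_negative p A h CF (cplx_metric gF) (cplx_conn DF) x0"
        and q: "p \<le> q" and L: "induced_connection A F DF q L" for p q L x0
      by (rule cplx_ext_H0_vanishes[OF assms(4) F L base p q neg(1)[rule_format] neg(2)])
  qed
qed

end
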